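(* Let $\mathcal{T}=(A,T,G)$ be a regularity structure, let $\alpha=\min A$, $p,q\in[1,\infty]$, $\gamma>0$, and let $\bar\alpha=\alpha$ if $q=\infty$ and $\bar\alpha<\alpha$ otherwise. For smooth models $Z=(\Pi,\Gamma)\in\mathcal{M}_{\mathcal{T}}$ the reconstruction operator, i.e. the unique continuous linear map $\mathcal{R}_Z:\mathcal{D}^\gamma_{p,q}\to\mathcal{B}^{\bar\alpha}_{p,q}$ satisfying the bound (i) below, can be defined via $$(\mathcal{R}_Zf)(x)=\big(\Pi_xf(x)\big)(x),\qquad x\in\mathbb{R}^d.$$ In particular, with this definition the following bounds hold. (i) Uniformly over all smooth models $Z=(\Pi,\Gamma)$ and all $f\in\mathcal{D}^\gamma_{p,q}$, $$\Bigg\|\Big\|\sup_{\eta\in\mathcal{B}^r}\frac{|\langle\mathcal{R}_Zf-\Pi_xf(x),\eta_x^\delta\rangle|}{\delta^\gamma}\Big\|_{L^p(dx)}\Bigg\|_{L^q_\delta}\lesssim\|f\|_{\mathcal{D}^\gamma_{p,q}}\|\Pi\|_\gamma(1+\|\Gamma\|_\gamma).$$ (ii) Uniformly over all smooth models $Z=(\Pi,\Gamma)$, $\bar Z=(\bar\Pi,\bar\Gamma)$ and all $f\in\mathcal{D}^\gamma_{p,q}$ (relative to $Z$), $\bar f\in\bar{\mathcal{D}}^\gamma_{p,q}$ (relative to $\bar Z$), $$\Bigg\|\Big\|\sup_{\eta\in\mathcal{B}^r}\frac{|\langle\mathcal{R}_Zf-\Pi_xf(x)-\mathcal{R}_{\bar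 Z}\bar f+\bar\Pi_x\bar f(x),\eta_x^\delta\rangle|}{\delta^\gamma}\Big\|_{L^p(dx)}\Bigg\|_{L^q_\delta}$$ $$\lesssim\|f,\bar f\|_{\mathcal{D}^\gamma_{p,q}}\|\Pi\|_\gamma(1+\|\Gamma\|_\gamma)+\|\bar f\|_{\bar{\mathcal{D}}^\gamma_{p,q}}\big(\|\Pi-\bar\Pi\|_\gamma(1+\|\Gamma\|_\gamma)+\|\bar\Pi\|_\gamma\|\Gamma-\bar\Gamma\|_\gamma\big).$$
   Context: Fix a dimension $d$ and a scaling $\mathfrak{s}\in\mathbb{N}_{\ge1}^d$; $|\mathfrak{s}|=\sum_i\mathfrak{s}_i$, and $|x|_{\mathfrak{s}}=\|x\|_{\mathfrak s}$ is the corresponding scaled distance on $\mathbb{R}^d$ with unit ball $B_1^{\mathfrak{s}}$. For a function $\varphi$ let $\varphi^\delta_x(y)=\delta^{-|\mathfrak{s}|}\varphi(\delta^{-\mathfrak{s}_1}(y_1-x_1),\dots,\delta^{-\mathfrak{s}_d}(y_d-x_d))$. $\mathcal{B}^r$ (also written $\mathfrak{B}^r$) is the set of $\mathcal{C}^r$ functions supported in the unit ball with $\mathcal{C}^r$-norm at most $1$, with $r$ a fixed integer larger than $|\min A|$. $L^q_\delta$ denotes $L^q((0,1),d\delta/\delta)$. $\mathcal{B}^{\bar\alpha}_{p,q}$ is the inhomogeneous Besov space on $\mathbb{R}^d$ relative to the scaling $\mathfrak{s}$; for $\bar\alpha<0$ it consists of the distributions $\xi$ with $\big\|\,\big\|\sup_{\eta\in\mathcal{B}^r}|\langle\xi,\eta^\delta_x\rangle|\delta^{-\bar\alpha}\big\|_{L^p(dx)}\big\|_{L^q_\delta}<\infty$.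 A regularity structure $\mathcal{T}=(A,T,G)$ consists of a locally finite, bounded below set $A\subset\mathbb{R}$, a graded space $T=\bigoplus_{\alpha\in A}T_\alpha$ of Banach spaces, and a group $G$ of linear maps on $T$ with $\Gamma\tau-\tau\in\bigoplus_{\beta<\alpha}T_\beta$ for $\tau\in T_\alpha$, $\Gamma\in G$. $|\tau|_\beta$ is the norm of the $T_\beta$-component of $\tau$; $T_{<\gamma}=\bigoplus_{\alpha<\gamma}T_\alpha$. A model $Z=(\Pi,\Gamma)\in\mathcal{M}_{\mathcal{T}}$ consists of maps $\Pi:\mathbb{R}^d\to L(T,\mathcal{D}'(\mathbb{R}^d))$ and $\Gamma:\mathbb{R}^d\times\mathbb{R}^d\to G$ with $\Pi_x\Gamma_{x,y}=\Pi_y$, $\Gamma_{x,y}\Gamma_{y,z}=\Gamma_{x,z}$, such that for all $\gamma\in\mathbb{R}$ the following are finite: $$\|\Pi\|_\gamma=\sup_{x}\sup_{\zeta\in A\cap(-\infty,\gamma)}\sup_{\tau\in T_\zeta}\sup_{\varphi\in\mathfrak{B}^r}\sup_{\delta<1}\frac{|\langle\Pi_x\tau,\varphi^\delta_x\rangle|}{|\tau|\,\delta^\zeta},\qquad \|\Gamma\|_\gamma=\sup_{\|x-y\|_{\mathfrak s}<1}\sup_{\zeta\in A\cap(-\infty,\gamma)}\sup_{A\ni\beta<\zeta}\sup_{\tau\in T_\zeta}\frac{|\Gamma_{x,y}\tau|_\beta}{|x-y|_{\mathfrak{s}}^{\zeta-\beta}|\tau|}.$$ $\|\Pi-\bar\Pi\|_\gamma$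 and $\|\Gamma-\bar\Gamma\|_\gamma$ are defined by the same formulas applied to the differences. A model is smooth if for all $x\in\mathbb{R}^d$ and $\tau\in T$ the distribution $\Pi_x\tau$ is a smooth function. $\mathcal{D}^\gamma_{p,q}$ (relative to $Z$) is the space of measurable maps $f:\mathbb{R}^d\to T_{<\gamma}$ with finite norm $$\|f\|_{\mathcal{D}^\gamma_{p,q}}=\sum_{\zeta\in A\cap(-\infty,\gamma)}\Bigg(\big\||f(x)|_\zeta\big\|_{L^p(dx)}+\Bigg(\int_{h\in B^{\mathfrak{s}}_1}\Big\|\frac{|f(x+h)-\Gamma_{x+h,x}f(x)|_\zeta}{\|h\|_{\mathfrak{s}}^{\gamma-\zeta}}\Big\|^q_{L^p(dx)}\frac{dh}{\|h\|_{\mathfrak{s}}^{|\mathfrak{s}|}}\Bigg)^{1/q}\Bigg)$$ (supremum modification for $q=\infty$). For $f\in\mathcal{D}^\gamma_{p,q}$ relative to $Z$ and $\bar f\in\bar{\mathcal{D}}^\gamma_{p,q}$ relative to $\bar Z$, $\|f,\bar f\|_{\mathcal{D}^\gamma_{p,q}}$ is the same expression with $f(x)$ replaced by $f(x)-\bar f(x)$ in the first term and $f(x+h)-\Gamma_{x+h,x}f(x)$ replaced by $f(x+h)-\Gamma_{x+h,x}f(x)-(\bar f(x+h)-\bar\Gamma_{x+h,x}\bar f(x))$ in the second. *)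

theory Defs
  imports "HOL-Analysis.Analysis" "HOL-Algebra.Bij"
begin

section \<open>Scalings\<close>

definition scaling :: "('d::finite \<Rightarrow> nat) \<Rightarrow> bool" where
  "scaling s \<longleftrightarrow> (\<forall>i. 1 \<le> s i)"

definition hom_dim :: "('d::finite \<Rightarrow> nat) \<Rightarrow> nat" where
  "hom_dim s = (\<Sum>i\<in>UNIV. s i)"

text \<open>Maximum convention; the unit ball is then the cube and does not depend on s.\<close>

definition snorm :: "('d::finite \<Rightarrow> nat) \<Rightarrow> real ^ 'd \<Rightarrow> real" where
  "snorm s x = Max (range (\<lambda>i. \<bar>x $ i\<bar> powr (1 / real (s i))))"

definition sball :: "('d::finite \<Rightarrow> nat) \<Rightarrow> (real ^ 'd) set" where
  "sball s = {x. snorm s x \<le> 1}"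

definition rescale ::
  "('d::finite \<Rightarrow> nat) \<Rightarrow> (real ^ 'd \<Rightarrow> real) \<Rightarrow> real \<Rightarrow> real ^ 'd \<Rightarrow> real ^ 'd \<Rightarrow> real" where
  "rescale s \<phi> \<delta> x = (\<lambda>y. \<phi> (\<chi> i. (y $ i - x $ i) / \<delta> ^ s i) / \<delta> ^ hom_dim s)"


section \<open>Functions of class \<open>C\<^sup>r\<close> and distributions\<close>

definition partial_deriv :: "'d::finite \<Rightarrow> (real ^ 'd \<Rightarrow> real) \<Rightarrow> real ^ 'd \<Rightarrow> real" where
  "partial_deriv i f = (\<lambda>x. frechet_derivative f (at x) (axis i 1))"

primrec C_class :: "nat \<Rightarrow> (real ^ 'd::finite \<Rightarrow> real) \<Rightarrow> bool" where
  "C_class 0 f \<longleftrightarrow> continuous_on UNIV f"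
| "C_class (Suc k) f \<longleftrightarrow> (\<forall>x. f differentiable at x) \<and> (\<forall>i. C_class k (partial_deriv i f))"

definition smooth :: "(real ^ 'd::finite \<Rightarrow> real) \<Rightarrow> bool" where
  "smooth f \<longleftrightarrow> (\<forall>k. C_class k f)"

text \<open>Derivatives of order at most r are indexed by lists of directions, rather than by
  multi-indices.\<close>

definition C_norm :: "nat \<Rightarrow> (real ^ 'd::finite \<Rightarrow> real) \<Rightarrow> ennreal" where
  "C_norm r f = (SUP ks\<in>{ks. length ks \<le> r}. SUP x. ennreal \<bar>foldr partial_deriv ks f x\<bar>)"

definition supported_in :: "('a \<Rightarrow> real) \<Rightarrow> 'a set \<Rightarrow> bool" where
  "supported_in f K \<longleftrightarrow> (\<forall>x. f x \<noteq> 0 \<longrightarrow> x \<in> K)"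

definition B_tests :: "('d::finite \<Rightarrow> nat) \<Rightarrow> nat \<Rightarrow> (real ^ 'd \<Rightarrow> real) set" where
  "B_tests s r = {\<phi>. C_class r \<phi> \<and> supported_in \<phi> (sball s) \<and> C_norm r \<phi> \<le> 1}"

text \<open>Monomials are indexed by \<open>k\<close>, with scaled degree \<open>\<Sum>i. k i * s i\<close>.\<close>

definition B_tests_ann :: "('d::finite \<Rightarrow> nat) \<Rightarrow> nat \<Rightarrow> real \<Rightarrow> (real ^ 'd \<Rightarrow> real) set" where
  "B_tests_ann s r a = {\<phi> \<in> B_tests s r. \<forall>k::'d \<Rightarrow> nat. real (\<Sum>i\<in>UNIV. k i * s i) \<le> a \<longrightarrow>
     (\<integral>x. \<phi> x * (\<Prod>i\<in>UNIV. (x $ i) ^ k i) \<partial>lborel) = 0}"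

definition test_funs :: "(real ^ 'd::finite \<Rightarrow> real) set" where
  "test_funs = {\<phi>. smooth \<phi> \<and> (\<exists>K. compact K \<and> supported_in \<phi> K)}"

type_synonym 'd functional = "(real ^ 'd \<Rightarrow> real) \<Rightarrow> real"

text \<open>A distribution is a functional of which only the values on \<open>test_funs\<close> matter.\<close>

definition distribution :: "'d::finite functional \<Rightarrow> bool" where
  "distribution u \<longleftrightarrow>
     (\<forall>\<phi>\<in>test_funs. \<forall>\<psi>\<in>test_funs. \<forall>a b. u (\<lambda>x. a * \<phi> x + b * \<psi> x) = a * u \<phi> + b * u \<psi>) \<and>
     (\<forall>K. compact K \<longrightarrow> (\<exists>N C. \<forall>\<phi>\<in>test_funs. supported_in \<phi> K \<longrightarrow>
        ennreal \<bar>u \<phi>\<bar> \<le> ennreal C * C_norm N \<phi>))"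

definition order_at_most :: "nat \<Rightarrow> 'd::finite functional \<Rightarrow> bool" where
  "order_at_most r u \<longleftrightarrow>
     (\<forall>K. compact K \<longrightarrow> (\<exists>C. \<forall>\<phi>\<in>test_funs. supported_in \<phi> K \<longrightarrow>
        ennreal \<bar>u \<phi>\<bar> \<le> ennreal C * C_norm r \<phi>))"

definition C_converges ::
  "nat \<Rightarrow> (nat \<Rightarrow> real ^ 'd::finite \<Rightarrow> real) \<Rightarrow> (real ^ 'd \<Rightarrow> real) \<Rightarrow> bool" where
  "C_converges r \<psi> \<phi> \<longleftrightarrow>
     (\<exists>K. compact K \<and> (\<forall>n. supported_in (\<psi> n) K)) \<and>
     (\<lambda>n. C_norm r (\<lambda>x. \<psi> n x - \<phi> x)) \<longlonglongrightarrow> 0"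

text \<open>The pairing of a distribution of order at most r with a compactly supported \<open>C\<^sup>r\<close> function,
  i.e. the unique continuous extension of u from \<open>test_funs\<close>. If u does not have order at most r,
  the value is unspecified; all uses are guarded by \<open>order_at_most\<close>.\<close>

definition pairing :: "nat \<Rightarrow> 'd::finite functional \<Rightarrow> (real ^ 'd \<Rightarrow> real) \<Rightarrow> real" where
  "pairing r u \<phi> = (THE l. \<forall>\<psi>. (\<forall>n. \<psi> n \<in> test_funs) \<and> C_converges r \<psi> \<phi>
      \<longrightarrow> (\<lambda>n. u (\<psi> n)) \<longlonglongrightarrow> l)"

definition dist_of :: "(real ^ 'd \<Rightarrow> real) \<Rightarrow> 'd::finite functional" where
  "dist_of g = (\<lambda>\<phi>. \<integral>y. g y * \<phi> y \<partial>lborel)"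

definition locally_integrable :: "(real ^ 'd::finite \<Rightarrow> real) \<Rightarrow> bool" where
  "locally_integrable g \<longleftrightarrow> (\<forall>K. compact K \<longrightarrow> set_integrable lborel K g)"

definition is_smooth_density :: "'d::finite functional \<Rightarrow> (real ^ 'd \<Rightarrow> real) \<Rightarrow> bool" where
  "is_smooth_density u g \<longleftrightarrow> smooth g \<and> (\<forall>\<phi>\<in>test_funs. u \<phi> = dist_of g \<phi>)"

definition smooth_density :: "'d::finite functional \<Rightarrow> real ^ 'd \<Rightarrow> real" where
  "smooth_density u = (THE g. is_smooth_density u g)"


section \<open>\<open>L\<^sup>p\<close> norms and Besov spaces\<close>

definition ennreal_powr :: "ennreal \<Rightarrow> real \<Rightarrow> ennreal" where
  "ennreal_powr x a = (if x = \<infinity> then \<infinity> else ennreal (enn2real x powr a))"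

text \<open>For \<open>p = \<infinity>\<close> this is the essential supremum, written out because \<open>esssup\<close> of the
  probability library is infinite on non-measurable functions.\<close>

definition Lp_norm :: "'a measure \<Rightarrow> ennreal \<Rightarrow> ('a \<Rightarrow> ennreal) \<Rightarrow> ennreal" where
  "Lp_norm M p g =
     (if p = \<infinity> then Inf {c. AE x in M. g x \<le> c}
      else ennreal_powr (\<integral>\<^sup>+x. ennreal_powr (g x) (enn2real p) \<partial>M) (1 / enn2real p))"

definition scale_measure01 :: "real measure" where
  "scale_measure01 = density lborel (\<lambda>\<delta>. indicator {0<..<1} \<delta> * ennreal (1 / \<delta>))"

definition ball_measure :: "('d::finite \<Rightarrow> nat) \<Rightarrow> (real ^ 'd) measure" where
  "ball_measure s = density lborel (\<lambda>h. indicator (sball s) h * ennreal (1 / snorm s h ^ hom_dim s))"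

text \<open>The common shape of the Besov norms and of the reconstruction bounds:
  the norm in \<open>L\<^sup>q((0,1), d\<delta>/\<delta>)\<close> of the norm in \<open>L\<^sup>p(dx)\<close> of the supremum over \<open>\<eta> \<in> E\<close> of the
  pairing of \<open>U x\<close> with the rescaled \<open>\<eta>\<close>, divided by \<open>\<delta>\<^sup>c\<close>.\<close>

definition multiscale_norm ::
  "('d::finite \<Rightarrow> nat) \<Rightarrow> nat \<Rightarrow> (real ^ 'd \<Rightarrow> real) set \<Rightarrow> real \<Rightarrow> ennreal \<Rightarrow> ennreal \<Rightarrow>
   (real ^ 'd \<Rightarrow> 'd functional) \<Rightarrow> ennreal" where
  "multiscale_norm s r E c p q U =
     Lp_norm scale_measure01 q (\<lambda>\<delta>. Lp_norm lborel p (\<lambda>x.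
       SUP \<eta>\<in>E. ennreal (\<bar>pairing r (U x) (rescale s \<eta> \<delta> x)\<bar> / \<delta> powr c)))"

text \<open>For \<open>a \<ge> 0\<close> this is the usual extension of the definition: a unit scale term, and rescaled
  test functions annihilating polynomials.\<close>

definition besov_norm ::
  "('d::finite \<Rightarrow> nat) \<Rightarrow> nat \<Rightarrow> real \<Rightarrow> ennreal \<Rightarrow> ennreal \<Rightarrow> 'd functional \<Rightarrow> ennreal" where
  "besov_norm s r a p q \<xi> =
     (if a < 0 then multiscale_norm s r (B_tests s r) a p q (\<lambda>x. \<xi>)
      else Lp_norm lborel p (\<lambda>x. SUP \<eta>\<in>B_tests s r. ennreal \<bar>pairing r \<xi> (rescale s \<eta> 1 x)\<bar>)
         + multiscale_norm s r (B_tests_ann s r a) a p q (\<lambda>x. \<xi>))"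

definition besov ::
  "('d::finite \<Rightarrow> nat) \<Rightarrow> nat \<Rightarrow> real \<Rightarrow> ennreal \<Rightarrow> ennreal \<Rightarrow> 'd functional set" where
  "besov s r a p q = {\<xi>. distribution \<xi> \<and> order_at_most r \<xi> \<and> besov_norm s r a p q \<xi> < \<infinity>}"


section \<open>Regularity structures and models\<close>

text \<open>The Banach spaces \<open>T\<^sub>\<alpha>\<close> are closed subspaces \<open>rs_T \<T> \<alpha>\<close> of one ambient Banach space;
  every countable family of Banach spaces can be realised in this way. The direct sum is the set
  \<open>rs_sum \<T>\<close> of finitely supported families, so that the \<open>\<beta>\<close>-component of \<open>\<tau>\<close> is \<open>\<tau> \<beta>\<close>.\<close>

record 'b regstruct =
  rs_A :: "real set"
  rs_T :: "real \<Rightarrow> 'b set"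
  rs_G :: "((real \<Rightarrow> 'b) \<Rightarrow> (real \<Rightarrow> 'b)) set"

definition rs_sum :: "('b::banach) regstruct \<Rightarrow> (real \<Rightarrow> 'b) set" where
  "rs_sum \<T> = {\<tau>. finite {\<alpha>. \<tau> \<alpha> \<noteq> 0} \<and> {\<alpha>. \<tau> \<alpha> \<noteq> 0} \<subseteq> rs_A \<T> \<and> (\<forall>\<alpha>\<in>rs_A \<T>. \<tau> \<alpha> \<in> rs_T \<T> \<alpha>)}"

definition rs_below :: "('b::banach) regstruct \<Rightarrow> real \<Rightarrow> (real \<Rightarrow> 'b) set" where
  "rs_below \<T> \<gamma> = {\<tau> \<in> rs_sum \<T>. \<forall>\<alpha>. \<gamma> \<le> \<alpha> \<longrightarrow> \<tau> \<alpha> = 0}"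

definition homog :: "real \<Rightarrow> 'b::banach \<Rightarrow> real \<Rightarrow> 'b" where
  "homog \<zeta> b = (\<lambda>\<alpha>. if \<alpha> = \<zeta> then b else 0)"

definition regularity_structure :: "('b::banach) regstruct \<Rightarrow> bool" where
  "regularity_structure \<T> \<longleftrightarrow>
     rs_A \<T> \<noteq> {} \<and> bdd_below (rs_A \<T>) \<and> (\<forall>a b. finite (rs_A \<T> \<inter> {a..b})) \<and>
     (\<forall>\<alpha>\<in>rs_A \<T>. subspace (rs_T \<T> \<alpha>) \<and> closed (rs_T \<T> \<alpha>)) \<and>
     subgroup (rs_G \<T>) (BijGroup (rs_sum \<T>)) \<and>
     (\<forall>g\<in>rs_G \<T>. \<forall>\<sigma>\<in>rs_sum \<T>. \<forall>\<tau>\<in>rs_sum \<T>. \<forall>a b.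
        g (\<lambda>\<alpha>. a *\<^sub>R \<sigma> \<alpha> + b *\<^sub>R \<tau> \<alpha>) = (\<lambda>\<alpha>. a *\<^sub>R g \<sigma> \<alpha> + b *\<^sub>R g \<tau> \<alpha>)) \<and>
     (\<forall>g\<in>rs_G \<T>. \<forall>\<alpha>\<in>rs_A \<T>. \<forall>b\<in>rs_T \<T> \<alpha>.
        (\<lambda>\<beta>. g (homog \<alpha> b) \<beta> - homog \<alpha> b \<beta>) \<in> rs_below \<T> \<alpha>)"

record ('d, 'b) model =
  m_Pi :: "real ^ 'd \<Rightarrow> (real \<Rightarrow> 'b) \<Rightarrow> 'd functional"
  m_Gam :: "real ^ 'd \<Rightarrow> real ^ 'd \<Rightarrow> (real \<Rightarrow> 'b) \<Rightarrow> (real \<Rightarrow> 'b)"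

definition Pi_norm ::
  "('b::banach) regstruct \<Rightarrow> ('d::finite \<Rightarrow> nat) \<Rightarrow> nat \<Rightarrow> real \<Rightarrow>
   (real ^ 'd \<Rightarrow> (real \<Rightarrow> 'b) \<Rightarrow> 'd functional) \<Rightarrow> ennreal" where
  "Pi_norm \<T> s r \<gamma> P =
     (SUP x. SUP \<zeta>\<in>rs_A \<T> \<inter> {..<\<gamma>}. SUP b\<in>rs_T \<T> \<zeta>. SUP \<phi>\<in>B_tests s r. SUP \<delta>\<in>{0<..<1}.
        ennreal (\<bar>pairing r (P x (homog \<zeta> b)) (rescale s \<phi> \<delta> x)\<bar> / (norm b * \<delta> powr \<zeta>)))"

definition Gam_norm ::
  "('b::banach) regstruct \<Rightarrow> ('d::finite \<Rightarrow> nat) \<Rightarrow> real \<Rightarrow>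
   (real ^ 'd \<Rightarrow> real ^ 'd \<Rightarrow> (real \<Rightarrow> 'b) \<Rightarrow> (real \<Rightarrow> 'b)) \<Rightarrow> ennreal" where
  "Gam_norm \<T> s \<gamma> g =
     (SUP (x, y)\<in>{(x, y). snorm s (x - y) < 1}.
      SUP \<zeta>\<in>rs_A \<T> \<inter> {..<\<gamma>}. SUP \<beta>\<in>rs_A \<T> \<inter> {..<\<zeta>}. SUP b\<in>rs_T \<T> \<zeta>.
        ennreal (norm (g x y (homog \<zeta> b) \<beta>) / (snorm s (x - y) powr (\<zeta> - \<beta>) * norm b)))"

text \<open>The requirement \<open>order_at_most\<close> makes the pairings with \<open>C\<^sup>r\<close> functions in \<open>Pi_norm\<close>
  meaningful. It holds automatically if the distributions \<open>m_Pi Z x \<tau>\<close> are functions.\<close>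

definition is_model ::
  "('b::banach) regstruct \<Rightarrow> ('d::finite \<Rightarrow> nat) \<Rightarrow> nat \<Rightarrow> ('d, 'b) model \<Rightarrow> bool" where
  "is_model \<T> s r Z \<longleftrightarrow>
     (\<forall>x. \<forall>\<tau>\<in>rs_sum \<T>. distribution (m_Pi Z x \<tau>) \<and> order_at_most r (m_Pi Z x \<tau>)) \<and>
     (\<forall>x. \<forall>\<sigma>\<in>rs_sum \<T>. \<forall>\<tau>\<in>rs_sum \<T>. \<forall>a b. \<forall>\<phi>\<in>test_funs.
        m_Pi Z x (\<lambda>\<alpha>. a *\<^sub>R \<sigma> \<alpha> + b *\<^sub>R \<tau> \<alpha>) \<phi> = a * m_Pi Z x \<sigma> \<phi> + b * m_Pi Z x \<tau> \<phi>) \<and>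
     (\<forall>x. \<forall>\<zeta>\<in>rs_A \<T>. \<forall>\<phi>\<in>test_funs. \<exists>C. \<forall>b\<in>rs_T \<T> \<zeta>. \<bar>m_Pi Z x (homog \<zeta> b) \<phi>\<bar> \<le> C * norm b) \<and>
     (\<forall>x y. m_Gam Z x y \<in> rs_G \<T>) \<and>
     (\<forall>x y. \<forall>\<tau>\<in>rs_sum \<T>. \<forall>\<phi>\<in>test_funs. m_Pi Z x (m_Gam Z x y \<tau>) \<phi> = m_Pi Z y \<tau> \<phi>) \<and>
     (\<forall>x y z. \<forall>\<tau>\<in>rs_sum \<T>. m_Gam Z x y (m_Gam Z y z \<tau>) = m_Gam Z x z \<tau>) \<and>
     (\<forall>\<gamma>. Pi_norm \<T> s r \<gamma> (m_Pi Z) < \<infinity> \<and> Gam_norm \<T> s \<gamma> (m_Gam Z) < \<infinity>)"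

definition smooth_model ::
  "('b::banach) regstruct \<Rightarrow> ('d::finite \<Rightarrow> nat) \<Rightarrow> nat \<Rightarrow> ('d, 'b) model \<Rightarrow> bool" where
  "smooth_model \<T> s r Z \<longleftrightarrow>
     is_model \<T> s r Z \<and> (\<forall>x. \<forall>\<tau>\<in>rs_sum \<T>. \<exists>g. is_smooth_density (m_Pi Z x \<tau>) g)"

definition Pi_diff ::
  "('d, 'b) model \<Rightarrow> ('d, 'b) model \<Rightarrow> real ^ 'd \<Rightarrow> (real \<Rightarrow> 'b) \<Rightarrow> 'd::finite functional" where
  "Pi_diff Z Z' = (\<lambda>x \<tau> \<phi>. m_Pi Z x \<tau> \<phi> - m_Pi Z' x \<tau> \<phi>)"

definition Gam_diff ::
  "('d::finite, 'b::banach) model \<Rightarrow> ('d, 'b) model \<Rightarrow>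
   real ^ 'd \<Rightarrow> real ^ 'd \<Rightarrow> (real \<Rightarrow> 'b) \<Rightarrow> (real \<Rightarrow> 'b)" where
  "Gam_diff Z Z' = (\<lambda>x y \<tau> \<beta>. m_Gam Z x y \<tau> \<beta> - m_Gam Z' x y \<tau> \<beta>)"


section \<open>Modelled distributions\<close>

text \<open>Measurability into the possibly non-separable Banach spaces \<open>T\<^sub>\<zeta>\<close> is strong (Bochner)
  measurability.\<close>

definition strongly_measurable :: "('a::topological_space \<Rightarrow> 'b::banach) \<Rightarrow> bool" where
  "strongly_measurable g \<longleftrightarrow>
     (\<exists>S. (\<forall>n. simple_function borel (S n)) \<and> (\<forall>x. (\<lambda>n. S n x) \<longlonglongrightarrow> g x))"

text \<open>\<open>g x \<zeta>\<close> plays the role of \<open>f(x)\<close> and \<open>I x h \<zeta>\<close> of the increment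
  \<open>f(x + h) - \<Gamma>\<^bsub>x+h,x\<^esub> f(x)\<close>.\<close>

definition increment_norm ::
  "('b::banach) regstruct \<Rightarrow> ('d::finite \<Rightarrow> nat) \<Rightarrow> real \<Rightarrow> ennreal \<Rightarrow> ennreal \<Rightarrow>
   (real ^ 'd \<Rightarrow> real \<Rightarrow> 'b) \<Rightarrow> (real ^ 'd \<Rightarrow> real ^ 'd \<Rightarrow> real \<Rightarrow> 'b) \<Rightarrow> ennreal" where
  "increment_norm \<T> s \<gamma> p q g I =
     (\<Sum>\<zeta>\<in>rs_A \<T> \<inter> {..<\<gamma>}.
        Lp_norm lborel p (\<lambda>x. ennreal (norm (g x \<zeta>))) +
        Lp_norm (ball_measure s) q (\<lambda>h. Lp_norm lborel p (\<lambda>x.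
          ennreal (norm (I x h \<zeta>) / snorm s h powr (\<gamma> - \<zeta>)))))"

definition D_norm ::
  "('b::banach) regstruct \<Rightarrow> ('d::finite \<Rightarrow> nat) \<Rightarrow> real \<Rightarrow> ennreal \<Rightarrow> ennreal \<Rightarrow>
   ('d, 'b) model \<Rightarrow> (real ^ 'd \<Rightarrow> real \<Rightarrow> 'b) \<Rightarrow> ennreal" where
  "D_norm \<T> s \<gamma> p q Z f =
     increment_norm \<T> s \<gamma> p q f (\<lambda>x h \<zeta>. f (x + h) \<zeta> - m_Gam Z (x + h) x (f x) \<zeta>)"

definition D_space ::
  "('b::banach) regstruct \<Rightarrow> ('d::finite \<Rightarrow> nat) \<Rightarrow> real \<Rightarrow> ennreal \<Rightarrow> ennreal \<Rightarrow>
   ('d, 'b) model \<Rightarrow> (real ^ 'd \<Rightarrow> real \<Rightarrow> 'b) set" where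
  "D_space \<T> s \<gamma> p q Z =
     {f. (\<forall>x. f x \<in> rs_below \<T> \<gamma>) \<and>
         (\<forall>\<zeta>\<in>rs_A \<T> \<inter> {..<\<gamma>}. strongly_measurable (\<lambda>x. f x \<zeta>)) \<and>
         D_norm \<T> s \<gamma> p q Z f < \<infinity>}"

definition D_dist ::
  "('b::banach) regstruct \<Rightarrow> ('d::finite \<Rightarrow> nat) \<Rightarrow> real \<Rightarrow> ennreal \<Rightarrow> ennreal \<Rightarrow>
   ('d, 'b) model \<Rightarrow> ('d, 'b) model \<Rightarrow>
   (real ^ 'd \<Rightarrow> real \<Rightarrow> 'b) \<Rightarrow> (real ^ 'd \<Rightarrow> real \<Rightarrow> 'b) \<Rightarrow> ennreal" where
  "D_dist \<T> s \<gamma> p q Z Z' f f' =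
     increment_norm \<T> s \<gamma> p q (\<lambda>x \<zeta>. f x \<zeta> - f' x \<zeta>)
       (\<lambda>x h \<zeta>. f (x + h) \<zeta> - m_Gam Z (x + h) x (f x) \<zeta>
                 - (f' (x + h) \<zeta> - m_Gam Z' (x + h) x (f' x) \<zeta>))"


section \<open>Reconstruction\<close>

definition recon_fun ::
  "('d::finite, 'b::banach) model \<Rightarrow> (real ^ 'd \<Rightarrow> real \<Rightarrow> 'b) \<Rightarrow> real ^ 'd \<Rightarrow> real" where
  "recon_fun Z f = (\<lambda>x. smooth_density (m_Pi Z x (f x)) x)"

definition recon ::
  "('d::finite, 'b::banach) model \<Rightarrow> (real ^ 'd \<Rightarrow> real \<Rightarrow> 'b) \<Rightarrow> 'd functional" where
  "recon Z f = dist_of (recon_fun Z f)"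

definition recon_error_norm ::
  "('d::finite \<Rightarrow> nat) \<Rightarrow> nat \<Rightarrow> real \<Rightarrow> ennreal \<Rightarrow> ennreal \<Rightarrow> ('d, 'b::banach) model \<Rightarrow>
   ((real ^ 'd \<Rightarrow> real \<Rightarrow> 'b) \<Rightarrow> 'd functional) \<Rightarrow> (real ^ 'd \<Rightarrow> real \<Rightarrow> 'b) \<Rightarrow> ennreal" where
  "recon_error_norm s r \<gamma> p q Z R f =
     multiscale_norm s r (B_tests s r) \<gamma> p q (\<lambda>x \<phi>. R f \<phi> - m_Pi Z x (f x) \<phi>)"

text \<open>Continuity is boundedness. Maps are only constrained on \<open>D_space\<close>, and equality of
  distributions is equality on \<open>test_funs\<close>.\<close>

definition reconstruction_operator ::
  "('b::banach) regstruct \<Rightarrow> ('d::finite \<Rightarrow> nat) \<Rightarrow> nat \<Rightarrow> real \<Rightarrow> real \<Rightarrow> ennreal \<Rightarrow> ennreal \<Rightarrow>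
   ('d, 'b) model \<Rightarrow> ((real ^ 'd \<Rightarrow> real \<Rightarrow> 'b) \<Rightarrow> 'd functional) \<Rightarrow> bool" where
  "reconstruction_operator \<T> s r a \<gamma> p q Z R \<longleftrightarrow>
     (\<forall>f\<in>D_space \<T> s \<gamma> p q Z. R f \<in> besov s r a p q) \<and>
     (\<forall>f\<in>D_space \<T> s \<gamma> p q Z. \<forall>g\<in>D_space \<T> s \<gamma> p q Z. \<forall>c d. \<forall>\<phi>\<in>test_funs.
        R (\<lambda>x \<zeta>. c *\<^sub>R f x \<zeta> + d *\<^sub>R g x \<zeta>) \<phi> = c * R f \<phi> + d * R g \<phi>) \<and>
     (\<exists>C::real. \<forall>f\<in>D_space \<T> s \<gamma> p q Z.
        besov_norm s r a p q (R f) \<le> ennreal C * D_norm \<T> s \<gamma> p q Z f) \<and>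
     (\<exists>C::real. \<forall>f\<in>D_space \<T> s \<gamma> p q Z.
        recon_error_norm s r \<gamma> p q Z R f \<le> ennreal C *
          (D_norm \<T> s \<gamma> p q Z f * Pi_norm \<T> s r \<gamma> (m_Pi Z) * (1 + Gam_norm \<T> s \<gamma> (m_Gam Z))))"

end

theory Submission
  imports Defs
begin

text \<open>The function \<open>g y = F y y\<close>, with \<open>F x\<close> the density of \<open>\<Pi>\<^sub>x f(x)\<close>, is approximated by the averages
  \<open>\<integral>F z y \<rho>(z, y) dz\<close> against a smooth bump at scale \<open>\<delta> / 2\<^sup>n\<close>. Inserting the bump of the next scale turns the difference
  of two consecutive averages, tested against \<open>\<eta>\<close>, into pairings of the increments \<open>F (z + h) - F z\<close> with admissible
  test functions at scale \<open>\<delta> / 2\<^sup>n\<close>. Summing over \<open>n\<close> bounds the reconstruction error by integrals of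
  the increments of \<open>f\<close> against a kernel that obeys Schur's test, and Minkowski's inequality gives the
  norms. All estimates are done for a germ \<open>F\<close>, so that the bound for two models is the bound
  for the difference of two germs. Two reconstructions differ by a distribution which is of order
  \<open>\<delta>\<^sup>\<gamma>\<close> on rescaled test functions in \<open>L\<^sup>p\<close>, along a sequence of scales, and therefore vanishes.\<close>

text \<open>Three obstacles shape the proof. The spaces \<open>rs_T\<close> need not be separable
  and \<open>f\<close> is merely measurable, so already the joint measurability of the germ is a
  problem. It rests on continuity of the densities in base point and argument, hence on a bound for
  their point values that is linear in the norm of the vector. A model bounds only one pairing at a
  time in this way; the principle of uniform boundedness on the closed subspaces \<open>rs_T\<close>
  passes from pairings to point values. Secondly, products of bumps and test functions must again be
  admissible of class C^r: the finest bump carries the support, and the coarser factors vary slowly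
  at its scale, so the product is admissible up to a constant. Thirdly, increments are controlled
  only for |h| < 1, so for scales above 1/4 the size of \<open>f\<close> itself is used. All
  constants depend on \<open>s\<close>, \<open>r\<close>, \<open>ga\<close>, \<open>q\<close> and
  the homogeneities below \<open>ga\<close>, which makes the bounds uniform over models. The
  condition on \<open>abar\<close> says that the gain dl^(alpha - abar) lies in L^q of the
  scales.\<close>

abbreviation nnint :: "('a::euclidean_space => ennreal) => ennreal" (binder "NI " 10) where
  "nnint f \<equiv> nn_integral lborel f"

abbreviation lbint :: "('a::euclidean_space => real) => real" (binder "LI " 10) where
  "lbint f \<equiv> integral\<^sup>L lborel f"

abbreviation "Lp \<equiv> Lp_norm lborel"
abbreviation "Ls \<equiv> Lp_norm scale_measure01"
abbreviation "Lb s \<equiv> Lp_norm (ball_measure s)"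

section \<open>The scaled norm\<close>

text \<open>The \<open>s i\<close>-th root is increasing, so the maximum of roots becomes a
  polynomial condition on each coordinate. Boxes, volumes and the triangle inequality are all read
  off from this form.\<close>

lemma snorm_le_iff:
 assumes "scaling s" "0 <= dl"
 shows "snorm s x <= dl \<longleftrightarrow> (\<forall>i. \<bar>x $ i\<bar> <= dl ^ s i)"
proof -
 have "\<bar>x $ i\<bar> powr (1 / real (s i)) <= dl \<longleftrightarrow> \<bar>x $ i\<bar> <= dl ^ s i" for i
 proof -
  have s: "0 < s i" using assms(1) by (auto simp: scaling_def Suc_le_eq)
  have "\<bar>x $ i\<bar> powr (1 / real (s i)) = root (s i) \<bar>x $ i\<bar>"
   using s by (simp add: root_powr_inverse)
  moreover have "root (s i) \<bar>x $ i\<bar> <= dl \<longleftrightarrow> \<bar>x $ i\<bar> <= dl ^ s i"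
   using real_root_le_iff[OF s, of "\<bar>x $ i\<bar>" "dl ^ s i"] s assms(2)
   by (simp add: real_root_pos2)
  ultimately show ?thesis by simp
 qed
 then show ?thesis unfolding snorm_def by (subst Max_le_iff) auto
qed

lemma snorm_nonneg [simp]: "0 <= snorm s x"
proof -
 have "0 <= \<bar>x $ undefined\<bar> powr (1 / real (s undefined))" by simp
 also have "... <= snorm s x" unfolding snorm_def by (rule Max_ge) auto
 finally show ?thesis .
qed

lemma snorm_comp_le:
 assumes "scaling s"
 shows "\<bar>x $ i\<bar> <= snorm s x ^ s i"
 using snorm_le_iff[OF assms snorm_nonneg, of x s x] by auto

lemma snorm_eq_0_iff:
 assumes "scaling s"
 shows "snorm s x = 0 \<longleftrightarrow> x = 0"
proof
 assume "snorm s x = 0"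
 then have "\<bar>x $ i\<bar> <= 0" for i
  using snorm_comp_le[OF assms, of x i] assms by (auto simp: scaling_def zero_power Suc_le_eq)
 then show "x = 0" by (simp add: vec_eq_iff)
next
 assume "x = 0"
 then have "snorm s x <= 0" using snorm_le_iff[OF assms, of 0 x] by simp
 then show "snorm s x = 0" using snorm_nonneg[of s x] by linarith
qed

lemma snorm_minus [simp]: "snorm s (- x) = snorm s x"
 by (simp add: snorm_def)

lemma snorm_diff_commute: "snorm s (x - y) = snorm s (y - x)"
 by (metis minus_diff_eq snorm_minus)

lemma continuous_snorm: "scaling s ==> continuous_on A (snorm s)"
proof -
 assume s: "scaling s"
 have "continuous_on A (%x. Max ((%i. \<bar>x $ i\<bar> powr (1 / real (s i))) ` I))"
  if "finite I" "I ~= {}" for I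
  using that
 proof (induction I rule: finite_ne_induct)
  case (singleton i)
  \<comment> \<open>\<open>root\<close> is continuous everywhere, the base 0 included.\<close>
  have "\<bar>x $ i\<bar> powr (1 / real (s i)) = root (s i) \<bar>x $ i\<bar>" for x :: "real^'a"
   using s by (simp add: root_powr_inverse scaling_def Suc_le_eq)
  then show ?case by (auto intro!: continuous_on_real_root continuous_on_rabs continuous_on_component)
 next
  case (insert i I)
  have "\<bar>x $ i\<bar> powr (1 / real (s i)) = root (s i) \<bar>x $ i\<bar>" for x :: "real^'a"
   using s by (simp add: root_powr_inverse scaling_def Suc_le_eq)
  moreover have "Max ((%i. \<bar>x $ i\<bar> powr (1 / real (s i))) ` insert i I) =
   max (\<bar>x $ i\<bar> powr (1 / real (s i))) (Max ((%i. \<bar>x $ i\<bar> powr (1 / real (s i))) ` I))" for x :: "real^'a"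
   using insert by simp
  ultimately show ?case using insert
   by (auto intro!: continuous_on_max continuous_on_real_root continuous_on_rabs continuous_on_component)
 qed
 from this[of UNIV] show ?thesis by (simp add: snorm_def)
qed

lemma snorm_borel_measurable [measurable]: "snorm s \<in> borel_measurable borel"
proof -
 have "(%x. Max ((%i. \<bar>x $ i\<bar> powr (1 / real (s i))) ` I)) \<in> borel_measurable borel"
  if "finite I" "I ~= {}" for I
  using that by (intro borel_measurable_Max) auto
 from this[of UNIV] show ?thesis by (simp add: snorm_def[abs_def])
qed

text \<open>Superadditivity of powers is subadditivity of roots: the reason why \<open>snorm\<close>
  satisfies the triangle inequality with constant 1.\<close>

lemma power_two_sum_le:
 fixes a b c :: real
 assumes "0 <= a" "0 <= b" "1 <= k"
 shows "a ^ k + b ^ k <= (a + b) ^ k"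
 using assms
proof (induction k)
 case (Suc k)
 show ?case
 proof (cases "k = 0")
  case False
  then have IH: "a ^ k + b ^ k <= (a + b) ^ k" using Suc by simp
  have "a ^ Suc k + b ^ Suc k <= (a + b) * (a ^ k + b ^ k)"
   using Suc.prems by (simp add: algebra_simps)
  also have "... <= (a + b) * (a + b) ^ k" using IH Suc.prems by (intro mult_left_mono) auto
  finally show ?thesis by simp
 qed (use Suc in auto)
qed simp

lemma snorm_triangle:
 assumes "scaling s"
 shows "snorm s (x + y) <= snorm s x + snorm s y"
proof -
 have "\<bar>(x + y) $ i\<bar> <= (snorm s x + snorm s y) ^ s i" for i
 proof -
  have "\<bar>(x + y) $ i\<bar> <= snorm s x ^ s i + snorm s y ^ s i"
   using snorm_comp_le[OF assms, of x i] snorm_comp_le[OF assms, of y i] by simp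
  also have "... <= (snorm s x + snorm s y) ^ s i"
   using assms by (intro power_two_sum_le) (auto simp: scaling_def)
  finally show ?thesis .
 qed
 then show ?thesis using snorm_le_iff[OF assms, of "snorm s x + snorm s y"] by simp
qed

lemma sball_eq_cbox: "scaling s ==> sball s = cbox (- 1) 1"
proof -
 assume s: "scaling s"
 show ?thesis
  unfolding sball_def snorm_le_iff[OF s zero_le_one]
  by (auto simp: mem_box_cart abs_le_iff)
qed

definition sbox :: "('d::finite => nat) => real ^ 'd => real => (real ^ 'd) set" where
 "sbox s x dl = {y. snorm s (y - x) <= dl}"

lemma sbox_eq_cbox:
 assumes "scaling s" "0 <= dl"
 shows "sbox s x dl = cbox (\<chi> i. x $ i - dl ^ s i) (\<chi> i. x $ i + dl ^ s i)"
 unfolding sbox_def snorm_le_iff[OF assms]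
 by (auto simp: mem_box_cart abs_le_iff algebra_simps; metis add.commute diff_le_eq le_diff_eq minus_diff_eq)

lemma compact_sbox: "scaling s ==> 0 <= dl ==> compact (sbox s x dl)"
 by (simp add: sbox_eq_cbox compact_cbox)

lemma sbox_measurable [measurable]: "sbox s x dl \<in> sets borel"
 unfolding sbox_def by measurable

lemma emeasure_sbox:
 fixes x :: "real ^ 'd::finite"
 assumes "scaling s" "0 <= dl"
 shows "emeasure lborel (sbox s x dl) = ennreal (2 ^ CARD('d) * dl ^ hom_dim s)"
proof -
 have "emeasure lborel (sbox s x dl) = ennreal (\<Prod>b\<in>(Basis :: (real^'d) set).
     ((\<chi> i. x $ i + dl ^ s i) - (\<chi> i. x $ i - dl ^ s i)) \<bullet> b)"
  unfolding sbox_eq_cbox[OF assms]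
  by (subst emeasure_lborel_cbox) (auto simp: Basis_vec_def inner_axis assms(2) power_mono)
 also have "(\<Prod>b\<in>(Basis :: (real^'d) set).
     ((\<chi> i. x $ i + dl ^ s i) - (\<chi> i. x $ i - dl ^ s i)) \<bullet> b) = (\<Prod>i\<in>UNIV. 2 * dl ^ s i)"
 proof -
  have B: "(Basis :: (real^'d) set) = (%i. axis i 1) ` UNIV" by (auto simp: Basis_vec_def)
  show ?thesis unfolding B
   by (subst prod.reindex) (auto simp: inj_on_def axis_eq_axis inner_axis intro!: prod.cong)
 qed
 also have "... = 2 ^ CARD('d) * dl ^ hom_dim s"
  by (simp add: prod.distrib power_sum hom_dim_def)
 finally show ?thesis .
qed

section \<open>Coordinatewise affine changes of variables\<close>

lemma lborel_affine_vec:
 fixes m c :: "'d::finite => real"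
 assumes "!!i. m i ~= 0"
 shows "lborel = density (distr lborel borel (%v::real^'d. \<chi> i. c i + m i * v $ i))
      (%_. ennreal (\<Prod>i\<in>UNIV. \<bar>m i\<bar>))"
proof -
 have B: "(Basis :: (real^'d) set) = (%i. axis i 1) ` UNIV" by (auto simp: Basis_vec_def)
 have inj: "inj (%i::'d. axis i (1::real))" by (auto simp: inj_on_def axis_eq_axis)
 \<comment> \<open>\<open>M\<close> transports the coefficients from indices to basis vectors: at
   \<open>axis i 1\<close> the sum picks out \<open>m i\<close>.\<close>
 define M where "M = (%b::real^'d. \<Sum>i\<in>UNIV. b $ i * m i)"
 have M: "M (axis i 1) = m i" for i
  by (simp add: M_def axis_def if_distrib[of "%x. x * _"] cong: if_cong)
 have eq: "(%x::real^'d. (\<chi> i. c i) + (\<Sum>j\<in>Basis. (M j * (x \<bullet> j)) *\<^sub>R j)) = (%v. \<chi> i. c i + m i * v $ i)"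
 proof
  fix x :: "real^'d"
  have "(\<Sum>j\<in>Basis. (M j * (x \<bullet> j)) *\<^sub>R j) $ i = m i * x $ i" for i
   unfolding B
   by (subst sum.reindex[OF inj], simp add: M inner_axis)
    (simp add: axis_def if_distrib[of "%x. _ * x"] cong: if_cong)
  then show "(\<chi> i. c i) + (\<Sum>j\<in>Basis. (M j * (x \<bullet> j)) *\<^sub>R j) = (\<chi> i. c i + m i * x $ i)"
   by (simp add: vec_eq_iff)
 qed
 have P: "(\<Prod>j\<in>Basis. \<bar>M j\<bar>) = (\<Prod>i\<in>UNIV. \<bar>m i\<bar>)"
  unfolding B by (subst prod.reindex[OF inj]) (simp add: M)
 have "M j ~= 0" if "j \<in> Basis" for j using that assms M by (auto simp: B)
 from lborel_affine_euclidean[where c = M and t = "\<chi> i. c i", OF this] show ?thesis unfolding eq P by simp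
qed

lemma affine_vec_measurable [measurable]:
 "(%v::real^'d::finite. \<chi> i. c i + m i * v $ i) \<in> borel_measurable borel"
 by (intro borel_measurable_continuous_onI continuous_on_vec_lambda continuous_intros)

lemma lborel_integral_affine_vec:
 fixes f :: "real^'d::finite => real"
 assumes "!!i. m i ~= 0" and [measurable]: "f \<in> borel_measurable borel"
 shows "(LI v. f (\<chi> i. c i + m i * v $ i)) * (\<Prod>i\<in>UNIV. \<bar>m i\<bar>) = (LI y. f y)"
proof -
 have "(LI y. f y) = (\<integral>y. f y \<partial>density (distr lborel borel (%v::real^'d. \<chi> i. c i + m i * v $ i))
      (%_. ennreal (\<Prod>i\<in>UNIV. \<bar>m i\<bar>)))"
  using lborel_affine_vec[OF assms(1), of c] by simp
 also have "... = (LI v. (\<Prod>i\<in>UNIV. \<bar>m i\<bar>) *\<^sub>R f (\<chi> i. c i + m i * v $ i))"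
  by (subst integral_density) (auto simp: integral_distr prod_nonneg)
 finally show ?thesis by (simp add: mult.commute)
qed

lemma nn_integral_lborel_translate:
 fixes f :: "'a::euclidean_space => ennreal"
 assumes [measurable]: "f \<in> borel_measurable borel"
 shows "(NI x. f (a + x)) = (NI x. f x)"
proof -
 have "(NI x. f x) = (\<integral>\<^sup>+x. f x \<partial>distr lborel borel ((+) a))"
  by (simp add: lborel_distr_plus)
 also have "... = (NI x. f (a + x))" by (subst nn_integral_distr) auto
 finally show ?thesis by simp
qed

section \<open>Quantitative bounds on derivatives\<close>

lemma partial_deriv_eq:
 "(f has_derivative D) (at x) ==> partial_deriv i f x = D (axis i 1)"
 unfolding partial_deriv_def using frechet_derivative_at by metis

lemma has_derivative_partial:
 fixes f :: "real ^ 'd::finite => real"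
 assumes "f differentiable at x"
 shows "(f has_derivative (%h. \<Sum>i\<in>UNIV. h $ i * partial_deriv i f x)) (at x)"
proof -
 have D: "(f has_derivative frechet_derivative f (at x)) (at x)"
  using assms frechet_derivative_works by blast
 have "frechet_derivative f (at x) h = (\<Sum>i\<in>UNIV. h $ i * partial_deriv i f x)" for h
 proof -
  have "frechet_derivative f (at x) h = frechet_derivative f (at x) (\<Sum>i\<in>UNIV. h $ i *\<^sub>R axis i 1)"
   by (subst (1) basis_expansion[symmetric]) (simp add: scalar_mult_eq_scaleR)
  also have "... = (\<Sum>i\<in>UNIV. h $ i * partial_deriv i f x)"
   using has_derivative_bounded_linear[OF D, THEN bounded_linear.linear]
   by (simp add: linear_sum linear_scale partial_deriv_def)
  finally show ?thesis .
 qed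
 then have "frechet_derivative f (at x) = (%h. \<Sum>i\<in>UNIV. h $ i * partial_deriv i f x)" by (rule ext)
 then show ?thesis using D by simp
qed

text \<open>\<open>C_class\<close> together with a bound on all derivatives of order at most
  \<open>k\<close>. It recurses on \<open>k\<close> in the same way as \<open>C_class\<close>, which
  makes the product and substitution rules provable by induction; \<open>Cb_iff\<close> translates
  it to \<open>C_norm\<close>.\<close>

primrec Cb :: "nat => real => (real ^ 'd::finite => real) => bool" where
 "Cb 0 a f \<longleftrightarrow> continuous_on UNIV f \<and> (\<forall>x. \<bar>f x\<bar> <= a)"
| "Cb (Suc k) a f \<longleftrightarrow> (\<forall>x. f differentiable at x) \<and> (\<forall>x. \<bar>f x\<bar> <= a) \<and> (\<forall>i. Cb k a (partial_deriv i f))"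

lemma Cb_bound: "Cb k a f ==> \<bar>f x\<bar> <= a"
 by (cases k) auto

lemma Cb_nonneg: "Cb k a f ==> 0 <= a"
 using Cb_bound[of k a f 0] by linarith

lemma Cb_mono: "Cb k a f ==> a <= b ==> Cb k b f"
 by (induction k arbitrary: f) (auto intro: order_trans)

lemma Cb_lower: "Cb (Suc k) a f ==> Cb k a f"
proof (induction k arbitrary: f)
 case 0
 then show ?case by (auto intro!: differentiable_imp_continuous_on simp: differentiable_on_def)
next
 case (Suc k)
 then show ?case by simp
qed

lemma C_class_lower: "C_class (Suc k) f ==> C_class k f"
proof (induction k arbitrary: f)
 case 0
 then show ?case by (auto intro!: differentiable_imp_continuous_on simp: differentiable_on_def)
next
 case (Suc k)
 then show ?case by simp
qed

lemma C_class_mono: "C_class k f ==> j <= k ==> C_class j f"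
 using C_class_lower by (induction k) (auto simp: le_Suc_eq)

lemma C_class_continuous: "C_class k f ==> continuous_on A f"
 using C_class_mono[of k f 0] continuous_on_subset by auto

lemma Cb_C_class: "Cb k a f ==> C_class k f"
 by (induction k arbitrary: f) auto

lemma C_norm_le_iff:
 assumes "0 <= a"
 shows "C_norm r f <= ennreal a \<longleftrightarrow> (\<forall>ks x. length ks <= r --> \<bar>foldr partial_deriv ks f x\<bar> <= a)"
 unfolding C_norm_def by (auto simp: SUP_le_iff ennreal_le_iff[OF assms])

lemma C_norm_ge: "length ks <= r ==> ennreal \<bar>foldr partial_deriv ks f x\<bar> <= C_norm r f"
 unfolding C_norm_def by (intro SUP_upper2[of ks] SUP_upper) auto

lemma C_norm_ge_abs: "ennreal \<bar>f x\<bar> <= C_norm r f"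
 using C_norm_ge[of "[]" r f x] by simp

lemma Cb_iff:
 fixes f :: "real ^ 'd::finite => real"
 assumes "0 <= a"
 shows "Cb r a f \<longleftrightarrow> C_class r f \<and> C_norm r f <= ennreal a"
proof (induction r arbitrary: f)
 case 0
 show ?case unfolding C_norm_le_iff[OF assms] by auto
next
 case (Suc r)
 have "C_norm (Suc r) f <= ennreal a \<longleftrightarrow> (\<forall>x. \<bar>f x\<bar> <= a) \<and> (\<forall>i. C_norm r (partial_deriv i f) <= ennreal a)"
  unfolding C_norm_le_iff[OF assms]
 proof (intro iffI conjI allI impI)
  fix ks :: "'d list" and x
  assume *: "(\<forall>x. \<bar>f x\<bar> <= a) \<and> (\<forall>i. \<forall>(ks :: 'd list) x. length ks <= r --> \<bar>foldr partial_deriv ks (partial_deriv i f) x\<bar> <= a)"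
   and l: "length ks <= Suc r"
  show "\<bar>foldr partial_deriv ks f x\<bar> <= a"
  \<comment> \<open>\<open>foldr\<close> applies the last entry of the list first, so the derivative
    taken by the recursion of \<open>Cb\<close> is the last entry.\<close>
  proof (cases ks rule: rev_cases)
   case (snoc js i)
   then show ?thesis using * l by simp
  qed (use * in simp)
 next
  fix x
  assume "\<forall>(ks :: 'd list) x. length ks <= Suc r --> \<bar>foldr partial_deriv ks f x\<bar> <= a"
  then show "\<bar>f x\<bar> <= a" by (force dest: spec[of _ "[]"])
 next
  fix i x and ks :: "'d list"
  assume "\<forall>(ks :: 'd list) x. length ks <= Suc r --> \<bar>foldr partial_deriv ks f x\<bar> <= a" "length ks <= r"
  then show "\<bar>foldr partial_deriv ks (partial_deriv i f) x\<bar> <= a"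
   by (force dest: spec[of _ "ks @ [i]"])
 qed
 then show ?case by (auto simp: Suc.IH)
qed

lemma partial_deriv_mult:
 assumes "f differentiable at x" "g differentiable at x"
 shows "partial_deriv i (%x. f x * g x) x = partial_deriv i f x * g x + f x * partial_deriv i g x"
proof -
 have "((%x. f x * g x) has_derivative
   (%h. f x * frechet_derivative g (at x) h + frechet_derivative f (at x) h * g x)) (at x)"
  by (intro has_derivative_mult) (use assms frechet_derivative_works in blast)+
 from partial_deriv_eq[OF this] show ?thesis by (simp add: partial_deriv_def)
qed

lemma partial_deriv_add:
 assumes "f differentiable at x" "g differentiable at x"
 shows "partial_deriv i (%x. f x + g x) x = partial_deriv i f x + partial_deriv i g x"
proof -
 have "((%x. f x + g x) has_derivative
   (%h. frechet_derivative f (at x) h + frechet_derivative g (at x) h)) (at x)"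
  by (intro has_derivative_add) (use assms frechet_derivative_works in blast)+
 from partial_deriv_eq[OF this] show ?thesis by (simp add: partial_deriv_def)
qed

lemma partial_deriv_cmult:
 assumes "f differentiable at x"
 shows "partial_deriv i (%x. c * f x) x = c * partial_deriv i f x"
proof -
 have "((%x. c * f x) has_derivative (%h. c * frechet_derivative f (at x) h)) (at x)"
  by (intro has_derivative_mult_right) (use assms frechet_derivative_works in blast)
 from partial_deriv_eq[OF this] show ?thesis by (simp add: partial_deriv_def)
qed

lemma partial_deriv_const: "partial_deriv i (%x. c) = (%x. 0)"
 using partial_deriv_eq[OF has_derivative_const] by (intro ext) fastforce

lemma Cb_zero: "0 <= a ==> Cb k a (%x. 0)"
 by (induction k) (auto simp: partial_deriv_const)

lemma Cb_const: "\<bar>c\<bar> <= a ==> Cb k a (%x. c)"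
 by (cases k) (auto simp: partial_deriv_const intro!: Cb_zero)

lemma Cb_cmult: "Cb k a f ==> Cb k (\<bar>c\<bar> * a) (%x. c * f x)"
proof (induction k arbitrary: f)
 case (Suc k)
 then have "partial_deriv i (%x. c * f x) = (%x. c * partial_deriv i f x)" for i
  by (intro ext partial_deriv_cmult) auto
 then show ?case using Suc by (auto simp: abs_mult intro!: mult_left_mono)
qed (auto simp: abs_mult intro!: mult_left_mono continuous_intros)

lemma Cb_add: "Cb k a f ==> Cb k b g ==> Cb k (a + b) (%x. f x + g x)"
proof (induction k arbitrary: f g)
 case 0
 then show ?case by (auto intro!: continuous_intros order_trans[OF abs_triangle_ineq] add_mono)
next
 case (Suc k)
 then have "partial_deriv i (%x. f x + g x) = (%x. partial_deriv i f x + partial_deriv i g x)" for i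
  by (intro ext partial_deriv_add) auto
 then show ?case using Suc by (auto intro!: order_trans[OF abs_triangle_ineq] add_mono)
qed

text \<open>Each derivative doubles the number of terms in Leibniz's rule, hence the factor
  2^k.\<close>

lemma Cb_mult: "Cb k a f ==> Cb k b g ==> Cb k (2 ^ k * a * b) (%x. f x * g x)"
proof (induction k arbitrary: f g)
 case 0
 then show ?case
  by (auto simp: abs_mult intro!: continuous_intros mult_mono order_trans[OF abs_ge_zero])
next
 case (Suc k)
 have D: "partial_deriv i (%x. f x * g x) = (%x. partial_deriv i f x * g x + f x * partial_deriv i g x)" for i
  using Suc by (intro ext partial_deriv_mult) auto
 have "Cb k (2 ^ k * a * b + 2 ^ k * a * b) (%x. partial_deriv i f x * g x + f x * partial_deriv i g x)" for i
  using Suc.prems by (intro Cb_add Suc.IH Cb_lower[of k _ f] Cb_lower[of k _ g]) auto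
 moreover have "\<bar>f x * g x\<bar> <= 2 ^ Suc k * a * b" for x
 proof -
  have "\<bar>f x * g x\<bar> <= a * b"
   using Suc.prems unfolding abs_mult by (intro mult_mono) (auto intro: order_trans[OF abs_ge_zero])
  also have "... <= 2 ^ Suc k * (a * b)"
   using Cb_nonneg[OF Suc.prems(1)] Cb_nonneg[OF Suc.prems(2)]
   using mult_right_mono[of 1 "2 ^ Suc k" "a * b"] one_le_power[of "2::real" "Suc k"] by simp
  finally show ?thesis by (simp add: mult.assoc)
 qed
 ultimately show ?case using Suc.prems by (auto simp: D algebra_simps)
qed

lemma has_derivative_affine_vec:
 "((%v::real^'d::finite. \<chi> i. c i + m i * v $ i) has_derivative (%h. \<chi> i. m i * h $ i)) (at v)"
proof -
 have *: "(%v::real^'d. \<chi> i. c i + m i * v $ i) = (%v. (\<chi> i. c i) + (\<chi> i. m i * v $ i))"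
  by (auto simp: vec_eq_iff)
 have "bounded_linear (%v::real^'d. \<chi> i. m i * v $ i)"
  by (intro linear_conv_bounded_linear[THEN iffD1] linearI) (auto simp: vec_eq_iff algebra_simps)
 then show ?thesis unfolding *
  by (auto intro!: derivative_eq_intros bounded_linear_imp_has_derivative)
qed

lemma partial_deriv_affine:
 assumes "f differentiable at (\<chi> i. c i + m i * v $ i)"
 shows "(%v::real^'d::finite. f (\<chi> i. c i + m i * v $ i)) differentiable at v"
  and "partial_deriv j (%v. f (\<chi> i. c i + m i * v $ i)) v = m j * partial_deriv j f (\<chi> i. c i + m i * v $ i)"
proof -
 let ?A = "%v::real^'d. \<chi> i. c i + m i * v $ i"
 have D: "(f has_derivative frechet_derivative f (at (?A v))) (at (?A v))"
  using assms frechet_derivative_works by blast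
 have "((%v. f (?A v)) has_derivative (%h. frechet_derivative f (at (?A v)) (\<chi> i. m i * h $ i))) (at v)"
  using has_derivative_compose[OF has_derivative_affine_vec D] .
 then show "(%v. f (?A v)) differentiable at v" "partial_deriv j (%v. f (?A v)) v = m j * partial_deriv j f (?A v)"
 proof -
  assume *: "((%v. f (?A v)) has_derivative (%h. frechet_derivative f (at (?A v)) (\<chi> i. m i * h $ i))) (at v)"
  then show "(%v. f (?A v)) differentiable at v" by (auto simp: differentiable_def)
  have "(\<chi> i. m i * axis j (1::real) $ i) = m j *\<^sub>R axis j 1" by (auto simp: vec_eq_iff axis_def)
  then show "partial_deriv j (%v. f (?A v)) v = m j * partial_deriv j f (?A v)"
   using partial_deriv_eq[OF *, of j] has_derivative_bounded_linear[OF D, THEN bounded_linear.linear]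
   by (simp add: partial_deriv_def linear_scale)
 qed
qed

text \<open>The chain rule produces one factor \<open>m i\<close> per derivative; with
  \<open>1 <= L\<close> the power \<open>L ^ k\<close> dominates the lower orders as well.\<close>

lemma Cb_affine:
 fixes f :: "real ^ 'd::finite => real"
 assumes "Cb k a f" "!!i. \<bar>m i\<bar> <= L" "1 <= L"
 shows "Cb k (L ^ k * a) (%v. f (\<chi> i. c i + m i * v $ i))"
 using assms(1)
proof (induction k arbitrary: f)
 case 0
 have "continuous_on UNIV (%v::real^'d. \<chi> i. c i + m i * v $ i)"
  by (intro continuous_on_vec_lambda continuous_intros)
 with 0 show ?case by (auto intro: continuous_on_compose2)
next
 case (Suc k)
 let ?A = "%v::real^'d. \<chi> i. c i + m i * v $ i"
 have D: "partial_deriv j (%v. f (?A v)) = (%v. m j * partial_deriv j f (?A v))" for j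
  using Suc.prems by (intro ext partial_deriv_affine(2)) auto
 have "Cb k (L ^ Suc k * a) (%v. m j * partial_deriv j f (?A v))" for j
 proof -
  have "Cb k (\<bar>m j\<bar> * (L ^ k * a)) (%v. m j * partial_deriv j f (?A v))"
   using Suc by (intro Cb_cmult) auto
  moreover have "\<bar>m j\<bar> * (L ^ k * a) <= L * (L ^ k * a)"
   using assms(2,3) Cb_nonneg[OF Suc.prems] by (intro mult_right_mono) auto
  ultimately show ?thesis using Cb_mono by (simp add: mult.assoc) blast
 qed
 moreover have "\<bar>f (?A v)\<bar> <= L ^ Suc k * a" for v
 proof -
  have "\<bar>f (?A v)\<bar> <= 1 * a" using Suc.prems by simp
  also have "... <= L ^ Suc k * a"
   using assms(3) Cb_nonneg[OF Suc.prems] by (intro mult_right_mono one_le_power) auto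
  finally show ?thesis .
 qed
 ultimately show ?case using Suc.prems unfolding D by (auto intro: partial_deriv_affine(1) simp: D)
qed

section \<open>Closure properties of \<open>C_class\<close> and of supports\<close>

lemma C_class_const: "C_class k (%x. c)"
 using Cb_C_class[OF Cb_const[OF order_refl]] .

lemma C_class_add: "C_class k f ==> C_class k g ==> C_class k (%x. f x + g x)"
proof (induction k arbitrary: f g)
 case (Suc k)
 then have "partial_deriv i (%x. f x + g x) = (%x. partial_deriv i f x + partial_deriv i g x)" for i
  by (intro ext partial_deriv_add) auto
 then show ?case using Suc by auto
qed (auto intro: continuous_intros)

lemma C_class_mult: "C_class k f ==> C_class k g ==> C_class k (%x. f x * g x)"
proof (induction k arbitrary: f g)
 case (Suc k)
 then have "partial_deriv i (%x. f x * g x) = (%x. partial_deriv i f x * g x + f x * partial_deriv i g x)" for i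
  by (intro ext partial_deriv_mult) auto
 then show ?case using Suc C_class_lower[of k f] C_class_lower[of k g] by (auto intro!: C_class_add)
qed (auto intro: continuous_intros)

lemma C_class_cmult: "C_class k f ==> C_class k (%x. c * f x)"
 by (intro C_class_mult C_class_const)

lemma C_class_diff: "C_class k f ==> C_class k g ==> C_class k (%x. f x - g x)"
 using C_class_add[of k f "%x. (-1) * g x"] C_class_cmult[of k g "-1"] by simp

lemma C_class_prod: "(!!i. i \<in> I ==> C_class k (f i)) ==> C_class k (%x. \<Prod>i\<in>I. f i x)"
 by (induction I rule: infinite_finite_induct) (auto intro: C_class_mult C_class_const)

lemma C_class_affine:
 fixes f :: "real ^ 'd::finite => real"
 assumes "C_class k f"
 shows "C_class k (%v. f (\<chi> i. c i + m i * v $ i))"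
 using assms
proof (induction k arbitrary: f)
 case 0
 have "continuous_on UNIV (%v::real^'d. \<chi> i. c i + m i * v $ i)"
  by (intro continuous_on_vec_lambda continuous_intros)
 with 0 show ?case by (auto intro: continuous_on_compose2)
next
 case (Suc k)
 have "partial_deriv j (%v. f (\<chi> i. c i + m i * v $ i)) = (%v. m j * partial_deriv j f (\<chi> i. c i + m i * v $ i))" for j
  using Suc.prems by (intro ext partial_deriv_affine(2)) auto
 then show ?case using Suc by (auto intro!: C_class_cmult partial_deriv_affine(1))
qed

text \<open>Off a closed set containing the support the function vanishes in a whole neighbourhood,
  and so does its derivative.\<close>

lemma supported_in_partial_deriv:
 assumes "supported_in f K" "closed K"
 shows "supported_in (partial_deriv i f) K"
 unfolding supported_in_def
proof (intro allI impI)
 fix x assume nz: "partial_deriv i f x ~= 0"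
 show "x \<in> K"
 proof (rule ccontr)
  assume "x \<notin> K"
  then have "(f has_derivative (%h. 0)) (at x)"
   using assms by (intro has_derivative_transform_within_open[OF has_derivative_const[of 0], of "- K"])
    (auto simp: supported_in_def)
  from partial_deriv_eq[OF this, of i] nz show False by simp
 qed
qed

text \<open>Each derivative is continuous with compact support, hence bounded, and there are only
  finitely many directions, so a maximum exists.\<close>

lemma Cb_exists:
 fixes f :: "real ^ 'd::finite => real"
 assumes "C_class k f" "supported_in f K" "compact K"
 shows "\<exists>a. Cb k a f"
 using assms(1,2)
proof (induction k arbitrary: f)
 have bdd: "\<exists>a. \<forall>x. \<bar>f x\<bar> <= a" if "continuous_on UNIV f" "supported_in f K" for f :: "real ^ 'd => real"
 proof -
  have "compact (f ` K)" using that assms(3) by (intro compact_continuous_image) (auto intro: continuous_on_subset)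
  then obtain a where "!!x. x \<in> K ==> \<bar>f x\<bar> <= a" using compact_imp_bounded[of "f ` K"] by (auto simp: bounded_iff)
  moreover have "f x = 0" if "x \<notin> K" for x using that \<open>supported_in f K\<close> by (auto simp: supported_in_def)
  ultimately have "\<bar>f x\<bar> <= max a 0" for x by (cases "x \<in> K") (auto simp: le_max_iff_disj)
  then show ?thesis by blast
 qed
 {
  case 0
  then show ?case using bdd by auto
 next
  case (Suc k)
  obtain a where a: "!!x. \<bar>f x\<bar> <= a"
   using bdd[of f] Suc.prems C_class_continuous by blast
  have "\<exists>b. Cb k b (partial_deriv i f)" for i
   using Suc assms(3) by (intro Suc.IH supported_in_partial_deriv) (auto simp: compact_imp_closed)
  then obtain b where b: "!!i. Cb k (b i) (partial_deriv i f)" by metis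
  have "Cb k (Max (insert a (range b))) (partial_deriv i f)" for i
   by (intro Cb_mono[OF b] Max_ge) auto
  moreover have "\<bar>f x\<bar> <= Max (insert a (range b))" for x
   by (rule order_trans[OF a Max_ge]) auto
  ultimately have "Cb (Suc k) (Max (insert a (range b))) f" using Suc.prems by simp
  then show ?case by blast
 }
qed

section \<open>Smooth functions of one variable\<close>

text \<open>\<open>C1 k\<close> is the class C^k of functions of one real variable, not the class
  C^1. Quantifying over the derivative keeps the closure rules to one-step inductions.\<close>

primrec C1 :: "nat => (real => real) => bool" where
 "C1 0 f \<longleftrightarrow> continuous_on UNIV f"
| "C1 (Suc k) f \<longleftrightarrow> (\<exists>f'. (\<forall>t. (f has_real_derivative f' t) (at t)) \<and> C1 k f')"

lemma C1_SucI: "(!!t. (f has_real_derivative f' t) (at t)) ==> C1 k f' ==> C1 (Suc k) f"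
 by auto

lemma DERIV_continuous_on: "(!!t. (f has_real_derivative f' t) (at t)) ==> continuous_on UNIV f"
 using DERIV_isCont by (blast intro: continuous_at_imp_continuous_on)

lemma C1_lower: "C1 (Suc k) f ==> C1 k f"
proof (induction k arbitrary: f)
 case 0
 then show ?case using DERIV_continuous_on by auto
qed auto

lemma C1_const: "C1 k (%t. c)"
 by (induction k arbitrary: c) (auto intro!: exI[of _ "%t. 0"])

lemma C1_add: "C1 k f ==> C1 k g ==> C1 k (%t. f t + g t)"
proof (induction k arbitrary: f g)
 case (Suc k)
 then obtain f' g' where "!!t. (f has_real_derivative f' t) (at t)" "C1 k f'"
  "!!t. (g has_real_derivative g' t) (at t)" "C1 k g'" by auto
 with Suc.IH show ?case by (auto intro!: exI[of _ "%t. f' t + g' t"] derivative_intros)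
qed (auto intro: continuous_intros)

lemma C1_mult: "C1 k f ==> C1 k g ==> C1 k (%t. f t * g t)"
proof (induction k arbitrary: f g)
 case (Suc k)
 then obtain f' g' where *: "!!t. (f has_real_derivative f' t) (at t)" "C1 k f'"
  "!!t. (g has_real_derivative g' t) (at t)" "C1 k g'" by auto
 have "C1 k (%t. f t * g' t + f' t * g t)"
  using * Suc.prems by (intro C1_add Suc.IH) (auto dest: C1_lower simp del: C1.simps(2))
 moreover have "((%t. f t * g t) has_real_derivative f t * g' t + f' t * g t) (at t)" for t
  using DERIV_mult'[OF *(1) *(3)] .
 ultimately show ?case by (intro C1_SucI)
qed (auto intro: continuous_intros)

lemma C1_affine: "C1 k f ==> C1 k (%t. f (c + m * t))"
proof (induction k arbitrary: f)
 case 0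
 then show ?case by (auto intro!: continuous_intros continuous_on_compose2[of UNIV f])
next
 case (Suc k)
 then obtain f' where *: "!!t. (f has_real_derivative f' t) (at t)" "C1 k f'" by auto
 have "((%t. f (c + m * t)) has_real_derivative m * f' (c + m * t)) (at t)" for t
 proof -
  have "((%t. c + m * t) has_real_derivative m) (at t)" by (auto intro!: derivative_eq_intros)
  from DERIV_chain2[OF *(1) this] show ?thesis by (simp add: mult.commute)
 qed
 moreover have "C1 k (%t. m * f' (c + m * t))" using * Suc.IH by (intro C1_mult C1_const) auto
 ultimately show ?case by (intro C1_SucI)
qed

lemma C1_inverse:
 assumes "C1 k f" "!!t. f t ~= 0"
 shows "C1 k (%t. inverse (f t))"
 using assms
proof (induction k arbitrary: f)
 case 0
 then show ?case by (auto intro: continuous_intros)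
next
 case (Suc k)
 then obtain f' where *: "!!t. (f has_real_derivative f' t) (at t)" "C1 k f'" by auto
 have "((%t. inverse (f t)) has_real_derivative - (inverse (f t) * f' t * inverse (f t))) (at t)" for t
  using DERIV_inverse'[OF *(1) Suc.prems(2)] by simp
 moreover have "C1 k (%t. (-1) * (inverse (f t) * f' t * inverse (f t)))"
  using Suc * by (intro C1_mult C1_const Suc.IH) (auto dest: C1_lower simp del: C1.simps(2))
 ultimately show ?case by (intro C1_SucI) simp_all
qed

lemma C_class_C1: "C1 k f ==> C_class k (%x::real^'d::finite. f (x $ i))"
proof (induction k arbitrary: f)
 case 0
 then show ?case by (auto intro!: continuous_on_compose2[of UNIV f] continuous_intros)
next
 case (Suc k)
 then obtain f' where *: "!!t. (f has_real_derivative f' t) (at t)" "C1 k f'" by auto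
 have D: "((%x::real^'d. f (x $ i)) has_derivative (%h. f' (x $ i) * h $ i)) (at x)" for x
  using has_derivative_compose[of "%x::real^'d. x $ i" "%h. h $ i" x UNIV f "(*) (f' (x $ i))"] *(1)[of "x $ i"]
  by (auto simp: has_field_derivative_def intro!: bounded_linear_imp_has_derivative bounded_linear_vec_nth)
 have "partial_deriv j (%x::real^'d. f (x $ i)) = (%x. (if i = j then 1 else 0) * f' (x $ i))" for j
  by (rule ext, subst partial_deriv_eq[OF D]) (simp add: axis_def)
 then show ?case using D * Suc.IH by (auto intro!: C_class_cmult C_class_const simp: differentiable_def)
qed

text \<open>Cauchy's function, flat at 0. Every bump and cut-off below is built from it.\<close>

definition exp_inv :: "real => real" where
 "exp_inv t = (if t > 0 then exp (- inverse t) else 0)"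

text \<open>With u = 1/t this is the decay of a polynomial against the exponential at
  infinity.\<close>

lemma tendsto_poly_exp_inv:
 "((%t. poly P (inverse t) * exp (- inverse t)) \<longlongrightarrow> 0) (at_right (0::real))"
proof -
 have "((%u. \<Sum>i\<le>degree P. coeff P i * (u ^ i / exp u)) \<longlongrightarrow> (\<Sum>i\<le>degree P. coeff P i * 0)) at_top"
  by (intro tendsto_sum tendsto_mult tendsto_const tendsto_power_div_exp_0)
 then have "((%u. poly P u * exp (- u)) \<longlongrightarrow> 0) at_top"
  by (simp add: poly_altdef sum_divide_distrib sum_distrib_right exp_minus field_simps)
 then show ?thesis
  by (rule filterlim_compose[OF _ filterlim_inverse_at_top_right])
qed

text \<open>The functions P(1/t) exp(-1/t), extended by 0, are closed under differentiation: P
  becomes X^2 (P - P'). Smoothness of \<open>exp_inv\<close> follows by induction over all P at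
  once.\<close>

lemma has_derivative_poly_exp_inv:
 fixes P :: "real poly"
 defines "f \<equiv> %P t. if t > 0 then poly P (inverse t) * exp (- inverse t) else (0::real)"
 shows "(f P has_real_derivative f (monom 1 2 * (P - pderiv P)) t) (at t)"
proof -
 consider "t > 0" | "t < 0" | "t = 0" by linarith
 then show ?thesis
 proof cases
  case 1
  have "((%t. poly P (inverse t) * exp (- inverse t)) has_real_derivative
    f (monom 1 2 * (P - pderiv P)) t) (at t)"
   using 1 unfolding f_def
   by (auto intro!: derivative_eq_intros simp: poly_monom field_simps power2_eq_square)
  then show ?thesis
   by (rule has_field_derivative_transform_within_open[of _ _ _ "{0<..}"]) (use 1 in \<open>auto simp: f_def\<close>)
 next
  case 2
  show ?thesis
   by (rule has_field_derivative_transform_within_open[of "%t. 0" _ _ "{..<0}"]) (use 2 in \<open>auto simp: f_def\<close>)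
 next
  case 3
  have "((%h. (f P (0 + h) - f P 0) / h) \<longlongrightarrow> 0) (at 0)"
   unfolding filterlim_at_split
  proof
   have "eventually (%h. (f P (0 + h) - f P 0) / h = 0) (at_left (0::real))"
    using eventually_at_left_real[of "-1::real" 0, simplified] by eventually_elim (auto simp: f_def)
   then show "((%h. (f P (0 + h) - f P 0) / h) \<longlongrightarrow> 0) (at_left 0)"
    by (rule tendsto_eventually)
   \<comment> \<open>Division by h multiplies P by the variable, so the right difference quotient at
     0 belongs to the same family.\<close>
   have "eventually (%h. poly (pCons 0 P) (inverse h) * exp (- inverse h) = (f P (0 + h) - f P 0) / h) (at_right (0::real))"
    using eventually_at_right_less[of "0::real"] by eventually_elim (auto simp: f_def field_simps)
   then show "((%h. (f P (0 + h) - f P 0) / h) \<longlongrightarrow> 0) (at_right 0)"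
    by (rule Lim_transform_eventually[OF tendsto_poly_exp_inv])
  qed
  then have "(f P has_real_derivative 0) (at 0)" unfolding DERIV_def .
  moreover have "f (monom 1 2 * (P - pderiv P)) 0 = 0" by (simp add: f_def)
  ultimately show ?thesis using 3 by simp
 qed
qed

lemma C1_exp_inv: "C1 k exp_inv"
proof -
 have "C1 k (%t. if t > 0 then poly P (inverse t) * exp (- inverse t) else (0::real))" for P
 proof (induction k arbitrary: P)
  case 0
  show ?case using has_derivative_poly_exp_inv[of P]
   by (auto intro!: continuous_at_imp_continuous_on DERIV_isCont)
 next
  case (Suc k)
  show ?case by (rule C1_SucI[OF has_derivative_poly_exp_inv Suc.IH])
 qed
 from this[of 1] show ?thesis by (simp add: exp_inv_def[abs_def] cong: if_cong)
qed

lemma exp_inv_nonneg: "0 <= exp_inv t" by (simp add: exp_inv_def)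
lemma exp_inv_pos_iff: "0 < exp_inv t \<longleftrightarrow> 0 < t" by (simp add: exp_inv_def)

text \<open>A smooth transition from 0 to 1 across [-1/2, 1/2]. The two arguments in the denominator
  add up to 1, so one of them is positive and the denominator never vanishes.\<close>

definition step :: "real => real" where
 "step t = exp_inv (1/2 + t) * inverse (exp_inv (1/2 + t) + exp_inv (1/2 - t))"

lemma C1_step: "C1 k step"
proof -
 have "exp_inv (1/2 + t) + exp_inv (1/2 - t) ~= 0" for t
  using exp_inv_nonneg[of "1/2 + t"] exp_inv_nonneg[of "1/2 - t"]
   exp_inv_pos_iff[of "1/2 + t"] exp_inv_pos_iff[of "1/2 - t"] by linarith
 moreover have "C1 k (%t. exp_inv (1/2 + t))" "C1 k (%t. exp_inv (1/2 - t))"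
  using C1_affine[OF C1_exp_inv, of k "1/2" 1] C1_affine[OF C1_exp_inv, of k "1/2" "-1"] by simp_all
 ultimately show ?thesis unfolding step_def[abs_def]
  by (intro C1_mult C1_inverse C1_add)
qed

lemma step_eq_0: "t <= -1/2 ==> step t = 0"
 and step_eq_1: "t \<ge> 1/2 ==> step t = 1"
 by (auto simp: step_def exp_inv_def)

text \<open>As a difference of two steps at distance 1 it has integer translates that telescope: a
  smooth partition of unity, from which the cells of the uniqueness argument are made.\<close>

definition hat :: "real => real" where
 "hat t = step (t + 1/2) - step (t - 1/2)"

lemma C1_hat: "C1 k hat"
 using C1_add[OF C1_affine[OF C1_step, of k "1/2" 1] C1_mult[OF C1_const[of k "-1"] C1_affine[OF C1_step, of k "-1/2" 1]]]
 by (simp add: hat_def[abs_def] add.commute)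

lemma hat_eq_0: "1 <= \<bar>t\<bar> ==> hat t = 0"
 using step_eq_0[of "t + 1/2"] step_eq_0[of "t - 1/2"] step_eq_1[of "t + 1/2"] step_eq_1[of "t - 1/2"]
 by (cases "t \<ge> 0") (auto simp: hat_def)

text \<open>Telescoping leaves two steps, both evaluated outside their transition intervals.\<close>

lemma sum_hat:
 assumes "\<bar>t\<bar> <= real n"
 shows "(\<Sum>k\<in>{- int n..int n}. hat (t - real_of_int k)) = 1"
proof -
 have "(\<Sum>k\<in>{- int n..int n}. hat (t - real_of_int k)) = step (t + real n + 1/2) - step (t - real n - 1/2)"
 proof (induction n)
  case (Suc n)
  have "{- int (Suc n)..int (Suc n)} = insert (- int (Suc n)) (insert (int (Suc n)) {- int n..int n})" by auto
  then show ?case using Suc by (simp add: hat_def algebra_simps)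
 qed (simp add: hat_def)
 then show ?thesis using assms step_eq_1[of "t + real n + 1/2"] step_eq_0[of "t - real n - 1/2"] by auto
qed

section \<open>Bump functions\<close>

definition bump0 :: "real ^ 'd::finite => real" where
 "bump0 x = (\<Prod>i\<in>UNIV. exp_inv (1 + x $ i) * exp_inv (1 - x $ i))"

lemma C_class_bump0: "C_class k bump0"
proof -
 have "C1 k (%t. exp_inv (1 + t) * exp_inv (1 - t))"
  using C1_mult[OF C1_affine[OF C1_exp_inv, of k 1 1] C1_affine[OF C1_exp_inv, of k 1 "-1"]] by simp
 from C_class_C1[OF this] show ?thesis unfolding bump0_def[abs_def] by (intro C_class_prod)
qed

lemma bump0_nonneg: "0 <= bump0 x"
 unfolding bump0_def by (intro prod_nonneg) (simp add: exp_inv_nonneg)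

lemma bump0_pos_iff: "0 < bump0 x \<longleftrightarrow> (\<forall>i. \<bar>x $ i\<bar> < 1)"
proof -
 have "0 < bump0 x \<longleftrightarrow> bump0 x ~= 0" using bump0_nonneg[of x] by linarith
 also have "... \<longleftrightarrow> (\<forall>i. \<bar>x $ i\<bar> < 1)"
  by (auto simp: bump0_def exp_inv_def abs_less_iff; smt (verit))
 finally show ?thesis .
qed

lemma bump0_supp: "bump0 x ~= 0 ==> \<bar>x $ i\<bar> < 1"
 using bump0_pos_iff[of x] bump0_nonneg[of x] by fastforce

lemma integrable_compact_support:
 fixes f :: "'a::euclidean_space => real"
 assumes "continuous_on UNIV f" "supported_in f K" "compact K"
 shows "integrable lborel f"
proof -
 have "integrable lborel (%x. indicator K x *\<^sub>R f x)"
  using borel_integrable_compact[of K f] assms continuous_on_subset[of UNIV f K] by (simp add: set_integrable_def)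
 then show ?thesis
  by (rule Bochner_Integration.integrable_cong[THEN iffD1, rotated -1])
    (use assms(2) in \<open>auto simp: supported_in_def indicator_def\<close>)
qed

lemma bump0_supported: "supported_in bump0 (cbox (-1) 1)"
 using bump0_supp by (fastforce simp: supported_in_def mem_box_cart abs_less_iff intro: less_imp_le)

text \<open>A nonnegative function with integral 0 vanishes almost everywhere, but
  \<open>bump0\<close> is positive on an open cube of positive volume.\<close>

lemma integral_bump0_pos: "0 < (\<integral>x. bump0 x \<partial>(lborel :: (real^'d::finite) measure))"
proof -
 have "(\<integral>x. bump0 x \<partial>(lborel :: (real^'d) measure)) ~= 0"
 proof
  assume *: "(\<integral>x. bump0 x \<partial>(lborel :: (real^'d) measure)) = 0"
  have "integrable lborel (bump0 :: real^'d => real)"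
   using C_class_continuous[OF C_class_bump0] bump0_supported by (rule integrable_compact_support) auto
  then have "AE x::real^'d in lborel. bump0 x = 0"
   using integral_nonneg_eq_0_iff_AE[of lborel "bump0 :: real^'d => real"] bump0_nonneg * by auto
  then have "AE x::real^'d in lborel. x \<notin> box (-1) 1"
   by eventually_elim (use bump0_pos_iff in \<open>force simp: mem_box_cart abs_less_iff\<close>)
  then have "emeasure lborel (box (-1) 1 :: (real^'d) set) = 0"
   by (subst (asm) AE_iff_measurable[OF _ refl]) (auto simp: Collect_neg_eq[symmetric])
  moreover have "emeasure lborel (box (-1) 1 :: (real^'d) set) = ennreal (\<Prod>b\<in>(Basis :: (real^'d) set). (1 - (-1)) \<bullet> b)"
   by (subst emeasure_lborel_box) (auto simp: Basis_vec_def inner_axis)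
  moreover have "0 < (\<Prod>b\<in>(Basis :: (real^'d) set). (1 - (-1)) \<bullet> b)"
   by (intro prod_pos) (auto simp: Basis_vec_def inner_axis)
  ultimately show False by (metis ennreal_eq_0_iff not_le)
 qed
 moreover have "0 <= (\<integral>x. bump0 x \<partial>(lborel :: (real^'d) measure))"
  by (intro integral_nonneg_AE) (simp add: bump0_nonneg)
 ultimately show ?thesis by simp
qed

definition bump :: "real ^ 'd::finite => real" where
 "bump x = inverse (\<integral>x. bump0 x \<partial>(lborel :: (real^'d) measure)) * bump0 x"

lemma C_class_bump: "C_class k bump"
 unfolding bump_def[abs_def] by (intro C_class_cmult C_class_bump0)

lemma bump_nonneg: "0 <= bump x"
 unfolding bump_def using integral_bump0_pos bump0_nonneg by (intro mult_nonneg_nonneg) (auto simp: less_imp_le)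

lemma bump_supported: "supported_in bump (cbox (-1) 1)"
 using bump0_supported by (auto simp: bump_def supported_in_def)

lemma integral_bump: "(\<integral>x. bump x \<partial>(lborel :: (real^'d::finite) measure)) = 1"
 unfolding bump_def using integral_bump0_pos[where 'd='d] by simp

section \<open>Mollification and the pairing with densities\<close>

text \<open>The map \<open>T\<close> makes one statement cover both ways of differentiating a
  convolution: with \<open>T\<close> the identity the derivative falls on the smooth kernel, with
  \<open>T u = ep *\<^sub>R u\<close> it falls on the mollified function.\<close>

lemma partial_deriv_integral:
 fixes k :: "real ^ 'd::finite => real" and m :: "real ^ 'd => real" and T :: "real ^ 'd => real ^ 'd" and a b :: "real ^ 'd"
 assumes k: "C_class (Suc 0) k" and T: "continuous_on UNIV T" and m: "continuous_on UNIV m"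
 defines "W \<equiv> %(k :: real ^ 'd => real) x. integral (cbox a b) (%t. k (x - T t) * m t)"
 shows "W k differentiable at x" "partial_deriv i (W k) x = W (partial_deriv i k) x"
proof -
 \<comment> \<open>The derivative of the integrand in \<open>x\<close> as a bounded linear map, the
   form in which Leibniz's rule takes it.\<close>
 define F where "F x t = (\<Sum>i\<in>UNIV. (m t * partial_deriv i k (x - T t)) *\<^sub>R blinfun_inner_left (axis i (1::real)))" for x t
 have k': "continuous_on UNIV (partial_deriv i k)" "!!x. k differentiable at x" for i
  using k by auto
 have kc: "continuous_on UNIV k" using C_class_continuous[OF k] .
 have cont: "continuous_on UNIV (%z. g (fst z - T (snd z)))" if "continuous_on UNIV g" for g :: "real^'d => real"
  using that T by (intro continuous_on_compose2[OF that] continuous_intros continuous_on_compose2[OF T]) auto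
 have "((%x. integral (cbox a b) (%t. k (x - T t) * m t)) has_derivative integral (cbox a b) (F x)) (at x within UNIV)"
 proof (rule leibniz_rule)
  fix x t
  have "((%x. k (x - T t)) has_derivative (%h. \<Sum>i\<in>UNIV. h $ i * partial_deriv i k (x - T t))) (at x)"
  proof -
   have "((%x. x - T t) has_derivative (%h. h)) (at x)" by (auto intro!: derivative_eq_intros)
   from has_derivative_compose[OF this has_derivative_partial[OF k'(2)]] show ?thesis by simp
  qed
  then have "((%x. k (x - T t) * m t) has_derivative (%h. (\<Sum>i\<in>UNIV. h $ i * partial_deriv i k (x - T t)) * m t)) (at x)"
   by (rule has_derivative_mult_left)
  moreover have "blinfun_apply (F x t) = (%h. (\<Sum>i\<in>UNIV. h $ i * partial_deriv i k (x - T t)) * m t)"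
   unfolding F_def by (rule ext) (simp add: blinfun.sum_left blinfun.scaleR_left inner_axis sum_distrib_left algebra_simps)
  ultimately show "((%x. k (x - T t) * m t) has_derivative blinfun_apply (F x t)) (at x within UNIV)"
   by simp
 next
  fix x
  have "continuous_on (cbox a b) (%t. k (x - T t) * m t)"
   by (intro continuous_on_mult continuous_on_compose2[OF kc] continuous_on_diff continuous_on_const
     continuous_on_subset[OF T] continuous_on_subset[OF m]) auto
  then show "(%t. k (x - T t) * m t) integrable_on cbox a b" by (rule integrable_continuous)
 next
  have "continuous_on (UNIV \<times> cbox a b) (%z. F (fst z) (snd z))"
   unfolding F_def
   by (intro continuous_on_sum continuous_on_scaleR continuous_on_mult continuous_on_const
     continuous_on_compose2[OF m] continuous_on_snd continuous_on_id
     continuous_on_subset[OF cont[OF k'(1)]]) auto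
  then show "continuous_on (UNIV \<times> cbox a b) (%(x, t). F x t)" by (simp add: case_prod_beta')
 qed auto
 then have D: "(W k has_derivative integral (cbox a b) (F x)) (at x)" by (simp add: W_def)
 then show "W k differentiable at x" by (auto simp: differentiable_def)
 have "F x integrable_on cbox a b"
  unfolding F_def
  by (intro integrable_continuous continuous_on_sum continuous_on_scaleR continuous_on_mult continuous_on_const
     continuous_on_compose2[OF k'(1)] continuous_on_diff
     continuous_on_subset[OF T] continuous_on_subset[OF m]) auto
 then have "integral (cbox a b) (F x) (axis i 1) = integral (cbox a b) (%t. F x t (axis i 1))"
  by (rule blinfun_apply_integral)
 also have "... = W (partial_deriv i k) x"
  unfolding F_def W_def
  by (simp add: blinfun.sum_left blinfun.scaleR_left inner_axis_axis mult_delta_left mult_delta_right mult.commute)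
 finally show "partial_deriv i (W k) x = W (partial_deriv i k) x"
  using partial_deriv_eq[OF D] by simp
qed

lemma C_class_convolution:
 fixes k m :: "real ^ 'd::finite => real"
 assumes "C_class n k" "continuous_on UNIV T" "continuous_on UNIV m"
 shows "C_class n (%x. integral (cbox a b) (%t. k (x - T t) * m t))"
 using assms(1)
proof (induction n arbitrary: k)
 case 0
 have *: "continuous_on UNIV (%z. k (fst z - T (snd z)) * m (snd z))"
  by (intro continuous_on_mult continuous_on_compose2[OF 0[simplified]] continuous_on_diff
    continuous_on_compose2[OF assms(2)] continuous_on_compose2[OF assms(3)]
    continuous_on_fst continuous_on_snd continuous_on_id) auto
 have "continuous_on UNIV (%x. integral (cbox a b) (%t. k (x - T t) * m t))"
  using integral_continuous_on_param[where U = UNIV and a = a and b = b and f = "%x t. k (x - T t) * m t"] continuous_on_subset[OF *]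
  by (auto simp: case_prod_beta')
 then show ?case by simp
next
 case (Suc n)
 then have "C_class (Suc 0) k" using C_class_mono by (metis One_nat_def Suc_le_mono zero_le)
 note D = partial_deriv_integral[OF this assms(2,3), where a = a and b = b]
 from D(2) have "partial_deriv i (%x. integral (cbox a b) (%t. k (x - T t) * m t)) =
   (%x. integral (cbox a b) (%t. partial_deriv i k (x - T t) * m t))" for i
  by (intro ext)
 then show ?case using D(1) Suc by simp
qed

lemma foldr_partial_deriv_convolution:
 fixes k m :: "real ^ 'd::finite => real"
 assumes "C_class n k" "continuous_on UNIV T" "continuous_on UNIV m" "length ks <= n"
 shows "foldr partial_deriv ks (%x. integral (cbox a b) (%t. k (x - T t) * m t)) =
  (%x. integral (cbox a b) (%t. foldr partial_deriv ks k (x - T t) * m t))"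
 using assms(1,4)
proof (induction ks arbitrary: k n rule: rev_induct)
 case (snoc i ks)
 then obtain n' where n': "n = Suc n'" "length ks <= n'" by (cases n) auto
 then have "C_class (Suc 0) k" using snoc.prems C_class_mono by (metis One_nat_def Suc_le_mono zero_le)
 from partial_deriv_integral(2)[OF this assms(2,3), where a = a and b = b]
 have "partial_deriv i (%x. integral (cbox a b) (%t. k (x - T t) * m t)) =
   (%x. integral (cbox a b) (%t. partial_deriv i k (x - T t) * m t))"
  by (intro ext)
 then show ?case using snoc.IH[of n' "partial_deriv i k"] snoc.prems n' by simp
qed simp

lemma C_class_foldr: "C_class n k ==> length ks <= n ==> C_class (n - length ks) (foldr partial_deriv ks k)"
proof (induction ks arbitrary: k n rule: rev_induct)
 case (snoc i ks)
 then obtain n' where n': "n = Suc n'" "length ks <= n'" by (cases n) auto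
 then show ?case using snoc.IH[of n' "partial_deriv i k"] snoc.prems by simp
qed simp

lemma supported_in_foldr:
 "supported_in f K ==> closed K ==> supported_in (foldr partial_deriv ks f) K"
 by (induction ks) (auto intro: supported_in_partial_deriv)

lemma uniformly_continuous_compact_support:
 fixes f :: "'a::euclidean_space => real"
 assumes "continuous_on UNIV f" "supported_in f K" "compact K"
 shows "uniformly_continuous_on UNIV f"
proof -
 obtain B where B: "!!x. x \<in> K ==> norm x <= B"
  using compact_imp_bounded[OF assms(3)] by (auto simp: bounded_iff)
 \<comment> \<open>The ball exceeds \<open>K\<close> by 1, so a point within distance 1 of
   \<open>K\<close> is still inside.\<close>
 have "uniformly_continuous_on (cball 0 (B + 1)) f"
  using assms(1) by (intro compact_uniformly_continuous) (auto intro: continuous_on_subset)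
 then show ?thesis unfolding uniformly_continuous_on_def
 proof (intro allI impI)
  fix e :: real assume u: "\<forall>e>0. \<exists>d>0. \<forall>x\<in>cball 0 (B + 1). \<forall>x'\<in>cball 0 (B + 1). dist x' x < d --> dist (f x') (f x) < e"
   and e: "0 < e"
  then obtain d where d: "d > 0" "!!x x'. x \<in> cball 0 (B + 1) ==> x' \<in> cball 0 (B + 1) ==> dist x' x < d ==> dist (f x') (f x) < e"
   by metis
  have "dist (f x') (f x) < e" if "dist x' x < min d 1" for x x'
  proof (cases "x \<in> K \<or> x' \<in> K")
   case True
   have "norm x <= norm x' + dist x' x" "norm x' <= norm x + dist x' x"
    using norm_triangle_ineq2[of x x'] norm_triangle_ineq2[of x' x] by (auto simp: dist_norm norm_minus_commute)
   then show ?thesis using True B[of x] B[of x'] that by (intro d(2)) auto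
  next
   case False
   then have "f x = 0" "f x' = 0" using assms(2) unfolding supported_in_def by blast+
   then show ?thesis using e by simp
  qed
  then show "\<exists>d>0. \<forall>x\<in>UNIV. \<forall>x'\<in>UNIV. dist x' x < d --> dist (f x') (f x) < e"
   using d(1) by (intro exI[of _ "min d 1"]) auto
 qed
qed

lemma integral_cbox_eq_lborel:
 fixes f :: "'a::euclidean_space => real"
 assumes "continuous_on UNIV f" "supported_in f (cbox a b)"
 shows "integral (cbox a b) f = (LI x. f x)"
proof -
 have i: "integrable lborel f" using integrable_compact_support[OF assms compact_cbox] .
 have "integral (cbox a b) f = integral UNIV (%x. if x \<in> cbox a b then f x else 0)"
  by (simp add: integral_restrict_UNIV)
 also have "(%x. if x \<in> cbox a b then f x else 0) = f"
  using assms(2) by (fastforce simp: supported_in_def)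
 finally show ?thesis using integral_lborel[OF i] by simp
qed

text \<open>Isotropic rather than adapted to the scaling, since only the limit \<open>ep\<close> to
  0 in the C^r norm matters.\<close>

definition mollify :: "real => (real ^ 'd::finite => real) => real ^ 'd => real" where
 "mollify ep ph x = integral (cbox (-1) 1) (%u. ph (x - ep *\<^sub>R u) * bump u)"

lemma bump_continuous: "continuous_on A bump"
 using C_class_continuous[OF C_class_bump] .

lemma mollify_close:
 fixes ph :: "real ^ 'd::finite => real"
 assumes c: "continuous_on UNIV ph" and d: "!!x y. dist x y < d ==> \<bar>ph x - ph y\<bar> <= e"
  and e: "0 <= ep" "ep * real CARD('d) < d"
 shows "\<bar>mollify ep ph x - ph x\<bar> <= e"
proof -
 let ?B = "cbox (-1) 1 :: (real^'d) set"
 have c1: "continuous_on ?B (%u. ph (x - ep *\<^sub>R u) * bump u)" for x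
  by (intro continuous_intros continuous_on_compose2[OF c] bump_continuous) auto
 have one: "integral ?B bump = 1"
  by (simp add: integral_cbox_eq_lborel[OF bump_continuous bump_supported] integral_bump)
 have "mollify ep ph x - ph x = integral ?B (%u. ph (x - ep *\<^sub>R u) * bump u) - integral ?B (%u. ph x * bump u)"
  by (simp add: mollify_def one)
 also have "... = integral ?B (%u. ph (x - ep *\<^sub>R u) * bump u - ph x * bump u)"
  by (intro integral_diff[symmetric] integrable_continuous c1 continuous_intros bump_continuous)
 also have "norm ... <= integral ?B (%u. e * bump u)"
 proof (rule integral_norm_bound_integral)
  fix u :: "real^'d" assume u: "u \<in> ?B"
  \<comment> \<open>On the cube the Euclidean norm is at most the dimension; this is the origin of
    the factor \<open>CARD('d)\<close> in the hypothesis.\<close>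
  have "norm u <= (\<Sum>i\<in>UNIV. \<bar>u $ i\<bar>)" by (rule norm_le_l1_cart)
  also have "... <= (\<Sum>i\<in>(UNIV::'d set). 1)" using u by (intro sum_mono) (auto simp: mem_box_cart abs_le_iff minus_le_iff)
  finally have "dist (x - ep *\<^sub>R u) x < d"
   using e mult_left_mono[of "norm u" "real CARD('d)" ep] by (simp add: dist_norm)
  then have "\<bar>ph (x - ep *\<^sub>R u) - ph x\<bar> * bump u <= e * bump u"
   by (intro mult_right_mono d bump_nonneg)
  then show "norm (ph (x - ep *\<^sub>R u) * bump u - ph x * bump u) <= e * bump u"
   using bump_nonneg[of u] by (simp add: abs_mult left_diff_distrib[symmetric])
 qed (intro integrable_continuous continuous_intros c1 bump_continuous)+
 also have "... = e" by (simp add: one)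
 finally show ?thesis by simp
qed

lemma mollify_supported:
 assumes "supported_in ph (cbox (\<chi> i. - B) (\<chi> i. B))" "0 <= ep" "ep <= 1"
 shows "supported_in (mollify ep ph) (cbox (\<chi> i. - (B + 1)) (\<chi> i. B + 1))"
 unfolding supported_in_def
proof (intro allI impI)
 fix x assume nz: "mollify ep ph x ~= 0"
 show "x \<in> cbox (\<chi> i. - (B + 1)) (\<chi> i. B + 1)"
 proof (rule ccontr)
  assume "x \<notin> cbox (\<chi> i. - (B + 1)) (\<chi> i. B + 1)"
  then obtain i where "\<not> (- (B + 1) <= x $ i \<and> x $ i <= B + 1)" by (auto simp: mem_box_cart)
  then have i: "\<bar>x $ i\<bar> > B + 1" by linarith
  have "ph (x - ep *\<^sub>R u) * bump u = 0" if "u \<in> cbox (-1) 1" for u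
  proof -
   have u: "\<bar>u $ i\<bar> <= 1" using that by (auto simp: mem_box_cart abs_le_iff minus_le_iff)
   have "\<bar>ep * u $ i\<bar> <= 1" using assms(2,3) u mult_mono[of ep 1 "\<bar>u $ i\<bar>" 1] by (simp add: abs_mult)
   then have "\<bar>(x - ep *\<^sub>R u) $ i\<bar> > B" using i by simp
   then have "\<not> (- B <= (x - ep *\<^sub>R u) $ i \<and> (x - ep *\<^sub>R u) $ i <= B)" by linarith
   then have "x - ep *\<^sub>R u \<notin> cbox (\<chi> i. - B) (\<chi> i. B)" by (auto simp: mem_box_cart simp del: vector_minus_component)
   then show ?thesis using assms(1) by (auto simp: supported_in_def)
  qed
  then have "mollify ep ph x = integral (cbox (-1) 1) (%u::real^'a. 0)"
   unfolding mollify_def by (intro integral_cong) auto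
  with nz show False by simp
 qed
qed

text \<open>The substitution y = x - ep u moves \<open>x\<close> into the bump, so that the result
  is as smooth as the bump.\<close>

lemma mollify_eq_convolution:
 fixes ph :: "real ^ 'd::finite => real"
 assumes c: "continuous_on UNIV ph" and supp: "supported_in ph (cbox a b)" and "0 < ep"
 shows "mollify ep ph x = (inverse ep ^ CARD('d)) * integral (cbox a b) (%y. bump (\<chi> i. 0 + inverse ep * (x - y) $ i) * ph y)"
proof -
 have c1: "continuous_on UNIV (%u. ph (x - ep *\<^sub>R u) * bump u)"
  by (intro continuous_intros continuous_on_compose2[OF c] bump_continuous) auto
 have c2: "continuous_on UNIV (%y. bump (\<chi> i. 0 + inverse ep * (x - y) $ i) * ph y)"
  by (intro continuous_intros c continuous_on_compose2[OF bump_continuous[of UNIV]] continuous_on_vec_lambda) auto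
 have "mollify ep ph x = (LI u. ph (x - ep *\<^sub>R u) * bump u)"
  unfolding mollify_def using bump_supported
  by (intro integral_cbox_eq_lborel c1) (auto simp: supported_in_def)
 also have "... = (LI y. (%u. ph (x - ep *\<^sub>R u) * bump u) (\<chi> i. inverse ep * x $ i + (- inverse ep) * y $ i)) *
   (\<Prod>i\<in>(UNIV::'d set). \<bar>- inverse ep\<bar>)"
  using assms(3) c1 by (subst lborel_integral_affine_vec) (auto intro!: borel_measurable_continuous_onI)
 also have "(%y. (%u. ph (x - ep *\<^sub>R u) * bump u) (\<chi> i. inverse ep * x $ i + (- inverse ep) * y $ i)) =
   (%y. bump (\<chi> i. 0 + inverse ep * (x - y) $ i) * ph y)"
 proof
  fix y
  have "x - ep *\<^sub>R (\<chi> i. inverse ep * x $ i + (- inverse ep) * y $ i) = y"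
   using assms(3) by (simp add: vec_eq_iff field_simps)
  then show "(%u. ph (x - ep *\<^sub>R u) * bump u) (\<chi> i. inverse ep * x $ i + (- inverse ep) * y $ i) =
    bump (\<chi> i. 0 + inverse ep * (x - y) $ i) * ph y"
   by (simp add: right_diff_distrib mult.commute)
 qed
 also have "(LI y. bump (\<chi> i. 0 + inverse ep * (x - y) $ i) * ph y) =
   integral (cbox a b) (%y. bump (\<chi> i. 0 + inverse ep * (x - y) $ i) * ph y)"
  using supp by (intro integral_cbox_eq_lborel[symmetric] c2) (auto simp: supported_in_def)
 finally show ?thesis using assms(3) by (simp add: mult.commute)
qed

lemma mollify_smooth:
 fixes ph :: "real ^ 'd::finite => real"
 assumes "continuous_on UNIV ph" "supported_in ph (cbox a b)" "0 < ep"
 shows "smooth (mollify ep ph)"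
 unfolding smooth_def
proof
 fix k
 have "C_class k (%x. integral (cbox a b) (%y. (%v. bump (\<chi> i. 0 + inverse ep * v $ i)) (x - y) * ph y))"
  by (intro C_class_convolution[where T = "%y. y"] C_class_affine C_class_bump assms continuous_intros)
 then have "C_class k (%x. (inverse ep ^ CARD('d)) * integral (cbox a b) (%y. bump (\<chi> i. 0 + inverse ep * (x - y) $ i) * ph y))"
  by (intro C_class_cmult) simp
 then show "C_class k (mollify ep ph)"
  unfolding mollify_eq_convolution[OF assms, abs_def] .
qed

lemma bounded_subset_cube: "bounded K ==> \<exists>B. K \<subseteq> cbox (\<chi> i. - B) (\<chi> i. B :: real ^ 'd::finite)"
proof -
 assume "bounded K"
 then obtain B where B: "!!x. x \<in> K ==> norm x <= B" by (auto simp: bounded_iff)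
 have "\<bar>x $ i\<bar> <= B" if "x \<in> K" for x i
  using component_le_norm_cart[of x i] B[OF that] by linarith
 then have "- B <= x $ i \<and> x $ i <= B" if "x \<in> K" for x i using that by (simp add: abs_le_iff minus_le_iff)
 then have "K \<subseteq> cbox (\<chi> i. - B) (\<chi> i. B)" unfolding mem_box_cart subset_iff by simp
 then show ?thesis by blast
qed

lemma foldr_partial_deriv_diff:
 "C_class n f ==> C_class n g ==> length ks <= n ==>
  foldr partial_deriv ks (%x. f x - g x) = (%x. foldr partial_deriv ks f x - foldr partial_deriv ks g x)"
proof (induction ks arbitrary: f g n rule: rev_induct)
 case (snoc i ks)
 then obtain n' where n': "n = Suc n'" "length ks <= n'" by (cases n) auto
 have "partial_deriv i (%x. f x - g x) = (%x. partial_deriv i f x - partial_deriv i g x)"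
 proof
  fix x
  have "f differentiable at x" "g differentiable at x" using snoc.prems n' by auto
  then have "((%x. f x - g x) has_derivative
   (%h. frechet_derivative f (at x) h - frechet_derivative g (at x) h)) (at x)"
   by (intro has_derivative_diff) (use frechet_derivative_works in blast)+
  from partial_deriv_eq[OF this] show "partial_deriv i (%x. f x - g x) x = partial_deriv i f x - partial_deriv i g x"
   by (simp add: partial_deriv_def)
 qed
 then show ?case using snoc.IH[of n' "partial_deriv i f" "partial_deriv i g"] snoc.prems n' by simp
qed simp

text \<open>Test functions are dense in the compactly supported C^r functions. Derivatives up to
  order \<open>r\<close> commute with mollification and are uniformly continuous, and only finitely
  many lists of directions occur, so a single \<open>ep\<close> serves all of them.\<close>

lemma C_converges_exists:
 fixes ph :: "real ^ 'd::finite => real"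
 assumes "C_class r ph" "supported_in ph K" "compact K"
 shows "\<exists>ps. (\<forall>n. ps n \<in> test_funs) \<and> C_converges r ps ph"
proof -
 obtain B where B: "K \<subseteq> cbox (\<chi> i. - B) (\<chi> i. B)"
  using bounded_subset_cube[OF compact_imp_bounded[OF assms(3)]] by blast
 then have supp: "supported_in ph (cbox (\<chi> i. - B) (\<chi> i. B))"
  using assms(2) by (auto simp: supported_in_def)
 have c: "continuous_on UNIV ph" using C_class_continuous[OF assms(1)] .
 have "\<exists>ep. 0 < ep \<and> ep <= 1 \<and> C_norm r (%x. mollify ep ph x - ph x) <= ennreal (inverse (real (Suc n)))" for n
 proof -
  let ?e = "inverse (real (Suc n))"
  have "\<exists>d>0. \<forall>x y. dist x y < d --> \<bar>foldr partial_deriv ks ph x - foldr partial_deriv ks ph y\<bar> <= ?e"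
   if "length ks <= r" for ks :: "'d list"
  proof -
   have "uniformly_continuous_on UNIV (foldr partial_deriv ks ph)"
    using C_class_continuous[OF C_class_foldr[OF assms(1) that]] supported_in_foldr[OF assms(2)] assms(3)
    by (intro uniformly_continuous_compact_support[of _ K]) (auto simp: compact_imp_closed)
   moreover have "0 < ?e" by simp
   ultimately obtain d where "d > 0" "!!x y. dist x y < d ==> dist (foldr partial_deriv ks ph x) (foldr partial_deriv ks ph y) < ?e"
    unfolding uniformly_continuous_on_def by blast
   then show ?thesis by (intro exI[of _ d]) (auto simp: dist_real_def intro: less_imp_le)
  qed
  then obtain d where d: "!!ks. length ks <= r ==> d ks > 0"
   "!!ks x y. length ks <= r ==> dist x y < d ks ==> \<bar>foldr partial_deriv ks ph x - foldr partial_deriv ks ph y\<bar> <= ?e"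
   by metis
  let ?L = "{ks :: 'd list. length ks <= r}"
  have fin: "finite ?L" using finite_lists_length_le[of "UNIV :: 'd set" r] by simp
  have ne: "[] \<in> ?L" by simp
  define D where "D = Min (d ` ?L)"
  have "d ` ?L ~= {}" using ne by blast
  then have D: "0 < D" "!!ks. ks \<in> ?L ==> D <= d ks"
   unfolding D_def using fin d(1) by (subst Min_gr_iff, auto intro!: Min_le)
  define ep where "ep = min 1 (D / (2 * real CARD('d)))"
  have card: "0 < real CARD('d)" by simp
  have ep: "0 < ep" "ep <= 1" using D(1) card by (auto simp: ep_def)
  have "ep * real CARD('d) <= D / (2 * real CARD('d)) * real CARD('d)"
   unfolding ep_def by (intro mult_right_mono) auto
  also have "... = D / 2" by simp
  also have "... < D" using D(1) by simp
  finally have epD: "ep * real CARD('d) < D" .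
  have "C_norm r (%x. mollify ep ph x - ph x) <= ennreal ?e"
  proof (subst C_norm_le_iff)
   show "\<forall>ks x. length ks <= r --> \<bar>foldr partial_deriv ks (%x. mollify ep ph x - ph x) x\<bar> <= ?e"
   proof (intro allI impI)
    fix ks :: "'d list" and x assume l: "length ks <= r"
    have sm: "C_class r (mollify ep ph)"
     using mollify_smooth[OF c supp ep(1)] by (simp add: smooth_def)
    have eq: "foldr partial_deriv ks (mollify ep ph) = mollify ep (foldr partial_deriv ks ph)"
     unfolding mollify_def[abs_def]
     by (intro foldr_partial_deriv_convolution[OF assms(1) _ _ l] continuous_intros bump_continuous)
    have "\<bar>mollify ep (foldr partial_deriv ks ph) x - foldr partial_deriv ks ph x\<bar> <= ?e"
     using C_class_continuous[OF C_class_foldr[OF assms(1) l]] d(2)[OF l] ep(1) epD D(2)[of ks] l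
     by (intro mollify_close[of _ "d ks"]) auto
    then show "\<bar>foldr partial_deriv ks (%x. mollify ep ph x - ph x) x\<bar> <= ?e"
     by (simp add: foldr_partial_deriv_diff[OF sm assms(1) l] eq)
   qed
  qed simp
  with ep show ?thesis by blast
 qed
 then obtain ep where ep: "!!n. 0 < ep n" "!!n. ep n <= 1"
  "!!n. C_norm r (%x. mollify (ep n) ph x - ph x) <= ennreal (inverse (real (Suc n)))" by metis
 have s: "supported_in (mollify (ep n) ph) (cbox (\<chi> i. - (B + 1)) (\<chi> i. B + 1))" for n
  using mollify_supported[OF supp] ep(1)[of n] ep(2)[of n] by (simp add: less_imp_le)
 have t: "mollify (ep n) ph \<in> test_funs" for n
  using mollify_smooth[OF c supp ep(1)[of n]] s[of n] compact_cbox unfolding test_funs_def by blast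
 have *: "(%n. ennreal (inverse (real (Suc n)))) \<longlonglongrightarrow> ennreal 0"
  by (intro tendsto_ennrealI LIMSEQ_inverse_real_of_nat)
 have "(%n. C_norm r (%x. mollify (ep n) ph x - ph x)) \<longlonglongrightarrow> 0"
 proof (rule tendsto_sandwich[rotated 3])
  show "(%n. ennreal (inverse (real (Suc n)))) \<longlonglongrightarrow> 0" using * by simp
 qed (use ep(3) in auto)
 then have "C_converges r (%n. mollify (ep n) ph) ph"
  unfolding C_converges_def using s compact_cbox by blast
 with t show ?thesis by (intro exI[of _ "%n. mollify (ep n) ph"]) simp
qed

section \<open>Evaluation of \<open>pairing\<close>\<close>

lemma integrable_density_mult:
 fixes g ph :: "real ^ 'd::finite => real"
 assumes g: "locally_integrable g" and "continuous_on UNIV ph" "supported_in ph K" "compact K"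
 shows "integrable lborel (%y. g y * ph y)"
proof -
 obtain a where a: "!!x. \<bar>ph x\<bar> <= a"
  using Cb_exists[of 0 ph K] assms by (auto dest: Cb_bound)
 have i: "integrable lborel (%y. indicator K y * g y)"
  using g assms(4) by (auto simp: locally_integrable_def set_integrable_def)
 have [measurable]: "ph \<in> borel_measurable lborel"
  using assms(2) by (simp add: borel_measurable_continuous_onI)
 have eq: "(%y. g y * ph y) = (%y. (indicator K y * g y) * ph y)"
  using assms(3) by (auto simp: supported_in_def fun_eq_iff indicator_def)
 have "integrable lborel (%y. (indicator K y * g y) * ph y)"
 proof (rule Bochner_Integration.integrable_bound[of _ "%y. a * (indicator K y * g y)"])
  show "(%y. indicator K y * g y * ph y) \<in> borel_measurable lborel"
   using borel_measurable_integrable[OF i] by measurable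
  show "AE y in lborel. norm (indicator K y * g y * ph y) <= norm (a * (indicator K y * g y))"
  proof (rule AE_I2)
   fix y
   have "\<bar>ph y\<bar> <= \<bar>a\<bar>" using a[of y] by linarith
   then show "norm (indicator K y * g y * ph y) <= norm (a * (indicator K y * g y))"
    by (simp add: abs_mult mult_mono mult.commute mult_left_mono)
  qed
 qed (use i in simp)
 then show ?thesis unfolding eq .
qed

lemma C_convergesD:
 assumes "C_converges r ps ph"
 obtains K e where "compact K" "!!n. supported_in (ps n) K" "e \<longlonglongrightarrow> (0::real)"
  "eventually (%n. \<forall>y. \<bar>ps n y - ph y\<bar> <= e n) sequentially"
proof -
 obtain K where K: "compact K" "!!n. supported_in (ps n) K"
  and lim: "(%n. C_norm r (%x. ps n x - ph x)) \<longlonglongrightarrow> 0"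
  using assms unfolding C_converges_def by blast
 define e where "e n = enn2real (C_norm r (%x. ps n x - ph x))" for n
 have e: "e \<longlonglongrightarrow> 0" unfolding e_def using lim by (intro tendsto_enn2real) simp_all
 have "eventually (%n. C_norm r (%x. ps n x - ph x) < 1) sequentially"
  using order_tendstoD(2)[OF lim, of 1] by simp
 then have "eventually (%n. \<forall>y. \<bar>ps n y - ph y\<bar> <= e n) sequentially"
 proof eventually_elim
  case (elim n)
  then have "C_norm r (%x. ps n x - ph x) = ennreal (e n)" unfolding e_def
   by (metis ennreal_enn2real ennreal_one_less_top order.strict_trans infinity_ennreal_def)
  then have "ennreal \<bar>ps n y - ph y\<bar> <= ennreal (e n)" for y
   using C_norm_ge_abs[of "%x. ps n x - ph x" y r] by simp
  moreover have "0 <= e n" by (simp add: e_def)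
  ultimately show ?case by (auto simp: ennreal_le_iff)
 qed
 with K e that show thesis by blast
qed

text \<open>Uniform convergence with supports in one compact set gives the same limit along every
  approximating sequence, and \<open>C_converges_exists\<close> provides such a sequence, so the
  description in \<open>pairing\<close> is determined.\<close>

lemma pairing_density:
 fixes g ph :: "real ^ 'd::finite => real"
 assumes g: "locally_integrable g" and u: "!!ph. ph \<in> test_funs ==> u ph = dist_of g ph"
  and ph: "C_class r ph" "supported_in ph K" "compact K"
 shows "pairing r u ph = dist_of g ph"
proof -
 have lim: "(%n. u (ps n)) \<longlonglongrightarrow> dist_of g ph" if t: "\<forall>n. ps n \<in> test_funs" and c: "C_converges r ps ph" for ps
 proof -
  obtain K' e where K': "compact K'" "!!n. supported_in (ps n) K'" and e: "e \<longlonglongrightarrow> (0::real)"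
   "eventually (%n. \<forall>y. \<bar>ps n y - ph y\<bar> <= e n) sequentially"
   using C_convergesD[OF c] by blast
  define L where "L = K \<union> K'"
  have L: "compact L" "supported_in ph L" "!!n. supported_in (ps n) L"
   using ph K' by (auto simp: L_def supported_in_def)
  have i: "integrable lborel (%y. indicator L y * g y)"
   using g L(1) by (auto simp: locally_integrable_def set_integrable_def)
  have i1: "integrable lborel (%y. g y * ph y)"
   by (rule integrable_density_mult[OF g C_class_continuous[OF ph(1)] L(2,1)])
  have i2: "integrable lborel (%y. g y * ps n y)" for n
  proof -
   have "C_class 0 (ps n)" using t by (auto simp: test_funs_def smooth_def)
   from integrable_density_mult[OF g C_class_continuous[OF this] L(3,1)] show ?thesis .
  qed
  have "eventually (%n. \<bar>u (ps n) - dist_of g ph\<bar> <= e n * (LI y. \<bar>indicator L y * g y\<bar>)) sequentially"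
   using e(2)
  proof eventually_elim
   case (elim n)
   have "u (ps n) - dist_of g ph = (LI y. g y * ps n y - g y * ph y)"
    using t i1 i2 by (simp add: u dist_of_def Bochner_Integration.integral_diff)
   also have "\<bar>...\<bar> <= (LI y. \<bar>g y * ps n y - g y * ph y\<bar>)"
    using integral_norm_bound[of lborel "%y. g y * ps n y - g y * ph y"] by simp
   also have "... <= (LI y. e n * \<bar>indicator L y * g y\<bar>)"
   proof (rule integral_mono)
    fix y
    show "\<bar>g y * ps n y - g y * ph y\<bar> <= e n * \<bar>indicator L y * g y\<bar>"
    proof (cases "y \<in> L")
     case True
     have "\<bar>g y\<bar> * \<bar>ps n y - ph y\<bar> <= \<bar>g y\<bar> * e n" using elim by (intro mult_left_mono) auto
     then show ?thesis using True by (simp add: abs_mult[symmetric] right_diff_distrib mult.commute)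
    next
     case False
     then have "ps n y = 0" "ph y = 0" using L(2,3) by (auto simp: supported_in_def)
     then show ?thesis using False by simp
    qed
   qed (use i i1 i2 in auto)
   also have "... = e n * (LI y. \<bar>indicator L y * g y\<bar>)" by simp
   finally show ?case .
  qed
  then have "eventually (%n. norm (u (ps n) - dist_of g ph) <= e n * (LI y. \<bar>indicator L y * g y\<bar>)) sequentially"
   by simp
  moreover have "(%n. e n * (LI y. \<bar>indicator L y * g y\<bar>)) \<longlonglongrightarrow> 0"
   using tendsto_mult_right[OF e(1), of "LI y. \<bar>indicator L y * g y\<bar>"] by simp
  ultimately have "(%n. u (ps n) - dist_of g ph) \<longlonglongrightarrow> 0"
   by (rule Lim_null_comparison)
  then show ?thesis by (simp add: LIM_zero_iff)
 qed
 show ?thesis unfolding pairing_def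
 proof (rule the_equality)
  fix l assume *: "\<forall>ps. (\<forall>n. ps n \<in> test_funs) \<and> C_converges r ps ph --> (%n. u (ps n)) \<longlonglongrightarrow> l"
  obtain ps where "\<forall>n. ps n \<in> test_funs" "C_converges r ps ph" using C_converges_exists[OF ph] by blast
  then show "l = dist_of g ph" using * lim LIMSEQ_unique by blast
 qed (use lim in blast)
qed

lemma C_norm_zero: "C_norm r (%x::real^'d::finite. 0) = 0"
proof -
 have "Cb r 0 (%x::real^'d. 0)" by (rule Cb_zero) simp
 then show ?thesis using Cb_iff[of 0 r "%x::real^'d. 0"] by simp
qed

lemma test_funs_diff: "ph \<in> test_funs ==> ps \<in> test_funs ==> (%x. ph x - ps x) \<in> test_funs"
proof -
 assume *: "ph \<in> test_funs" "ps \<in> test_funs"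
 then obtain K L where "compact K" "supported_in ph K" "compact L" "supported_in ps L"
  by (auto simp: test_funs_def)
 then have "compact (K \<union> L)" "supported_in (%x. ph x - ps x) (K \<union> L)"
  unfolding supported_in_def by (blast, metis UnCI diff_self)
 moreover have "smooth (%x. ph x - ps x)"
  using * by (auto simp: test_funs_def smooth_def intro: C_class_diff)
 ultimately show ?thesis by (auto simp: test_funs_def)
qed

lemma distribution_diff:
 assumes "distribution u" "ph \<in> test_funs" "ps \<in> test_funs"
 shows "u (%x. ph x - ps x) = u ph - u ps"
proof -
 have "u (%x. 1 * ph x + (-1) * ps x) = 1 * u ph + (-1) * u ps"
  using assms unfolding distribution_def by blast
 then show ?thesis by simp
qed

text \<open>The bound of order \<open>r\<close> gives the limit in place of a density; the constant
  sequence shows that it is the only one.\<close>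

lemma pairing_test_fun:
 assumes d: "distribution u" and o: "order_at_most r u" and ph: "ph \<in> test_funs"
 shows "pairing r u ph = u ph"
proof -
 have lim: "(%n. u (ps n)) \<longlonglongrightarrow> u ph" if t: "\<forall>n. ps n \<in> test_funs" and c: "C_converges r ps ph" for ps
 proof -
  obtain K where K: "compact K" "!!n. supported_in (ps n) K"
   and lim: "(%n. C_norm r (%x. ps n x - ph x)) \<longlonglongrightarrow> 0"
   using c unfolding C_converges_def by blast
  obtain L where L: "compact L" "supported_in ph L" using ph unfolding test_funs_def by blast
  have "compact (K \<union> L)" using K L by auto
  then obtain C where C: "!!ph. ph \<in> test_funs ==> supported_in ph (K \<union> L) ==> ennreal \<bar>u ph\<bar> <= ennreal C * C_norm r ph"
   using o unfolding order_at_most_def by blast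
  have le: "ennreal \<bar>u (ps n) - u ph\<bar> <= ennreal C * C_norm r (%x. ps n x - ph x)" for n
   using C[of "%x. ps n x - ph x"] test_funs_diff[of "ps n" ph] distribution_diff[OF d, of "ps n" ph] t ph K(2)[of n] L(2)
   by (simp add: supported_in_def) (metis diff_self)
  have to0: "(%n. ennreal C * C_norm r (%x. ps n x - ph x)) \<longlonglongrightarrow> ennreal C * 0"
   by (intro ennreal_tendsto_cmult lim) simp
  have "(%n. ennreal \<bar>u (ps n) - u ph\<bar>) \<longlonglongrightarrow> ennreal 0"
  proof (rule tendsto_sandwich[rotated 3])
   show "(%n. ennreal C * C_norm r (%x. ps n x - ph x)) \<longlonglongrightarrow> ennreal 0" using to0 by simp
  qed (use le in auto)
  then have "(%n. enn2real (ennreal \<bar>u (ps n) - u ph\<bar>)) \<longlonglongrightarrow> 0"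
   by (rule tendsto_enn2real) simp
  then have "(%n. \<bar>u (ps n) - u ph\<bar>) \<longlonglongrightarrow> 0" by simp
  then have "(%n. u (ps n) - u ph) \<longlonglongrightarrow> 0" by (rule tendsto_rabs_zero_cancel)
  then show ?thesis by (rule LIM_zero_cancel)
 qed
 obtain K where K: "compact K" "supported_in ph K" using ph unfolding test_funs_def by blast
 show ?thesis unfolding pairing_def
 proof (rule the_equality)
  fix l assume *: "\<forall>ps. (\<forall>n. ps n \<in> test_funs) \<and> C_converges r ps ph --> (%n. u (ps n)) \<longlonglongrightarrow> l"
  have "C_converges r (%n. ph) ph" unfolding C_converges_def using K by (auto simp: C_norm_zero cong del: image_cong)
  then have "(%n. u ph) \<longlonglongrightarrow> l" using *[rule_format, of "%n. ph"] ph by simp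
  then show "l = u ph" by (rule LIMSEQ_unique[OF _ tendsto_const])
 qed (use lim in blast)
qed

lemma locally_integrable_continuous:
 assumes "continuous_on UNIV g"
 shows "locally_integrable g"
 unfolding locally_integrable_def set_integrable_def
 using borel_integrable_compact[OF _ continuous_on_subset[OF assms]] by simp

section \<open>Rescaled test functions\<close>

text \<open>Rewrites rescaling as an affine substitution, to which \<open>C_class_affine\<close>
  applies.\<close>

lemma rescale_eq: "rescale s ph dl x = (%y. inverse (dl ^ hom_dim s) * ph (\<chi> i. - x $ i / dl ^ s i + inverse (dl ^ s i) * y $ i))"
proof
 fix y
 have "(\<chi> i. (y $ i - x $ i) / dl ^ s i) = (\<chi> i. - x $ i / dl ^ s i + inverse (dl ^ s i) * y $ i)"
  by (simp add: vec_eq_iff diff_divide_distrib divide_inverse algebra_simps)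
 then show "rescale s ph dl x y = inverse (dl ^ hom_dim s) * ph (\<chi> i. - x $ i / dl ^ s i + inverse (dl ^ s i) * y $ i)"
  by (simp add: rescale_def divide_inverse mult.commute)
qed

lemma C_class_rescale: "C_class k ph ==> C_class k (rescale s ph dl x)"
 unfolding rescale_eq by (intro C_class_cmult C_class_affine)

lemma rescale_supp:
 assumes s: "scaling s" and "supported_in ph (sball s)" "0 < dl"
 shows "supported_in (rescale s ph dl x) (sbox s x dl)"
 unfolding supported_in_def
proof (intro allI impI)
 fix y assume "rescale s ph dl x y ~= 0"
 then have "ph (\<chi> i. (y $ i - x $ i) / dl ^ s i) ~= 0" by (simp add: rescale_def)
 then have "snorm s (\<chi> i. (y $ i - x $ i) / dl ^ s i) <= 1" using assms by (auto simp: supported_in_def sball_def)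
 then have "\<bar>(y - x) $ i\<bar> <= dl ^ s i" for i
  using assms(3) by (auto simp: snorm_le_iff[OF s] divide_le_eq_1 dest: spec[of _ i])
 then show "y \<in> sbox s x dl" using assms(3) by (simp add: sbox_def snorm_le_iff[OF s])
qed

lemma bump_supported_sball: "scaling s ==> supported_in bump (sball s)"
 using bump_supported by (simp add: sball_eq_cbox)

lemma rescale_mult_rescale:
 assumes "0 < dl"
 shows "rescale s (%v. ph v * m (\<chi> i. w $ i + dl ^ s i * v $ i)) dl w y = rescale s ph dl w y * m y"
proof -
 have "(\<chi> i. w $ i + dl ^ s i * (\<chi> i. (y $ i - w $ i) / dl ^ s i) $ i) = y"
  using assms by (simp add: vec_eq_iff)
 then show ?thesis by (simp add: rescale_def)
qed

lemma integral_rescale: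
 assumes "0 < dl" "continuous_on UNIV ph"
 shows "(LI y. rescale s ph dl x y) = (LI v. ph v)"
proof -
 have c: "continuous_on UNIV (rescale s ph dl x)"
  using C_class_continuous[OF C_class_rescale[of 0 ph]] assms(2) by simp
 have "(LI y. rescale s ph dl x y) =
   (LI v. rescale s ph dl x (\<chi> i. x $ i + dl ^ s i * v $ i)) * (\<Prod>i\<in>UNIV. \<bar>dl ^ s i\<bar>)"
  using assms(1) c by (intro lborel_integral_affine_vec[symmetric] borel_measurable_continuous_onI) auto
 also have "(%v. rescale s ph dl x (\<chi> i. x $ i + dl ^ s i * v $ i)) = (%v. ph v / dl ^ hom_dim s)"
  using assms(1) by (auto simp: rescale_def)
 also have "(\<Prod>i\<in>UNIV. \<bar>dl ^ s i\<bar>) = dl ^ hom_dim s" using assms(1) by (simp add: hom_dim_def power_sum)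
 finally show ?thesis using assms(1) by simp
qed

text \<open>The integral runs over the centre and not over the argument. Rescaled bumps are
  therefore a continuous partition of unity indexed by their centres.\<close>

lemma integral_rescale_center:
 assumes "0 < dl" "continuous_on UNIV ph"
 shows "(LI x. rescale s ph dl x y) = (LI v. ph v)"
proof -
 have "continuous_on UNIV (%x. rescale s ph dl x y)"
  unfolding rescale_def
  by (intro continuous_on_divide continuous_on_compose2[OF assms(2)] continuous_on_vec_lambda continuous_intros)
   (use assms in auto)
 then have "(LI x. rescale s ph dl x y) =
   (LI v. rescale s ph dl (\<chi> i. y $ i + (- (dl ^ s i)) * v $ i) y) * (\<Prod>i\<in>UNIV. \<bar>- (dl ^ s i)\<bar>)"
  using assms(1) by (intro lborel_integral_affine_vec[symmetric] borel_measurable_continuous_onI) auto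
 also have "(%v. rescale s ph dl (\<chi> i. y $ i + (- (dl ^ s i)) * v $ i) y) = (%v. ph v / dl ^ hom_dim s)"
  using assms(1) by (auto simp: rescale_def)
 also have "(\<Prod>i\<in>UNIV. \<bar>- (dl ^ s i)\<bar>) = dl ^ hom_dim s" using assms(1) by (simp add: hom_dim_def power_sum)
 finally show ?thesis using assms(1) by simp
qed

lemma bump_Cb: "\<exists>a\<ge>1. Cb r a (bump :: real^'d::finite => real)"
proof -
 obtain a where "Cb r a (bump :: real^'d => real)"
  using Cb_exists[OF C_class_bump bump_supported compact_cbox] by blast
 then show ?thesis by (intro exI[of _ "max 1 a"]) (auto intro: Cb_mono)
qed

text \<open>The \<open>itself\<close> argument carries the dimension.\<close>

definition bump_bound :: "'d::finite itself => nat => real" where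
 "bump_bound _ r = (SOME a. a \<ge> 1 \<and> Cb r a (bump :: real^'d::finite => real))"

lemma bump_bound: "1 <= bump_bound TYPE('d::finite) r" "Cb r (bump_bound TYPE('d) r) (bump :: real^'d => real)"
 using someI_ex[OF bump_Cb[where 'd = 'd and r = r]] unfolding bump_bound_def by auto

lemma rescale_cmult: "rescale s (%v. c * ph v) dl x = (%y. c * rescale s ph dl x y)"
 by (simp add: rescale_def)

text \<open>A bump centred at \<open>w\<close> turns any function that is smooth at a coarser scale into a multiple of
 a rescaled admissible test function centred at \<open>w\<close>.\<close>

lemma bump_localize:
 fixes m :: "real ^ 'd::finite => real"
 assumes s: "scaling s" and "0 < ep" and m: "Cb r a (%v. m (\<chi> i. w $ i + ep ^ s i * v $ i))" and a: "0 < a"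
 shows "\<exists>ph\<in>B_tests s r. \<forall>y. rescale s bump ep w y * m y = 2 ^ r * bump_bound TYPE('d) r * a * rescale s ph ep w y"
proof -
 let ?c = "2 ^ r * bump_bound TYPE('d) r * a"
 have c: "0 < ?c" using a bump_bound(1)[of r, where 'd='d] by simp
 define ph where "ph = (%v. inverse ?c * (bump v * m (\<chi> i. w $ i + ep ^ s i * v $ i)))"
 have "Cb r (\<bar>inverse ?c\<bar> * ?c) ph"
  unfolding ph_def by (intro Cb_cmult Cb_mult bump_bound m)
 moreover have "\<bar>inverse ?c\<bar> * ?c = 1" using c
  by (metis abs_of_pos less_irrefl left_inverse positive_imp_inverse_positive)
 ultimately have "Cb r 1 ph" by simp
 then have "C_class r ph" "C_norm r ph <= 1" using Cb_iff[of 1 r ph] by auto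
 moreover have "supported_in ph (sball s)"
  using bump_supported_sball[OF s] by (auto simp: ph_def supported_in_def)
 ultimately have "ph \<in> B_tests s r" by (simp add: B_tests_def)
 moreover have "rescale s bump ep w y * m y = ?c * rescale s ph ep w y" for y
 proof -
  have "?c * rescale s ph ep w y = ?c * (inverse ?c * (rescale s bump ep w y * m y))"
   unfolding ph_def rescale_cmult rescale_mult_rescale[OF assms(2)] ..
  moreover have "b * (inverse b * z) = z" if "b ~= 0" for b z :: real using that by simp
  ultimately show ?thesis using c by (metis less_irrefl)
 qed
 ultimately show ?thesis by blast
qed

lemma B_tests_Cb: "ph \<in> B_tests s r ==> Cb r 1 ph"
 using Cb_iff[of 1 r ph] by (auto simp: B_tests_def)

text \<open>Seen at the finer scale \<open>ep\<close> each derivative brings a factor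
  \<open>ep ^ s i / dl ^ s i\<close>, at most 1. Only the amplitude
  \<open>inverse (dl ^ hom_dim s)\<close> remains.\<close>

lemma Cb_rescale_at_finer_scale:
 fixes ph :: "real ^ 'd::finite => real"
 assumes "Cb r a ph" "0 < ep" "ep <= dl"
 shows "Cb r (inverse (dl ^ hom_dim s) * a) (%v. rescale s ph dl x (\<chi> i. w $ i + ep ^ s i * v $ i))"
proof -
 have "Cb r (1 ^ r * a) (%v. ph (\<chi> i. (w $ i - x $ i) / dl ^ s i + (ep ^ s i / dl ^ s i) * v $ i))"
  using assms by (intro Cb_affine) (auto simp: divide_le_eq_1 power_mono)
 from Cb_cmult[OF this, of "inverse (dl ^ hom_dim s)"] assms(2,3)
 show ?thesis by (simp add: rescale_def divide_inverse algebra_simps)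
qed

section \<open>Uniqueness of smooth densities\<close>

lemma rescale_test_fun: "scaling s ==> 0 < dl ==> rescale s bump dl x \<in> test_funs"
 unfolding test_funs_def smooth_def
 using C_class_rescale[OF C_class_bump] rescale_supp[OF _ bump_supported_sball, of s dl x]
  compact_sbox[of s dl x]
 by (intro CollectI conjI allI exI[of _ "sbox s x dl"]) auto

lemma rescale_bump_nonneg: "0 <= dl ==> 0 <= rescale s bump dl x y"
 by (simp add: rescale_def bump_nonneg)

lemma dist_of_approx_value:
 fixes h :: "real ^ 'd::finite => real"
 assumes s: "scaling s" and h: "continuous_on UNIV h" and "0 < dl"
  and e: "!!y. y \<in> sbox s x dl ==> \<bar>h y - h x\<bar> <= e"
 shows "\<bar>dist_of h (rescale s bump dl x) - h x\<bar> <= e"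
proof -
 let ?rh = "rescale s bump dl x"
 have K: "supported_in ?rh (sbox s x dl)" "compact (sbox s x dl)"
  using assms rescale_supp[OF s bump_supported_sball[OF s]] compact_sbox[OF s] by auto
 have c: "continuous_on UNIV ?rh" using C_class_continuous[OF C_class_rescale[OF C_class_bump]] .
 have one: "(LI y. ?rh y) = 1"
  using integral_rescale[OF assms(3) bump_continuous] integral_bump by metis
 have i: "integrable lborel ?rh" by (rule integrable_compact_support[OF c K])
 have i2: "integrable lborel (%y. h y * ?rh y)"
  by (rule integrable_density_mult[OF locally_integrable_continuous[OF h] c K])
 have "dist_of h ?rh - h x = (LI y. h y * ?rh y - h x * ?rh y)"
  using i i2 one by (simp add: dist_of_def)
 also have "\<bar>...\<bar> <= (LI y. \<bar>h y * ?rh y - h x * ?rh y\<bar>)"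
  using integral_norm_bound[of lborel "%y. h y * ?rh y - h x * ?rh y"] by simp
 also have "... <= (LI y. e * ?rh y)"
 proof (rule integral_mono)
  fix y
  show "\<bar>h y * ?rh y - h x * ?rh y\<bar> <= e * ?rh y"
  proof (cases "y \<in> sbox s x dl")
   case True
   have "\<bar>h y - h x\<bar> * ?rh y <= e * ?rh y"
    using e[OF True] rescale_bump_nonneg[of dl s x y] assms(3) by (intro mult_right_mono) auto
   then show ?thesis using rescale_bump_nonneg[of dl s x y] assms(3)
    by (simp add: abs_mult left_diff_distrib[symmetric])
  next
   case False
   then have "?rh y = 0" using K(1) by (auto simp: supported_in_def)
   then show ?thesis by simp
  qed
 qed (use i i2 in auto)
 also have "... = e" using one by simp
 finally show ?thesis .
qed

lemma sbox_small:
 fixes x :: "real ^ 'd::finite"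
 assumes s: "scaling s" and "0 < d"
 shows "\<exists>dl0>0. \<forall>dl. 0 < dl --> dl <= dl0 --> (\<forall>y\<in>sbox s x dl. dist y x < d)"
proof -
 let ?d0 = "min 1 (d / (2 * real CARD('d)))"
 have pos: "0 < ?d0" using assms by simp
 have "dist y x < d" if "0 < dl" "dl <= ?d0" "y \<in> sbox s x dl" for dl y
 proof -
  have "\<bar>(y - x) $ i\<bar> <= ?d0" for i
  proof -
   have "\<bar>(y - x) $ i\<bar> <= dl ^ s i" using that snorm_le_iff[OF s, of dl "y - x"] by (simp add: sbox_def)
   also have "... <= dl ^ 1" using that s by (intro power_decreasing) (auto simp: scaling_def)
   finally show ?thesis using that by simp
  qed
  then have "norm (y - x) <= (\<Sum>i\<in>(UNIV :: 'd set). ?d0)"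
   by (intro order_trans[OF norm_le_l1_cart] sum_mono) auto
  also have "... = real CARD('d) * ?d0" by simp
  also have "... <= real CARD('d) * (d / (2 * real CARD('d)))" by (intro mult_left_mono) auto
  also have "... < d" using assms by simp
  finally show ?thesis by (simp add: dist_norm)
 qed
 then show ?thesis using pos by blast
qed

lemma dist_of_rescale_tendsto:
 fixes h :: "real ^ 'd::finite => real"
 assumes s: "scaling s" and h: "continuous_on UNIV h"
 shows "((%dl. dist_of h (rescale s bump dl x)) \<longlongrightarrow> h x) (at_right 0)"
proof (rule tendstoI)
 fix e :: real assume "0 < e"
 then obtain d where d: "d > 0" "!!y. dist y x < d ==> dist (h y) (h x) < e / 2"
  using h unfolding continuous_on_iff by (metis UNIV_I half_gt_zero)
 obtain dl0 where dl0: "dl0 > 0" "!!dl y. 0 < dl ==> dl <= dl0 ==> y \<in> sbox s x dl ==> dist y x < d"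
  using sbox_small[OF s d(1)] by blast
 have "eventually (%dl. dl \<in> {0<..<dl0}) (at_right (0::real))"
  using dl0(1) by (rule eventually_at_right_real)
 then show "eventually (%dl. dist (dist_of h (rescale s bump dl x)) (h x) < e) (at_right 0)"
 proof eventually_elim
  case (elim dl)
  then have "\<bar>dist_of h (rescale s bump dl x) - h x\<bar> <= e / 2"
   using d(2) dl0(2)[of dl] by (intro dist_of_approx_value[OF s h]) (auto simp: dist_real_def intro: less_imp_le)
  then show ?case using \<open>0 < e\<close> by (simp add: dist_real_def)
 qed
qed

lemma scaling_one: "scaling (%i. 1)" by (simp add: scaling_def)

lemma smooth_continuous: "smooth f ==> continuous_on A f"
 unfolding smooth_def using C_class_continuous by blast

text \<open>Values at a point are limits of pairings with bumps shrinking to that point. The trivial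
  scaling is good enough for this; the result justifies the description in
  \<open>smooth_density\<close>.\<close>

lemma is_smooth_density_unique:
 assumes "is_smooth_density u g" "is_smooth_density u h"
 shows "g = h"
proof
 fix x
 have c: "continuous_on UNIV g" "continuous_on UNIV h"
  using assms smooth_continuous by (auto simp: is_smooth_density_def)
 have "eventually (%dl. dist_of g (rescale (%i. 1) bump dl x) = dist_of h (rescale (%i. 1) bump dl x)) (at_right 0)"
  using eventually_at_right_less[of "0::real"]
 proof eventually_elim
  case (elim dl)
  then show ?case using assms rescale_test_fun[OF scaling_one, of dl x] by (auto simp: is_smooth_density_def)
 qed
 then show "g x = h x"
  using dist_of_rescale_tendsto[OF scaling_one c(1), of x] dist_of_rescale_tendsto[OF scaling_one c(2), of x]
  by (intro tendsto_unique[OF trivial_limit_at_right_real Lim_transform_eventually])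
qed

lemma smooth_density_eq: "is_smooth_density u g ==> smooth_density u = g"
 unfolding smooth_density_def by (rule the_equality) (auto intro: is_smooth_density_unique)

lemma test_funs_supp: "ph \<in> test_funs ==> \<exists>K. compact K \<and> supported_in ph K"
 by (simp add: test_funs_def)

text \<open>The constant for \<open>K\<close> is the L^1 norm of \<open>g\<close> on
  \<open>K\<close>, whatever the order, since only the supremum of the test function enters.\<close>

lemma distribution_dist_of:
 fixes g :: "real ^ 'd::finite => real"
 assumes g: "locally_integrable g"
 shows "distribution (dist_of g)" "order_at_most r (dist_of g)"
proof -
 have i: "integrable lborel (%y. g y * ph y)" if ph: "ph \<in> test_funs" for ph
 proof -
  obtain K where "compact K" "supported_in ph K" using test_funs_supp[OF ph] by blast
  moreover have "continuous_on UNIV ph" using ph smooth_continuous by (auto simp: test_funs_def)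
  ultimately show ?thesis using integrable_density_mult[OF g] by blast
 qed
 have bound: "\<exists>C. \<forall>r. \<forall>ph\<in>test_funs. supported_in ph K --> ennreal \<bar>dist_of g ph\<bar> <= ennreal C * C_norm r ph"
  if K: "compact K" for K
 proof -
  have iK: "integrable lborel (%y. indicator K y * g y)"
   using g K by (auto simp: locally_integrable_def set_integrable_def)
  have "ennreal \<bar>dist_of g ph\<bar> <= ennreal (LI y. \<bar>indicator K y * g y\<bar>) * C_norm r ph"
   if t: "ph \<in> test_funs" and supp: "supported_in ph K" for ph r
  proof -
   have "ennreal \<bar>dist_of g ph\<bar> <= (NI y. ennreal \<bar>g y * ph y\<bar>)"
    using integral_norm_bound_ennreal[OF i[OF t]] by (simp add: dist_of_def)
   also have "... <= (NI y. ennreal \<bar>indicator K y * g y\<bar> * C_norm r ph)"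
   proof (rule nn_integral_mono)
    fix y
    show "ennreal \<bar>g y * ph y\<bar> <= ennreal \<bar>indicator K y * g y\<bar> * C_norm r ph"
    proof (cases "y \<in> K")
     case True
     then show ?thesis by (simp add: abs_mult ennreal_mult mult_left_mono C_norm_ge_abs)
    next
     case False
     then have "ph y = 0" using supp by (auto simp: supported_in_def)
     then show ?thesis by simp
    qed
   qed
   also have "... = (NI y. ennreal \<bar>indicator K y * g y\<bar>) * C_norm r ph"
    using borel_measurable_integrable[OF iK] by (intro nn_integral_multc) auto
   also have "(NI y. ennreal \<bar>indicator K y * g y\<bar>) = ennreal (LI y. \<bar>indicator K y * g y\<bar>)"
    using iK by (intro nn_integral_eq_integral) auto
   finally show ?thesis .
  qed
  then show ?thesis by blast
 qed
 have lin: "dist_of g (%x. a * ph x + b * ps x) = a * dist_of g ph + b * dist_of g ps"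
  if "ph \<in> test_funs" "ps \<in> test_funs" for ph ps a b
 proof -
  have "(%y. g y * (a * ph y + b * ps y)) = (%y. a * (g y * ph y) + b * (g y * ps y))" by (auto simp: algebra_simps)
  then show ?thesis using i[OF that(1)] i[OF that(2)] by (simp add: dist_of_def)
 qed
 show "distribution (dist_of g)" unfolding distribution_def
 proof (intro conjI ballI allI impI)
  fix K :: "(real ^ 'd) set" assume "compact K"
  from bound[OF this] show "\<exists>N C. \<forall>ph\<in>test_funs. supported_in ph K --> ennreal \<bar>dist_of g ph\<bar> <= ennreal C * C_norm N ph"
   by metis
 qed (rule lin)
 show "order_at_most r (dist_of g)" unfolding order_at_most_def
 proof (intro allI impI)
  fix K :: "(real ^ 'd) set" assume "compact K"
  from bound[OF this] show "\<exists>C. \<forall>ph\<in>test_funs. supported_in ph K --> ennreal \<bar>dist_of g ph\<bar> <= ennreal C * C_norm r ph"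
   by metis
 qed
qed

hide_const (open) Order.top

section \<open>\<open>L\<^sup>p\<close> norms\<close>

lemma ennreal_powr_ennreal [simp]: "0 <= x ==> ennreal_powr (ennreal x) a = ennreal (x powr a)"
 by (simp add: ennreal_powr_def)

lemma ennreal_powr_top [simp]: "ennreal_powr top a = top"
 by (simp add: ennreal_powr_def)

lemma ennreal_powr_0 [simp]: "ennreal_powr 0 a = 0"
 by (simp add: ennreal_powr_def)

lemma ennreal_powr_mono: "0 <= a ==> x <= y ==> ennreal_powr x a <= ennreal_powr y a"
 by (cases x; cases y) (auto intro!: ennreal_leI powr_mono2 simp: top_unique)

lemma ennreal_powr_powr: "0 < a ==> 0 < b ==> ennreal_powr (ennreal_powr x a) b = ennreal_powr x (a * b)"
 by (cases x) (auto simp: powr_powr)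

lemma ennreal_powr_one [simp]: "ennreal_powr x 1 = x"
 by (cases x) auto

lemma ennreal_powr_mult: "0 < a ==> ennreal_powr (x * y) a = ennreal_powr x a * ennreal_powr y a"
proof (cases x; cases y)
 fix r assume "0 < a" "0 <= r" "x = ennreal r" "y = top"
 then show ?thesis by (cases "r = 0") (auto simp: ennreal_mult_top)
next
 fix r assume "0 < a" "0 <= r" "y = ennreal r" "x = top"
 then show ?thesis by (cases "r = 0") (auto simp: ennreal_top_mult)
qed (auto simp: ennreal_mult[symmetric] powr_mult ennreal_powr_ennreal mult_nonneg_nonneg)

lemma ennreal_powr_eq_0_iff: "0 < a ==> ennreal_powr x a = 0 \<longleftrightarrow> x = 0"
 by (cases x) auto

lemma ennreal_powr_eq_top_iff: "ennreal_powr x a = top \<longleftrightarrow> x = top"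
 by (cases x) auto

lemma ennreal_powr_measurable [measurable]:
 assumes [measurable]: "f \<in> borel_measurable M"
 shows "(%x. ennreal_powr (f x) a) \<in> borel_measurable M"
 unfolding ennreal_powr_def by measurable

lemma Lp_norm_finite: "p ~= top ==>
 Lp_norm M p g = ennreal_powr (\<integral>\<^sup>+x. ennreal_powr (g x) (enn2real p) \<partial>M) (1 / enn2real p)"
 by (simp add: Lp_norm_def)

lemma Lp_norm_infinity: "Lp_norm M top g = Inf {c. AE x in M. g x <= c}"
 by (simp add: Lp_norm_def)

lemma enn2real_ge_1: "1 <= p ==> p ~= top ==> 1 <= enn2real p"
 by (cases p) (auto simp: ennreal_ge_1)

text \<open>The infimum is approached by a sequence of admissible constants, and countably many null
  sets form a null set, so it is attained.\<close>

lemma AE_le_Lp_norm_infinity: "AE x in M. g x <= Lp_norm M top g"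
proof -
 have "{c. AE x in M. g x <= c} ~= {}" by (auto intro: exI[of _ top])
 from ennreal_Inf_countable_INF[OF this] obtain f :: "nat => ennreal"
  where f: "range f \<subseteq> {c. AE x in M. g x <= c}" "Inf {c. AE x in M. g x <= c} = (INF i. f i)" by auto
 then have "AE x in M. \<forall>i. g x <= f i" by (subst AE_all_countable) auto
 then show ?thesis unfolding Lp_norm_infinity f(2) by eventually_elim (auto intro: INF_greatest)
qed

lemma Lp_norm_infinity_le: "AE x in M. g x <= c ==> Lp_norm M top g <= c"
 unfolding Lp_norm_infinity by (rule Inf_lower) simp

lemma Lp_norm_mono_AE:
 assumes "AE x in M. g x <= h x"
 shows "Lp_norm M p g <= Lp_norm M p h"
proof (cases "p = top")
 case True
 have "AE x in M. g x <= Lp_norm M top h" using assms AE_le_Lp_norm_infinity[of h M] by eventually_elim auto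
 then show ?thesis using True Lp_norm_infinity_le by auto
next
 case False
 have "AE x in M. ennreal_powr (g x) (enn2real p) <= ennreal_powr (h x) (enn2real p)"
  using assms by eventually_elim (auto intro: ennreal_powr_mono)
 then show ?thesis unfolding Lp_norm_finite[OF False]
  by (intro ennreal_powr_mono nn_integral_mono_AE) auto
qed

lemma Lp_norm_mono: "(!!x. x \<in> space M ==> g x <= h x) ==> Lp_norm M p g <= Lp_norm M p h"
 by (intro Lp_norm_mono_AE AE_I2)

lemma Lp_norm_cong_AE: "AE x in M. g x = h x ==> Lp_norm M p g = Lp_norm M p h"
 by (intro antisym Lp_norm_mono_AE) (auto elim: eventually_mono)

lemma Lp_norm_cong: "(!!x. x \<in> space M ==> g x = h x) ==> Lp_norm M p g = Lp_norm M p h"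
 by (intro Lp_norm_cong_AE AE_I2)

lemma Lp_norm_cmult_le:
 assumes p: "1 <= p" and [measurable]: "g \<in> borel_measurable M"
 shows "Lp_norm M p (%x. c * g x) <= c * Lp_norm M p g"
proof (cases "p = top")
 case True
 have "AE x in M. c * g x <= c * Lp_norm M top g"
  using AE_le_Lp_norm_infinity[of g M] by eventually_elim (auto intro: mult_left_mono)
 then show ?thesis using True Lp_norm_infinity_le by auto
next
 case False
 let ?P = "enn2real p"
 have P: "1 <= ?P" using enn2real_ge_1[OF p False] .
 have "(\<integral>\<^sup>+x. ennreal_powr (c * g x) ?P \<partial>M) = ennreal_powr c ?P * (\<integral>\<^sup>+x. ennreal_powr (g x) ?P \<partial>M)"
  using P by (simp add: ennreal_powr_mult nn_integral_cmult)
 then show ?thesis unfolding Lp_norm_finite[OF False]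
  using P by (simp add: ennreal_powr_mult ennreal_powr_powr)
qed

lemma Lp_norm_zero [simp]: "1 <= p ==> Lp_norm M p (%x. 0) = 0"
 using Lp_norm_cmult_le[of p "%x. 0" M 0] by simp

text \<open>The tangent of the convex function x^P at \<open>m\<close>, up to the factor P. Being
  affine in \<open>x\<close> on the left and free of products on the right, it can be integrated,
  which yields Jensen's inequality.\<close>

lemma ennreal_Young:
 assumes P: "1 <= P" and m: "0 < m"
 shows "x * ennreal (m powr (P - 1)) <= ennreal (1 / P) * ennreal_powr x P + ennreal ((1 - 1 / P) * m powr P)"
proof (cases x)
 case (real a)
 have "a * m powr (P - 1) <= (1 / P) * a powr P + (1 - 1 / P) * m powr P"
 proof (cases "P = 1")
  case True
  then show ?thesis using real m by (auto simp: powr_zero_eq_one)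
 next
  case False
  define Q where "Q = P / (P - 1)"
  have P1: "P > 1" using P False by simp
  have Q: "Q > 1" "1 / P + 1 / Q = 1" using P1 by (auto simp: Q_def field_simps)
  have "a * m powr (P - 1) <= a powr P / P + (m powr (P - 1)) powr Q / Q"
   using P1 Q real by (intro Youngs_inequality) auto
  also have "(m powr (P - 1)) powr Q = m powr P" using P1 by (simp add: powr_powr Q_def)
  also have "1 / Q = 1 - 1 / P" using Q(2) by linarith
  then have "m powr P / Q = (1 - 1 / P) * m powr P" by (metis mult.commute divide_inverse inverse_eq_divide)
  finally show ?thesis by simp
 qed
 then have "ennreal (a * m powr (P - 1)) <= ennreal ((1 / P) * a powr P + (1 - 1 / P) * m powr P)"
  by (rule ennreal_leI)
 also have "... = ennreal (1 / P * a powr P) + ennreal ((1 - 1 / P) * m powr P)"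
  using P by (intro ennreal_plus) auto
 also have "ennreal (1 / P * a powr P) = ennreal (1 / P) * ennreal (a powr P)"
  using P by (intro ennreal_mult) auto
 finally show ?thesis using real by (simp add: ennreal_mult)
next
 case top
 then show ?thesis using P by (simp add: ennreal_mult_top)
qed

text \<open>Young's inequality is integrated with the parameter \<open>m\<close> equal to the mean
  itself. Mass at most 1 is sufficient because the constant term is nonnegative.\<close>

lemma Jensen_nn_integral:
 assumes P: "1 <= P" and mass: "emeasure Q (space Q) <= 1" and [measurable]: "G \<in> borel_measurable Q"
 shows "ennreal_powr (\<integral>\<^sup>+h. G h \<partial>Q) P <= (\<integral>\<^sup>+h. ennreal_powr (G h) P \<partial>Q)"
proof -
 define M where "M = (\<integral>\<^sup>+h. G h \<partial>Q)"
 define I where "I = (\<integral>\<^sup>+h. ennreal_powr (G h) P \<partial>Q)"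
 have Y: "M * ennreal (m powr (P - 1)) <= ennreal (1 / P) * I + ennreal ((1 - 1 / P) * m powr P)" if m: "0 < m" for m
 proof -
  have "M * ennreal (m powr (P - 1)) = (\<integral>\<^sup>+h. G h * ennreal (m powr (P - 1)) \<partial>Q)"
   unfolding M_def by (simp add: nn_integral_multc)
  also have "... <= (\<integral>\<^sup>+h. ennreal (1 / P) * ennreal_powr (G h) P + ennreal ((1 - 1 / P) * m powr P) \<partial>Q)"
   by (intro nn_integral_mono ennreal_Young P m)
  also have "... = ennreal (1 / P) * I + ennreal ((1 - 1 / P) * m powr P) * emeasure Q (space Q)"
   unfolding I_def by (simp add: nn_integral_add nn_integral_cmult)
  also have "... <= ennreal (1 / P) * I + ennreal ((1 - 1 / P) * m powr P) * 1"
   using mass by (intro add_left_mono mult_left_mono) auto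
  finally show ?thesis by simp
 qed
 have "ennreal_powr M P <= I"
 proof (cases "M = 0 \<or> I = top")
  case False
  show ?thesis
  proof (cases M)
   case (real a)
   with False have a: "0 < a" by (auto simp: less_le)
   obtain b where b: "I = ennreal b" "0 <= b" using False by (cases I) auto
   \<comment> \<open>With \<open>m = a\<close> the two multiples of a^P combine, leaving a^P / P on
     the left.\<close>
   have "ennreal (a * a powr (P - 1)) <= ennreal (1 / P * b + (1 - 1 / P) * a powr P)"
   proof -
    have "ennreal (a * a powr (P - 1)) = M * ennreal (a powr (P - 1))"
     using real by (simp add: ennreal_mult)
    also have "... <= ennreal (1 / P) * I + ennreal ((1 - 1 / P) * a powr P)" by (rule Y[OF a])
    also have "ennreal (1 / P) * I = ennreal (1 / P * b)"
     unfolding b(1) using b P by (intro ennreal_mult[symmetric]) auto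
    also have "ennreal (1 / P * b) + ennreal ((1 - 1 / P) * a powr P) = ennreal (1 / P * b + (1 - 1 / P) * a powr P)"
     using b P by (intro ennreal_plus[symmetric]) auto
    finally show ?thesis .
   qed
   then have "a * a powr (P - 1) <= 1 / P * b + (1 - 1 / P) * a powr P"
    using b P by (subst (asm) ennreal_le_iff) auto
   moreover have "a * a powr (P - 1) = a powr P" using a by (simp add: powr_diff)
   ultimately have "1 / P * a powr P <= 1 / P * b" by (simp add: algebra_simps)
   then have "a powr P <= b" using P by (simp add: field_simps)
   then show ?thesis using real b by (simp add: ennreal_leI)
  next
   \<comment> \<open>For an infinite mean already \<open>m = 1\<close> forces the right-hand side to
     be infinite.\<close>
   case top
   then have "ennreal (1 / P) * I + ennreal ((1 - 1 / P) * 1 powr P) = top"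
    using Y[of 1] by (simp add: top_unique)
   then show ?thesis using False by (auto simp: ennreal_mult_eq_top_iff)
  qed
 qed auto
 then show ?thesis by (simp add: M_def I_def)
qed

text \<open>The weight divided by \<open>c\<close> has mass at most 1. Undoing the normalisation
  costs c^P outside and gains 1/c inside.\<close>

lemma Jensen_nn_integral_weighted:
 assumes P: "1 <= P" and c: "0 < c" and [measurable]: "G \<in> borel_measurable Q" "k \<in> borel_measurable Q"
  and mass: "(\<integral>\<^sup>+h. k h \<partial>Q) <= ennreal c"
 shows "ennreal_powr (\<integral>\<^sup>+h. k h * G h \<partial>Q) P <= ennreal (c powr (P - 1)) * (\<integral>\<^sup>+h. k h * ennreal_powr (G h) P \<partial>Q)"
proof -
 define k' where "k' h = ennreal (inverse c) * k h" for h
 have [measurable]: "k' \<in> borel_measurable Q" unfolding k'_def by measurable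
 have k: "k h = ennreal c * k' h" for h
  using c by (simp add: k'_def mult.assoc[symmetric] ennreal_mult[symmetric])
 have "emeasure (density Q k') (space (density Q k')) = ennreal (inverse c) * (\<integral>\<^sup>+h. k h \<partial>Q)"
  unfolding k'_def by (subst emeasure_density) (auto simp: nn_integral_cmult cong: nn_integral_cong)
 also have "... <= ennreal (inverse c) * ennreal c" by (intro mult_left_mono mass) auto
 also have "... = 1" using c by (simp add: ennreal_mult[symmetric])
 finally have m: "emeasure (density Q k') (space (density Q k')) <= 1" .
 have "ennreal_powr (\<integral>\<^sup>+h. k h * G h \<partial>Q) P = ennreal_powr (ennreal c * (\<integral>\<^sup>+h. G h \<partial>density Q k')) P"
  by (simp add: k nn_integral_density nn_integral_cmult mult.assoc)
 also have "... = ennreal (c powr P) * ennreal_powr (\<integral>\<^sup>+h. G h \<partial>density Q k') P"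
  using P c by (simp add: ennreal_powr_mult)
 also have "... <= ennreal (c powr P) * (\<integral>\<^sup>+h. ennreal_powr (G h) P \<partial>density Q k')"
  by (intro mult_left_mono Jensen_nn_integral P m) auto
 also have "... = ennreal (c powr P) * (ennreal (inverse c) * (\<integral>\<^sup>+h. k h * ennreal_powr (G h) P \<partial>Q))"
  by (simp add: k'_def nn_integral_density nn_integral_cmult mult.assoc)
 also have "... = ennreal (c powr (P - 1)) * (\<integral>\<^sup>+h. k h * ennreal_powr (G h) P \<partial>Q)"
  using c by (simp add: mult.assoc[symmetric] ennreal_mult[symmetric] powr_diff divide_inverse)
 finally show ?thesis .
qed

text \<open>Jensen's inequality for the probability measure \<open>N(h) dh / S\<close>, where \<open>N(h)\<close> is the norm of
 the slice at \<open>h\<close> and \<open>S\<close> the integral of \<open>N\<close>, applied to the normalised slices.\<close>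

lemma Minkowski_integral_finite:
 assumes M: "sigma_finite_measure M" and Q: "sigma_finite_measure Q" and P: "1 <= P"
  and [measurable]: "(%(x, h). G x h) \<in> borel_measurable (M \<Otimes>\<^sub>M Q)"
 shows "ennreal_powr (\<integral>\<^sup>+x. ennreal_powr (\<integral>\<^sup>+h. G x h \<partial>Q) P \<partial>M) (1 / P)
  <= (\<integral>\<^sup>+h. ennreal_powr (\<integral>\<^sup>+x. ennreal_powr (G x h) P \<partial>M) (1 / P) \<partial>Q)"
proof -
 interpret M: sigma_finite_measure M by fact
 interpret Q: sigma_finite_measure Q by fact
 interpret pair_sigma_finite M Q ..
 define N where "N h = ennreal_powr (\<integral>\<^sup>+x. ennreal_powr (G x h) P \<partial>M) (1 / P)" for h
 define S where "S = (\<integral>\<^sup>+h. N h \<partial>Q)"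
 have [measurable]: "N \<in> borel_measurable Q" unfolding N_def by measurable
 have NP: "ennreal_powr (N h) P = (\<integral>\<^sup>+x. ennreal_powr (G x h) P \<partial>M)" for h
  using P by (simp add: N_def ennreal_powr_powr)
 have main: "ennreal_powr (\<integral>\<^sup>+x. ennreal_powr (\<integral>\<^sup>+h. G x h \<partial>Q) P \<partial>M) (1 / P) <= S"
 proof (cases "S = top")
  case False
  have Gx [measurable]: "(%x. G x h) \<in> borel_measurable M" if "h \<in> space Q" for h
   using that by measurable
  \<comment> \<open>Slices of norm 0 cannot be normalised. By Tonelli they contribute nothing for
    almost every \<open>x\<close>.\<close>
  define Z0 where "Z0 = {h\<in>space Q. N h = 0}"
  have [measurable]: "Z0 \<in> sets Q" unfolding Z0_def by measurable
  have Z: "AE x in M. (\<integral>\<^sup>+h. G x h * indicator Z0 h \<partial>Q) = 0"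
  proof -
   have "(\<integral>\<^sup>+x. (\<integral>\<^sup>+h. G x h * indicator Z0 h \<partial>Q) \<partial>M)
     = (\<integral>\<^sup>+h. (\<integral>\<^sup>+x. G x h * indicator Z0 h \<partial>M) \<partial>Q)"
    by (rule Fubini'[symmetric]) measurable
   also have "... = (\<integral>\<^sup>+h. 0 \<partial>Q)"
   proof (rule nn_integral_cong)
    fix h assume h: "h \<in> space Q"
    show "(\<integral>\<^sup>+x. G x h * indicator Z0 h \<partial>M) = 0"
    proof (cases "N h = 0")
     case True
     then have "(\<integral>\<^sup>+x. ennreal_powr (G x h) P \<partial>M) = 0" using NP[of h] P by simp
     then have "AE x in M. G x h = 0"
      using P h by (subst (asm) nn_integral_0_iff_AE) (auto simp: ennreal_powr_eq_0_iff)
     then have "AE x in M. G x h * indicator Z0 h = 0" by eventually_elim simp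
     then show ?thesis using h by (subst nn_integral_0_iff_AE) auto
    qed (use h in \<open>simp add: Z0_def\<close>)
   qed
   finally have "(\<integral>\<^sup>+x. (\<integral>\<^sup>+h. G x h * indicator Z0 h \<partial>Q) \<partial>M) = 0" by simp
   then show ?thesis
    by (subst (asm) nn_integral_0_iff_AE) auto
  qed
  have Nfin: "AE h in Q. N h ~= top"
   using False nn_integral_PInf_AE[of N Q] by (simp add: S_def)
  have eq: "AE x in M. (\<integral>\<^sup>+h. G x h \<partial>Q) = (\<integral>\<^sup>+h. N h * (G x h / N h) \<partial>Q)"
   using Z AE_space[of M]
  proof (eventually_elim, goal_cases)
   case (1 x)
   show ?case
   proof (cases "x \<in> space M")
    case True
    have [measurable]: "(%h. G x h) \<in> borel_measurable Q" using True by measurable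
    have "AE h in Q. G x h * indicator Z0 h = 0"
     using 1(1) by (subst (asm) nn_integral_0_iff_AE) auto
    then have "AE h in Q. G x h = N h * (G x h / N h)"
     using Nfin AE_space[of Q]
    proof eventually_elim
     case (elim h)
     show ?case
     proof (cases "N h = 0")
      case False
      then have "N h * (G x h / N h) = G x h"
       using elim by (simp add: ennreal_times_divide mult_divide_eq_ennreal mult.commute[of "N h"])
      then show ?thesis by simp
     qed (use elim in \<open>auto simp: Z0_def\<close>)
    qed
    then show ?thesis by (rule nn_integral_cong_AE)
   qed (use 1 in \<open>auto\<close>)
  qed
  show ?thesis
  proof (cases "S = 0")
   case True
   then have "AE h in Q. N h = 0" unfolding S_def by (subst (asm) nn_integral_0_iff_AE) auto
   then have "(\<integral>\<^sup>+h. N h * (G x h / N h) \<partial>Q) = 0" for x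
    by (subst nn_integral_cong_AE[where v = "%h. 0"]) (auto elim: eventually_mono)
   then have "AE x in M. ennreal_powr (\<integral>\<^sup>+h. G x h \<partial>Q) P = 0" using eq by (auto elim!: eventually_mono)
   then have "(\<integral>\<^sup>+x. ennreal_powr (\<integral>\<^sup>+h. G x h \<partial>Q) P \<partial>M) = 0"
    by (subst nn_integral_cong_AE[where v = "%h. 0"]) auto
   then show ?thesis by simp
  next
   case S0: False
   obtain c where c: "S = ennreal c" "0 < c" using False S0 by (cases S) (auto simp: less_le)
   have "(\<integral>\<^sup>+x. ennreal_powr (\<integral>\<^sup>+h. G x h \<partial>Q) P \<partial>M)
     = (\<integral>\<^sup>+x. ennreal_powr (\<integral>\<^sup>+h. N h * (G x h / N h) \<partial>Q) P \<partial>M)"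
    using eq by (intro nn_integral_cong_AE) auto
   also have "... <= (\<integral>\<^sup>+x. ennreal (c powr (P - 1)) * (\<integral>\<^sup>+h. N h * ennreal_powr (G x h / N h) P \<partial>Q) \<partial>M)"
    using c by (intro nn_integral_mono Jensen_nn_integral_weighted P) (auto simp: S_def[symmetric])
   also have "... = ennreal (c powr (P - 1)) * (\<integral>\<^sup>+x. (\<integral>\<^sup>+h. N h * ennreal_powr (G x h / N h) P \<partial>Q) \<partial>M)"
    by (intro nn_integral_cmult) measurable
   also have "(\<integral>\<^sup>+x. (\<integral>\<^sup>+h. N h * ennreal_powr (G x h / N h) P \<partial>Q) \<partial>M)
     = (\<integral>\<^sup>+h. (\<integral>\<^sup>+x. N h * ennreal_powr (G x h / N h) P \<partial>M) \<partial>Q)"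
    by (rule Fubini'[symmetric]) measurable
   also have "... <= (\<integral>\<^sup>+h. N h \<partial>Q)"
   proof (rule nn_integral_mono_AE)
    show "AE h in Q. (\<integral>\<^sup>+x. N h * ennreal_powr (G x h / N h) P \<partial>M) <= N h"
     using Nfin AE_space[of Q]
    proof eventually_elim
     case (elim h)
     show ?case
     proof (cases "N h = 0")
      case N0: False
      have "(\<integral>\<^sup>+x. N h * ennreal_powr (G x h / N h) P \<partial>M)
        = N h * (ennreal_powr (inverse (N h)) P * (\<integral>\<^sup>+x. ennreal_powr (G x h) P \<partial>M))"
       using elim P by (simp add: nn_integral_cmult divide_ennreal_def ennreal_powr_mult nn_integral_multc mult.commute)
      also have "... = N h * ennreal_powr (inverse (N h) * N h) P"
       using P by (simp add: NP[symmetric] ennreal_powr_mult)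
      also have "inverse (N h) * N h = 1"
       using N0 elim by (metis divide_ennreal_def ennreal_divide_self mult.commute top.not_eq_extremum)
      also have "ennreal_powr 1 P = 1" using ennreal_powr_ennreal[of 1 P] by simp
      finally show ?thesis by simp
     qed simp
    qed
   qed
   also have "... = ennreal c" using c S_def by simp
   finally have "(\<integral>\<^sup>+x. ennreal_powr (\<integral>\<^sup>+h. G x h \<partial>Q) P \<partial>M) <= ennreal (c powr (P - 1)) * ennreal c"
    by (simp add: mult_left_mono)
   also have "... = ennreal_powr S P" using c by (simp add: ennreal_mult[symmetric] powr_diff)
   finally have "ennreal_powr (\<integral>\<^sup>+x. ennreal_powr (\<integral>\<^sup>+h. G x h \<partial>Q) P \<partial>M) (1 / P) <= ennreal_powr (ennreal_powr S P) (1 / P)"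
    using P by (intro ennreal_powr_mono) auto
   also have "... = S" using P by (simp add: ennreal_powr_powr)
   finally show ?thesis .
  qed
 qed simp
 then show ?thesis by (simp add: S_def N_def)
qed

lemma Lp_norm_measurable:
 assumes M: "sigma_finite_measure M" and G [measurable]: "(%(x, h). G x h) \<in> borel_measurable (M \<Otimes>\<^sub>M Q)"
 shows "(%h. Lp_norm M p (%x. G x h)) \<in> borel_measurable Q"
proof -
 interpret M: sigma_finite_measure M by fact
 have G' [measurable]: "(%(h, x). G x h) \<in> borel_measurable (Q \<Otimes>\<^sub>M M)"
  using measurable_pair_swap[OF G] by (simp add: case_prod_beta')
 show ?thesis
 proof (cases "p = top")
  case True
  show ?thesis
  proof (rule borel_measurableI_le)
   fix c :: ennreal
   \<comment> \<open>The essential supremum is at most \<open>c\<close> iff the set where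
     \<open>c\<close> is exceeded is null. Its measure is an integral, which depends measurably on
     \<open>h\<close>.\<close>
   have "{h \<in> space Q. Lp_norm M p (%x. G x h) <= c} =
     {h \<in> space Q. (\<integral>\<^sup>+x. indicator {c<..} (G x h) \<partial>M) = 0}"
   proof (intro Collect_cong conj_cong refl)
    fix h assume h: "h \<in> space Q"
    have [measurable]: "(%x. G x h) \<in> borel_measurable M" using h by measurable
    have "Lp_norm M p (%x. G x h) <= c \<longleftrightarrow> (AE x in M. G x h <= c)"
     using AE_le_Lp_norm_infinity[of "%x. G x h" M] Lp_norm_infinity_le[of "%x. G x h" c M] True
     by (auto elim: eventually_mono)
    also have "... \<longleftrightarrow> (\<integral>\<^sup>+x. indicator {c<..} (G x h) \<partial>M) = (0::ennreal)"
     by (subst nn_integral_0_iff_AE) (auto simp: indicator_def not_less elim: eventually_mono)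
    finally show "Lp_norm M p (%x. G x h) <= c \<longleftrightarrow> (\<integral>\<^sup>+x. indicator {c<..} (G x h) \<partial>M) = (0::ennreal)" .
   qed
   also have "... \<in> sets Q" by measurable
   finally show "{h \<in> space Q. Lp_norm M p (%x. G x h) <= c} \<in> sets Q" .
  qed
 next
  case False
  show ?thesis unfolding Lp_norm_finite[OF False] by measurable
 qed
qed

lemma Minkowski_integral:
 assumes M: "sigma_finite_measure M" and Q: "sigma_finite_measure Q" and p: "1 <= p"
  and G [measurable]: "(%(x, h). G x h) \<in> borel_measurable (M \<Otimes>\<^sub>M Q)"
 shows "Lp_norm M p (%x. \<integral>\<^sup>+h. G x h \<partial>Q) <= (\<integral>\<^sup>+h. Lp_norm M p (%x. G x h) \<partial>Q)"
proof (cases "p = top")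
 case False
 then show ?thesis unfolding Lp_norm_finite[OF False]
  by (intro Minkowski_integral_finite M Q enn2real_ge_1 p G)
next
 case True
 interpret M: sigma_finite_measure M by fact
 interpret Q: sigma_finite_measure Q by fact
 interpret pair_sigma_finite M Q ..
 have [measurable]: "(%h. Lp_norm M p (%x. G x h)) \<in> borel_measurable Q"
  by (rule Lp_norm_measurable[OF M G])
 have "AE h in Q. AE x in M. G x h <= Lp_norm M p (%x. G x h)"
  unfolding True by (intro AE_I2 AE_le_Lp_norm_infinity)
 \<comment> \<open>Fubini for null sets exchanges the two almost everywhere quantifiers.\<close>
 then have "AE x in M. AE h in Q. G x h <= Lp_norm M p (%x. G x h)"
  by (subst AE_commute) measurable
 then have "AE x in M. (\<integral>\<^sup>+h. G x h \<partial>Q) <= (\<integral>\<^sup>+h. Lp_norm M p (%x. G x h) \<partial>Q)"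
  by eventually_elim (rule nn_integral_mono_AE)
 then show ?thesis using True Lp_norm_infinity_le by auto
qed

text \<open>Minkowski's integral inequality for the counting measure on the index set.\<close>

lemma Lp_norm_sum_le:
 assumes M: "sigma_finite_measure M" and p: "1 <= p" and I: "finite I"
  and g: "!!i. i \<in> I ==> g i \<in> borel_measurable M"
 shows "Lp_norm M p (%x. \<Sum>i\<in>I. g i x) <= (\<Sum>i\<in>I. Lp_norm M p (g i))"
proof -
 have sf: "sigma_finite_measure (count_space I)"
  using I by (intro sigma_finite_measure_count_space_countable countable_finite)
 have "(%(x, i). g i x) \<in> borel_measurable (M \<Otimes>\<^sub>M count_space I)"
  using measurable_pair_swap[OF measurable_pair_measure_countable1[of I "%(i, x). g i x" M borel]] I g
  by (simp add: countable_finite)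
 from Minkowski_integral[OF M sf p this] show ?thesis
  using I by (simp add: nn_integral_count_space_finite)
qed

lemma Lp_norm_add_le:
 assumes M: "sigma_finite_measure M" and p: "1 <= p"
  and g: "g \<in> borel_measurable M" and h: "h \<in> borel_measurable M"
 shows "Lp_norm M p (%x. g x + h x) <= Lp_norm M p g + Lp_norm M p h"
 using Lp_norm_sum_le[OF M p, of "{True, False}" "%b. if b then g else h"] g h by simp

lemma Lp_norm_translate:
 fixes g :: "'a::euclidean_space => ennreal"
 assumes [measurable]: "g \<in> borel_measurable borel"
 shows "Lp p (%x. g (a + x)) = Lp p g"
proof (cases "p = top")
 case True
 have "(AE x in lborel. g (a + x) <= c) \<longleftrightarrow> (AE x in lborel. g x <= c)" for c
 proof -
  have "(AE x in lborel. g x <= c) \<longleftrightarrow> (AE x in distr lborel borel ((+) a). g x <= c)"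
   by (subst lborel_distr_plus) (rule refl)
  also have "... \<longleftrightarrow> (AE x in lborel. g (a + x) <= c)" by (subst AE_distr_iff) auto
  finally show ?thesis by simp
 qed
 then show ?thesis unfolding True Lp_norm_infinity by simp
next
 case False
 show ?thesis unfolding Lp_norm_finite[OF False]
  by (subst nn_integral_lborel_translate[where f = "%x. ennreal_powr (g x) (enn2real p)"]) auto
qed

text \<open>For finite \<open>p\<close> the weighted Jensen inequality leaves the weight in the
  integral, where \<open>k x <= 1\<close> removes it; the constant depends on \<open>c\<close> and
  \<open>p\<close> only.\<close>

lemma Hoelder_weighted:
 assumes p: "1 <= p" and c: "0 < c" and [measurable]: "k \<in> borel_measurable M" and k1: "!!x. k x <= 1"
  and mass: "(\<integral>\<^sup>+x. k x \<partial>M) <= ennreal c"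
 shows "\<exists>C::real. 0 < C \<and> (\<forall>G\<in>borel_measurable M. (\<integral>\<^sup>+x. k x * G x \<partial>M) <= ennreal C * Lp_norm M p G)"
proof (cases "p = top")
 case True
 have "(\<integral>\<^sup>+x. k x * G x \<partial>M) <= ennreal c * Lp_norm M p G" for G
 proof -
  have "AE x in M. k x * G x <= k x * Lp_norm M p G"
   using AE_le_Lp_norm_infinity[of G M] True by (auto elim!: eventually_mono intro: mult_left_mono)
  then have "(\<integral>\<^sup>+x. k x * G x \<partial>M) <= (\<integral>\<^sup>+x. k x * Lp_norm M p G \<partial>M)" by (rule nn_integral_mono_AE)
  also have "... = (\<integral>\<^sup>+x. k x \<partial>M) * Lp_norm M p G" by (rule nn_integral_multc) simp
  also have "... <= ennreal c * Lp_norm M p G" by (intro mult_right_mono mass) auto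
  finally show ?thesis .
 qed
 then show ?thesis using c by blast
next
 case False
 let ?P = "enn2real p"
 have P: "1 <= ?P" using enn2real_ge_1[OF p False] .
 have "(\<integral>\<^sup>+x. k x * G x \<partial>M) <= ennreal ((c powr (?P - 1)) powr (1 / ?P)) * Lp_norm M p G"
  if [measurable]: "G \<in> borel_measurable M" for G
 proof -
  have "ennreal_powr (\<integral>\<^sup>+x. k x * G x \<partial>M) ?P <= ennreal (c powr (?P - 1)) * (\<integral>\<^sup>+x. k x * ennreal_powr (G x) ?P \<partial>M)"
   by (intro Jensen_nn_integral_weighted P c mass) auto
  also have "... <= ennreal (c powr (?P - 1)) * (\<integral>\<^sup>+x. ennreal_powr (G x) ?P \<partial>M)"
   using mult_right_mono[OF k1] by (intro mult_left_mono nn_integral_mono) auto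
  finally have "ennreal_powr (ennreal_powr (\<integral>\<^sup>+x. k x * G x \<partial>M) ?P) (1 / ?P) <=
    ennreal_powr (ennreal (c powr (?P - 1)) * (\<integral>\<^sup>+x. ennreal_powr (G x) ?P \<partial>M)) (1 / ?P)"
   using P by (intro ennreal_powr_mono) auto
  then show ?thesis unfolding Lp_norm_finite[OF False]
   using P by (simp add: ennreal_powr_powr ennreal_powr_mult)
 qed
 then show ?thesis using c by (intro exI[of _ "(c powr (?P - 1)) powr (1 / ?P)"]) auto
qed

section \<open>Uniform boundedness\<close>

text \<open>Sokal's elementary proof: the partial sums \<open>X n\<close> of \<open>\<plusminus>3\<^sup>-\<^sup>n u n\<close>, with suitably chosen signs, converge to
 a point at which the family is unbounded.\<close>

lemma uniform_boundedness:
 fixes T :: "'b::banach set" and L :: "'i => 'b => real"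
 assumes T: "subspace T" "closed T"
  and lin: "!!i a b x y. i \<in> I ==> x \<in> T ==> y \<in> T ==> L i (a *\<^sub>R x + b *\<^sub>R y) = a * L i x + b * L i y"
  and bdd: "!!i. i \<in> I ==> \<exists>C. \<forall>x\<in>T. \<bar>L i x\<bar> <= C * norm x"
  and ptw: "!!x. x \<in> T ==> \<exists>C. \<forall>i\<in>I. \<bar>L i x\<bar> <= C"
 shows "\<exists>C\<ge>0. \<forall>i\<in>I. \<forall>x\<in>T. \<bar>L i x\<bar> <= C * norm x"
proof (rule ccontr)
 assume contra: "\<not> ?thesis"
 have T0: "0 \<in> T" using T(1) by (rule subspace_0)
 have L0: "L i 0 = 0" if "i \<in> I" for i using lin[OF that T0 T0, of 0 0] by simp
 have scale: "L i (a *\<^sub>R x) = a * L i x" if "i \<in> I" "x \<in> T" for i a x using lin[OF that T0, of a 0] by simp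
 \<comment> \<open>\<open>u\<close> nearly attains the operator norm of \<open>L i\<close> on
   \<open>T\<close>, so that 3/2 of its value may stand in for that norm.\<close>
 have near_max: "\<exists>i u. i \<in> I \<and> u \<in> T \<and> norm u <= 1 \<and> 4 ^ n <= \<bar>L i u\<bar> \<and>
   (\<forall>x\<in>T. \<bar>L i x\<bar> <= 3/2 * \<bar>L i u\<bar> * norm x)" for n :: nat
 proof -
  obtain i x where ix: "i \<in> I" "x \<in> T" "\<bar>L i x\<bar> > 2 * 4 ^ n * norm x"
   using contra by (metis mult_nonneg_nonneg not_le zero_le_numeral zero_le_power)
  then have x: "norm x > 0" using L0 by (cases "x = 0") auto
  define B where "B = (%x. \<bar>L i x\<bar>) ` {x\<in>T. norm x <= 1}"
  obtain C where C: "!!x. x \<in> T ==> \<bar>L i x\<bar> <= C * norm x" using bdd[OF ix(1)] by blast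
  have "\<bar>L i x\<bar> <= \<bar>C\<bar>" if "x \<in> T" "norm x <= 1" for x
  proof -
   have "C * norm x <= \<bar>C\<bar> * 1" using that by (intro mult_mono) auto
   then show ?thesis using C[OF that(1)] by simp
  qed
  then have B: "bdd_above B" unfolding B_def by (intro bdd_aboveI[of _ "\<bar>C\<bar>"]) auto
  define c where "c = Sup B"
  have le_c: "\<bar>L i x\<bar> <= c" if "x \<in> T" "norm x <= 1" for x
   unfolding c_def using that B by (intro cSup_upper) (auto simp: B_def)
  have le_cn: "\<bar>L i y\<bar> <= c * norm y" if "y \<in> T" for y
  proof (cases "y = 0")
   case False
   have "\<bar>L i (inverse (norm y) *\<^sub>R y)\<bar> <= c"
    using False that T(1) by (intro le_c) (auto simp: subspace_scale)
   then show ?thesis using False scale[OF ix(1) that] by (simp add: abs_mult field_simps)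
  qed (use L0 ix in auto)
  have c: "c > 2 * 4 ^ n"
   using le_cn[OF ix(2)] ix(3) x by (metis less_le_trans mult_less_cancel_right_pos)
  have cpos: "0 < c" using c by (smt (verit) zero_less_power)
  have "2/3 * c < c" using cpos by simp
  then have "\<exists>b\<in>B. 2/3 * c < b"
   unfolding c_def using B T0 by (subst less_cSup_iff[symmetric]) (auto simp: B_def)
  then obtain u where u: "u \<in> T" "norm u <= 1" "2/3 * c < \<bar>L i u\<bar>" by (auto simp: B_def)
  have "\<bar>L i x\<bar> <= 3/2 * \<bar>L i u\<bar> * norm x" if "x \<in> T" for x
   using le_cn[OF that] u(3) mult_right_mono[of c "3/2 * \<bar>L i u\<bar>" "norm x"] by auto
  moreover have "4 ^ n <= \<bar>L i u\<bar>" using u(3) c zero_less_power[of "4::real" n] by linarith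
  ultimately show ?thesis using ix u by blast
 qed
 then obtain i u where i: "!!n::nat. i n \<in> I" and u: "!!n. u n \<in> T" "!!n. norm (u n) <= 1"
  "!!n. 4 ^ n <= \<bar>L (i n) (u n)\<bar>" "!!n x. x \<in> T ==> \<bar>L (i n) x\<bar> <= 3/2 * \<bar>L (i n) (u n)\<bar> * norm x"
  by metis
 define X where "X = rec_nat 0 (%n x. if (1/3) ^ n * \<bar>L (i n) (u n)\<bar> <= \<bar>L (i n) (x + (1/3) ^ n *\<^sub>R u n)\<bar>
   then x + (1/3) ^ n *\<^sub>R u n else x - (1/3) ^ n *\<^sub>R u n)"
 have X0: "X 0 = 0" by (simp add: X_def)
 have XS: "X (Suc n) = (if (1/3) ^ n * \<bar>L (i n) (u n)\<bar> <= \<bar>L (i n) (X n + (1/3) ^ n *\<^sub>R u n)\<bar>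
   then X n + (1/3) ^ n *\<^sub>R u n else X n - (1/3) ^ n *\<^sub>R u n)" for n by (simp add: X_def)
 have XT: "X n \<in> T" for n
  by (induction n) (auto simp: X0 XS T0 T(1) u subspace_add subspace_diff subspace_scale)
 \<comment> \<open>Of the two numbers |a + b| and |a - b| one is at least |b|; the definition of
   \<open>X\<close> picks the sign accordingly.\<close>
 have big: "(1/3) ^ n * \<bar>L (i n) (u n)\<bar> <= \<bar>L (i n) (X (Suc n))\<bar>" for n
 proof -
  have "L (i n) (X n + (1/3) ^ n *\<^sub>R u n) = L (i n) (X n) + (1/3) ^ n * L (i n) (u n)"
   using lin[OF i XT u(1), of n 1 n "(1/3)^n" n] by simp
  moreover have "L (i n) (X n - (1/3) ^ n *\<^sub>R u n) = L (i n) (X n) - (1/3) ^ n * L (i n) (u n)"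
   using lin[OF i XT u(1), of n 1 n "-((1/3)^n)" n] by simp
  moreover have "\<bar>(1/3) ^ n * L (i n) (u n)\<bar> = (1/3) ^ n * \<bar>L (i n) (u n)\<bar>" by (simp add: abs_mult)
  ultimately show ?thesis unfolding XS by (smt (verit))
 qed
 define d where "d n = X (Suc n) - X n" for n
 have nd: "norm (d n) <= (1/3) ^ n" for n
  using u(2)[of n] mult_left_mono[of "norm (u n)" 1 "(1/3)^n"] by (auto simp: d_def XS)
 have sd: "summable d"
  by (rule summable_comparison_test'[OF _ nd]) (simp add: summable_geometric)
 have sumX: "(\<Sum>k<n. d k) = X n" for n by (simp add: d_def sum_lessThan_telescope X0)
 define Y where "Y = suminf d"
 have XY: "X \<longlonglongrightarrow> Y"
 proof -
  have "(%n. \<Sum>k<n. d k) \<longlonglongrightarrow> Y" unfolding Y_def using sd by (rule summable_LIMSEQ)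
  then show ?thesis by (simp add: sumX)
 qed
 have YT: "Y \<in> T" using closed_sequentially[OF T(2) XT XY] .
 \<comment> \<open>The remaining steps have norms 3^-k with k > n, which sum to half of
   3^-n.\<close>
 have close: "norm (Y - X (Suc n)) <= (1/3) ^ n / 2" for n
 proof -
  have "Y - X (Suc n) = (\<Sum>k. d (k + Suc n))"
   using suminf_minus_initial_segment[OF sd, of "Suc n"]
   by (simp add: Y_def sumX del: sum.lessThan_Suc)
  also have "norm ... <= (\<Sum>k. (1/3) ^ (k + Suc n))"
  proof (rule norm_suminf_le)
   show "summable (%k. (1/3 :: real) ^ (k + Suc n))"
    unfolding power_add by (intro summable_mult2 summable_geometric) simp
  qed (rule nd)
  also have "... = (\<Sum>k. (1/3) ^ k) * (1/3) ^ Suc n"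
   unfolding power_add by (intro suminf_mult2[symmetric] summable_geometric) simp
  also have "... = (1/3) ^ n / 2" by (simp add: suminf_geometric)
  finally show ?thesis .
 qed
 obtain C where C: "!!j. j \<in> I ==> \<bar>L j Y\<bar> <= C" using ptw[OF YT] by blast
 \<comment> \<open>Passing from \<open>X (Suc n)\<close> to the limit changes the value by at most
   3/4 of 3^-n \<open>?l\<close>. A quarter survives, and \<open>?l\<close> is at least 4^n.\<close>
 have le_C: "(4/3) ^ n / 4 <= C" for n
 proof -
  let ?l = "\<bar>L (i n) (u n)\<bar>"
  have "L (i n) (Y - X (Suc n)) = L (i n) Y - L (i n) (X (Suc n))"
   using lin[OF i YT XT, of n 1 "-1"] by simp
  moreover have "\<bar>L (i n) (Y - X (Suc n))\<bar> <= 3/2 * ?l * ((1/3) ^ n / 2)"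
   using u(4)[of "Y - X (Suc n)" n] close[of n] mult_left_mono[OF close[of n], of "3/2 * ?l"] YT XT T(1)
   by (simp add: subspace_diff)
  ultimately have "(1/3) ^ n * ?l / 4 <= \<bar>L (i n) Y\<bar>" using big[of n] by (simp add: algebra_simps)
  moreover have "(4/3) ^ n <= (1/3) ^ n * ?l"
   using mult_left_mono[OF u(3)[of n], of "(1/3)^n"] by (simp add: power_mult_distrib[symmetric])
  ultimately show ?thesis using C[OF i[of n]] by linarith
 qed
 obtain n where "4 * C < (4/3) ^ n" using real_arch_pow[of "4/3"] by auto
 with le_C[of n] show False by linarith
qed

section \<open>Regularity structures\<close>

definition hom_below :: "('b::banach) regstruct => real => real set" where
 "hom_below \<T> ga = rs_A \<T> \<inter> {..<ga}"

definition rs_norm :: "('b::banach) regstruct => real => (real => 'b) => real" where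
 "rs_norm \<T> ga ta = (\<Sum>ze\<in>hom_below \<T> ga. norm (ta ze))"

lemma rs_norm_nonneg: "0 <= rs_norm \<T> ga ta"
 by (simp add: rs_norm_def sum_nonneg)

locale reg_structure =
 fixes \<T> :: "('b::banach) regstruct"
 assumes rs: "regularity_structure \<T>"
begin

lemma finite_hom_below [simp]: "finite (hom_below \<T> ga)"
proof -
 obtain a where "!!x. x \<in> rs_A \<T> ==> a <= x"
  using rs by (auto simp: regularity_structure_def bdd_below_def)
 then have "hom_below \<T> ga \<subseteq> rs_A \<T> \<inter> {a..ga}" by (auto simp: hom_below_def)
 moreover have "finite (rs_A \<T> \<inter> {a..ga})" using rs by (simp add: regularity_structure_def)
 ultimately show ?thesis by (rule finite_subset)
qed

lemma subspace_T: "al \<in> rs_A \<T> ==> subspace (rs_T \<T> al)"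
 and closed_T: "al \<in> rs_A \<T> ==> closed (rs_T \<T> al)"
 using rs by (auto simp: regularity_structure_def)

lemma rs_sum_lin:
 assumes "si \<in> rs_sum \<T>" "ta \<in> rs_sum \<T>"
 shows "(%al. a *\<^sub>R si al + b *\<^sub>R ta al) \<in> rs_sum \<T>"
proof -
 have sub: "{al. a *\<^sub>R si al + b *\<^sub>R ta al ~= 0} \<subseteq> {al. si al ~= 0} \<union> {al. ta al ~= 0}" by auto
 moreover have "finite ({al. si al ~= 0} \<union> {al. ta al ~= 0})" using assms by (simp add: rs_sum_def)
 ultimately have "finite {al. a *\<^sub>R si al + b *\<^sub>R ta al ~= 0}" by (rule finite_subset)
 moreover have "{al. a *\<^sub>R si al + b *\<^sub>R ta al ~= 0} \<subseteq> rs_A \<T>"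
  using sub assms unfolding rs_sum_def by blast
 ultimately show ?thesis using assms subspace_T
  unfolding rs_sum_def by (auto intro!: subspace_add subspace_scale)
qed

lemma rs_below_lin:
 assumes "si \<in> rs_below \<T> ga" "ta \<in> rs_below \<T> ga"
 shows "(%al. a *\<^sub>R si al + b *\<^sub>R ta al) \<in> rs_below \<T> ga"
 using assms rs_sum_lin[of si ta a b] by (simp add: rs_below_def)

lemma rs_below_diff: "si \<in> rs_below \<T> ga ==> ta \<in> rs_below \<T> ga ==> (%al. si al - ta al) \<in> rs_below \<T> ga"
 using rs_below_lin[of si ga ta 1 "-1"] by simp

lemma rs_below_sum: "ta \<in> rs_below \<T> ga ==> ta \<in> rs_sum \<T>"
 by (simp add: rs_below_def)

lemma rs_sum_zero: "(%al. 0) \<in> rs_sum \<T>"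
 using subspace_T by (auto simp: rs_sum_def subspace_0)

lemma homog_in_sum: "ze \<in> rs_A \<T> ==> b \<in> rs_T \<T> ze ==> homog ze b \<in> rs_sum \<T>"
proof -
 assume *: "ze \<in> rs_A \<T>" "b \<in> rs_T \<T> ze"
 have "{al. homog ze b al ~= 0} \<subseteq> {ze}" by (auto simp: homog_def)
 then show ?thesis using * subspace_T finite_subset[of "{al. homog ze b al ~= 0}" "{ze}"]
  by (auto simp: rs_sum_def homog_def subspace_0)
qed

lemma comp_in_T: "ta \<in> rs_sum \<T> ==> ze \<in> rs_A \<T> ==> ta ze \<in> rs_T \<T> ze"
 by (simp add: rs_sum_def)

lemma rs_below_comp_zero: "ta \<in> rs_below \<T> ga ==> ze \<notin> hom_below \<T> ga ==> ta ze = 0"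
 by (auto simp: rs_below_def rs_sum_def hom_below_def not_less)

text \<open>Linear maps on the direct sum are determined by their values on homogeneous elements.\<close>

lemma additive_decomposition:
 fixes P :: "(real => 'b) => 'c::real_vector"
 assumes lin: "!!si ta a b. si \<in> rs_sum \<T> ==> ta \<in> rs_sum \<T> ==>
   P (%al. a *\<^sub>R si al + b *\<^sub>R ta al) = a *\<^sub>R P si + b *\<^sub>R P ta"
  and ta: "ta \<in> rs_below \<T> ga"
 shows "P ta = (\<Sum>ze\<in>hom_below \<T> ga. P (homog ze (ta ze)))"
proof -
 have P0: "P (%al. 0) = 0" using lin[OF rs_sum_zero rs_sum_zero, of 0 0] by simp
 have "P (%al. if al \<in> F then ta al else 0) = (\<Sum>ze\<in>F. P (homog ze (ta ze))) \<and> (%al. if al \<in> F then ta al else 0) \<in> rs_sum \<T>"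
  if "finite F" "F \<subseteq> hom_below \<T> ga" for F
  using that
 proof (induction F)
  case empty
  then show ?case using P0 rs_sum_zero by simp
 next
  case (insert ze F)
  have h: "homog ze (ta ze) \<in> rs_sum \<T>"
   using insert.prems ta by (intro homog_in_sum comp_in_T rs_below_sum) (auto simp: hom_below_def)
  have eq: "(%al. if al \<in> insert ze F then ta al else 0) =
    (%al. 1 *\<^sub>R homog ze (ta ze) al + 1 *\<^sub>R (if al \<in> F then ta al else 0))"
   using insert.hyps by (auto simp: homog_def fun_eq_iff)
  have IH: "P (%al. if al \<in> F then ta al else 0) = (\<Sum>ze\<in>F. P (homog ze (ta ze)))"
   "(%al. if al \<in> F then ta al else 0) \<in> rs_sum \<T>" using insert by auto
  show ?case unfolding eq lin[OF h IH(2)] using insert.hyps IH(1) rs_sum_lin[OF h IH(2), of 1 1] by simp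
 qed
 from this[of "hom_below \<T> ga"] have "P (%al. if al \<in> hom_below \<T> ga then ta al else 0) = (\<Sum>ze\<in>hom_below \<T> ga. P (homog ze (ta ze)))"
  by simp
 moreover have "(%al. if al \<in> hom_below \<T> ga then ta al else 0) = ta"
  using rs_below_comp_zero[OF ta] by auto
 ultimately show ?thesis by simp
qed

lemma G_lin:
 assumes "g \<in> rs_G \<T>" "si \<in> rs_sum \<T>" "ta \<in> rs_sum \<T>"
 shows "g (%al. a *\<^sub>R si al + b *\<^sub>R ta al) = (%al. a *\<^sub>R g si al + b *\<^sub>R g ta al)"
 using rs assms unfolding regularity_structure_def by blast

lemma G_bij: "g \<in> rs_G \<T> ==> bij_betw g (rs_sum \<T>) (rs_sum \<T>)"
proof -
 assume "g \<in> rs_G \<T>"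
 moreover have "rs_G \<T> \<subseteq> carrier (BijGroup (rs_sum \<T>))"
  using rs subgroup.subset unfolding regularity_structure_def by blast
 ultimately show ?thesis by (auto simp: BijGroup_def Bij_def)
qed

lemma G_sum: "g \<in> rs_G \<T> ==> ta \<in> rs_sum \<T> ==> g ta \<in> rs_sum \<T>"
 using G_bij bij_betwE by blast

lemma G_homog:
 assumes "g \<in> rs_G \<T>" "al \<in> rs_A \<T>" "b \<in> rs_T \<T> al"
 shows "(%be. g (homog al b) be - homog al b be) \<in> rs_below \<T> al"
 using rs assms unfolding regularity_structure_def by blast

text \<open>By additivity it suffices to look at homogeneous elements, which the structure group
  changes only in strictly lower homogeneities.\<close>

lemma G_comp:
 assumes g: "g \<in> rs_G \<T>" and ta: "ta \<in> rs_below \<T> ga"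
 shows "g ta be - ta be = (\<Sum>ze\<in>hom_below \<T> ga \<inter> {be<..}. g (homog ze (ta ze)) be)"
proof -
 have "g ta be - ta be = (\<Sum>ze\<in>hom_below \<T> ga. g (homog ze (ta ze)) be - homog ze (ta ze) be)"
  using g ta by (intro additive_decomposition[where P = "%ta. g ta be - ta be"]) (auto simp: G_lin algebra_simps)
 also have "... = (\<Sum>ze\<in>hom_below \<T> ga \<inter> {be<..}. g (homog ze (ta ze)) be - homog ze (ta ze) be)"
 proof (rule sum.mono_neutral_right)
  show "\<forall>ze\<in>hom_below \<T> ga - hom_below \<T> ga \<inter> {be<..}. g (homog ze (ta ze)) be - homog ze (ta ze) be = 0"
  proof
   fix ze assume ze: "ze \<in> hom_below \<T> ga - hom_below \<T> ga \<inter> {be<..}"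
   then have "(%be. g (homog ze (ta ze)) be - homog ze (ta ze) be) \<in> rs_below \<T> ze"
    using g ta by (intro G_homog comp_in_T rs_below_sum) (auto simp: hom_below_def)
   then show "g (homog ze (ta ze)) be - homog ze (ta ze) be = 0" using ze by (auto simp: rs_below_def not_less)
  qed
 qed auto
 also have "... = (\<Sum>ze\<in>hom_below \<T> ga \<inter> {be<..}. g (homog ze (ta ze)) be)"
  by (intro sum.cong) (auto simp: homog_def)
 finally show ?thesis .
qed

lemma G_below:
 assumes "g \<in> rs_G \<T>" "ta \<in> rs_below \<T> ga"
 shows "g ta \<in> rs_below \<T> ga"
proof -
 have "g ta be = 0" if "ga <= be" for be
 proof -
  have "hom_below \<T> ga \<inter> {be<..} = {}" using that by (auto simp: hom_below_def)
  moreover have "ta be = 0" using that assms(2) by (simp add: rs_below_def)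
  ultimately show ?thesis using G_comp[OF assms, of be] by simp
 qed
 then show ?thesis using G_sum[OF assms(1)] assms(2) by (simp add: rs_below_def)
qed

lemma rs_norm_triangle: "rs_norm \<T> ga (%al. si al + ta al) <= rs_norm \<T> ga si + rs_norm \<T> ga ta"
 by (simp add: rs_norm_def sum.distrib[symmetric] sum_mono norm_triangle_ineq)

lemma norm_comp_le_rs_norm: "ta \<in> rs_below \<T> ga ==> norm (ta ze) <= rs_norm \<T> ga ta"
proof (cases "ze \<in> hom_below \<T> ga")
 case True
 then show ?thesis unfolding rs_norm_def by (intro member_le_sum) auto
qed (simp add: rs_below_comp_zero rs_norm_nonneg)

end

section \<open>Smooth models\<close>

locale smooth_model_scaled = reg_structure \<T> for \<T> :: "('b::banach) regstruct" +
 fixes s :: "'d::finite => nat" and r :: nat and ga :: real and Z :: "('d, 'b) model"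
 assumes s: "scaling s" and smooth_model: "smooth_model \<T> s r Z"
begin

abbreviation "H \<equiv> hom_below \<T> ga"
abbreviation "nrm \<equiv> rs_norm \<T> ga"

definition dens :: "real ^ 'd => (real => 'b) => real ^ 'd => real" where
 "dens x ta = smooth_density (m_Pi Z x ta)"

definition nPi :: real where "nPi = enn2real (Pi_norm \<T> s r ga (m_Pi Z))"
definition nGam :: real where "nGam = enn2real (Gam_norm \<T> s ga (m_Gam Z))"

lemma model: "is_model \<T> s r Z" using smooth_model by (simp add: smooth_model_def)

lemma Pi_norm_eq: "Pi_norm \<T> s r ga (m_Pi Z) = ennreal nPi"
 using model by (simp add: is_model_def nPi_def less_top[symmetric])

lemma Gam_norm_eq: "Gam_norm \<T> s ga (m_Gam Z) = ennreal nGam"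
 using model by (simp add: is_model_def nGam_def less_top[symmetric])

lemma nPi_nonneg: "0 <= nPi" and nGam_nonneg: "0 <= nGam"
 by (simp_all add: nPi_def nGam_def)

lemma Gam_G: "m_Gam Z x y \<in> rs_G \<T>"
 using model by (simp add: is_model_def)

lemma is_dens: "ta \<in> rs_sum \<T> ==> is_smooth_density (m_Pi Z x ta) (dens x ta)"
 using smooth_model smooth_density_eq unfolding smooth_model_def dens_def by metis

lemma dens_continuous: "ta \<in> rs_sum \<T> ==> continuous_on A (dens x ta)"
 using is_dens[of ta x] smooth_continuous[of "dens x ta"] by (simp add: is_smooth_density_def)

lemma dens_eq: "ta \<in> rs_sum \<T> ==> ph \<in> test_funs ==> m_Pi Z x ta ph = dist_of (dens x ta) ph"
 using is_dens by (auto simp: is_smooth_density_def)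

lemma dens_unique:
 assumes "smooth g" "!!ph. ph \<in> test_funs ==> m_Pi Z x ta ph = dist_of g ph"
 shows "dens x ta = g"
 unfolding dens_def using assms by (intro smooth_density_eq) (auto simp: is_smooth_density_def)

text \<open>Uniqueness of densities turns the identity of distributions into one of point
  values.\<close>

lemma dens_Gam: "ta \<in> rs_sum \<T> ==> dens x (m_Gam Z x y ta) = dens y ta"
proof -
 assume ta: "ta \<in> rs_sum \<T>"
 show ?thesis
 proof (rule dens_unique)
  show "smooth (dens y ta)" using is_dens[OF ta] by (simp add: is_smooth_density_def)
  fix ph :: "real^'d => real" assume "ph \<in> test_funs"
  then show "m_Pi Z x (m_Gam Z x y ta) ph = dist_of (dens y ta) ph"
   using model ta dens_eq[OF ta] by (simp add: is_model_def)
 qed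
qed

lemma test_fun_integrable:
 "continuous_on UNIV g ==> ph \<in> test_funs ==> integrable lborel (%y. g y * ph y)"
proof -
 assume g: "continuous_on UNIV g" and ph: "ph \<in> test_funs"
 obtain K where "compact K" "supported_in ph K" using test_funs_supp[OF ph] by blast
 moreover have "continuous_on UNIV ph" using ph smooth_continuous by (auto simp: test_funs_def)
 ultimately show ?thesis using integrable_density_mult[OF locally_integrable_continuous[OF g]] by blast
qed

lemma dens_lin:
 assumes "si \<in> rs_sum \<T>" "ta \<in> rs_sum \<T>"
 shows "dens x (%al. a *\<^sub>R si al + b *\<^sub>R ta al) = (%y. a * dens x si y + b * dens x ta y)"
proof (rule dens_unique)
 show "smooth (%y. a * dens x si y + b * dens x ta y)"
  using is_dens[OF assms(1), of x] is_dens[OF assms(2), of x]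
  by (auto simp: is_smooth_density_def smooth_def intro!: C_class_add C_class_cmult)
 fix ph :: "real^'d => real" assume ph: "ph \<in> test_funs"
 have "m_Pi Z x (%al. a *\<^sub>R si al + b *\<^sub>R ta al) ph = a * m_Pi Z x si ph + b * m_Pi Z x ta ph"
  using model assms ph by (simp add: is_model_def)
 also have "... = (LI y. a * (dens x si y * ph y) + b * (dens x ta y * ph y))"
  using assms ph test_fun_integrable[OF dens_continuous] by (simp add: dens_eq dist_of_def)
 also have "... = dist_of (%y. a * dens x si y + b * dens x ta y) ph"
  by (simp add: dist_of_def algebra_simps)
 finally show "m_Pi Z x (%al. a *\<^sub>R si al + b *\<^sub>R ta al) ph = dist_of (%y. a * dens x si y + b * dens x ta y) ph" .
qed

lemma dens_diff:
 assumes "si \<in> rs_sum \<T>" "ta \<in> rs_sum \<T>"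
 shows "dens x (%al. si al - ta al) y = dens x si y - dens x ta y"
 using dens_lin[OF assms, of x 1 "-1"] by simp

lemma dens_decomp: "ta \<in> rs_below \<T> ga ==> dens x ta y = (\<Sum>ze\<in>H. dens x (homog ze (ta ze)) y)"
 by (rule additive_decomposition[where P = "%ta. dens x ta y"]) (simp_all add: dens_lin)

lemma homog_comp_in_sum: "ta \<in> rs_below \<T> ga ==> ze \<in> H ==> homog ze (ta ze) \<in> rs_sum \<T>"
 by (intro homog_in_sum comp_in_T rs_below_sum) (auto simp: hom_below_def)

lemma C_class_supp_rescale:
 assumes "ph \<in> B_tests s r" "0 < dl"
 shows "C_class r (rescale s ph dl x)" "supported_in (rescale s ph dl x) (sbox s x dl)" "compact (sbox s x dl)"
 using assms rescale_supp[OF s] compact_sbox[OF s] by (auto simp: B_tests_def intro!: C_class_rescale)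

lemma pairing_dens:
 assumes "ta \<in> rs_sum \<T>" "ph \<in> B_tests s r" "0 < dl"
 shows "pairing r (m_Pi Z x ta) (rescale s ph dl y) = dist_of (dens x ta) (rescale s ph dl y)"
 using assms dens_eq C_class_supp_rescale[OF assms(2,3)]
 by (intro pairing_density[of _ _ _ _ "sbox s y dl"] locally_integrable_continuous dens_continuous) auto

lemma dist_of_dens_homog_le:
 assumes "ze \<in> H" "b \<in> rs_T \<T> ze" "ph \<in> B_tests s r" "0 < dl" "dl < 1"
 shows "\<bar>dist_of (dens x (homog ze b)) (rescale s ph dl x)\<bar> <= nPi * norm b * dl powr ze"
proof (cases "b = 0")
 \<comment> \<open>Here the quotient in \<open>Pi_norm\<close> is a division by 0, which has the
   value 0 and carries no information; linearity is used instead.\<close>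
 case True
 have "homog ze b = (%al. 0)" using True by (simp add: homog_def fun_eq_iff)
 then have "dens x (homog ze b) = (%y. 0)" using dens_lin[OF rs_sum_zero rs_sum_zero, of x 0 0] by simp
 then show ?thesis using True by (simp add: dist_of_def)
next
 case False
 have m: "homog ze b \<in> rs_sum \<T>" using assms by (intro homog_in_sum) (auto simp: hom_below_def)
 have "ennreal (\<bar>pairing r (m_Pi Z x (homog ze b)) (rescale s ph dl x)\<bar> / (norm b * dl powr ze)) <= Pi_norm \<T> s r ga (m_Pi Z)"
  unfolding Pi_norm_def using assms
  by (intro SUP_upper2[of x] SUP_upper2[of ze] SUP_upper2[of b] SUP_upper2[of ph] SUP_upper2[of dl]) (auto simp: hom_below_def)
 then have "\<bar>dist_of (dens x (homog ze b)) (rescale s ph dl x)\<bar> / (norm b * dl powr ze) <= nPi"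
  unfolding Pi_norm_eq pairing_dens[OF m assms(3,4)] using nPi_nonneg by (simp add: ennreal_le_iff)
 then show ?thesis using False assms by (simp add: divide_le_eq mult.assoc)
qed

lemma dist_of_dens_decomp:
 assumes "ta \<in> rs_below \<T> ga" "continuous_on UNIV ph" "supported_in ph K" "compact K"
 shows "dist_of (dens x ta) ph = (\<Sum>ze\<in>H. dist_of (dens x (homog ze (ta ze))) ph)"
proof -
 have "dist_of (dens x ta) ph = (LI y. (\<Sum>ze\<in>H. dens x (homog ze (ta ze)) y * ph y))"
  unfolding dist_of_def dens_decomp[OF assms(1)] by (simp add: sum_distrib_right)
 also have "... = (\<Sum>ze\<in>H. LI y. dens x (homog ze (ta ze)) y * ph y)"
  using assms
  by (intro Bochner_Integration.integral_sum integrable_density_mult locally_integrable_continuous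
    dens_continuous homog_comp_in_sum)
 finally show ?thesis by (simp add: dist_of_def)
qed

lemma dist_of_dens_le:
 assumes "ta \<in> rs_below \<T> ga" "ph \<in> B_tests s r" "0 < dl" "dl < 1"
 shows "\<bar>dist_of (dens x ta) (rescale s ph dl x)\<bar> <= (\<Sum>ze\<in>H. nPi * norm (ta ze) * dl powr ze)"
proof -
 have "dist_of (dens x ta) (rescale s ph dl x) = (\<Sum>ze\<in>H. dist_of (dens x (homog ze (ta ze))) (rescale s ph dl x))"
  using C_class_supp_rescale[OF assms(2,3)] assms(1) by (intro dist_of_dens_decomp C_class_continuous)
 also have "\<bar>...\<bar> <= (\<Sum>ze\<in>H. nPi * norm (ta ze) * dl powr ze)"
  using assms
  by (intro order_trans[OF sum_abs] sum_mono dist_of_dens_homog_le comp_in_T rs_below_sum) (auto simp: hom_below_def)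
 finally show ?thesis .
qed

lemma Gam_below: "ta \<in> rs_below \<T> ga ==> m_Gam Z x y ta \<in> rs_below \<T> ga"
 by (rule G_below[OF Gam_G])

lemma Gam_Gam: "ta \<in> rs_sum \<T> ==> m_Gam Z x y (m_Gam Z y z ta) = m_Gam Z x z ta"
 using model by (simp add: is_model_def)

text \<open>The map is idempotent by the composition rule and injective as a member of the
  group.\<close>

lemma Gam_refl: "ta \<in> rs_sum \<T> ==> m_Gam Z x x ta = ta"
proof -
 assume ta: "ta \<in> rs_sum \<T>"
 have "inj_on (m_Gam Z x x) (rs_sum \<T>)" using G_bij[OF Gam_G] bij_betw_def by blast
 then show ?thesis using Gam_Gam[OF ta, of x x x] ta G_sum[OF Gam_G ta] by (auto dest: inj_onD)
qed

text \<open>One modulus of continuity for all entries of \<open>m_Gam\<close>: it adds up every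
  power occurring in \<open>Gam_norm\<close> for homogeneities below \<open>ga\<close>, and all
  exponents are positive.\<close>

definition modulus :: "real => real" where
 "modulus t = (\<Sum>ze\<in>H. \<Sum>be\<in>H \<inter> {..<ze}. t powr (ze - be))"

lemma modulus_nonneg: "0 <= modulus t"
 by (simp add: modulus_def sum_nonneg)

lemma modulus_tendsto: "(modulus \<longlongrightarrow> 0) (at 0 within {0..})"
proof -
 have "((%t. \<Sum>ze\<in>H. \<Sum>be\<in>H \<inter> {..<ze}. t powr (ze - be)) \<longlongrightarrow> (\<Sum>ze\<in>H. \<Sum>be\<in>H \<inter> {..<ze}. 0)) (at 0 within {0..})"
 proof (intro tendsto_sum)
  fix ze be assume "be \<in> H \<inter> {..<ze}"
  then have "((%t. t powr (ze - be)) \<longlongrightarrow> 0 powr (ze - be)) (at 0 within {0..})"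
   by (intro tendsto_powr' tendsto_intros) (auto simp: eventually_at_filter)
  then show "((%t. t powr (ze - be)) \<longlongrightarrow> 0) (at 0 within {0..})" by simp
 qed
 then show ?thesis by (simp add: modulus_def[abs_def])
qed

lemma modulus_snorm_tendsto: "((%z. modulus (snorm s (z - z0))) \<longlongrightarrow> 0) (at z0)"
proof (rule filterlim_compose[OF modulus_tendsto])
 have "continuous_on UNIV (%z. snorm s (z - z0))"
  by (intro continuous_on_compose2[OF continuous_snorm[OF s, of UNIV]] continuous_intros) auto
 then have "((%z. snorm s (z - z0)) \<longlongrightarrow> snorm s (z0 - z0)) (at z0)"
  unfolding continuous_on_def by (metis UNIV_I)
 moreover have "snorm s (0 :: real^'d) = 0" using snorm_eq_0_iff[OF s] by simp
 ultimately show "filterlim (%z. snorm s (z - z0)) (at 0 within {0..}) (at z0)"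
  using snorm_eq_0_iff[OF s]
  by (auto simp: filterlim_at eventually_at_filter)
qed

lemma Gam_comp_le:
 assumes ta: "ta \<in> rs_below \<T> ga" and xy: "snorm s (x - y) < 1"
 shows "norm (m_Gam Z x y ta be - ta be) <= nGam * modulus (snorm s (x - y)) * nrm ta"
proof (cases "be \<in> H")
 case True
 have "norm (m_Gam Z x y (homog ze (ta ze)) be) <= nGam * snorm s (x - y) powr (ze - be) * nrm ta"
  if ze: "ze \<in> H" "be < ze" for ze
 proof (cases "ta ze = 0 \<or> x = y")
  case False
  have b: "ta ze \<in> rs_T \<T> ze" using ta ze by (intro comp_in_T rs_below_sum) (auto simp: hom_below_def)
  have "ennreal (norm (m_Gam Z x y (homog ze (ta ze)) be) / (snorm s (x - y) powr (ze - be) * norm (ta ze))) <= Gam_norm \<T> s ga (m_Gam Z)"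
   unfolding Gam_norm_def
  proof (rule SUP_upper2[of "(x, y)"], use xy in simp, unfold prod.case, rule SUP_upper2[of ze])
   show "ennreal (norm (m_Gam Z x y (homog ze (ta ze)) be) / (snorm s (x - y) powr (ze - be) * norm (ta ze)))
    <= (SUP be\<in>rs_A \<T> \<inter> {..<ze}. SUP b\<in>rs_T \<T> ze.
       ennreal (norm (m_Gam Z x y (homog ze b) be) / (snorm s (x - y) powr (ze - be) * norm b)))"
    using ze True by (intro SUP_upper2[of be, OF _ SUP_upper[OF b]]) (auto simp: hom_below_def)
  qed (use ze in \<open>simp add: hom_below_def\<close>)
  then have "norm (m_Gam Z x y (homog ze (ta ze)) be) / (snorm s (x - y) powr (ze - be) * norm (ta ze)) <= nGam"
   unfolding Gam_norm_eq using nGam_nonneg by (simp add: ennreal_le_iff)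
  moreover have "0 < snorm s (x - y) powr (ze - be) * norm (ta ze)"
   using False snorm_eq_0_iff[OF s, of "x - y"] by simp
  ultimately have "norm (m_Gam Z x y (homog ze (ta ze)) be) <= nGam * (snorm s (x - y) powr (ze - be) * norm (ta ze))"
   by (simp add: divide_le_eq)
  also have "... <= nGam * (snorm s (x - y) powr (ze - be) * nrm ta)"
   by (intro mult_left_mono norm_comp_le_rs_norm ta nGam_nonneg) auto
  finally show ?thesis by (simp add: mult.assoc)
 next
  \<comment> \<open>In these degenerate cases the quotient in \<open>Gam_norm\<close> divides by 0;
    the entry itself vanishes.\<close>
  case True
  have h: "homog ze (ta ze) \<in> rs_sum \<T>" using homog_comp_in_sum[OF ta ze(1)] .
  have "m_Gam Z x y (homog ze (ta ze)) be = 0"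
  proof (cases "x = y")
   case True
   then show ?thesis using Gam_refl[OF h] ze by (simp add: homog_def)
  next
   case False
   then have eq0: "homog ze (ta ze) = (%al. 0)" using \<open>ta ze = 0 \<or> x = y\<close> by (simp add: homog_def fun_eq_iff)
   show ?thesis unfolding eq0 using G_lin[OF Gam_G rs_sum_zero rs_sum_zero, of x y 0 0] by (simp add: fun_eq_iff)
  qed
  then show ?thesis by (simp add: nGam_nonneg rs_norm_nonneg)
 qed
 then have "norm (m_Gam Z x y ta be - ta be) <= (\<Sum>ze\<in>H \<inter> {be<..}. nGam * snorm s (x - y) powr (ze - be) * nrm ta)"
  unfolding G_comp[OF Gam_G ta] by (intro order_trans[OF norm_sum] sum_mono) auto
 also have "... = (\<Sum>ze\<in>H \<inter> {be<..}. snorm s (x - y) powr (ze - be)) * (nGam * nrm ta)"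
  by (simp add: sum_distrib_right sum_distrib_left mult.commute mult.left_commute)
 also have "... <= modulus (snorm s (x - y)) * (nGam * nrm ta)"
 proof (rule mult_right_mono)
  have "(\<Sum>ze\<in>H \<inter> {be<..}. snorm s (x - y) powr (ze - be)) <=
    (\<Sum>ze\<in>H \<inter> {be<..}. \<Sum>be\<in>H \<inter> {..<ze}. snorm s (x - y) powr (ze - be))"
   using True by (intro sum_mono member_le_sum) auto
  also have "... <= modulus (snorm s (x - y))"
   unfolding modulus_def by (intro sum_mono2) (auto intro: sum_nonneg)
  finally show "(\<Sum>ze\<in>H \<inter> {be<..}. snorm s (x - y) powr (ze - be)) <= modulus (snorm s (x - y))" .
 qed (simp add: nGam_nonneg rs_norm_nonneg)
 finally show ?thesis by (simp add: mult.assoc mult.commute mult.left_commute)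
next
 case False
 then have "m_Gam Z x y ta be = 0" "ta be = 0" using rs_below_comp_zero[OF Gam_below[OF ta]] rs_below_comp_zero[OF ta] by auto
 then show ?thesis by (simp add: nGam_nonneg modulus_nonneg rs_norm_nonneg)
qed

lemma nrm_Gam_diff_le:
 assumes "ta \<in> rs_below \<T> ga" "snorm s (x - y) < 1"
 shows "nrm (%be. m_Gam Z x y ta be - ta be) <= real (card H) * (nGam * modulus (snorm s (x - y)) * nrm ta)"
 unfolding rs_norm_def[of _ _ "%be. m_Gam Z x y ta be - ta be"]
 using sum_bounded_above[of H, OF Gam_comp_le[OF assms]] by simp

lemma modulus_le: "0 <= t ==> t <= 1 ==> modulus t <= modulus 1"
 unfolding modulus_def by (intro sum_mono powr_mono2) auto

lemma nrm_Gam_le: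
 assumes "ta \<in> rs_below \<T> ga" "snorm s (x - y) < 1"
 shows "nrm (m_Gam Z x y ta) <= (1 + real (card H) * nGam * modulus 1) * nrm ta"
proof -
 have "nrm (m_Gam Z x y ta) <= nrm (%be. m_Gam Z x y ta be - ta be) + nrm ta"
  using rs_norm_triangle[of ga "%be. m_Gam Z x y ta be - ta be" ta] by simp
 also have "nrm (%be. m_Gam Z x y ta be - ta be) <= real (card H) * (nGam * modulus (snorm s (x - y)) * nrm ta)"
  by (rule nrm_Gam_diff_le[OF assms])
 also have "... <= real (card H) * (nGam * modulus 1 * nrm ta)"
  using assms by (intro mult_left_mono mult_right_mono modulus_le) (auto simp: nGam_nonneg rs_norm_nonneg)
 finally show ?thesis by (simp add: algebra_simps)
qed

text \<open>Pairings of the density with bumps of size \<open>dl n\<close> at \<open>y\<close> are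
  bounded linear functionals of the vector. For each fixed vector they are bounded uniformly in
  \<open>y\<close> and \<open>n\<close>, the density being bounded near \<open>K\<close>. Uniform
  boundedness makes the constant independent of the vector, and \<open>n\<close> to infinity
  recovers the point values.\<close>

lemma dens_homog_bound:
 assumes ze: "ze \<in> H" and K: "compact K"
 shows "\<exists>C\<ge>0. \<forall>y\<in>K. \<forall>b\<in>rs_T \<T> ze. \<bar>dens x (homog ze b) y\<bar> <= C * norm b"
proof -
 have zeA: "ze \<in> rs_A \<T>" using ze by (simp add: hom_below_def)
 let ?T = "rs_T \<T> ze"
 define dl where "dl n = inverse (real (Suc n))" for n
 have dl: "0 < dl n" "dl n <= 1" for n by (auto simp: dl_def inverse_le_1_iff)
 define L where "L = (%(y, n) b. dist_of (dens x (homog ze b)) (rescale s bump (dl n) y))"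
 have hs: "b \<in> ?T ==> homog ze b \<in> rs_sum \<T>" for b using homog_in_sum[OF zeA] .
 have L_eq: "L (y, n) b = m_Pi Z x (homog ze b) (rescale s bump (dl n) y)" if "b \<in> ?T" for y n b
  using dens_eq[OF hs[OF that] rescale_test_fun[OF s dl(1)]] by (simp add: L_def)
 have ub: "\<exists>C\<ge>0. \<forall>i\<in>K \<times> UNIV. \<forall>b\<in>?T. \<bar>L i b\<bar> <= C * norm b"
 proof (rule uniform_boundedness)
  show "subspace ?T" "closed ?T" using zeA subspace_T closed_T by auto
 next
  fix i a c b b' assume *: "i \<in> K \<times> (UNIV :: nat set)" "b \<in> ?T" "b' \<in> ?T"
  obtain y n where i: "i = (y, n)" by fastforce
  have sub: "a *\<^sub>R b + c *\<^sub>R b' \<in> ?T" using * subspace_T[OF zeA] by (intro subspace_add subspace_scale)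
  have "homog ze (a *\<^sub>R b + c *\<^sub>R b') = (%al. a *\<^sub>R homog ze b al + c *\<^sub>R homog ze b' al)"
   by (auto simp: homog_def)
  then show "L i (a *\<^sub>R b + c *\<^sub>R b') = a * L i b + c * L i b'"
   using model * hs rescale_test_fun[OF s dl(1)] unfolding i L_eq[OF *(2)] L_eq[OF *(3)] L_eq[OF sub]
   by (simp add: is_model_def)
 next
  fix i assume "i \<in> K \<times> (UNIV :: nat set)"
  obtain y n where i: "i = (y, n)" by fastforce
  obtain C where "!!b. b \<in> ?T ==> \<bar>m_Pi Z x (homog ze b) (rescale s bump (dl n) y)\<bar> <= C * norm b"
   using model zeA rescale_test_fun[OF s dl(1)] unfolding is_model_def by meson
  then show "\<exists>C. \<forall>b\<in>?T. \<bar>L i b\<bar> <= C * norm b" unfolding i using L_eq by auto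
 next
  fix b assume b: "b \<in> ?T"
  let ?K = "(%z. fst z + snd z) ` (K \<times> sbox s 0 1)"
  have cK: "compact ?K"
   using K compact_sbox[OF s] by (intro compact_continuous_image compact_Times continuous_intros) auto
  have "compact (dens x (homog ze b) ` ?K)"
   using dens_continuous[OF hs[OF b]] cK by (rule compact_continuous_image)
  then obtain c where c: "!!y. y \<in> ?K ==> \<bar>dens x (homog ze b) y\<bar> <= c"
   using compact_imp_bounded by (force simp: bounded_iff)
  \<comment> \<open>A bound \<open>c\<close> for the value at \<open>y\<close>, and 2
    \<open>c\<close> for the oscillation around it.\<close>
  have "\<bar>L i b\<bar> <= 3 * \<bar>c\<bar>" if i: "i \<in> K \<times> UNIV" for i
  proof -
   obtain y n where yn: "i = (y, n)" "y \<in> K" using i by auto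
   have in_K: "z \<in> ?K" if "z \<in> sbox s y (dl n)" for z
    using that yn dl(2)[of n] by (intro image_eqI[of _ _ "(y, z - y)"]) (auto simp: sbox_def)
   have "0 \<in> sbox s (0 :: real^'d) 1" using snorm_eq_0_iff[OF s, of 0] by (simp add: sbox_def)
   then have yK: "y \<in> ?K" using yn by (intro image_eqI[of _ _ "(y, 0)"]) auto
   have "\<bar>L i b - dens x (homog ze b) y\<bar> <= 2 * \<bar>c\<bar>"
    unfolding yn(1) L_def prod.case using c[OF in_K] c[OF yK] dl(1) dens_continuous[OF hs[OF b]]
    by (intro dist_of_approx_value[OF s]) (auto, smt (verit))
   then show ?thesis using c[OF yK] by linarith
  qed
  then show "\<exists>C. \<forall>i\<in>K \<times> (UNIV :: nat set). \<bar>L i b\<bar> <= C" by blast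
 qed
 then obtain C where C: "C \<ge> 0" "!!y n b. y \<in> K ==> b \<in> ?T ==> \<bar>L (y, n) b\<bar> <= C * norm b" by force
 have "\<bar>dens x (homog ze b) y\<bar> <= C * norm b" if "y \<in> K" "b \<in> ?T" for y b
 proof (rule LIMSEQ_le_const2)
  have "filterlim dl (at_right 0) sequentially"
   unfolding filterlim_at using dl(1) LIMSEQ_inverse_real_of_nat by (auto simp: dl_def[abs_def])
  from filterlim_compose[OF dist_of_rescale_tendsto[OF s dens_continuous[OF hs[OF that(2)]]] this]
  show "(%n. \<bar>L (y, n) b\<bar>) \<longlonglongrightarrow> \<bar>dens x (homog ze b) y\<bar>"
   by (auto simp: L_def intro!: tendsto_rabs)
 qed (use C(2)[OF that] in auto)
 with C(1) show ?thesis by blast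
qed

lemma dens_bound_fixed_base:
 assumes K: "compact K"
 shows "\<exists>C\<ge>0. \<forall>y\<in>K. \<forall>ta\<in>rs_below \<T> ga. \<bar>dens x ta y\<bar> <= C * nrm ta"
proof -
 obtain C where C: "!!ze. ze \<in> H ==> C ze \<ge> 0"
  "!!ze y b. ze \<in> H ==> y \<in> K ==> b \<in> rs_T \<T> ze ==> \<bar>dens x (homog ze b) y\<bar> <= C ze * norm b"
  using dens_homog_bound[OF _ K, of _ x] by metis
 have "\<bar>dens x ta y\<bar> <= (\<Sum>ze\<in>H. C ze) * nrm ta" if "y \<in> K" "ta \<in> rs_below \<T> ga" for y ta
 proof -
  have "\<bar>dens x ta y\<bar> <= (\<Sum>ze\<in>H. \<bar>dens x (homog ze (ta ze)) y\<bar>)"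
   unfolding dens_decomp[OF that(2)] by (rule sum_abs)
  also have "... <= (\<Sum>ze\<in>H. C ze * nrm ta)"
  proof (rule sum_mono)
   fix ze assume ze: "ze \<in> H"
   have "\<bar>dens x (homog ze (ta ze)) y\<bar> <= C ze * norm (ta ze)"
    using C(2)[OF ze that(1)] comp_in_T[OF rs_below_sum[OF that(2)]] ze by (simp add: hom_below_def)
   also have "... <= C ze * nrm ta" using C(1)[OF ze] norm_comp_le_rs_norm[OF that(2)] by (rule mult_left_mono[rotated])
   finally show "\<bar>dens x (homog ze (ta ze)) y\<bar> <= C ze * nrm ta" .
  qed
  finally show ?thesis by (simp add: sum_distrib_right)
 qed
 moreover have "0 <= (\<Sum>ze\<in>H. C ze)" using C(1) by (intro sum_nonneg)
 ultimately show ?thesis by blast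
qed

text \<open>Finitely many open unit balls of \<open>snorm\<close> cover \<open>K\<close>. Within
  each one \<open>m_Gam\<close> moves the base point to the centre at a bounded cost.\<close>

lemma dens_bound:
 assumes K: "compact K"
 shows "\<exists>C\<ge>0. \<forall>z\<in>K. \<forall>y\<in>K. \<forall>ta\<in>rs_below \<T> ga. \<bar>dens z ta y\<bar> <= C * nrm ta"
proof -
 obtain C where C: "!!x. C x \<ge> 0" "!!x y ta. y \<in> K ==> ta \<in> rs_below \<T> ga ==> \<bar>dens x ta y\<bar> <= C x * nrm ta"
  using dens_bound_fixed_base[OF K] by metis
 define U where "U x = {z. snorm s (x - z) < 1}" for x :: "real ^ 'd"
 have "open (U x)" for x
  unfolding U_def by (intro open_Collect_less continuous_on_compose2[OF continuous_snorm[OF s, of UNIV]] continuous_intros) auto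
 moreover have "K \<subseteq> (\<Union>x\<in>K. U x)" using snorm_eq_0_iff[OF s, of 0] by (auto simp: U_def)
 ultimately obtain F where F: "F \<subseteq> K" "finite F" "K \<subseteq> (\<Union>x\<in>F. U x)"
  using compactE_image[OF K, of K U] by metis
 let ?g = "1 + real (card H) * nGam * modulus 1"
 have g: "0 <= ?g" using nGam_nonneg modulus_nonneg[of 1] by simp
 have "\<bar>dens z ta y\<bar> <= (\<Sum>x\<in>F. C x) * ?g * nrm ta" if zy: "z \<in> K" "y \<in> K" "ta \<in> rs_below \<T> ga" for z y ta
 proof -
  obtain x where x: "x \<in> F" "snorm s (x - z) < 1" using F(3) zy(1) by (auto simp: U_def)
  have "dens z ta y = dens x (m_Gam Z x z ta) y" using dens_Gam[OF rs_below_sum[OF zy(3)]] by simp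
  also have "\<bar>...\<bar> <= C x * nrm (m_Gam Z x z ta)" using zy by (intro C(2) Gam_below)
  also have "... <= (\<Sum>x\<in>F. C x) * (?g * nrm ta)"
   using x F(2) C(1) g zy by (intro mult_mono nrm_Gam_le member_le_sum sum_nonneg) (auto simp: rs_norm_nonneg)
  finally show ?thesis by (simp add: mult.assoc)
 qed
 moreover have "0 <= (\<Sum>x\<in>F. C x) * ?g" using C(1) g by (intro mult_nonneg_nonneg sum_nonneg)
 ultimately show ?thesis by blast
qed

end

section \<open>Measurability\<close>

text \<open>The Banach space may be non-separable. Measurability is therefore transported through
 approximations by functions that depend continuously on the point and on a countable index.\<close>

lemma strongly_measurable_approx:
 fixes g :: "real ^ 'd::finite => 'b::banach"
 assumes "strongly_measurable g"
 shows "\<exists>(d :: nat => 'b) (k :: nat => real ^ 'd => nat). range d \<subseteq> range g \<and>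
  (\<forall>m. k m \<in> measurable borel (count_space UNIV)) \<and> (\<forall>x. (%m. d (k m x)) \<longlonglongrightarrow> g x)"
proof -
 obtain S where S: "!!n. simple_function borel (S n)" "!!x. (%n. S n x) \<longlonglongrightarrow> g x"
  using assms by (auto simp: strongly_measurable_def)
 define C where "C = (\<Union>n. range (S n))"
 have "finite (range (S n))" for n using S(1)[of n] by (simp add: simple_function_def)
 then have C: "countable C" unfolding C_def by (intro countable_UN) (auto intro: countable_finite)
 \<comment> \<open>Values of the simple functions may lie outside the range of \<open>g\<close>.
   Each is replaced by a point of the range nearby, so that for components of \<open>f\<close> the
   approximants stay in the right subspace \<open>rs_T\<close>.\<close>
 define P where "P n c b \<longleftrightarrow> b \<in> range g \<and> dist b c < inverse (real (Suc n))" for n c b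
 define e where "e = (%(n, c). if \<exists>b. P n c b then SOME b. P n c b else g 0)"
 have e: "P n c (e (n, c))" if "\<exists>b. P n c b" for n c
  unfolding e_def using that someI_ex[of "P n c"] by auto
 have eg: "e nc \<in> range g" for nc
  using e[of "fst nc" "snd nc"] by (cases nc) (auto simp: e_def P_def)
 define D where "D = e ` (UNIV \<times> C)"
 have D: "countable D" "D ~= {}" "D \<subseteq> range g"
  using C eg by (auto simp: D_def C_def intro!: countable_image countable_SIGMA)
 have dense: "\<exists>b\<in>D. norm (g x - b) < ep" if ep: "0 < ep" for x ep
 proof -
  obtain n where n: "inverse (real (Suc n)) < ep / 2" using reals_Archimedean[of "ep / 2"] ep by auto
  have "eventually (%N. dist (S N x) (g x) < inverse (real (Suc n))) sequentially"
   using S(2)[of x] by (rule tendstoD) simp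
  then obtain N where N: "dist (S N x) (g x) < inverse (real (Suc n))" by (auto simp: eventually_sequentially)
  then have "P n (S N x) (g x)" by (simp add: P_def dist_commute)
  then have "P n (S N x) (e (n, S N x))" using e by blast
  then have "dist (g x) (e (n, S N x)) < ep"
   using N n dist_triangle[of "g x" "e (n, S N x)" "S N x"] by (simp add: P_def dist_commute)
  moreover have "e (n, S N x) \<in> D" by (auto simp: D_def C_def)
  ultimately show ?thesis by (auto simp: dist_norm)
 qed
 define d where "d = from_nat_into D"
 have rd: "range d = D" unfolding d_def using D by (intro range_from_nat_into)
 \<comment> \<open>Taking the first index within the tolerance makes the choice measurable.\<close>
 define k where "k m x = (LEAST j. norm (g x - d j) < inverse (real (Suc m)))" for m x
 have k: "norm (g x - d (k m x)) < inverse (real (Suc m))" for m x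
 proof -
  obtain b where "b \<in> D" "norm (g x - b) < inverse (real (Suc m))" using dense[of "inverse (real (Suc m))" x] by auto
  then have "\<exists>j. norm (g x - d j) < inverse (real (Suc m))" using rd by blast
  then show ?thesis unfolding k_def by (rule LeastI_ex)
 qed
 have [measurable]: "(%x. norm (g x - d j)) \<in> borel_measurable borel" for j
 proof (rule borel_measurable_LIMSEQ_real)
  show "(%n. norm (S n x - d j)) \<longlonglongrightarrow> norm (g x - d j)" for x
   by (intro tendsto_intros S)
  show "(%x. norm (S n x - d j)) \<in> borel_measurable borel" for n
   using simple_function_compose1[OF S(1)[of n], of "%b. norm (b - d j)"] by (rule borel_measurable_simple_function)
 qed
 have "k m \<in> measurable borel (count_space UNIV)" for m
  unfolding k_def[abs_def] by measurable
 moreover have "(%m. d (k m x)) \<longlonglongrightarrow> g x" for x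
 proof -
  have "(%m. norm (d (k m x) - g x)) \<longlonglongrightarrow> 0"
  proof (rule tendsto_sandwich[OF _ _ tendsto_const LIMSEQ_inverse_real_of_nat])
   show "eventually (%m. norm (d (k m x) - g x) <= inverse (real (Suc m))) sequentially"
    using k[of x] by (intro always_eventually) (simp add: norm_minus_commute less_imp_le)
  qed simp
  then show ?thesis by (simp add: tendsto_norm_zero_iff LIM_zero_iff)
 qed
 ultimately show ?thesis using rd D(3) by blast
qed

definition piecewise_cont ::
 "('x::topological_space) set => ('x => 'b::topological_space) => bool" where
 "piecewise_cont U J \<longleftrightarrow> (\<exists>(k :: 'x => nat) c. k \<in> measurable borel (count_space UNIV) \<and>
   (\<forall>i. continuous_on U (c i)) \<and> (\<forall>p\<in>U. J p = c (k p) p))"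

definition limit_piecewise_cont ::
 "('x::topological_space) set => ('x => 'b::topological_space) => bool" where
 "limit_piecewise_cont U J \<longleftrightarrow> (\<exists>Jm. (\<forall>m::nat. piecewise_cont U (Jm m)) \<and> (\<forall>p\<in>U. (%m. Jm m p) \<longlonglongrightarrow> J p))"

text \<open>A pair of indices is coded as one number. This yields closure under differences, which
  is not automatic for Borel measurability in a non-separable space.\<close>

lemma piecewise_contI2:
 fixes k1 k2 :: "'x::topological_space => nat"
 assumes k: "k1 \<in> measurable borel (count_space UNIV)" "k2 \<in> measurable borel (count_space UNIV)"
  and c: "!!i j. continuous_on U (c i j)" and J: "!!p. p \<in> U ==> J p = c (k1 p) (k2 p) p"
 shows "piecewise_cont U J"
proof -
 have "(%p. prod_encode (k1 p, k2 p)) \<in> measurable borel (count_space UNIV)"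
  using k by measurable
 then show ?thesis unfolding piecewise_cont_def
  by (intro exI[of _ "%p. prod_encode (k1 p, k2 p)"] exI[of _ "%n. c (fst (prod_decode n)) (snd (prod_decode n))"])
   (auto simp: c J)
qed

lemma piecewise_cont_diff:
 fixes J J' :: "'x::topological_space => 'b::real_normed_vector"
 assumes "piecewise_cont U J" "piecewise_cont U J'"
 shows "piecewise_cont U (%p. J p - J' p)"
proof -
 obtain k c where 1: "k \<in> measurable borel (count_space UNIV)" "!!i::nat. continuous_on U (c i)" "!!p. p \<in> U ==> J p = c (k p) p"
  using assms(1) unfolding piecewise_cont_def by blast
 obtain k' c' where 2: "k' \<in> measurable borel (count_space UNIV)" "!!i::nat. continuous_on U (c' i)" "!!p. p \<in> U ==> J' p = c' (k' p) p"
  using assms(2) unfolding piecewise_cont_def by blast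
 show ?thesis
  by (rule piecewise_contI2[OF 1(1) 2(1), of U "%i j p. c i p - c' j p"]) (auto simp: 1 2 intro: continuous_on_diff)
qed

lemma limit_piecewise_cont_diff:
 fixes J J' :: "'x::topological_space => 'b::real_normed_vector"
 assumes "limit_piecewise_cont U J" "limit_piecewise_cont U J'"
 shows "limit_piecewise_cont U (%p. J p - J' p)"
proof -
 obtain A where A: "!!m::nat. piecewise_cont U (A m)" "!!p. p \<in> U ==> (%m. A m p) \<longlonglongrightarrow> J p"
  using assms(1) unfolding limit_piecewise_cont_def by blast
 obtain B where B: "!!m::nat. piecewise_cont U (B m)" "!!p. p \<in> U ==> (%m. B m p) \<longlonglongrightarrow> J' p"
  using assms(2) unfolding limit_piecewise_cont_def by blast
 show ?thesis unfolding limit_piecewise_cont_def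
  using A B by (intro exI[of _ "%m p. A m p - B m p"]) (auto intro: piecewise_cont_diff tendsto_diff)
qed

lemma piecewise_cont_measurable:
 fixes J :: "'x::topological_space => real"
 assumes "piecewise_cont U J" "open U"
 shows "(%p. indicator U p * J p) \<in> borel_measurable borel"
proof -
 obtain k c where 1: "k \<in> measurable borel (count_space UNIV)" "!!i::nat. continuous_on U (c i)" "!!p. p \<in> U ==> J p = c (k p) p"
  using assms(1) unfolding piecewise_cont_def by blast
 have "(%p. indicator U p * c (k p) p) \<in> borel_measurable borel"
 proof (rule measurable_compose_countable'[OF _ 1(1), of "%i p. indicator U p * c i p"])
  show "(%p. indicator U p * c i p) \<in> borel_measurable borel" for i
   using borel_measurable_continuous_on_indicator[OF _ 1(2)[of i]] assms(2) by simp
 qed auto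
 also have "(%p. indicator U p * c (k p) p) = (%p. indicator U p * J p)"
  using 1(3) by (auto simp: indicator_def)
 finally show ?thesis .
qed

lemma piecewise_cont_norm: "piecewise_cont U J ==> piecewise_cont U (%p. norm (J p :: 'b::real_normed_vector))"
proof -
 assume "piecewise_cont U J"
 then obtain k c where "k \<in> measurable borel (count_space UNIV)" "!!i::nat. continuous_on U (c i)" "!!p. p \<in> U ==> J p = c (k p) p"
  unfolding piecewise_cont_def by blast
 then show ?thesis unfolding piecewise_cont_def
  by (intro exI[of _ k] exI[of _ "%i p. norm (c i p)"]) (auto intro: continuous_on_norm)
qed

lemma limit_piecewise_cont_norm_measurable:
 fixes J :: "'x::topological_space => 'b::real_normed_vector"
 assumes "limit_piecewise_cont U J" "open U"
 shows "(%p. indicator U p * norm (J p)) \<in> borel_measurable borel"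
proof -
 obtain A where A: "!!m::nat. piecewise_cont U (A m)" "!!p. p \<in> U ==> (%m. A m p) \<longlonglongrightarrow> J p"
  using assms(1) unfolding limit_piecewise_cont_def by blast
 show ?thesis
 proof (rule borel_measurable_LIMSEQ_real)
  show "(%m. indicator U p * norm (A m p)) \<longlonglongrightarrow> indicator U p * norm (J p)" for p
   using A(2)[of p] by (cases "p \<in> U") (auto intro: tendsto_norm)
  show "(%p. indicator U p * norm (A m p)) \<in> borel_measurable borel" for m
   by (intro piecewise_cont_measurable piecewise_cont_norm A assms)
 qed
qed

context smooth_model_scaled
begin

lemma modulus_snorm_tendsto':
 assumes "(g \<longlongrightarrow> z0) F"
 shows "((%p. modulus (snorm s (g p - z0))) \<longlongrightarrow> 0) F"
proof -
 have "isCont (%z. modulus (snorm s (z - z0))) z0"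
  using modulus_snorm_tendsto[of z0] by (simp add: isCont_def modulus_def snorm_eq_0_iff[OF s, THEN iffD2])
 from isCont_tendsto_compose[OF this assms] show ?thesis
  by (simp add: modulus_def snorm_eq_0_iff[OF s, THEN iffD2])
qed

text \<open>The composition rule gives Gamma(y,x) = Gamma(y,y0) Gamma(y0,x0) Gamma(x0,x). The outer
  factors are close to the identity by \<open>Gam_comp_le\<close>, and the middle one is a fixed
  bounded map.\<close>

lemma Gam_continuous:
 assumes ta: "ta \<in> rs_below \<T> ga"
 shows "continuous_on {p. snorm s (fst p - snd p) < 1} (%p. m_Gam Z (fst p) (snd p) ta ze)"
proof (rule continuous_at_imp_continuous_on, rule ballI)
 fix p0 :: "(real^'d) \<times> (real^'d)" assume "p0 \<in> {p. snorm s (fst p - snd p) < 1}"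
 then have p0: "snorm s (fst p0 - snd p0) < 1" by simp
 let ?y0 = "fst p0" and ?x0 = "snd p0"
 let ?c = "real (card H)"
 let ?g = "1 + ?c * nGam * modulus 1"
 define si where "si = m_Gam Z ?y0 ?x0 ta"
 define a where "a p = ?c * (nGam * modulus (snorm s (snd p - ?x0)) * nrm ta)" for p :: "(real^'d) \<times> (real^'d)"
 define b where "b p = nGam * modulus (snorm s (fst p - ?y0)) * (nrm si + ?g * a p) + ?g * a p" for p
 have fs: "(fst \<longlongrightarrow> ?y0) (at p0)" "(snd \<longlongrightarrow> ?x0) (at p0)"
  by (auto intro: tendsto_fst tendsto_snd tendsto_ident_at)
 have a0: "(a \<longlongrightarrow> 0) (at p0)"
  unfolding a_def using modulus_snorm_tendsto'[OF fs(2)]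
  by (auto intro!: tendsto_mult_right_zero tendsto_mult_left_zero)
 have b0: "(b \<longlongrightarrow> 0) (at p0)"
 proof -
  have "(b \<longlongrightarrow> nGam * 0 * (nrm si + ?g * 0) + ?g * 0) (at p0)"
   unfolding b_def by (intro tendsto_intros a0 modulus_snorm_tendsto' fs)
  then show ?thesis by simp
 qed
 have ev: "eventually (%p. snorm s (g p - z0) < 1) (at p0)" if "(g \<longlongrightarrow> z0) (at p0)" for g :: "(real^'d) \<times> (real^'d) => real^'d" and z0
 proof -
  have "isCont (snorm s) 0" using continuous_snorm[OF s, of UNIV] by (simp add: continuous_on_eq_continuous_at)
  moreover have "((%p. g p - z0) \<longlongrightarrow> 0) (at p0)" using that by (rule LIM_zero)
  ultimately have "((%p. snorm s (g p - z0)) \<longlongrightarrow> snorm s 0) (at p0)" by (rule isCont_tendsto_compose)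
  then show ?thesis using snorm_eq_0_iff[OF s, of 0] by (auto intro: order_tendstoD)
 qed
 have "eventually (%p. norm (m_Gam Z (fst p) (snd p) ta ze - si ze) <= b p) (at p0)"
  using ev[OF fs(1)] ev[OF fs(2)]
 proof eventually_elim
  case (elim p)
  define ta1 where "ta1 = (%be. m_Gam Z ?x0 (snd p) ta be - ta be)"
  have ta1: "ta1 \<in> rs_below \<T> ga" unfolding ta1_def by (intro rs_below_diff Gam_below ta)
  have n1: "nrm ta1 <= a p"
   using nrm_Gam_diff_le[OF ta, of ?x0 "snd p"] elim(2) by (simp add: ta1_def a_def snorm_diff_commute)
  define si1 where "si1 = m_Gam Z ?y0 ?x0 ta1"
  have si1: "si1 \<in> rs_below \<T> ga" unfolding si1_def by (intro Gam_below ta1)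
  have g0: "0 <= ?g" using nGam_nonneg modulus_nonneg[of 1] by simp
  have n2: "nrm si1 <= ?g * a p"
   unfolding si1_def using nrm_Gam_le[OF ta1 p0] mult_left_mono[OF n1 g0] by linarith
  have si: "si \<in> rs_below \<T> ga" unfolding si_def by (intro Gam_below ta)
  define w where "w = (%be. si be + si1 be)"
  have w: "w \<in> rs_below \<T> ga" unfolding w_def using rs_below_lin[OF si si1, of 1 1] by simp
  have wG: "w = m_Gam Z ?y0 (snd p) ta"
  proof -
   have "m_Gam Z ?y0 (snd p) ta = m_Gam Z ?y0 ?x0 (m_Gam Z ?x0 (snd p) ta)"
    using Gam_Gam[OF rs_below_sum[OF ta]] by simp
   also have "m_Gam Z ?x0 (snd p) ta = (%be. 1 *\<^sub>R ta be + 1 *\<^sub>R ta1 be)" by (simp add: ta1_def)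
   also have "m_Gam Z ?y0 ?x0 ... = (%be. 1 *\<^sub>R si be + 1 *\<^sub>R si1 be)"
    unfolding si_def si1_def by (rule G_lin[OF Gam_G rs_below_sum[OF ta] rs_below_sum[OF ta1]])
   finally show ?thesis by (simp add: w_def)
  qed
  have "m_Gam Z (fst p) (snd p) ta = m_Gam Z (fst p) ?y0 w"
   unfolding wG using Gam_Gam[OF rs_below_sum[OF ta]] by simp
  then have "norm (m_Gam Z (fst p) (snd p) ta ze - si ze) <= norm (m_Gam Z (fst p) ?y0 w ze - w ze) + norm (si1 ze)"
   using norm_triangle_ineq[of "m_Gam Z (fst p) ?y0 w ze - w ze" "si1 ze"] by (simp add: w_def)
  also have "... <= nGam * modulus (snorm s (fst p - ?y0)) * nrm w + nrm si1"
   using elim by (intro add_mono Gam_comp_le w norm_comp_le_rs_norm si1)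
  also have "... <= nGam * modulus (snorm s (fst p - ?y0)) * (nrm si + ?g * a p) + ?g * a p"
  proof (intro add_mono mult_left_mono n2)
   show "nrm w <= nrm si + ?g * a p" using rs_norm_triangle[of ga si si1] n2 by (simp add: w_def)
  qed (simp add: nGam_nonneg modulus_nonneg)
  finally show ?case by (simp add: b_def)
 qed
 then have "((%p. m_Gam Z (fst p) (snd p) ta ze - si ze) \<longlongrightarrow> 0) (at p0)"
  by (rule Lim_null_comparison[OF _ b0])
 then show "isCont (%p. m_Gam Z (fst p) (snd p) ta ze) p0"
  by (simp add: isCont_def LIM_zero_iff si_def)
qed

text \<open>Moving the base point to \<open>?z0\<close> leaves the density of
  \<open>m_Gam Z ?z0 (fst p) ta - ta\<close>, which is small uniformly for arguments near
  \<open>?y0\<close>. At the fixed base point the density is continuous.\<close>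

lemma dens_joint_continuous:
 assumes ta: "ta \<in> rs_below \<T> ga"
 shows "continuous_on UNIV (%p. dens (fst p) ta (snd p))"
proof (rule continuous_at_imp_continuous_on, rule ballI)
 fix p0 :: "(real^'d) \<times> (real^'d)"
 let ?z0 = "fst p0" and ?y0 = "snd p0"
 have fs: "(fst \<longlongrightarrow> ?z0) (at p0)" "(snd \<longlongrightarrow> ?y0) (at p0)"
  by (auto intro: tendsto_fst tendsto_snd tendsto_ident_at)
 obtain C where C: "!!y si. y \<in> cball ?y0 1 ==> si \<in> rs_below \<T> ga ==> \<bar>dens ?z0 si y\<bar> <= C * nrm si" "C \<ge> 0"
  using dens_bound_fixed_base[OF compact_cball, of ?y0 1 ?z0] by blast
 define a where "a p = C * (real (card H) * (nGam * modulus (snorm s (fst p - ?z0)) * nrm ta))" for p :: "(real^'d) \<times> (real^'d)"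
 have a0: "(a \<longlongrightarrow> 0) (at p0)"
  unfolding a_def using modulus_snorm_tendsto'[OF fs(1)]
  by (auto intro!: tendsto_mult_right_zero tendsto_mult_left_zero)
 have ev1: "eventually (%p. snorm s (fst p - ?z0) < 1) (at p0)"
 proof -
  have "isCont (snorm s) 0" using continuous_snorm[OF s, of UNIV] by (simp add: continuous_on_eq_continuous_at)
  moreover have "((%p. fst p - ?z0) \<longlongrightarrow> 0) (at p0)" using fs(1) by (rule LIM_zero)
  ultimately have "((%p. snorm s (fst p - ?z0)) \<longlongrightarrow> snorm s 0) (at p0)" by (rule isCont_tendsto_compose)
  then show ?thesis using snorm_eq_0_iff[OF s, of 0] by (auto intro: order_tendstoD)
 qed
 have ev2: "eventually (%p. snd p \<in> cball ?y0 1) (at p0)"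
  using tendstoD[OF fs(2), of 1] by (auto elim!: eventually_mono simp: dist_commute)
 have "eventually (%p. norm (dens (fst p) ta (snd p) - dens ?z0 ta (snd p)) <= a p) (at p0)"
  using ev1 ev2
 proof eventually_elim
  case (elim p)
  have "dens (fst p) ta (snd p) - dens ?z0 ta (snd p) = dens ?z0 (%be. m_Gam Z ?z0 (fst p) ta be - ta be) (snd p)"
   using dens_diff[OF rs_below_sum[OF Gam_below[OF ta]] rs_below_sum[OF ta]] dens_Gam[OF rs_below_sum[OF ta]] by simp
  also have "\<bar>...\<bar> <= C * nrm (%be. m_Gam Z ?z0 (fst p) ta be - ta be)"
   using elim by (intro C rs_below_diff Gam_below ta)
  also have "... <= a p"
   unfolding a_def using nrm_Gam_diff_le[OF ta, of ?z0 "fst p"] elim C(2)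
   by (intro mult_left_mono) (auto simp: snorm_diff_commute)
  finally show ?case by simp
 qed
 then have "((%p. dens (fst p) ta (snd p) - dens ?z0 ta (snd p)) \<longlongrightarrow> 0) (at p0)"
  by (rule Lim_null_comparison[OF _ a0])
 moreover have "((%p. dens ?z0 ta (snd p)) \<longlongrightarrow> dens ?z0 ta ?y0) (at p0)"
 proof (rule isCont_tendsto_compose[OF _ fs(2)])
  show "isCont (dens ?z0 ta) ?y0"
   using dens_continuous[OF rs_below_sum[OF ta], of UNIV ?z0] by (simp add: continuous_on_eq_continuous_at)
 qed
 ultimately have "((%p. (dens (fst p) ta (snd p) - dens ?z0 ta (snd p)) + dens ?z0 ta (snd p)) \<longlongrightarrow> 0 + dens ?z0 ta ?y0) (at p0)"
  by (rule tendsto_add)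
 then show "isCont (%p. dens (fst p) ta (snd p)) p0" by (simp add: isCont_def)
qed

end

section \<open>The multiscale kernel\<close>

lemma scale_measure01_AE: "(!!dl. 0 < dl ==> dl < 1 ==> P dl) ==> AE dl in scale_measure01. P dl"
 unfolding scale_measure01_def by (subst AE_density) (auto intro!: AE_I2 simp: indicator_def split: if_splits)

lemma Lp_norm_scale_mono:
 "(!!dl. 0 < dl ==> dl < 1 ==> g dl <= h dl) ==> Ls q g <= Ls q h"
 by (intro Lp_norm_mono_AE scale_measure01_AE)

lemma nn_integral_scale_measure01:
 assumes [measurable]: "f \<in> borel_measurable borel"
 shows "(\<integral>\<^sup>+dl. f dl \<partial>scale_measure01) = (NI dl. indicator {0<..<1} dl * ennreal (1 / dl) * f dl)"
 unfolding scale_measure01_def by (subst nn_integral_density) auto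

lemma sets_scale_measure01 [measurable_cong, simp]: "sets scale_measure01 = sets borel"
 and space_scale_measure01 [simp]: "space scale_measure01 = UNIV"
 by (simp_all add: scale_measure01_def)

lemma sets_ball_measure [measurable_cong, simp]: "sets (ball_measure s) = sets borel"
 and space_ball_measure [simp]: "space (ball_measure s) = UNIV"
 by (simp_all add: ball_measure_def)

lemma sball_measurable [measurable]: "sball s \<in> sets borel"
 unfolding sball_def by measurable

lemma nn_integral_ball_measure:
 assumes [measurable]: "f \<in> borel_measurable borel"
 shows "(\<integral>\<^sup>+h. f h \<partial>ball_measure s) = (NI h. indicator (sball s) h * ennreal (1 / snorm s h ^ hom_dim s) * f h)"
 unfolding ball_measure_def by (subst nn_integral_density) auto

lemma sigma_finite_scale_measure01: "sigma_finite_measure scale_measure01"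
 unfolding scale_measure01_def
 by (subst sigma_finite_measure.sigma_finite_iff_density_finite[OF sigma_finite_lborel]) (auto simp: indicator_def)

lemma hom_dim_ge_1: "scaling s ==> 1 <= hom_dim (s :: 'd::finite => nat)"
proof -
 assume s: "scaling s"
 have "1 <= s undefined" using s by (simp add: scaling_def)
 also have "... <= hom_dim s" unfolding hom_dim_def by (rule member_le_sum) auto
 finally show ?thesis .
qed

text \<open>With N = |s| this is the mass of one layer of \<open>scale_kernel\<close> with respect
  to the measure on scales.\<close>

lemma nn_integral_inverse_power_tail:
 assumes "0 < a" "1 <= N"
 shows "(NI dl. ennreal (inverse (dl ^ Suc N)) * indicator {a..} dl) = ennreal (inverse (real N * a ^ N))"
proof -
 have "(NI dl. ennreal (inverse (dl ^ Suc N)) * indicator {a..} dl) =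
   ennreal (0 - (- inverse (real N * a ^ N)))"
 proof (rule nn_integral_FTC_atLeast)
  fix x assume x: "a <= x"
  have "((%x. - (inverse (real N) * inverse (x ^ N))) has_real_derivative inverse (x ^ Suc N)) (at x)"
  proof -
   obtain k where k: "N = Suc k" using assms(2) by (cases N) auto
   have x0: "x ~= 0" using x assms by simp
   have "((%x. x ^ N) has_real_derivative real N * x ^ k) (at x)"
    unfolding k by (rule DERIV_cong[OF DERIV_pow]) simp
   from DERIV_cmult[OF DERIV_inverse'[OF this], of "- inverse (real N)"] x0
   have "((%x. - inverse (real N) * inverse (x ^ N)) has_real_derivative
     - inverse (real N) * - (inverse (x ^ N) * (real N * x ^ k) * inverse (x ^ N))) (at x)" by simp
   moreover have "- inverse (real N) * - (inverse (x ^ N) * (real N * x ^ k) * inverse (x ^ N)) = inverse (x ^ Suc N)"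
   proof -
    have "real N ~= 0" using assms(2) by simp
    then have "- inverse (real N) * - (inverse (x ^ N) * (real N * x ^ k) * inverse (x ^ N)) =
      inverse (x ^ N) * x ^ k * inverse (x ^ N)" by simp
    also have "... = inverse (x ^ Suc N)" using x0 by (simp add: k field_simps)
    finally show ?thesis .
   qed
   ultimately have "((%x. - inverse (real N) * inverse (x ^ N)) has_real_derivative inverse (x ^ Suc N)) (at x)"
    by (simp only:)
   then show ?thesis by simp
  qed
  then show "((%x. - inverse (real N * x ^ N)) has_real_derivative inverse (x ^ Suc N)) (at x)"
   by (simp add: inverse_mult_distrib)
  show "0 <= inverse (x ^ Suc N)" using x assms by simp
 next
  have "((%x. - (inverse (real N) * inverse (x ^ N))) \<longlongrightarrow> - (inverse (real N) * 0)) at_top"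
   using assms by (intro tendsto_intros tendsto_inverse_0_at_top filterlim_pow_at_top filterlim_ident) auto
  then show "((%x. - inverse (real N * x ^ N)) \<longlongrightarrow> 0) at_top" by simp
 qed simp
 then show ?thesis by simp
qed

text \<open>Layer \<open>n\<close> records what the step from scale 2^-n to 2^-(n+1) contributes:
  the weight 2^(-n ga) and a normalised indicator of the possible distances between the centres of
  the two bumps. The origin is removed because |h| appears in denominators.\<close>

definition scale_kernel :: "('d::finite => nat) => real => real => real ^ 'd => ennreal" where
 "scale_kernel s ga dl h = (\<Sum>n. ennreal (2 powr (- real n * ga) * inverse ((dl / 2 ^ n) ^ hom_dim s)) *
   indicator {h. 0 < snorm s h \<and> snorm s h <= 2 * (dl / 2 ^ n)} h)"

lemma scale_kernel_measurable [measurable]: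
 "(%(dl, h). scale_kernel s ga dl h) \<in> borel_measurable (borel \<Otimes>\<^sub>M borel)"
proof -
 have "scale_kernel s ga dl h = (\<Sum>n. ennreal (2 powr (- real n * ga) * inverse ((dl / 2 ^ n) ^ hom_dim s)) *
   (if 0 < snorm s h \<and> snorm s h <= 2 * (dl / 2 ^ n) then 1 else 0))" for dl h
  unfolding scale_kernel_def by (intro suminf_cong) (auto simp: indicator_def)
 then show ?thesis by (simp add: case_prod_beta')
qed

lemma scale_kernel_measurable' [measurable]: "scale_kernel s ga dl \<in> borel_measurable borel"
 using measurable_compose[OF _ scale_kernel_measurable, of "%h. (dl, h)" borel s ga] by simp

lemma scale_kernel_measurable'' [measurable]: "(%dl. scale_kernel s ga dl h) \<in> borel_measurable borel"
 using measurable_compose[OF _ scale_kernel_measurable, of "%dl. (dl, h)" borel s ga] by simp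

definition geom_sum :: "real => real" where
 "geom_sum ga = (\<Sum>n. 2 powr (- real n * ga))"

lemma geom_summable: "0 < ga ==> summable (%n. 2 powr (- real n * ga))"
proof -
 assume "0 < ga"
 have "2 powr (- real n * ga) = (2 powr (- ga)) ^ n" for n
  by (simp add: powr_realpow[symmetric] powr_powr mult.commute)
 moreover have "summable (%n. (2 powr (- ga)) ^ n)"
  using \<open>0 < ga\<close> by (intro summable_geometric) (simp add: powr_less_one)
 ultimately show ?thesis by simp
qed

lemma suminf_geom: "0 < ga ==> 0 <= c ==> (\<Sum>n. ennreal (2 powr (- real n * ga) * c)) = ennreal (geom_sum ga * c)"
proof -
 assume ga: "0 < ga" and c: "0 <= c"
 have "(\<Sum>n. ennreal (2 powr (- real n * ga) * c)) = ennreal (\<Sum>n. 2 powr (- real n * ga) * c)"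
  using c by (intro suminf_ennreal2 summable_mult2 geom_summable ga) auto
 also have "(\<Sum>n. 2 powr (- real n * ga) * c) = geom_sum ga * c"
  unfolding geom_sum_def by (rule suminf_mult2[OF geom_summable[OF ga], symmetric])
 finally show ?thesis .
qed

lemma geom_sum_pos: "0 < ga ==> 0 < geom_sum ga"
 unfolding geom_sum_def by (intro suminf_pos geom_summable) auto

text \<open>Each layer is an indicator divided by its volume, up to a constant, so the masses form a
  geometric series.\<close>

lemma scale_kernel_mass:
 fixes s :: "'d::finite => nat"
 assumes s: "scaling s" and ga: "0 < ga" and dl: "0 < dl"
 shows "(NI h. scale_kernel s ga dl h) <= ennreal (geom_sum ga * (2 ^ CARD('d) * 2 ^ hom_dim s))"
proof -
 have "(NI h. scale_kernel s ga dl h) = (\<Sum>n. NI h. ennreal (2 powr (- real n * ga) * inverse ((dl / 2 ^ n) ^ hom_dim s)) *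
   indicator {h. 0 < snorm s h \<and> snorm s h <= 2 * (dl / 2 ^ n)} h)"
  unfolding scale_kernel_def by (intro nn_integral_suminf) measurable
 also have "... <= (\<Sum>n. ennreal (2 powr (- real n * ga) * (2 ^ CARD('d) * 2 ^ hom_dim s)))"
 proof (intro suminf_le)
  fix n :: nat
  let ?d = "dl / 2 ^ n"
  have d: "0 < ?d" using dl by simp
  have "(NI h. ennreal (2 powr (- real n * ga) * inverse (?d ^ hom_dim s)) *
    indicator {h. 0 < snorm s h \<and> snorm s h <= 2 * ?d} h)
    <= (NI h. ennreal (2 powr (- real n * ga) * inverse (?d ^ hom_dim s)) * indicator (sbox s 0 (2 * ?d)) h)"
   by (intro nn_integral_mono mult_left_mono) (auto simp: indicator_def sbox_def)
  also have "... = ennreal (2 powr (- real n * ga) * inverse (?d ^ hom_dim s)) * ennreal (2 ^ CARD('d) * (2 * ?d) ^ hom_dim s)"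
   using emeasure_sbox[OF s, of "2 * ?d" 0] d by (subst nn_integral_cmult_indicator) auto
  also have "... = ennreal (2 powr (- real n * ga) * (2 ^ CARD('d) * 2 ^ hom_dim s))"
   using d by (subst ennreal_mult[symmetric]) (auto simp: power_mult_distrib field_simps)
  finally show "(NI h. ennreal (2 powr (- real n * ga) * inverse (?d ^ hom_dim s)) *
    indicator {h. 0 < snorm s h \<and> snorm s h <= 2 * ?d} h) <= ennreal (2 powr (- real n * ga) * (2 ^ CARD('d) * 2 ^ hom_dim s))" .
 qed auto
 also have "... = ennreal (geom_sum ga * (2 ^ CARD('d) * 2 ^ hom_dim s))"
  using ga by (intro suminf_geom) auto
 finally show ?thesis .
qed

text \<open>On layer \<open>n\<close> the distance is at most 2 dl / 2^n, so the normalisation is at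
  most 2^|s| times |h|^-|s|.\<close>

lemma scale_kernel_le:
 fixes s :: "'d::finite => nat"
 assumes s: "scaling s" and ga: "0 < ga" and dl: "0 < dl" and h: "0 < snorm s h"
 shows "scale_kernel s ga dl h <= ennreal (geom_sum ga * 2 ^ hom_dim s) * ennreal (1 / snorm s h ^ hom_dim s)"
proof -
 have "scale_kernel s ga dl h <= (\<Sum>n. ennreal (2 powr (- real n * ga) * (2 ^ hom_dim s * (1 / snorm s h ^ hom_dim s))))"
  unfolding scale_kernel_def
 proof (intro suminf_le)
  fix n :: nat
  let ?d = "dl / 2 ^ n"
  have d: "0 < ?d" using dl by simp
  show "ennreal (2 powr (- real n * ga) * inverse (?d ^ hom_dim s)) * indicator {h. 0 < snorm s h \<and> snorm s h <= 2 * ?d} h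
   <= ennreal (2 powr (- real n * ga) * (2 ^ hom_dim s * (1 / snorm s h ^ hom_dim s)))"
  proof (cases "snorm s h <= 2 * ?d")
   case True
   have "snorm s h ^ hom_dim s <= (2 * ?d) ^ hom_dim s" using True h by (intro power_mono) auto
   then have *: "inverse (?d ^ hom_dim s) <= 2 ^ hom_dim s * (1 / snorm s h ^ hom_dim s)"
    using d h by (simp add: power_mult_distrib field_simps)
   have ind: "indicator {h. 0 < snorm s h \<and> snorm s h <= 2 * ?d} h = (1 :: ennreal)"
    using True h by (simp add: indicator_def)
   show ?thesis unfolding ind mult_1_right by (intro ennreal_leI mult_left_mono *) simp
  qed (auto simp: indicator_def)
 qed auto
 also have "... = ennreal (geom_sum ga * (2 ^ hom_dim s * (1 / snorm s h ^ hom_dim s)))"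
  using ga by (intro suminf_geom) auto
 also have "... = ennreal (geom_sum ga * 2 ^ hom_dim s) * ennreal (1 / snorm s h ^ hom_dim s)"
  using geom_sum_pos[OF ga] by (subst ennreal_mult[symmetric]) (auto simp: mult.assoc)
 finally show ?thesis .
qed

text \<open>Layer \<open>n\<close> is active only for \<open>dl\<close> above a threshold
  proportional to |h| 2^n. The tail integral from there cancels the factor 2^(n |s|) of the
  normalisation, and the weights 2^(-n ga) remain to be summed.\<close>

lemma scale_kernel_dual_mass:
 fixes s :: "'d::finite => nat"
 assumes s: "scaling s" and ga: "0 < ga" and h: "0 < snorm s h"
 shows "(\<integral>\<^sup>+dl. scale_kernel s ga dl h \<partial>scale_measure01) <= ennreal (geom_sum ga * 2 ^ hom_dim s) * ennreal (1 / snorm s h ^ hom_dim s)"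
proof -
 let ?N = "hom_dim s"
 have N: "1 <= ?N" by (rule hom_dim_ge_1[OF s])
 have "(\<integral>\<^sup>+dl. scale_kernel s ga dl h \<partial>scale_measure01) =
  (\<Sum>n. \<integral>\<^sup>+dl. ennreal (2 powr (- real n * ga) * inverse ((dl / 2 ^ n) ^ hom_dim s)) *
   indicator {h. 0 < snorm s h \<and> snorm s h <= 2 * (dl / 2 ^ n)} h \<partial>scale_measure01)"
  unfolding scale_kernel_def
 proof (intro nn_integral_suminf)
  fix n :: nat
  have "(%dl. ennreal (2 powr (- real n * ga) * inverse ((dl / 2 ^ n) ^ hom_dim s)) *
    (if 0 < snorm s h \<and> snorm s h <= 2 * (dl / 2 ^ n) then 1 else 0)) \<in> borel_measurable scale_measure01"
   by measurable
  then show "(%dl. ennreal (2 powr (- real n * ga) * inverse ((dl / 2 ^ n) ^ hom_dim s)) *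
    indicator {h. 0 < snorm s h \<and> snorm s h <= 2 * (dl / 2 ^ n)} h) \<in> borel_measurable scale_measure01"
   by (simp add: indicator_def cong: if_cong)
 qed
 also have "... <= (\<Sum>n. ennreal (2 powr (- real n * ga) * (2 ^ hom_dim s * (1 / snorm s h ^ hom_dim s))))"
 proof (intro suminf_le)
  fix n :: nat
  \<comment> \<open>The smallest \<open>dl\<close> for which \<open>h\<close> belongs to layer
    \<open>n\<close>.\<close>
  define a where "a = snorm s h * 2 ^ n / 2"
  have a: "0 < a" using h by (simp add: a_def)
  have "(\<integral>\<^sup>+dl. ennreal (2 powr (- real n * ga) * inverse ((dl / 2 ^ n) ^ hom_dim s)) *
    indicator {h. 0 < snorm s h \<and> snorm s h <= 2 * (dl / 2 ^ n)} h \<partial>scale_measure01)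
   <= (NI dl. ennreal (2 powr (- real n * ga) * (2 ^ n) ^ ?N) * (ennreal (inverse (dl ^ Suc ?N)) * indicator {a..} dl))"
   unfolding scale_measure01_def
  proof (subst nn_integral_density)
   show "(%dl. ennreal (2 powr (- real n * ga) * inverse ((dl / 2 ^ n) ^ hom_dim s)) *
    indicator {h. 0 < snorm s h \<and> snorm s h <= 2 * (dl / 2 ^ n)} h) \<in> borel_measurable lborel"
    unfolding indicator_def mem_Collect_eq by measurable
   show "(NI dl. indicator {0<..<1} dl * ennreal (1 / dl) * (ennreal (2 powr (- real n * ga) * inverse ((dl / 2 ^ n) ^ hom_dim s)) *
    indicator {h. 0 < snorm s h \<and> snorm s h <= 2 * (dl / 2 ^ n)} h))
    <= (NI dl. ennreal (2 powr (- real n * ga) * (2 ^ n) ^ ?N) * (ennreal (inverse (dl ^ Suc ?N)) * indicator {a..} dl))"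
   proof (rule nn_integral_mono)
    fix dl :: real
    show "indicator {0<..<1} dl * ennreal (1 / dl) * (ennreal (2 powr (- real n * ga) * inverse ((dl / 2 ^ n) ^ hom_dim s)) *
      indicator {h. 0 < snorm s h \<and> snorm s h <= 2 * (dl / 2 ^ n)} h)
     <= ennreal (2 powr (- real n * ga) * (2 ^ n) ^ ?N) * (ennreal (inverse (dl ^ Suc ?N)) * indicator {a..} dl)"
    proof (cases "0 < dl \<and> dl < 1 \<and> snorm s h <= 2 * (dl / 2 ^ n)")
     case True
     then have "a <= dl" by (simp add: a_def field_simps)
     with True h have ind: "indicator {h. 0 < snorm s h \<and> snorm s h <= 2 * (dl / 2 ^ n)} h = (1 :: ennreal)"
      "indicator {0<..<1} dl = (1 :: ennreal)" "indicator {a..} dl = (1 :: ennreal)" by (auto simp: indicator_def)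
     have "ennreal (1 / dl) * ennreal (2 powr (- real n * ga) * inverse ((dl / 2 ^ n) ^ ?N))
       = ennreal (1 / dl * (2 powr (- real n * ga) * inverse ((dl / 2 ^ n) ^ ?N)))"
      using True by (intro ennreal_mult[symmetric]) auto
     also have "1 / dl * (2 powr (- real n * ga) * inverse ((dl / 2 ^ n) ^ ?N))
       = 2 powr (- real n * ga) * (2 ^ n) ^ ?N * inverse (dl ^ Suc ?N)"
      using True by (simp add: power_divide field_simps)
     also have "ennreal ... = ennreal (2 powr (- real n * ga) * (2 ^ n) ^ ?N) * ennreal (inverse (dl ^ Suc ?N))"
      using True by (intro ennreal_mult) auto
     finally show ?thesis unfolding ind by simp
    qed (auto simp: indicator_def)
   qed
  qed simp
  also have "... = ennreal (2 powr (- real n * ga) * (2 ^ n) ^ ?N) * ennreal (inverse (real ?N * a ^ ?N))"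
   by (subst nn_integral_cmult, measurable) (simp only: nn_integral_inverse_power_tail[OF a N])
  also have "... = ennreal (2 powr (- real n * ga) * ((2 ^ n) ^ ?N * inverse (real ?N * a ^ ?N)))"
   using a by (subst ennreal_mult[symmetric]) (auto simp: mult.assoc)
  also have "... <= ennreal (2 powr (- real n * ga) * (2 ^ ?N * (1 / snorm s h ^ ?N)))"
  proof (intro ennreal_leI mult_left_mono)
   have "(2 ^ n) ^ ?N * inverse (real ?N * a ^ ?N) = 2 ^ ?N * (1 / snorm s h ^ ?N) * inverse (real ?N)"
    using h by (simp add: a_def power_mult_distrib power_divide field_simps)
   also have "... <= 2 ^ ?N * (1 / snorm s h ^ ?N) * 1"
    using N h by (intro mult_left_mono) (auto simp: inverse_le_1_iff)
   finally show "(2 ^ n) ^ ?N * inverse (real ?N * a ^ ?N) <= 2 ^ ?N * (1 / snorm s h ^ ?N)" by simp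
  qed simp
  finally show "(\<integral>\<^sup>+dl. ennreal (2 powr (- real n * ga) * inverse ((dl / 2 ^ n) ^ hom_dim s)) *
    indicator {h. 0 < snorm s h \<and> snorm s h <= 2 * (dl / 2 ^ n)} h \<partial>scale_measure01)
   <= ennreal (2 powr (- real n * ga) * (2 ^ hom_dim s * (1 / snorm s h ^ hom_dim s)))" .
 qed auto
 also have "... = ennreal (geom_sum ga * (2 ^ hom_dim s * (1 / snorm s h ^ hom_dim s)))"
  using ga by (intro suminf_geom) auto
 also have "... = ennreal (geom_sum ga * 2 ^ hom_dim s) * ennreal (1 / snorm s h ^ hom_dim s)"
  using geom_sum_pos[OF ga] by (subst ennreal_mult[symmetric]) (auto simp: mult.assoc)
 finally show ?thesis .
qed

text \<open>On the punctured open ball the density of \<open>ball_measure\<close> is positive, so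
  null sets carry over to Lebesgue measure; elsewhere \<open>om\<close> vanishes.\<close>

lemma AE_ball_measure_le:
 assumes "AE h in ball_measure s. om h <= W" and supp: "!!h. om h ~= 0 ==> 0 < snorm s h \<and> snorm s h < 1"
 shows "AE h in lborel. om h <= (W :: ennreal)"
proof -
 have "AE h in lborel. 0 < indicator (sball s) h * ennreal (1 / snorm s h ^ hom_dim s) --> om h <= W"
  using assms(1) unfolding ball_measure_def by (subst (asm) AE_density) auto
 then show ?thesis
 proof eventually_elim
  case (elim h)
  show ?case
  proof (cases "om h = 0")
   case False
   then have "0 < snorm s h" "snorm s h < 1" using supp by auto
   then have "0 < indicator (sball s) h * ennreal (1 / snorm s h ^ hom_dim s)"
    by (simp add: sball_def ennreal_zero_less_mult_iff)
   then show ?thesis using elim by simp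
  qed simp
 qed
qed

context
 fixes s :: "'d::finite => nat" and ga :: real and q :: ennreal
 assumes s: "scaling s" and ga: "0 < ga" and q: "1 <= q"
begin

text \<open>Schur's test: \<open>scale_kernel\<close> has bounded mass in \<open>h\<close>, and mass in \<open>\<delta>\<close> controlled by the density of
 \<open>ball_measure\<close>. The pointwise bound in \<open>\<delta>\<close> is used for the uniqueness of the reconstruction.\<close>

lemma scale_kernel_Lq:
 "\<exists>C::real. 0 < C \<and> (\<forall>om\<in>borel_measurable borel. (\<forall>h. om h ~= 0 --> 0 < snorm s h \<and> snorm s h < 1) -->
   Ls q (%dl. NI h. scale_kernel s ga dl h * om h) <= ennreal C * Lb s q om \<and>
   (\<forall>dl>0. (NI h. scale_kernel s ga dl h * om h) <= ennreal C * Lb s q om))"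
proof -
 define c where "c = geom_sum ga * (2 ^ CARD('d) * 2 ^ hom_dim s)"
 have c: "0 < c" using geom_sum_pos[OF ga] by (simp add: c_def)
 have mass: "(NI h. scale_kernel s ga dl h) <= ennreal c" if "0 < dl" for dl
  unfolding c_def by (rule scale_kernel_mass[OF s ga that])
 show ?thesis
 proof (cases "q = top")
  case True
  have "(NI h. scale_kernel s ga dl h * om h) <= ennreal c * Lb s q om"
   if dl: "0 < dl" and [measurable]: "om \<in> borel_measurable borel" and supp: "\<forall>h. om h ~= 0 --> 0 < snorm s h \<and> snorm s h < 1" for dl om
  proof -
   let ?W = "Lb s q om"
   have "AE h in lborel. om h <= ?W"
    using supp AE_le_Lp_norm_infinity[of om "ball_measure s"] unfolding True by (intro AE_ball_measure_le) auto
   then have "AE h in lborel. scale_kernel s ga dl h * om h <= scale_kernel s ga dl h * ?W"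
    by eventually_elim (rule mult_left_mono, auto)
   then have "(NI h. scale_kernel s ga dl h * om h) <= (NI h. scale_kernel s ga dl h * ?W)"
    by (rule nn_integral_mono_AE)
   also have "... = (NI h. scale_kernel s ga dl h) * ?W" by (rule nn_integral_multc) simp
   also have "... <= ennreal c * ?W" by (intro mult_right_mono mass dl) auto
   finally show ?thesis .
  qed
  then show ?thesis
   using c unfolding True
   by (intro exI[of _ c]) (auto intro!: Lp_norm_infinity_le scale_measure01_AE)
 next
  case False
  let ?Q = "enn2real q"
  have Q: "1 <= ?Q" using enn2real_ge_1[OF q False] .
  let ?d = "geom_sum ga * 2 ^ hom_dim s"
  have d: "0 < ?d" using geom_sum_pos[OF ga] by simp
  \<comment> \<open>Jensen in \<open>h\<close> costs c^(Q-1), exchanging the integrals costs the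
    dual mass \<open>?d\<close>; the norm takes the Q-th root.\<close>
  define e where "e = (c powr (?Q - 1) * ?d) powr (1 / ?Q)"
  have e: "0 < e" using c geom_sum_pos[OF ga] by (simp add: e_def)
  have "Ls q (%dl. NI h. scale_kernel s ga dl h * om h) <= ennreal e * Lb s q om \<and>
   (\<forall>dl>0. (NI h. scale_kernel s ga dl h * om h) <= ennreal e * Lb s q om)"
   if [measurable]: "om \<in> borel_measurable borel" and supp: "\<forall>h. om h ~= 0 --> 0 < snorm s h \<and> snorm s h < 1" for om
  proof -
   define I where "I = (\<integral>\<^sup>+h. ennreal_powr (om h) ?Q \<partial>ball_measure s)"
   define k where "k = (%h. indicator (sball s) h * ennreal (1 / snorm s h ^ hom_dim s))"
   have [measurable]: "k \<in> borel_measurable borel" unfolding k_def by measurable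
   have I: "I = (NI h. k h * ennreal_powr (om h) ?Q)"
    unfolding I_def k_def by (rule nn_integral_ball_measure) measurable
   have J: "ennreal_powr (NI h. scale_kernel s ga dl h * om h) ?Q
     <= ennreal (c powr (?Q - 1)) * (NI h. scale_kernel s ga dl h * ennreal_powr (om h) ?Q)"
    if "0 < dl" for dl
    by (intro Jensen_nn_integral_weighted Q c mass that) measurable
   have pw: "m * ennreal_powr (om h) ?Q <= ennreal ?d * (k h * ennreal_powr (om h) ?Q)"
    if "0 < snorm s h ==> m <= ennreal ?d * ennreal (1 / snorm s h ^ hom_dim s)" for m h
   proof (cases "om h = 0")
    case False
    then have h: "0 < snorm s h" "snorm s h < 1" using supp by auto
    then have "m <= ennreal ?d * k h" using that by (simp add: k_def sball_def)
    then show ?thesis by (simp add: mult.assoc[symmetric] mult_right_mono)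
   qed simp
   have fin: "ennreal_powr (ennreal (c powr (?Q - 1)) * (ennreal ?d * I)) (1 / ?Q) = ennreal e * Lb s q om"
   proof -
    have "ennreal (c powr (?Q - 1)) * (ennreal ?d * I) = ennreal (c powr (?Q - 1) * ?d) * I"
     using d by (simp add: ennreal_mult mult.assoc)
    then show ?thesis
     unfolding Lp_norm_finite[OF False] e_def I_def[symmetric] using Q d by (simp add: ennreal_powr_mult)
   qed
   have "(\<integral>\<^sup>+dl. ennreal_powr (NI h. scale_kernel s ga dl h * om h) ?Q \<partial>scale_measure01)
     <= (\<integral>\<^sup>+dl. ennreal (c powr (?Q - 1)) * (NI h. scale_kernel s ga dl h * ennreal_powr (om h) ?Q) \<partial>scale_measure01)"
    using J by (intro nn_integral_mono_AE scale_measure01_AE)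
   also have "... = ennreal (c powr (?Q - 1)) * (\<integral>\<^sup>+dl. (NI h. scale_kernel s ga dl h * ennreal_powr (om h) ?Q) \<partial>scale_measure01)"
    by (intro nn_integral_cmult) measurable
   also have "(\<integral>\<^sup>+dl. (NI h. scale_kernel s ga dl h * ennreal_powr (om h) ?Q) \<partial>scale_measure01)
     = (NI h. (\<integral>\<^sup>+dl. scale_kernel s ga dl h * ennreal_powr (om h) ?Q \<partial>scale_measure01))"
   proof -
    interpret A: sigma_finite_measure scale_measure01 by (rule sigma_finite_scale_measure01)
    interpret B: sigma_finite_measure "lborel :: (real^'d) measure" by (rule sigma_finite_lborel)
    interpret pair_sigma_finite scale_measure01 "lborel :: (real^'d) measure" ..
    show ?thesis by (rule Fubini'[symmetric]) measurable
   qed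
   also have "... <= (NI h. ennreal ?d * (k h * ennreal_powr (om h) ?Q))"
   proof (rule nn_integral_mono)
    fix h
    have "(\<integral>\<^sup>+dl. scale_kernel s ga dl h * ennreal_powr (om h) ?Q \<partial>scale_measure01) =
      (\<integral>\<^sup>+dl. scale_kernel s ga dl h \<partial>scale_measure01) * ennreal_powr (om h) ?Q"
     by (rule nn_integral_multc) measurable
    then show "(\<integral>\<^sup>+dl. scale_kernel s ga dl h * ennreal_powr (om h) ?Q \<partial>scale_measure01) <= ennreal ?d * (k h * ennreal_powr (om h) ?Q)"
     using pw[OF scale_kernel_dual_mass[OF s ga]] by simp
   qed
   also have "... = ennreal ?d * I" unfolding I by (intro nn_integral_cmult) measurable
   finally have "(\<integral>\<^sup>+dl. ennreal_powr (NI h. scale_kernel s ga dl h * om h) ?Q \<partial>scale_measure01)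
     <= ennreal (c powr (?Q - 1)) * (ennreal ?d * I)" by (simp add: mult_left_mono)
   then have 1: "Ls q (%dl. NI h. scale_kernel s ga dl h * om h) <= ennreal e * Lb s q om"
    unfolding fin[symmetric] unfolding Lp_norm_finite[OF False] using Q by (intro ennreal_powr_mono) auto
   \<comment> \<open>The same chain at a single scale, with \<open>scale_kernel_le\<close> in place
     of the mass over scales.\<close>
   have 2: "(NI h. scale_kernel s ga dl h * om h) <= ennreal e * Lb s q om" if dl: "0 < dl" for dl
   proof -
    have "(NI h. scale_kernel s ga dl h * ennreal_powr (om h) ?Q) <= (NI h. ennreal ?d * (k h * ennreal_powr (om h) ?Q))"
     by (intro nn_integral_mono pw scale_kernel_le s ga dl)
    also have "... = ennreal ?d * I" unfolding I by (intro nn_integral_cmult) measurable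
    finally have "ennreal_powr (NI h. scale_kernel s ga dl h * om h) ?Q <= ennreal (c powr (?Q - 1)) * (ennreal ?d * I)"
     using J[OF dl] by (meson mult_left_mono order_trans zero_le)
    then have "ennreal_powr (ennreal_powr (NI h. scale_kernel s ga dl h * om h) ?Q) (1 / ?Q) <= ennreal e * Lb s q om"
     unfolding fin[symmetric] using Q by (intro ennreal_powr_mono) auto
    then show ?thesis using Q by (simp add: ennreal_powr_powr)
   qed
   show ?thesis using 1 2 by blast
  qed
  then show ?thesis using e by (intro exI[of _ e]) blast
 qed
qed

text \<open>With \<open>e\<close> the difference between the lowest homogeneity and
  \<open>abar\<close>, this is the dichotomy in the choice of \<open>abar\<close>: bounded for q
  infinite when e is 0, but for finite q the integral of dl^(e q - 1) over (0,1) needs e >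
  0.\<close>

lemma Lq_scale_powr:
 assumes "if q = top then 0 <= e else 0 < e"
 shows "Ls q (%dl. ennreal (dl powr e)) < top"
proof (cases "q = top")
 case True
 have "Ls q (%dl. ennreal (dl powr e)) <= 1"
  unfolding True using assms True
  by (intro Lp_norm_infinity_le scale_measure01_AE) (auto simp: ennreal_le_1 powr_le1)
 then show ?thesis by (simp add: order_le_less_trans)
next
 case False
 let ?Q = "enn2real q"
 have Q: "1 <= ?Q" using enn2real_ge_1[OF q False] .
 have e: "0 < e * ?Q" using assms False Q by simp
 have "(\<integral>\<^sup>+dl. ennreal_powr (ennreal (dl powr e)) ?Q \<partial>scale_measure01)
   = (NI dl. indicator {0<..<1} dl * ennreal (1 / dl) * ennreal (dl powr (e * ?Q)))"
  by (subst nn_integral_scale_measure01) (auto simp: powr_powr)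
 also have "... <= (NI dl. ennreal (dl powr (e * ?Q - 1)) * indicator {0..1} dl)"
  by (intro nn_integral_mono) (auto simp: indicator_def ennreal_mult[symmetric] powr_diff)
 also have "... = (NI dl. ennreal (indicator {0..1} dl * dl powr (e * ?Q - 1)))"
  by (intro nn_integral_cong) (auto simp: indicator_def)
 also have "... = ennreal (1 powr (e * ?Q - 1 + 1) / (e * ?Q - 1 + 1))"
  using e by (intro nn_integral_has_integral_lebesgue has_integral_powr_from_0) auto
 also have "... < top" by simp
 finally show ?thesis unfolding Lp_norm_finite[OF False] by (simp only: less_top[symmetric] ennreal_powr_eq_top_iff not_False_eq_True)
qed

end

section \<open>Reconstruction of a germ\<close>

lemma rescale_joint_continuous:
 assumes "continuous_on UNIV ph" "0 < dl"
 shows "continuous_on UNIV (%p. rescale s ph dl (fst p) (snd p))"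
 unfolding rescale_def using assms(2)
 by (intro continuous_on_divide continuous_on_compose2[OF assms(1)] continuous_on_vec_lambda
   continuous_on_diff continuous_on_component continuous_on_fst continuous_on_snd continuous_on_id continuous_on_const) auto

lemma rescale_measurable:
 assumes "continuous_on UNIV ph" "0 < dl" and f: "f \<in> borel_measurable M" and g: "g \<in> borel_measurable M"
 shows "(%p. rescale s ph dl (f p) (g p)) \<in> borel_measurable M"
 by (rule borel_measurable_continuous_Pair[OF f g rescale_joint_continuous[OF assms(1,2)]])

lemma rescale_bound:
 assumes "!!v. \<bar>ph v\<bar> <= a" "0 < dl"
 shows "\<bar>rescale s ph dl x y\<bar> <= inverse (dl ^ hom_dim s) * a"
 using assms by (simp add: rescale_def abs_mult divide_inverse mult.commute mult_left_mono)

lemma sbox_triangle: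
 assumes "scaling s" "y \<in> sbox s z a" "y \<in> sbox s x b"
 shows "snorm s (z - x) <= a + b"
proof -
 have "snorm s (z - x) <= snorm s (z - y) + snorm s (y - x)"
  using snorm_triangle[OF assms(1), of "z - y" "y - x"] by simp
 then show ?thesis using assms(2,3) by (simp add: sbox_def snorm_diff_commute[of s z y])
qed

text \<open>What the analysis uses of \<open>F\<close>, be it the germ of one modelled distribution
  or the difference of two. \<open>J\<close> and \<open>M\<close> are majorants for the components
  of increments and of values, with the model norms already included. \<open>F_lim\<close> is a
  Lebesgue point property of the diagonal, in the mean over compact sets.\<close>

locale germ =
 fixes s :: "'d::finite => nat" and r :: nat and ga :: real and F :: "real ^ 'd => real ^ 'd => real"
  and homs :: "real set" and J :: "real => real ^ 'd => real ^ 'd => ennreal"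
  and M :: "real => real ^ 'd => ennreal"
 assumes s: "scaling s" and ga: "0 < ga" and homs: "finite homs" "!!ze. ze \<in> homs ==> ze < ga"
  and F_meas: "(%p. F (fst p) (snd p)) \<in> borel_measurable borel"
  and F_bound: "!!K. compact K ==> \<exists>m. (\<forall>z. 0 <= m z) \<and> integrable lborel (%z. indicator K z * m z) \<and>
    (\<forall>z\<in>K. \<forall>y\<in>K. \<bar>F z y\<bar> <= m z)"
  and F_lim: "!!K. compact K ==> ((%dl. NI y. indicator K y * (NI z. ennreal (inverse (dl ^ hom_dim s)) *
    indicator (sbox s y dl) z * ennreal \<bar>F z y - F y y\<bar>)) \<longlongrightarrow> 0) (at_right 0)"
  and J_meas: "!!ze. ze \<in> homs ==> (%p. J ze (fst p) (snd p)) \<in> borel_measurable borel"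
  and M_meas: "!!ze. ze \<in> homs ==> M ze \<in> borel_measurable borel"
  and J_bound: "!!z h ph dl. 0 < snorm s h ==> snorm s h < 1 ==> ph \<in> B_tests s r ==> 0 < dl ==> dl < 1 ==>
    ennreal \<bar>LI y. (F (z + h) y - F z y) * rescale s ph dl (z + h) y\<bar> <= (\<Sum>ze\<in>homs. ennreal (dl powr ze) * J ze z h)"
  and M_bound: "!!z ph dl. ph \<in> B_tests s r ==> 0 < dl ==> dl < 1 ==>
    ennreal \<bar>LI y. F z y * rescale s ph dl z y\<bar> <= (\<Sum>ze\<in>homs. ennreal (dl powr ze) * M ze z)"
  and J_supp: "!!ze z h. J ze z h ~= 0 ==> 0 < snorm s h \<and> snorm s h < 1"
begin

abbreviation "N \<equiv> hom_dim s"

lemma F_measurable [measurable (raw)]: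
 assumes "f \<in> borel_measurable A" "g \<in> borel_measurable A"
 shows "(%p. F (f p) (g p)) \<in> borel_measurable A"
proof -
 have "(%p. (f p, g p)) \<in> borel_measurable A" using assms by simp
 from measurable_compose[OF this F_meas] show ?thesis by simp
qed

lemma J_measurable [measurable (raw)]:
 assumes "ze \<in> homs" "f \<in> borel_measurable A" "g \<in> borel_measurable A"
 shows "(%p. J ze (f p) (g p)) \<in> borel_measurable A"
proof -
 have "(%p. (f p, g p)) \<in> borel_measurable A" using assms by simp
 from measurable_compose[OF this J_meas[OF assms(1)]] show ?thesis by simp
qed

definition diag :: "real ^ 'd => real" where "diag y = F y y"

lemma locally_integrable_diag: "locally_integrable diag"
 unfolding locally_integrable_def
proof (intro allI impI)
 fix K :: "(real^'d) set" assume K: "compact K"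
 then have [measurable]: "K \<in> sets borel" by (simp add: compact_imp_closed borel_closed)
 obtain m where m: "!!z. 0 <= m z" "integrable lborel (%z. indicator K z * m z)" "!!z y. z \<in> K ==> y \<in> K ==> \<bar>F z y\<bar> <= m z"
  using F_bound[OF K] by blast
 show "set_integrable lborel K diag"
  unfolding set_integrable_def
 proof (rule Bochner_Integration.integrable_bound[OF m(2)])
  show "(%x. indicator K x *\<^sub>R diag x) \<in> borel_measurable lborel" unfolding diag_def by measurable
  show "AE x in lborel. norm (indicator K x *\<^sub>R diag x) <= norm (indicator K x * m x)"
   using m(1,3) by (intro AE_I2) (auto simp: indicator_def diag_def)
 qed
qed

end

locale germ_test = germ s r ga F homs J M
 for s :: "'d::finite => nat" and r ga F homs J M +
 fixes et :: "real ^ 'd => real" and dl :: real and x :: "real ^ 'd"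
 assumes et: "et \<in> B_tests s r" and dl: "0 < dl" "dl <= 1"
begin

definition ps :: "real ^ 'd => real" where "ps = rescale s et dl x"
text \<open>The factor 1/4 keeps the distances between neighbouring centres, at most
  \<open>2 * d n\<close>, below 1 even for \<open>dl = 1\<close>, as \<open>J_bound\<close>
  requires.\<close>

definition d :: "nat => real" where "d n = dl / 4 / 2 ^ n"
definition rh :: "nat => real ^ 'd => real ^ 'd => real" where "rh n z y = rescale s bump (d n) z y"
text \<open>Large enough for all points that matter: arguments lie within \<open>dl\<close> of
  \<open>x\<close>, and base points within \<open>2 * dl\<close>.\<close>

definition K :: "(real ^ 'd) set" where "K = sbox s x 2"
definition S :: "nat => real" where "S n = (LI y. (LI z. F z y * rh n z y * ps y))"

lemma d_pos: "0 < d n" and d_le: "d n <= dl / 4" and d_lt_1: "d n < 1" and d_Suc: "d n = 2 * d (Suc n)"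
proof -
 show "0 < d n" using dl by (simp add: d_def)
 show "d n <= dl / 4" using dl unfolding d_def by (simp add: divide_le_eq mult_le_cancel_left1 one_le_power)
 then show "d n < 1" using dl by linarith
 show "d n = 2 * d (Suc n)" by (simp add: d_def)
qed

lemma C_class_et: "C_class r et" and supp_et: "supported_in et (sball s)" and et_le: "\<bar>et v\<bar> <= 1"
 using et Cb_bound[OF B_tests_Cb[OF et]] by (auto simp: B_tests_def)

lemma ps_continuous: "continuous_on A ps"
 unfolding ps_def using C_class_continuous[OF C_class_rescale[OF C_class_et]] .

lemma ps_measurable [measurable]: "ps \<in> borel_measurable borel"
 by (intro borel_measurable_continuous_onI ps_continuous)

lemma ps_supp: "ps y ~= 0 ==> y \<in> sbox s x dl"
 unfolding ps_def using rescale_supp[OF s supp_et dl(1), of x] by (auto simp: supported_in_def)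

lemma ps_bound: "\<bar>ps y\<bar> <= inverse (dl ^ N)"
 unfolding ps_def using rescale_bound[where ph = et and a = 1 and dl = dl, OF et_le dl(1)] by simp

lemma rh_measurable [measurable (raw)]:
 "f \<in> borel_measurable A ==> g \<in> borel_measurable A ==> (%p. rh n (f p) (g p)) \<in> borel_measurable A"
 unfolding rh_def by (intro rescale_measurable bump_continuous d_pos)

lemma rh_supp: "rh n z y ~= 0 ==> y \<in> sbox s z (d n)"
 unfolding rh_def using rescale_supp[OF s bump_supported_sball[OF s] d_pos[of n], where x = z] by (auto simp: supported_in_def)

lemma rh_nonneg: "0 <= rh n z y"
 unfolding rh_def using d_pos[of n] by (intro rescale_bump_nonneg) simp

definition B :: real where "B = bump_bound TYPE('d) r"

lemma B: "1 <= B" "Cb r B (bump :: real^'d => real)"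
 unfolding B_def by (rule bump_bound)+

lemma rh_bound: "\<bar>rh n z y\<bar> <= inverse (d n ^ N) * B"
 unfolding rh_def by (rule rescale_bound[OF Cb_bound[OF B(2)] d_pos])

lemma rh_integral: "(LI z. rh n z y) = 1"
 unfolding rh_def using integral_rescale_center[OF d_pos bump_continuous] integral_bump by metis

lemma compact_K: "compact K" unfolding K_def by (intro compact_sbox s) simp

lemma K_measurable [measurable]: "K \<in> sets borel" unfolding K_def by measurable

lemma in_K_y: "ps y ~= 0 ==> y \<in> K"
 using ps_supp[of y] dl by (auto simp: K_def sbox_def)

lemma near_x: "ps y ~= 0 ==> rh n z y ~= 0 ==> snorm s (z - x) <= 2 * dl"
 using sbox_triangle[OF s rh_supp[of n z y] ps_supp[of y]] d_le[of n] dl by linarith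

lemma in_K_z: "ps y ~= 0 ==> rh n z y ~= 0 ==> z \<in> K"
 using near_x[of y n z] dl by (auto simp: K_def sbox_def)

lemma finite_K: "emeasure lborel K < top"
 using emeasure_sbox[OF s, of 2 x] by (simp add: K_def)

definition m :: "real ^ 'd => real" where
 "m = (SOME m. (\<forall>z. 0 <= m z) \<and> integrable lborel (%z. indicator K z * m z) \<and> (\<forall>z\<in>K. \<forall>y\<in>K. \<bar>F z y\<bar> <= m z))"

lemma m: "0 <= m z" "integrable lborel (%z. indicator K z * m z)" "z \<in> K ==> y \<in> K ==> \<bar>F z y\<bar> <= m z"
 using someI_ex[OF F_bound[OF compact_K]] unfolding m_def[symmetric] by auto

text \<open>The function is general because besides \<open>F\<close> itself the germ with base point
  frozen at \<open>x\<close> has to be integrated.\<close>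

lemma integrable_pair_bounded:
 assumes [measurable]: "(%p. \<Phi> (fst p) (snd p)) \<in> borel_measurable (lborel \<Otimes>\<^sub>M lborel)"
  and \<mu>: "!!z. 0 <= \<mu> z" "integrable lborel (%z. indicator K z * \<mu> z)" "!!z y. z \<in> K ==> y \<in> K ==> \<bar>\<Phi> z y\<bar> <= \<mu> z"
 shows "integrable (lborel \<Otimes>\<^sub>M lborel) (%p. \<Phi> (fst p) (snd p) * rh n (fst p) (snd p) * ps (snd p))"
proof (rule integrableI_bounded)
 have [measurable]: "(%z. indicator K z * \<mu> z) \<in> borel_measurable borel"
  using borel_measurable_integrable[OF \<mu>(2)] by simp
 have fin: "(NI z. ennreal (indicator K z * \<mu> z)) < top"
  using \<mu>(1,2) by (subst nn_integral_eq_integral) auto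
 let ?c = "inverse (d n ^ N) * B * inverse (dl ^ N)"
 have c: "0 <= ?c" using d_pos[of n] B(1) dl by simp
 show "(%p. \<Phi> (fst p) (snd p) * rh n (fst p) (snd p) * ps (snd p)) \<in> borel_measurable (lborel \<Otimes>\<^sub>M lborel)"
  by measurable
 have "(\<integral>\<^sup>+p. ennreal (norm (\<Phi> (fst p) (snd p) * rh n (fst p) (snd p) * ps (snd p))) \<partial>(lborel \<Otimes>\<^sub>M lborel))
  <= (\<integral>\<^sup>+p. ennreal ?c * (ennreal (indicator K (fst p) * \<mu> (fst p)) * indicator K (snd p)) \<partial>(lborel \<Otimes>\<^sub>M lborel))"
 proof (rule nn_integral_mono)
  fix p :: "(real^'d) \<times> (real^'d)"
  obtain z y where p: "p = (z, y)" by fastforce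
  show "ennreal (norm (\<Phi> (fst p) (snd p) * rh n (fst p) (snd p) * ps (snd p))) <=
    ennreal ?c * (ennreal (indicator K (fst p) * \<mu> (fst p)) * indicator K (snd p))"
  proof (cases "rh n z y = 0 \<or> ps y = 0")
   case False
   then have zK: "z \<in> K" "y \<in> K" using in_K_z in_K_y by auto
   have "\<bar>\<Phi> z y\<bar> * \<bar>rh n z y\<bar> * \<bar>ps y\<bar> <= \<mu> z * (inverse (d n ^ N) * B) * inverse (dl ^ N)"
    using \<mu>(1)[of z] \<mu>(3)[OF zK] rh_bound[of n z y] ps_bound[of y] d_pos[of n] B(1)
    by (intro mult_mono) auto
   then have "ennreal (norm (\<Phi> z y * rh n z y * ps y)) <= ennreal (?c * \<mu> z)"
    by (intro ennreal_leI) (simp add: abs_mult mult.commute mult.left_commute)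
   also have "... = ennreal ?c * ennreal (\<mu> z)" using c \<mu>(1) by (intro ennreal_mult)
   finally show ?thesis using zK by (simp add: p)
  qed (auto simp: p)
 qed
 also have "... = (NI z. (NI y. ennreal ?c * (ennreal (indicator K z * \<mu> z) * indicator K y)))"
  by (subst lborel.nn_integral_fst[symmetric]) auto
 also have "... = ennreal ?c * ((NI z. ennreal (indicator K z * \<mu> z)) * emeasure lborel K)"
  by (simp add: nn_integral_cmult nn_integral_multc mult.assoc)
 also have "... < top" using fin finite_K by (simp add: ennreal_mult_less_top)
 finally show "(\<integral>\<^sup>+p. ennreal (norm (\<Phi> (fst p) (snd p) * rh n (fst p) (snd p) * ps (snd p))) \<partial>(lborel \<Otimes>\<^sub>M lborel)) < \<infinity>"
  by simp
qed

lemma integrable_pair: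
 "integrable (lborel \<Otimes>\<^sub>M lborel) (%p. F (fst p) (snd p) * rh n (fst p) (snd p) * ps (snd p))"
 by (intro integrable_pair_bounded[of F m] m) measurable

lemma integrable_pair': "integrable (lborel \<Otimes>\<^sub>M lborel) (%(z, y). F z y * rh n z y * ps y)"
 using integrable_pair[of n] unfolding case_prod_beta' .

text \<open>Inserting the partition of unity at scale \<open>k\<close>, centred at \<open>u\<close>, into the integral defining \<open>S n\<close>,
 centred at \<open>z\<close>.\<close>

lemma S_insert:
 shows "integrable (lborel \<Otimes>\<^sub>M lborel) (%q. LI y. F (fst q) y * rh n (fst q) y * ps y * rh k (snd q) y)"
  and "S n = (\<integral>q. (LI y. F (fst q) y * rh n (fst q) y * ps y * rh k (snd q) y) \<partial>(lborel \<Otimes>\<^sub>M lborel))"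
proof -
 let ?P = "lborel \<Otimes>\<^sub>M lborel :: ((real^'d) \<times> (real^'d)) measure"
 interpret P: sigma_finite_measure ?P by (rule lborel_pair.sigma_finite_measure_axioms)
 interpret T: pair_sigma_finite ?P "lborel :: (real^'d) measure" ..
 define \<Phi> where "\<Phi> z y = F z y * rh n z y * ps y" for z y
 define f where "f = (%(q, y). \<Phi> (fst q) y * rh k (snd q) y)"
 have [measurable (raw)]: "f' \<in> borel_measurable A ==> g' \<in> borel_measurable A ==> (%p. \<Phi> (f' p) (g' p)) \<in> borel_measurable A"
  for f' g' :: "'x => real^'d" and A unfolding \<Phi>_def
  by (intro borel_measurable_times F_measurable rh_measurable measurable_compose[OF _ ps_measurable])
 have fm [measurable]: "f \<in> borel_measurable (?P \<Otimes>\<^sub>M lborel)" unfolding f_def by measurable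
 have rho1: "(NI u. ennreal (rh k u y)) = 1" for y
 proof -
  have "integrable lborel (%u. rh k u y)" using rh_integral[of k y] by (metis not_integrable_integral_eq zero_neq_one)
  then show ?thesis using rh_integral[of k y] rh_nonneg by (subst nn_integral_eq_integral) auto
 qed
 have int\<Phi>: "integrable ?P (%p. \<Phi> (fst p) (snd p))" unfolding \<Phi>_def by (rule integrable_pair)
 \<comment> \<open>By Tonelli and the unit mass of the inserted bump, integrability in three
   variables reduces to that in two.\<close>
 have int: "integrable (?P \<Otimes>\<^sub>M lborel) f"
 proof (rule integrableI_bounded[OF fm])
  have "(\<integral>\<^sup>+w. ennreal (norm (f w)) \<partial>(?P \<Otimes>\<^sub>M lborel)) = (NI y. (\<integral>\<^sup>+q. ennreal (norm (f (q, y))) \<partial>?P))"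
   by (subst T.nn_integral_snd) auto
  also have "... = (NI y. (NI z. (NI u. ennreal (norm (f ((z, u), y))))))"
   by (intro nn_integral_cong, subst lborel.nn_integral_fst[symmetric]) auto
  also have "... = (NI y. (NI z. ennreal \<bar>\<Phi> z y\<bar>))"
   using rho1 rh_nonneg
   by (simp add: f_def abs_mult ennreal_mult nn_integral_cmult)
  also have "... = (\<integral>\<^sup>+p. ennreal (norm (\<Phi> (fst p) (snd p))) \<partial>?P)"
   by (subst lborel_pair.nn_integral_snd[symmetric]) auto
  also have "... < \<infinity>" using int\<Phi> by (simp add: integrable_iff_bounded)
  finally show "(\<integral>\<^sup>+w. ennreal (norm (f w)) \<partial>(?P \<Otimes>\<^sub>M lborel)) < \<infinity>" .
 qed
 show "integrable ?P (%q. LI y. F (fst q) y * rh n (fst q) y * ps y * rh k (snd q) y)"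
  using T.integrable_fst'[OF int] by (simp add: f_def \<Phi>_def)
 have "(\<integral>q. (LI y. F (fst q) y * rh n (fst q) y * ps y * rh k (snd q) y) \<partial>?P) = (\<integral>w. f w \<partial>(?P \<Otimes>\<^sub>M lborel))"
  using T.integral_fst'[OF int] by (simp add: f_def \<Phi>_def)
 also have "... = (LI y. (\<integral>q. f (q, y) \<partial>?P))"
  using T.integral_snd[of "%q y. f (q, y)"] int by simp
 also have "... = (LI y. (LI z. \<Phi> z y))"
 proof (rule integral_cong_AE)
  have "AE y in lborel. integrable ?P (%q. f (q, y))" using T.AE_integrable_snd[of "%q y. f (q, y)"] int by simp
  then show "AE y in lborel. (\<integral>q. f (q, y) \<partial>?P) = (LI z. \<Phi> z y)"
  proof eventually_elim
   case (elim y)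
   have "(\<integral>q. f (q, y) \<partial>?P) = (LI z. (LI u. f ((z, u), y)))"
    using lborel_pair.integral_fst'[OF elim] by simp
   also have "... = (LI z. \<Phi> z y)" by (simp add: f_def rh_integral)
   finally show ?case .
  qed
 qed measurable
 finally show "S n = (\<integral>q. (LI y. F (fst q) y * rh n (fst q) y * ps y * rh k (snd q) y) \<partial>?P)"
  by (simp add: S_def \<Phi>_def)
qed

lemma integrable_y:
 assumes "z \<in> K" and g: "continuous_on UNIV g"
 shows "integrable lborel (%y. F z y * g y * ps y)"
proof -
 have "bounded (g ` K)" using compact_continuous_image[of K g] compact_K continuous_on_subset[OF g]
  by (auto intro: compact_imp_bounded)
 then obtain b where b: "!!y. y \<in> K ==> \<bar>g y\<bar> <= b" by (auto simp: bounded_iff)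
 have [measurable]: "g \<in> borel_measurable borel" using g by (rule borel_measurable_continuous_onI)
 show ?thesis
 proof (rule Bochner_Integration.integrable_bound[of _ "%y. m z * b * inverse (dl ^ N) * indicator K y"])
  show "integrable lborel (%y. m z * b * inverse (dl ^ N) * indicator K y :: real)"
   using finite_K by (intro integrable_mult_right) simp
  show "AE y in lborel. norm (F z y * g y * ps y) <= norm (m z * b * inverse (dl ^ N) * indicator K y)"
  proof (rule AE_I2)
   fix y
   show "norm (F z y * g y * ps y) <= norm (m z * b * inverse (dl ^ N) * indicator K y)"
   proof (cases "ps y = 0")
    case False
    then have y: "y \<in> K" by (rule in_K_y)
    then have b0: "0 <= b" using b[of y] by linarith
    have "\<bar>F z y\<bar> * \<bar>g y\<bar> * \<bar>ps y\<bar> <= m z * b * inverse (dl ^ N)"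
     using m(1)[of z] m(3)[OF assms(1) y] b[OF y] ps_bound[of y] b0 by (intro mult_mono) auto
    then show ?thesis using y b0 m(1)[of z] dl by (simp add: abs_mult)
   qed simp
  qed
 qed measurable
qed

lemma AE_integrable_z: "AE y in lborel. integrable lborel (%z. F z y * rh n z y * ps y)"
proof -
 have "AE y in lborel. integrable lborel (%z. (%(z, y). F z y * rh n z y * ps y) (z, y))"
  using lborel_pair.AE_integrable_snd[of "%z y. F z y * rh n z y * ps y"] integrable_pair'[of n] by simp
 then show ?thesis by simp
qed

text \<open>The bump has mass 1 in \<open>z\<close>, so the difference is an average of
  \<open>F z y - F y y\<close>, and the bump is at most a multiple of the normalised
  indicator.\<close>

lemma inner_diff_le:
 assumes elim: "integrable lborel (%z. F z y * rh n z y * ps y)"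
 shows "ennreal \<bar>(LI z. F z y * rh n z y * ps y) - diag y * ps y\<bar> <=
  ennreal (B * inverse (dl ^ N)) * (indicator K y * (NI z. ennreal (inverse (d n ^ N)) * indicator (sbox s y (d n)) z * ennreal \<bar>F z y - F y y\<bar>))"
proof (cases "ps y = 0")
 case False
 let ?c = "B * inverse (dl ^ N)"
 have c: "0 <= ?c" using B(1) dl by simp
 have y: "y \<in> K" using False by (rule in_K_y)
 have ir: "integrable lborel (%z. rh n z y)"
 proof (rule ccontr)
  assume "\<not> integrable lborel (%z. rh n z y)"
  then show False using rh_integral[of n y] not_integrable_integral_eq[of lborel "%z. rh n z y"] by simp
 qed
 then have ir': "integrable lborel (%z. diag y * ps y * rh n z y)" by simp
 have "(LI z. diag y * ps y * rh n z y) = diag y * ps y" by (simp add: rh_integral)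
 then have eq: "(LI z. F z y * rh n z y * ps y) - diag y * ps y = (LI z. F z y * rh n z y * ps y - diag y * ps y * rh n z y)"
  using Bochner_Integration.integral_diff[OF elim ir'] by simp
 have "ennreal \<bar>(LI z. F z y * rh n z y * ps y) - diag y * ps y\<bar> <= (NI z. ennreal \<bar>F z y * rh n z y * ps y - diag y * ps y * rh n z y\<bar>)"
  unfolding eq using integral_norm_bound_ennreal[OF Bochner_Integration.integrable_diff[OF elim ir']] by simp
 also have "... <= (NI z. ennreal ?c * (ennreal (inverse (d n ^ N)) * indicator (sbox s y (d n)) z * ennreal \<bar>F z y - F y y\<bar>))"
 proof (rule nn_integral_mono)
  fix z
  show "ennreal \<bar>F z y * rh n z y * ps y - diag y * ps y * rh n z y\<bar> <= ennreal ?c * (ennreal (inverse (d n ^ N)) * indicator (sbox s y (d n)) z * ennreal \<bar>F z y - F y y\<bar>)"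
  proof (cases "rh n z y = 0")
   case False
   then have zy: "z \<in> sbox s y (d n)" using rh_supp[OF False] snorm_diff_commute[of s y z] by (simp add: sbox_def)
   have "F z y * rh n z y * ps y - diag y * ps y * rh n z y = rh n z y * ps y * (F z y - F y y)"
    unfolding diag_def by (simp only: right_diff_distrib ac_simps)
   then have "\<bar>F z y * rh n z y * ps y - diag y * ps y * rh n z y\<bar> = \<bar>rh n z y\<bar> * \<bar>ps y\<bar> * \<bar>F z y - F y y\<bar>"
    by (simp only: abs_mult)
   also have "... <= (inverse (d n ^ N) * B) * inverse (dl ^ N) * \<bar>F z y - F y y\<bar>"
    using rh_bound[of n z y] ps_bound[of y] B(1) d_pos[of n] by (intro mult_right_mono mult_mono) auto
   also have "... = ?c * (inverse (d n ^ N) * \<bar>F z y - F y y\<bar>)" by (simp only: ac_simps)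
   finally have "ennreal \<bar>F z y * rh n z y * ps y - diag y * ps y * rh n z y\<bar> <= ennreal (?c * (inverse (d n ^ N) * \<bar>F z y - F y y\<bar>))"
    by (rule ennreal_leI)
   also have "... = ennreal ?c * (ennreal (inverse (d n ^ N)) * ennreal \<bar>F z y - F y y\<bar>)"
    using c d_pos[of n] by (subst ennreal_mult, simp, simp, subst ennreal_mult) auto
   finally show ?thesis using zy by simp
  qed simp
 qed
 also have "... = ennreal ?c * (NI z. ennreal (inverse (d n ^ N)) * indicator (sbox s y (d n)) z * ennreal \<bar>F z y - F y y\<bar>)"
  by (intro nn_integral_cmult) measurable
 finally show ?thesis using y by simp
qed simp

text \<open>The error is a multiple of the mean oscillation around the diagonal at scale
  \<open>d n\<close>, which \<open>F_lim\<close> sends to 0.\<close>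

lemma S_tendsto: "S \<longlonglongrightarrow> (LI y. diag y * ps y)"
proof -
 define E where "E ep = (NI y. indicator K y * (NI z. ennreal (inverse (ep ^ N)) *
    indicator (sbox s y ep) z * ennreal \<bar>F z y - F y y\<bar>))" for ep
 have dlim: "filterlim d (at_right 0) sequentially"
 proof -
  have "(%n. dl / 4 * inverse (2 ^ n)) \<longlonglongrightarrow> dl / 4 * 0"
   by (intro tendsto_mult_left LIMSEQ_inverse_realpow_zero) simp
  moreover have "d = (%n. dl / 4 * inverse (2 ^ n))" unfolding d_def[abs_def] divide_inverse by (rule refl)
  ultimately have "d \<longlonglongrightarrow> 0" by simp
  moreover have "d n \<in> {0<..} \<and> d n ~= 0" for n using d_pos[of n] by simp
  ultimately show ?thesis unfolding filterlim_at by simp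
 qed
 have E0: "(%n. E (d n)) \<longlonglongrightarrow> 0"
  using filterlim_compose[OF F_lim[OF compact_K] dlim] by (simp add: E_def)
 let ?c = "B * inverse (dl ^ N)"
 have c: "0 <= ?c" using B(1) dl by simp
 have le: "ennreal \<bar>S n - (LI y. diag y * ps y)\<bar> <= ennreal ?c * E (d n)" for n
 proof -
  have i1: "integrable lborel (%y. LI z. F z y * rh n z y * ps y)"
   by (rule lborel_pair.integrable_snd[OF integrable_pair'])
  have i2: "integrable lborel (%y. diag y * ps y)"
   using rescale_supp[OF s supp_et dl(1), of x] compact_sbox[OF s, of dl x] dl
   by (intro integrable_density_mult[OF locally_integrable_diag ps_continuous, of "sbox s x dl"]) (auto simp: ps_def)
  have eq: "S n - (LI y. diag y * ps y) = (LI y. (LI z. F z y * rh n z y * ps y) - diag y * ps y)"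
   unfolding S_def using i1 i2 by simp
  have "ennreal \<bar>S n - (LI y. diag y * ps y)\<bar> <= (NI y. ennreal \<bar>(LI z. F z y * rh n z y * ps y) - diag y * ps y\<bar>)"
   unfolding eq using integral_norm_bound_ennreal[OF Bochner_Integration.integrable_diff[OF i1 i2]] by simp
  also have "... <= (NI y. ennreal ?c * (indicator K y * (NI z. ennreal (inverse (d n ^ N)) *
    indicator (sbox s y (d n)) z * ennreal \<bar>F z y - F y y\<bar>)))"
  proof (rule nn_integral_mono_AE)
   show "AE y in lborel. ennreal \<bar>(LI z. F z y * rh n z y * ps y) - diag y * ps y\<bar> <=
     ennreal ?c * (indicator K y * (NI z. ennreal (inverse (d n ^ N)) * indicator (sbox s y (d n)) z * ennreal \<bar>F z y - F y y\<bar>))"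
    using AE_integrable_z[of n] by (rule eventually_mono) (rule inner_diff_le)
  qed
  also have "... = ennreal ?c * E (d n)"
   unfolding E_def
  proof (rule nn_integral_cmult)
   have "(%y. NI z. ennreal (inverse (d n ^ N)) * (if snorm s (z - y) <= d n then 1 else 0) * ennreal \<bar>F z y - F y y\<bar>) \<in> borel_measurable lborel"
    by measurable
   then show "(%y. indicator K y * (NI z. ennreal (inverse (d n ^ N)) * indicator (sbox s y (d n)) z * ennreal \<bar>F z y - F y y\<bar>)) \<in> borel_measurable lborel"
    by (simp add: indicator_def sbox_def cong: if_cong)
  qed
  finally show ?thesis .
 qed
 have "(%n. ennreal ?c * E (d n)) \<longlonglongrightarrow> ennreal ?c * 0" by (intro ennreal_tendsto_cmult E0) simp
 then have "(%n. ennreal \<bar>S n - (LI y. diag y * ps y)\<bar>) \<longlonglongrightarrow> ennreal 0"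
  by (intro tendsto_sandwich[OF always_eventually[OF allI] always_eventually[OF allI, OF le] tendsto_const]) auto
 then have "(%n. enn2real (ennreal \<bar>S n - (LI y. diag y * ps y)\<bar>)) \<longlonglongrightarrow> 0"
  by (rule tendsto_enn2real) simp
 then have "(%n. \<bar>S n - (LI y. diag y * ps y)\<bar>) \<longlonglongrightarrow> 0" by simp
 then have "(%n. S n - (LI y. diag y * ps y)) \<longlonglongrightarrow> 0" by (rule tendsto_rabs_zero_cancel)
 then show ?thesis by (rule LIM_zero_cancel)
qed

end

section \<open>Differences of averages at consecutive scales\<close>

context germ
begin

text \<open>The powers of |h| are those of \<open>D_norm\<close>, so the norms of \<open>G\<close>
  are controlled by the norm of the modelled distribution.\<close>

definition G :: "real ^ 'd => real ^ 'd => ennreal" where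
 "G z h = (\<Sum>ze\<in>homs. ennreal (inverse (snorm s h powr (ga - ze))) * J ze z h)"

lemma G_measurable [measurable (raw)]:
 assumes [measurable]: "f \<in> borel_measurable A" "g \<in> borel_measurable A"
 shows "(%p. G (f p) (g p)) \<in> borel_measurable A"
 unfolding G_def
proof (rule borel_measurable_sum)
 fix ze assume "ze \<in> homs"
 then have [measurable]: "(%p. J ze (f p) (g p)) \<in> borel_measurable A" by (intro J_measurable assms)
 show "(%p. ennreal (inverse (snorm s (g p) powr (ga - ze))) * J ze (f p) (g p)) \<in> borel_measurable A"
  by measurable
qed

text \<open>8 is the largest ratio of |h| to the scale of the test function: it is 4 between
  consecutive averages, and 8 between \<open>x\<close> and the centres of the coarsest average,
  where |h| is at most \<open>2 * dl = 8 * d 0\<close>.\<close>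

definition C0 :: real where "C0 = (\<Sum>ze\<in>homs. 8 powr (ga - ze))"

lemma C0_nonneg: "0 <= C0" by (simp add: C0_def sum_nonneg)

text \<open>Replaces the factor \<open>\<epsilon>\<^sup>\<zeta>\<close> by \<open>|h|\<^sup>\<zeta>\<close> up to \<open>\<epsilon>\<^sup>\<gamma> |h|\<^sup>-\<^sup>\<gamma>\<close>, for \<open>h\<close> at scale \<open>\<epsilon>\<close>.\<close>

lemma sum_J_le:
 assumes "0 < ep" "0 < snorm s h" "snorm s h <= 8 * ep"
 shows "(\<Sum>ze\<in>homs. ennreal (ep powr ze) * J ze z h) <= ennreal (C0 * ep powr ga) * G z h"
 unfolding G_def sum_distrib_left
proof (rule sum_mono)
 fix ze assume ze: "ze \<in> homs"
 have e: "0 < ga - ze" using homs(2)[OF ze] by simp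
 have "(snorm s h) powr (ga - ze) <= (8 * ep) powr (ga - ze)" using assms e by (intro powr_mono2) auto
 also have "... = 8 powr (ga - ze) * ep powr (ga - ze)" using assms by (simp add: powr_mult)
 also have "... <= C0 * ep powr (ga - ze)"
  unfolding C0_def using homs(1) ze by (intro mult_right_mono member_le_sum) auto
 finally have *: "snorm s h powr (ga - ze) <= C0 * ep powr (ga - ze)" .
 have "ep powr ze <= C0 * ep powr ga * inverse (snorm s h powr (ga - ze))"
  using assms mult_right_mono[OF *, of "ep powr ze"]
  by (simp add: field_simps powr_add[symmetric])
 then have "ennreal (ep powr ze) <= ennreal (C0 * ep powr ga) * ennreal (inverse (snorm s h powr (ga - ze)))"
  using C0_nonneg by (subst ennreal_mult[symmetric]) (auto intro: ennreal_leI)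
 then show "ennreal (ep powr ze) * J ze z h <= ennreal (C0 * ep powr ga) * (ennreal (inverse (snorm s h powr (ga - ze))) * J ze z h)"
  by (simp add: mult.assoc[symmetric] mult_right_mono)
qed

definition kmain :: "real => real ^ 'd => ennreal" where
 "kmain dl z = (NI h. scale_kernel s ga dl h * G z h)"

definition avg :: "real => (real ^ 'd => ennreal) => real ^ 'd => ennreal" where
 "avg dl g x = (NI z. ennreal (inverse (dl ^ N)) * indicator (sbox s x (2 * dl)) z * g z)"

lemma kmain_measurable [measurable]: "kmain dl \<in> borel_measurable borel"
 unfolding kmain_def[abs_def] by measurable

end

context germ_test
begin

text \<open>The integrand of \<open>S (Suc n) - S n\<close> once each average has received the bump
  of the other. Swapping the variables of one of them lets \<open>fst q\<close> carry scale
  \<open>n\<close> and \<open>snd q\<close> scale \<open>Suc n\<close> in both terms.\<close>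

definition A :: "nat => (real ^ 'd) \<times> (real ^ 'd) => real" where
 "A n q = (LI y. F (snd q) y * rh (Suc n) (snd q) y * ps y * rh n (fst q) y)
  - (LI y. F (fst q) y * rh n (fst q) y * ps y * rh (Suc n) (snd q) y)"

lemma S_Suc_diff_le: "ennreal \<bar>S (Suc n) - S n\<bar> <= (\<integral>\<^sup>+q. ennreal \<bar>A n q\<bar> \<partial>(lborel \<Otimes>\<^sub>M lborel))"
proof -
 define f where "f q = (LI y. F (fst q) y * rh (Suc n) (fst q) y * ps y * rh n (snd q) y)" for q :: "(real^'d) \<times> (real^'d)"
 define g where "g q = (LI y. F (fst q) y * rh n (fst q) y * ps y * rh (Suc n) (snd q) y)" for q :: "(real^'d) \<times> (real^'d)"
 have f: "integrable (lborel \<Otimes>\<^sub>M lborel) f" "S (Suc n) = (\<integral>q. f q \<partial>(lborel \<Otimes>\<^sub>M lborel))"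
  using S_insert[of "Suc n" n] by (auto simp: f_def[abs_def])
 have g: "integrable (lborel \<Otimes>\<^sub>M lborel) g" "S n = (\<integral>q. g q \<partial>(lborel \<Otimes>\<^sub>M lborel))"
  using S_insert[of n "Suc n"] by (auto simp: g_def[abs_def])
 have f': "integrable (lborel \<Otimes>\<^sub>M lborel) (%q. f (snd q, fst q))"
  "(\<integral>q. f (snd q, fst q) \<partial>(lborel \<Otimes>\<^sub>M lborel)) = (\<integral>q. f q \<partial>(lborel \<Otimes>\<^sub>M lborel))"
  using lborel_pair.integrable_product_swap[OF f(1)] lborel_pair.integral_product_swap[OF borel_measurable_integrable[OF f(1)]]
  by (simp_all add: case_prod_beta')
 have eq: "S (Suc n) - S n = (\<integral>q. f (snd q, fst q) - g q \<partial>(lborel \<Otimes>\<^sub>M lborel))"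
  unfolding f(2) g(2) using f' g(1) by simp
 have "ennreal \<bar>S (Suc n) - S n\<bar> <= (\<integral>\<^sup>+q. ennreal \<bar>f (snd q, fst q) - g q\<bar> \<partial>(lborel \<Otimes>\<^sub>M lborel))"
  unfolding eq using integral_norm_bound_ennreal[OF Bochner_Integration.integrable_diff[OF f'(1) g(1)]] by simp
 then show ?thesis by (simp add: f_def g_def A_def)
qed

definition C1c :: real where "C1c = 4 ^ r * B\<^sup>2 * 4 ^ N * C0"

lemma C1c_nonneg: "0 <= C1c" using C0_nonneg by (simp add: C1c_def)

text \<open>Both terms share the factor of two bumps and \<open>ps\<close>, so only the increment of
  \<open>F\<close> from z to z + h remains. Seen from z + h at the scale of the finer bump the other
  two factors are slowly varying, and \<open>bump_localize\<close> makes the product admissible for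
  \<open>J_bound\<close>.\<close>

lemma A_le:
 "ennreal \<bar>A n (z, z + h)\<bar> <= ennreal (C1c * dl powr ga) * (ennreal (inverse (dl ^ N)) * indicator (sbox s x (2 * dl)) z *
   (ennreal (2 powr (- real n * ga) * inverse ((dl / 2 ^ n) ^ N)) * indicator {h. 0 < snorm s h \<and> snorm s h <= 2 * (dl / 2 ^ n)} h * G z h))"
proof (cases "\<exists>y. rh n z y ~= 0 \<and> rh (Suc n) (z + h) y ~= 0 \<and> ps y ~= 0")
 case False
 then have z0: "F (z + h) y * rh (Suc n) (z + h) y * ps y * rh n z y = 0"
  "F z y * rh n z y * ps y * rh (Suc n) (z + h) y = 0" for y by auto
 have "A n (z, z + h) = 0" unfolding A_def fst_conv snd_conv z0 by simp
 then show ?thesis by simp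
next
 case True
 then obtain y0 where y0: "rh n z y0 ~= 0" "rh (Suc n) (z + h) y0 ~= 0" "ps y0 ~= 0" by blast
 have zK: "z \<in> K" "z + h \<in> K" using y0 in_K_z by blast+
 have zx: "z \<in> sbox s x (2 * dl)" using near_x[OF y0(3,1)] by (simp add: sbox_def)
 \<comment> \<open>Both bumps meet \<open>y0\<close>, so the centres are at most
   \<open>d n + d (Suc n)\<close> apart.\<close>
 have h_le: "snorm s h <= 2 * d n"
  using sbox_triangle[OF s rh_supp[OF y0(2)] rh_supp[OF y0(1)]] d_Suc[of n] d_pos[of n] by simp
 have rhc: "continuous_on UNIV (rh k w)" for k w
  unfolding rh_def using C_class_continuous[OF C_class_rescale[OF C_class_bump]] .
 have i1: "integrable lborel (%y. F (z + h) y * (rh (Suc n) (z + h) y * rh n z y) * ps y)"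
  and i2: "integrable lborel (%y. F z y * (rh (Suc n) (z + h) y * rh n z y) * ps y)"
  by (intro integrable_y zK continuous_on_mult rhc)+
 have A_eq: "A n (z, z + h) = (LI y. (F (z + h) y - F z y) * (rh (Suc n) (z + h) y * (rh n z y * ps y)))"
 proof -
  have "A n (z, z + h) = (LI y. F (z + h) y * (rh (Suc n) (z + h) y * rh n z y) * ps y) - (LI y. F z y * (rh (Suc n) (z + h) y * rh n z y) * ps y)"
   by (simp add: A_def mult.commute mult.left_commute)
  also have "... = (LI y. F (z + h) y * (rh (Suc n) (z + h) y * rh n z y) * ps y - F z y * (rh (Suc n) (z + h) y * rh n z y) * ps y)"
   using i1 i2 by simp
  finally show ?thesis by (simp add: algebra_simps)
 qed
 show ?thesis
 proof (cases "h = 0")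
  case True
  then have "A n (z, z + h) = 0" unfolding A_eq by simp
  then show ?thesis by simp
 next
  case False
  then have h0: "0 < snorm s h" using snorm_eq_0_iff[OF s, of h] snorm_nonneg[of s h] by linarith
  have h1: "snorm s h < 1" using h_le d_le[of n] dl by linarith
  let ?ep = "d (Suc n)"
  have ep: "0 < ?ep" "?ep <= d n" "?ep <= dl" "?ep < 1" using d_pos[of "Suc n"] d_Suc[of n] d_le[of "Suc n"] dl by auto
  define a where "a = 2 ^ r * (inverse (d n ^ N) * B) * (inverse (dl ^ N) * 1)"
  have a: "0 < a" unfolding a_def using d_pos[of n] dl B(1) by simp
  have "Cb r a (%v. (%y. rh n z y * ps y) (\<chi> i. (z + h) $ i + ?ep ^ s i * v $ i))"
   unfolding a_def rh_def ps_def
   by (intro Cb_mult Cb_rescale_at_finer_scale B(2) B_tests_Cb[OF et] ep)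
  from bump_localize[OF s ep(1) this a] obtain ph where ph: "ph \<in> B_tests s r"
   "!!y. rh (Suc n) (z + h) y * (rh n z y * ps y) = 2 ^ r * B * a * rescale s ph ?ep (z + h) y"
   unfolding rh_def B_def by blast
  have eq: "A n (z, z + h) = (LI y. (2 ^ r * B * a) * ((F (z + h) y - F z y) * rescale s ph ?ep (z + h) y))"
   unfolding A_eq ph(2) by (simp add: mult.commute mult.left_commute)
  have "ennreal \<bar>A n (z, z + h)\<bar> = ennreal (2 ^ r * B * a) * ennreal \<bar>LI y. (F (z + h) y - F z y) * rescale s ph ?ep (z + h) y\<bar>"
   unfolding eq integral_mult_right_zero using a B(1) by (simp add: abs_mult ennreal_mult)
  also have "... <= ennreal (2 ^ r * B * a) * (\<Sum>ze\<in>homs. ennreal (?ep powr ze) * J ze z h)"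
   by (intro mult_left_mono J_bound h0 h1 ph ep) auto
  also have "... <= ennreal (2 ^ r * B * a) * (ennreal (C0 * ?ep powr ga) * G z h)"
   using h_le d_Suc[of n] ep(1) by (intro mult_left_mono sum_J_le h0) auto
  also have "... = ennreal (2 ^ r * B * a * (C0 * ?ep powr ga)) * G z h"
   using a B(1) C0_nonneg by (simp add: ennreal_mult mult.assoc)
  also have "... <= ennreal (C1c * dl powr ga * (inverse (dl ^ N) * (2 powr (- real n * ga) * inverse ((dl / 2 ^ n) ^ N)))) * G z h"
  proof (intro mult_right_mono ennreal_leI)
   \<comment> \<open>The power \<open>ga\<close> of this scale supplies the weight of layer
     \<open>n\<close>; positivity of \<open>ga\<close> makes these weights summable.\<close>
   have "?ep <= dl * 2 powr (- real n)" using dl by (simp add: d_def powr_minus powr_realpow field_simps)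
   then have "?ep powr ga <= (dl * 2 powr (- real n)) powr ga" using ep(1) ga by (intro powr_mono2) auto
   also have "... = dl powr ga * 2 powr (- real n * ga)" using dl by (simp add: powr_mult powr_powr)
   finally have e: "?ep powr ga <= dl powr ga * 2 powr (- real n * ga)" .
   have da: "inverse (d n ^ N) = 4 ^ N * inverse ((dl / 2 ^ n) ^ N)"
    using dl by (simp add: d_def power_divide field_simps)
   have "2 ^ r * B * a * (C0 * ?ep powr ga) <= 2 ^ r * B * a * (C0 * (dl powr ga * 2 powr (- real n * ga)))"
    using e a B(1) C0_nonneg by (intro mult_left_mono) auto
   also have "... = C1c * dl powr ga * (inverse (dl ^ N) * (2 powr (- real n * ga) * inverse ((dl / 2 ^ n) ^ N)))"
   proof -
    have "(4::real) ^ r = 2 ^ r * 2 ^ r" by (simp add: power_mult_distrib[symmetric])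
    then show ?thesis unfolding a_def C1c_def da power2_eq_square by (simp only: mult_1_right ac_simps)
   qed
   finally show "2 ^ r * B * a * (C0 * ?ep powr ga) <= C1c * dl powr ga * (inverse (dl ^ N) * (2 powr (- real n * ga) * inverse ((dl / 2 ^ n) ^ N)))" .
  qed auto
  also have "... = ennreal (C1c * dl powr ga) * (ennreal (inverse (dl ^ N)) *
    (ennreal (2 powr (- real n * ga) * inverse ((dl / 2 ^ n) ^ N)) * G z h))"
  proof -
   have "ennreal (C1c * dl powr ga * (inverse (dl ^ N) * (2 powr (- real n * ga) * inverse ((dl / 2 ^ n) ^ N))))
    = ennreal (C1c * dl powr ga) * ennreal (inverse (dl ^ N) * (2 powr (- real n * ga) * inverse ((dl / 2 ^ n) ^ N)))"
    using C1c_nonneg dl by (intro ennreal_mult) auto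
   also have "ennreal (inverse (dl ^ N) * (2 powr (- real n * ga) * inverse ((dl / 2 ^ n) ^ N)))
    = ennreal (inverse (dl ^ N)) * ennreal (2 powr (- real n * ga) * inverse ((dl / 2 ^ n) ^ N))"
    using dl by (intro ennreal_mult) auto
   finally show ?thesis by (simp add: mult.assoc)
  qed
  finally have *: "ennreal \<bar>A n (z, z + h)\<bar> <= ennreal (C1c * dl powr ga) * (ennreal (inverse (dl ^ N)) *
    (ennreal (2 powr (- real n * ga) * inverse ((dl / 2 ^ n) ^ N)) * G z h))" .
  have "2 * d n <= 2 * (dl / 2 ^ n)" using dl by (simp add: d_def field_simps)
  then have ind: "indicator {h. 0 < snorm s h \<and> snorm s h <= 2 * (dl / 2 ^ n)} h = (1::ennreal)"
   "indicator (sbox s x (2 * dl)) z = (1::ennreal)" using h0 h_le zx by (auto simp: indicator_def)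
  show ?thesis unfolding ind using * by simp
 qed
qed

lemma telescope_le:
 fixes T :: "nat => real"
 assumes "T \<longlonglongrightarrow> L"
 shows "ennreal \<bar>L - T 0\<bar> <= (\<Sum>n. ennreal \<bar>T (Suc n) - T n\<bar>)"
proof (rule LIMSEQ_le_const2)
 show "(%m. ennreal \<bar>T m - T 0\<bar>) \<longlonglongrightarrow> ennreal \<bar>L - T 0\<bar>"
  by (intro tendsto_ennrealI tendsto_rabs tendsto_diff assms tendsto_const)
 have "ennreal \<bar>T m - T 0\<bar> <= (\<Sum>n. ennreal \<bar>T (Suc n) - T n\<bar>)" for m
 proof -
  have "\<bar>T m - T 0\<bar> = \<bar>\<Sum>n<m. T (Suc n) - T n\<bar>" by (simp add: sum_lessThan_telescope)
  also have "... <= (\<Sum>n<m. \<bar>T (Suc n) - T n\<bar>)" by (rule sum_abs)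
  finally have "ennreal \<bar>T m - T 0\<bar> <= ennreal (\<Sum>n<m. \<bar>T (Suc n) - T n\<bar>)" by (rule ennreal_leI)
  also have "... = (\<Sum>n<m. ennreal \<bar>T (Suc n) - T n\<bar>)" by (intro sum_ennreal[symmetric]) auto
  also have "... <= (\<Sum>n. ennreal \<bar>T (Suc n) - T n\<bar>)" by (rule sum_le_suminf) auto
  finally show ?thesis .
 qed
 then show "\<exists>N. \<forall>n\<ge>N. ennreal \<bar>T n - T 0\<bar> <= (\<Sum>n. ennreal \<bar>T (Suc n) - T n\<bar>)" by blast
qed

lemma reconstruction_minus_S0_le:
 "ennreal \<bar>(LI y. diag y * ps y) - S 0\<bar> <= ennreal (C1c * dl powr ga) * avg dl (kmain dl) x"
proof -
 define k where "k n h = ennreal (2 powr (- real n * ga) * inverse ((dl / 2 ^ n) ^ N)) *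
   indicator {h. 0 < snorm s h \<and> snorm s h <= 2 * (dl / 2 ^ n)} h" for n h
 have [measurable]: "k n \<in> borel_measurable borel" for n unfolding k_def[abs_def] by measurable
 have kk: "scale_kernel s ga dl h = (\<Sum>n. k n h)" for h by (simp add: scale_kernel_def k_def)
 define w where "w z = ennreal (inverse (dl ^ N)) * indicator (sbox s x (2 * dl)) z" for z
 have [measurable]: "w \<in> borel_measurable borel" unfolding w_def[abs_def] by measurable
 let ?c = "ennreal (C1c * dl powr ga)"
 have A_meas [measurable]: "A n \<in> borel_measurable (lborel \<Otimes>\<^sub>M lborel)" for n
  unfolding A_def[abs_def] by measurable
 have step: "ennreal \<bar>S (Suc n) - S n\<bar> <= ?c * (NI z. w z * (NI h. k n h * G z h))" for n
 proof -
  have "ennreal \<bar>S (Suc n) - S n\<bar> <= (\<integral>\<^sup>+q. ennreal \<bar>A n q\<bar> \<partial>(lborel \<Otimes>\<^sub>M lborel))" by (rule S_Suc_diff_le)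
  also have "... = (NI z. (NI u. ennreal \<bar>A n (z, u)\<bar>))"
   by (subst lborel.nn_integral_fst[symmetric]) auto
  also have "... = (NI z. (NI h. ennreal \<bar>A n (z, z + h)\<bar>))"
  proof (rule nn_integral_cong)
   fix z
   have "(%u. ennreal \<bar>A n (z, u)\<bar>) \<in> borel_measurable borel" by measurable
   from nn_integral_lborel_translate[OF this, of z]
   show "(NI u. ennreal \<bar>A n (z, u)\<bar>) = (NI h. ennreal \<bar>A n (z, z + h)\<bar>)" by simp
  qed
  also have "... <= (NI z. (NI h. ?c * (w z * (k n h * G z h))))"
   unfolding w_def k_def by (intro nn_integral_mono A_le)
  also have "... = ?c * (NI z. w z * (NI h. k n h * G z h))"
   by (simp add: nn_integral_cmult)
  finally show ?thesis .
 qed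
 have "ennreal \<bar>(LI y. diag y * ps y) - S 0\<bar> <= (\<Sum>n. ennreal \<bar>S (Suc n) - S n\<bar>)"
  by (rule telescope_le[OF S_tendsto])
 also have "... <= (\<Sum>n. ?c * (NI z. w z * (NI h. k n h * G z h)))"
  by (intro suminf_le step) auto
 also have "... = ?c * (\<Sum>n. NI z. w z * (NI h. k n h * G z h))" by (rule ennreal_suminf_cmult)
 also have "(\<Sum>n. NI z. w z * (NI h. k n h * G z h)) = (NI z. (\<Sum>n. w z * (NI h. k n h * G z h)))"
  by (intro nn_integral_suminf[symmetric]) measurable
 also have "... = (NI z. w z * kmain dl z)"
 proof (rule nn_integral_cong)
  fix z
  have "(\<Sum>n. w z * (NI h. k n h * G z h)) = w z * (\<Sum>n. NI h. k n h * G z h)" by (rule ennreal_suminf_cmult)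
  also have "(\<Sum>n. NI h. k n h * G z h) = (NI h. (\<Sum>n. k n h * G z h))"
   by (intro nn_integral_suminf[symmetric]) measurable
  also have "... = kmain dl z"
   unfolding kmain_def kk by (intro nn_integral_cong ennreal_suminf_multc)
  finally show "(\<Sum>n. w z * (NI h. k n h * G z h)) = w z * kmain dl z" .
 qed
 finally show ?thesis by (simp add: avg_def w_def)
qed

section \<open>The coarsest average and the pointwise error bound\<close>

definition C2c :: real where "C2c = 2 ^ r * B * C0"

lemma C2c_nonneg: "0 <= C2c" using C0_nonneg B(1) by (simp add: C2c_def)

lemma localize_0: "\<exists>ph\<in>B_tests s r. \<forall>y. rh 0 z y * ps y = 2 ^ r * B * inverse (dl ^ N) * rescale s ph (d 0) z y"
proof -
 have "Cb r (inverse (dl ^ N) * 1) (%v. ps (\<chi> i. z $ i + d 0 ^ s i * v $ i))"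
  unfolding ps_def using d_pos[of 0] d_le[of 0] dl by (intro Cb_rescale_at_finer_scale B_tests_Cb[OF et]) auto
 from bump_localize[OF s d_pos this] dl show ?thesis by (simp add: rh_def B_def)
qed

lemma S0_eq: "S 0 = (LI z. (LI y. F z y * rh 0 z y * ps y))"
 and S0_integrable: "integrable lborel (%z. LI y. F z y * rh 0 z y * ps y)"
proof -
 have i: "integrable (lborel \<Otimes>\<^sub>M lborel) (%(z, y). F z y * rh 0 z y * ps y)"
  by (rule integrable_pair')
 show "S 0 = (LI z. (LI y. F z y * rh 0 z y * ps y))"
  unfolding S_def using lborel_pair.Fubini_integral[OF i] by simp
 show "integrable lborel (%z. LI y. F z y * rh 0 z y * ps y)"
  using lborel_pair.integrable_fst[OF i] .
qed

text \<open>The coarsest average is not a difference, so the majorants \<open>M\<close> of the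
  values enter. The factor \<open>4 powr \<bar>ze\<bar>\<close> pays for replacing
  \<open>d 0 = dl / 4\<close> by \<open>dl\<close>, whatever the sign of \<open>ze\<close>.\<close>

lemma S0_le:
 "ennreal \<bar>S 0\<bar> <= (\<Sum>ze\<in>homs. ennreal (2 ^ r * B * 4 powr \<bar>ze\<bar> * dl powr ze) * avg dl (M ze) x)"
proof -
 let ?w = "%z. ennreal (inverse (dl ^ N)) * indicator (sbox s x (2 * dl)) z"
 have [measurable]: "ze \<in> homs ==> M ze \<in> borel_measurable borel" for ze by (rule M_meas)
 have "ennreal \<bar>S 0\<bar> <= (NI z. ennreal \<bar>LI y. F z y * rh 0 z y * ps y\<bar>)"
  unfolding S0_eq using integral_norm_bound_ennreal[OF S0_integrable] by simp
 also have "... <= (NI z. (\<Sum>ze\<in>homs. ennreal (2 ^ r * B * 4 powr \<bar>ze\<bar> * dl powr ze) * (?w z * M ze z)))"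
 proof (rule nn_integral_mono)
  fix z
  show "ennreal \<bar>LI y. F z y * rh 0 z y * ps y\<bar> <= (\<Sum>ze\<in>homs. ennreal (2 ^ r * B * 4 powr \<bar>ze\<bar> * dl powr ze) * (?w z * M ze z))"
  proof (cases "\<exists>y. rh 0 z y ~= 0 \<and> ps y ~= 0")
   case False
   then have "(%y. F z y * rh 0 z y * ps y) = (%y. 0)" by auto
   then show ?thesis by simp
  next
   case True
   then have zx: "z \<in> sbox s x (2 * dl)" using near_x by (auto simp: sbox_def)
   obtain ph where ph: "ph \<in> B_tests s r" "!!y. rh 0 z y * ps y = 2 ^ r * B * inverse (dl ^ N) * rescale s ph (d 0) z y"
    using localize_0[of z] by blast
   have eq: "(LI y. F z y * rh 0 z y * ps y) = (LI y. (2 ^ r * B * inverse (dl ^ N)) * (F z y * rescale s ph (d 0) z y))"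
    unfolding mult.assoc[of "F z _"] ph(2) by (simp add: mult.commute mult.left_commute)
   have "ennreal \<bar>LI y. F z y * rh 0 z y * ps y\<bar> = ennreal (2 ^ r * B * inverse (dl ^ N)) * ennreal \<bar>LI y. F z y * rescale s ph (d 0) z y\<bar>"
    unfolding eq integral_mult_right_zero using B(1) dl by (simp add: abs_mult ennreal_mult)
   also have "... <= ennreal (2 ^ r * B * inverse (dl ^ N)) * (\<Sum>ze\<in>homs. ennreal (d 0 powr ze) * M ze z)"
    by (intro mult_left_mono M_bound ph d_pos d_lt_1) auto
   also have "... <= (\<Sum>ze\<in>homs. ennreal (2 ^ r * B * 4 powr \<bar>ze\<bar> * dl powr ze) * (?w z * M ze z))"
    unfolding sum_distrib_left
   proof (rule sum_mono)
    fix ze assume "ze \<in> homs"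
    have "d 0 powr ze = dl powr ze / 4 powr ze" using dl by (simp add: d_def powr_divide)
    also have "... = dl powr ze * 4 powr (- ze)" by (simp only: powr_minus divide_inverse)
    also have "... <= dl powr ze * 4 powr \<bar>ze\<bar>" by (intro mult_left_mono powr_mono) auto
    finally have le: "2 ^ r * B * inverse (dl ^ N) * d 0 powr ze <= 2 ^ r * B * inverse (dl ^ N) * (dl powr ze * 4 powr \<bar>ze\<bar>)"
     using B(1) dl by (intro mult_left_mono) auto
    have "ennreal (2 ^ r * B * inverse (dl ^ N)) * ennreal (d 0 powr ze) <= ennreal (2 ^ r * B * 4 powr \<bar>ze\<bar> * dl powr ze) * ennreal (inverse (dl ^ N))"
     using B(1) dl le by (subst (1 2) ennreal_mult[symmetric]) (auto intro!: ennreal_leI simp: ac_simps)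
    then have "ennreal (2 ^ r * B * inverse (dl ^ N)) * ennreal (d 0 powr ze) * M ze z <= ennreal (2 ^ r * B * 4 powr \<bar>ze\<bar> * dl powr ze) * ennreal (inverse (dl ^ N)) * M ze z"
     by (rule mult_right_mono) simp
    then show "ennreal (2 ^ r * B * inverse (dl ^ N)) * (ennreal (d 0 powr ze) * M ze z) <= ennreal (2 ^ r * B * 4 powr \<bar>ze\<bar> * dl powr ze) * (?w z * M ze z)"
     using zx by (simp add: mult.assoc)
   qed
   finally show ?thesis .
  qed
 qed
 also have "... = (\<Sum>ze\<in>homs. ennreal (2 ^ r * B * 4 powr \<bar>ze\<bar> * dl powr ze) * avg dl (M ze) x)"
  unfolding avg_def by (subst nn_integral_sum) (auto simp: nn_integral_cmult intro!: sum.cong)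
 finally show ?thesis .
qed

end

text \<open>Collects the constants of the telescoping sum, of its start and of the crude bound. It
  depends on the scaling, the order and the homogeneities only, and hence is common to all
  germs.\<close>

definition germ_const :: "('d::finite => nat) => nat => real => real set => real" where
 "germ_const s r ga homs =
   4 ^ r * (bump_bound TYPE('d) r)\<^sup>2 * 4 ^ hom_dim s * (\<Sum>ze\<in>homs. 8 powr (ga - ze))
   + 2 ^ r * bump_bound TYPE('d) r * (\<Sum>ze\<in>homs. 8 powr (ga - ze))
   + (\<Sum>ze\<in>homs. 2 ^ r * bump_bound TYPE('d) r * 4 powr \<bar>ze\<bar> * 4 powr (ga - ze))"

context germ_test
begin

lemma germ_const_ge:
 shows "C1c <= germ_const s r ga homs" "C2c <= germ_const s r ga homs"
  "ze \<in> homs ==> 2 ^ r * B * 4 powr \<bar>ze\<bar> * 4 powr (ga - ze) <= germ_const s r ga homs"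
proof -
 let ?S = "\<Sum>ze\<in>homs. 2 ^ r * B * 4 powr \<bar>ze\<bar> * 4 powr (ga - ze)"
 have eq: "germ_const s r ga homs = C1c + C2c + ?S"
  unfolding germ_const_def C1c_def C2c_def C0_def B_def ..
 have "0 <= ?S" using B(1) by (intro sum_nonneg) simp
 then show "C1c <= germ_const s r ga homs" "C2c <= germ_const s r ga homs"
  using C1c_nonneg C2c_nonneg unfolding eq by linarith+
 assume "ze \<in> homs"
 then have "2 ^ r * B * 4 powr \<bar>ze\<bar> * 4 powr (ga - ze) <= ?S"
  using homs(1) B(1) by (intro member_le_sum) auto
 then show "2 ^ r * B * 4 powr \<bar>ze\<bar> * 4 powr (ga - ze) <= germ_const s r ga homs"
  using C1c_nonneg C2c_nonneg unfolding eq by linarith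
qed

lemma start_le:
 assumes dl4: "dl <= 1 / 4"
 shows "ennreal \<bar>S 0 - (LI y. F x y * ps y)\<bar> <= ennreal (C2c * dl powr ga) * kmain dl x"
proof -
 have xK: "x \<in> K" by (simp add: K_def sbox_def snorm_eq_0_iff[OF s, THEN iffD2])
 let ?P = "lborel \<Otimes>\<^sub>M lborel :: ((real^'d) \<times> (real^'d)) measure"
 have i1: "integrable ?P (%p. F (fst p) (snd p) * rh 0 (fst p) (snd p) * ps (snd p))" by (rule integrable_pair)
 have i2: "integrable ?P (%p. F x (snd p) * rh 0 (fst p) (snd p) * ps (snd p))"
 proof (rule integrable_pair_bounded[of "%z. F x" "%z. m x"])
  show "(%p. F x (snd p)) \<in> borel_measurable ?P" by measurable
  show "0 <= m x" by (rule m(1))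
  show "integrable lborel (%z. indicator K z * m x)"
   using finite_K by (intro integrable_mult_left) simp
  show "y \<in> K ==> \<bar>F x y\<bar> <= m x" for y by (rule m(3)[OF xK])
 qed
 define T where "T z = (LI y. (F z y - F x y) * (rh 0 z y * ps y))" for z
 define f where "f p = (F (fst p) (snd p) - F x (snd p)) * (rh 0 (fst p) (snd p) * ps (snd p))" for p
 have f_eq: "f p = F (fst p) (snd p) * rh 0 (fst p) (snd p) * ps (snd p) - F x (snd p) * rh 0 (fst p) (snd p) * ps (snd p)" for p
  unfolding f_def by (simp only: left_diff_distrib mult.assoc)
 have fi: "integrable ?P f" unfolding f_eq[abs_def] by (rule Bochner_Integration.integrable_diff[OF i1 i2])
 have Ti: "integrable lborel T" and TI: "(LI z. T z) = (\<integral>p. f p \<partial>?P)"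
  using lborel_pair.integrable_fst'[OF fi] lborel_pair.integral_fst'[OF fi] by (simp_all add: T_def[abs_def] f_def[abs_def])
 have e1: "(\<integral>p. F (fst p) (snd p) * rh 0 (fst p) (snd p) * ps (snd p) \<partial>?P) = S 0"
  unfolding S0_eq using lborel_pair.integral_fst'[OF i1] by simp
 have e2: "(\<integral>p. F x (snd p) * rh 0 (fst p) (snd p) * ps (snd p) \<partial>?P) = (LI y. F x y * ps y)"
 proof -
  have "integrable ?P (case_prod (%z y. F x y * rh 0 z y * ps y))" using i2 by (simp add: case_prod_beta')
  from lborel_pair.integral_snd[OF this]
  have "(\<integral>p. F x (snd p) * rh 0 (fst p) (snd p) * ps (snd p) \<partial>?P) = (LI y. (LI z. F x y * rh 0 z y * ps y))"
   by (simp add: case_prod_beta')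
  also have "... = (LI y. F x y * ps y)"
  proof (rule Bochner_Integration.integral_cong[OF refl])
   fix y
   have "(LI z. F x y * ps y * rh 0 z y) = F x y * ps y" by (simp add: rh_integral)
   then show "(LI z. F x y * rh 0 z y * ps y) = F x y * ps y" by (simp only: ac_simps)
  qed
  finally show ?thesis .
 qed
 have eq: "S 0 - (LI y. F x y * ps y) = (LI z. T z)"
  unfolding TI f_eq Bochner_Integration.integral_diff[OF i1 i2] e1 e2 ..
 have "ennreal \<bar>S 0 - (LI y. F x y * ps y)\<bar> <= (NI z. ennreal \<bar>T z\<bar>)"
  unfolding eq using integral_norm_bound_ennreal[OF Ti] by simp
 also have "... = (NI h. ennreal \<bar>T (x + h)\<bar>)"
 proof -
  have [measurable]: "T \<in> borel_measurable borel" using borel_measurable_integrable[OF Ti] by simp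
  show ?thesis by (rule nn_integral_lborel_translate[symmetric]) measurable
 qed
 also have "... <= (NI h. ennreal (C2c * dl powr ga) * (scale_kernel s ga dl h * G x h))"
 proof (rule nn_integral_mono)
  fix h
  show "ennreal \<bar>T (x + h)\<bar> <= ennreal (C2c * dl powr ga) * (scale_kernel s ga dl h * G x h)"
  proof (cases "h = 0 \<or> (\<forall>y. rh 0 (x + h) y = 0 \<or> ps y = 0)")
   case True
   then have z0: "(F (x + h) y - F x y) * (rh 0 (x + h) y * ps y) = 0" for y by auto
   have "T (x + h) = 0" unfolding T_def z0 by simp
   then show ?thesis by simp
  next
   case False
   then obtain y0 where y0: "rh 0 (x + h) y0 ~= 0" "ps y0 ~= 0" by blast
   have d0: "d 0 = dl / 4" by (simp add: d_def)
   have h_le: "snorm s h <= 2 * dl" using near_x[OF y0(2,1)] by simp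
   have h0: "0 < snorm s h" using False snorm_eq_0_iff[OF s, of h] snorm_nonneg[of s h] by linarith
   have h1: "snorm s h < 1" using h_le dl4 by linarith
   obtain ph where ph: "ph \<in> B_tests s r" "!!y. rh 0 (x + h) y * ps y = 2 ^ r * B * inverse (dl ^ N) * rescale s ph (d 0) (x + h) y"
    using localize_0[of "x + h"] by blast
   have eq: "T (x + h) = (LI y. (2 ^ r * B * inverse (dl ^ N)) * ((F (x + h) y - F x y) * rescale s ph (d 0) (x + h) y))"
    unfolding T_def ph(2) by (simp only: ac_simps)
   have "ennreal \<bar>T (x + h)\<bar> = ennreal (2 ^ r * B * inverse (dl ^ N)) * ennreal \<bar>LI y. (F (x + h) y - F x y) * rescale s ph (d 0) (x + h) y\<bar>"
    unfolding eq integral_mult_right_zero using B(1) dl by (simp add: abs_mult ennreal_mult)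
   also have "... <= ennreal (2 ^ r * B * inverse (dl ^ N)) * (\<Sum>ze\<in>homs. ennreal (d 0 powr ze) * J ze x h)"
    by (intro mult_left_mono J_bound h0 h1 ph d_pos d_lt_1) auto
   also have "... <= ennreal (2 ^ r * B * inverse (dl ^ N)) * (ennreal (C0 * d 0 powr ga) * G x h)"
    using h_le d0 by (intro mult_left_mono sum_J_le h0 d_pos) auto
   also have "... <= ennreal (2 ^ r * B * inverse (dl ^ N)) * (ennreal (C0 * dl powr ga) * G x h)"
    using d0 dl ga C0_nonneg by (intro mult_left_mono mult_right_mono ennreal_leI powr_mono2) auto
   also have "... = ennreal (C2c * dl powr ga) * (ennreal (inverse (dl ^ N)) * G x h)"
   proof -
    have "ennreal (2 ^ r * B * inverse (dl ^ N)) * ennreal (C0 * dl powr ga) = ennreal (2 ^ r * B * inverse (dl ^ N) * (C0 * dl powr ga))"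
     using B(1) C0_nonneg dl by (intro ennreal_mult[symmetric]) auto
    also have "2 ^ r * B * inverse (dl ^ N) * (C0 * dl powr ga) = C2c * dl powr ga * inverse (dl ^ N)"
     unfolding C2c_def by (simp only: ac_simps)
    also have "ennreal ... = ennreal (C2c * dl powr ga) * ennreal (inverse (dl ^ N))"
     using C2c_nonneg dl by (intro ennreal_mult) auto
    finally show ?thesis by (simp only: mult.assoc[symmetric])
   qed
   also have "... <= ennreal (C2c * dl powr ga) * (scale_kernel s ga dl h * G x h)"
   proof (intro mult_left_mono mult_right_mono)
    let ?k = "%n. ennreal (2 powr (- real n * ga) * inverse ((dl / 2 ^ n) ^ hom_dim s)) *
      indicator {h. 0 < snorm s h \<and> snorm s h <= 2 * (dl / 2 ^ n)} h"
    have "ennreal (inverse (dl ^ N)) = (\<Sum>n<1. ?k n)" using h0 h_le by simp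
    also have "... <= (\<Sum>n. ?k n)" by (rule sum_le_suminf) auto
    finally show "ennreal (inverse (dl ^ N)) <= scale_kernel s ga dl h" unfolding scale_kernel_def .
   qed auto
   finally show ?thesis .
  qed
 qed
 also have "... = ennreal (C2c * dl powr ga) * kmain dl x"
  unfolding kmain_def by (rule nn_integral_cmult) measurable
 finally show ?thesis .
qed

lemma ennreal_divide_powr_le:
 assumes "ennreal \<bar>u\<bar> <= U" shows "ennreal (\<bar>u\<bar> / dl powr c) <= ennreal (dl powr - c) * U"
proof -
 have "ennreal (\<bar>u\<bar> / dl powr c) = ennreal (dl powr - c) * ennreal \<bar>u\<bar>"
  by (subst ennreal_mult[symmetric]) (auto simp: powr_minus divide_inverse mult.commute)
 also have "... <= ennreal (dl powr - c) * U" by (intro mult_left_mono assms) simp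
 finally show ?thesis .
qed

text \<open>The error is split at \<open>S 0\<close>. Above the scale 1/4 the start is bounded by
  the sizes of its two parts, which is harmless since negative powers of \<open>dl\<close> are
  bounded there.\<close>

lemma error_le:
 assumes "dl < 1"
 shows "ennreal (\<bar>(LI y. diag y * ps y) - (LI y. F x y * ps y)\<bar> / dl powr ga) <= ennreal (germ_const s r ga homs) *
  (avg dl (kmain dl) x + kmain dl x + indicator {1/4<..} dl * (\<Sum>ze\<in>homs. avg dl (M ze) x + M ze x))"
proof -
 let ?g = "ennreal (germ_const s r ga homs)"
 let ?D = "LI y. diag y * ps y" and ?X = "LI y. F x y * ps y"
 have dd: "dl powr - ga * (c * dl powr ga) = c" for c using dl by (simp add: powr_minus)
 have cancel: "ennreal (dl powr - ga) * (ennreal (c * dl powr ga) * U) = ennreal c * U" if "0 <= c" for c U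
  using that by (subst mult.assoc[symmetric], subst ennreal_mult[symmetric]) (auto simp: dd)
 have 1: "ennreal (\<bar>?D - S 0\<bar> / dl powr ga) <= ?g * avg dl (kmain dl) x"
 proof -
  have "ennreal (\<bar>?D - S 0\<bar> / dl powr ga) <= ennreal C1c * avg dl (kmain dl) x"
   using ennreal_divide_powr_le[OF reconstruction_minus_S0_le, of ga] unfolding cancel[OF C1c_nonneg] .
  also have "... <= ?g * avg dl (kmain dl) x" by (intro mult_right_mono ennreal_leI germ_const_ge) auto
  finally show ?thesis .
 qed
 have 2: "ennreal (\<bar>S 0 - ?X\<bar> / dl powr ga) <= ?g * (kmain dl x + indicator {1/4<..} dl * (\<Sum>ze\<in>homs. avg dl (M ze) x + M ze x))"
 proof (cases "dl <= 1 / 4")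
  case True
  have "ennreal (\<bar>S 0 - ?X\<bar> / dl powr ga) <= ennreal C2c * kmain dl x"
   using ennreal_divide_powr_le[OF start_le[OF True], of ga] unfolding cancel[OF C2c_nonneg] .
  also have "... <= ?g * kmain dl x" by (intro mult_right_mono ennreal_leI germ_const_ge) auto
  finally show ?thesis using True by simp
 next
  case False
  let ?c = "%ze. ennreal (2 ^ r * B * 4 powr \<bar>ze\<bar> * dl powr ze)"
  have "ennreal \<bar>S 0 - ?X\<bar> <= ennreal (\<bar>S 0\<bar> + \<bar>?X\<bar>)" by (intro ennreal_leI) linarith
  also have "... = ennreal \<bar>S 0\<bar> + ennreal \<bar>?X\<bar>" by simp
  also have "... <= (\<Sum>ze\<in>homs. ?c ze * avg dl (M ze) x) + (\<Sum>ze\<in>homs. ennreal (dl powr ze) * M ze x)"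
   using M_bound[OF et dl(1) assms, of x] unfolding ps_def[symmetric] by (intro add_mono S0_le)
  also have "... <= (\<Sum>ze\<in>homs. ?c ze * avg dl (M ze) x) + (\<Sum>ze\<in>homs. ?c ze * M ze x)"
  proof (intro add_left_mono sum_mono mult_right_mono ennreal_leI)
   fix ze :: real
   have "1 * 1 * 1 <= 2 ^ r * B * 4 powr \<bar>ze\<bar>"
    using B(1) by (intro mult_mono ge_one_powr_ge_zero) auto
   then show "dl powr ze <= 2 ^ r * B * 4 powr \<bar>ze\<bar> * dl powr ze" using mult_right_mono[of 1 _ "dl powr ze"] by simp
  qed auto
  also have "... = (\<Sum>ze\<in>homs. ?c ze * (avg dl (M ze) x + M ze x))" by (simp add: sum.distrib distrib_left)
  finally have "ennreal (\<bar>S 0 - ?X\<bar> / dl powr ga) <= ennreal (dl powr - ga) * (\<Sum>ze\<in>homs. ?c ze * (avg dl (M ze) x + M ze x))"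
   by (rule ennreal_divide_powr_le)
  also have "... <= (\<Sum>ze\<in>homs. ?g * (avg dl (M ze) x + M ze x))"
   unfolding sum_distrib_left mult.assoc[symmetric]
  proof (intro sum_mono mult_right_mono)
   fix ze assume ze: "ze \<in> homs"
   have "ennreal (dl powr - ga) * ?c ze = ennreal (dl powr - ga * (2 ^ r * B * 4 powr \<bar>ze\<bar> * dl powr ze))"
    using B(1) by (intro ennreal_mult[symmetric]) auto
   also have "dl powr - ga * (2 ^ r * B * 4 powr \<bar>ze\<bar> * dl powr ze) = 2 ^ r * B * 4 powr \<bar>ze\<bar> * (dl powr (ze - ga))"
    using dl by (simp add: powr_diff powr_minus field_simps)
   also have "... <= 2 ^ r * B * 4 powr \<bar>ze\<bar> * 4 powr (ga - ze)"
   proof (intro mult_left_mono)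
    \<comment> \<open>The exponent is negative, so the power is largest at the lower end
      1/4.\<close>
    have "dl powr (ze - ga) <= (1/4) powr (ze - ga)" using False homs(2)[OF ze] by (intro powr_mono2') auto
    also have "... = 4 powr (ga - ze)" by (simp add: powr_divide powr_diff)
    finally show "dl powr (ze - ga) <= 4 powr (ga - ze)" .
   qed (use B(1) in auto)
   also have "... <= germ_const s r ga homs" by (rule germ_const_ge(3)[OF ze])
   finally show "ennreal (dl powr - ga) * ?c ze <= ?g" by (simp add: ennreal_leI)
  qed auto
  also have "... = ?g * (0 + indicator {1/4<..} dl * (\<Sum>ze\<in>homs. avg dl (M ze) x + M ze x))"
   using False by (simp add: sum_distrib_left[symmetric])
  also have "... <= ?g * (kmain dl x + indicator {1/4<..} dl * (\<Sum>ze\<in>homs. avg dl (M ze) x + M ze x))"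
   by (intro mult_left_mono add_right_mono) auto
  finally show ?thesis .
 qed
 have "\<bar>?D - ?X\<bar> / dl powr ga <= \<bar>?D - S 0\<bar> / dl powr ga + \<bar>S 0 - ?X\<bar> / dl powr ga"
  unfolding add_divide_distrib[symmetric] by (intro divide_right_mono) auto
 then have "ennreal (\<bar>?D - ?X\<bar> / dl powr ga) <= ennreal (\<bar>?D - S 0\<bar> / dl powr ga + \<bar>S 0 - ?X\<bar> / dl powr ga)"
  by (rule ennreal_leI)
 also have "... = ennreal (\<bar>?D - S 0\<bar> / dl powr ga) + ennreal (\<bar>S 0 - ?X\<bar> / dl powr ga)" by (intro ennreal_plus) auto
 also have "... <= ?g * avg dl (kmain dl) x + ?g * (kmain dl x + indicator {1/4<..} dl * (\<Sum>ze\<in>homs. avg dl (M ze) x + M ze x))"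
  by (intro add_mono 1 2)
 finally show ?thesis by (simp only: distrib_left[symmetric] add.assoc)
qed

text \<open>For the Besov norm nothing is subtracted: \<open>S 0\<close> is of order dl^ze and the
  telescoping sum of order dl^ga, and all these exponents are at least \<open>a + e\<close>.\<close>

lemma value_le:
 assumes e: "!!ze. ze \<in> homs ==> a + e <= ze"
 shows "ennreal (\<bar>LI y. diag y * ps y\<bar> / dl powr a) <=
  ennreal (germ_const s r ga homs) * (ennreal (dl powr e) * (avg dl (kmain dl) x + (\<Sum>ze\<in>homs. avg dl (M ze) x)))"
proof -
 let ?g = "ennreal (germ_const s r ga homs)"
 let ?D = "LI y. diag y * ps y"
 have g0: "0 <= germ_const s r ga homs" using germ_const_ge(1) C1c_nonneg by linarith
 have dp: "dl powr - a * dl powr b <= dl powr e" if "a + e <= b" for b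
  using dl that by (simp add: powr_add[symmetric] powr_mono')
 have bd: "ennreal (dl powr - a) * (ennreal (c * dl powr b) * U) <= ?g * (ennreal (dl powr e) * U)"
  if "0 <= c" "c <= germ_const s r ga homs" "a + e <= b" for b c U
 proof -
  have "dl powr - a * (c * dl powr b) = c * (dl powr - a * dl powr b)" by simp
  also have "... <= germ_const s r ga homs * dl powr e"
   using that(1,2) g0 dp[OF that(3)] by (intro mult_mono) auto
  finally have "ennreal (dl powr - a) * ennreal (c * dl powr b) <= ?g * ennreal (dl powr e)"
   using that(1) g0 by (subst (1 2) ennreal_mult[symmetric]) (auto intro: ennreal_leI)
  from mult_right_mono[OF this, of U] show ?thesis by (simp add: mult.assoc)
 qed
 have 1: "ennreal (\<bar>?D - S 0\<bar> / dl powr a) <= ?g * (ennreal (dl powr e) * avg dl (kmain dl) x)"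
 proof (cases "homs = {}")
  \<comment> \<open>Without homogeneities \<open>ga\<close> cannot be compared with
    \<open>a + e\<close>, but then \<open>C0\<close> is 0 and the telescoping sum vanishes.\<close>
  case True
  have "C1c = 0" by (subst C1c_def, subst C0_def, subst True) simp
  then have "?D = S 0" using reconstruction_minus_S0_le by simp
  then show ?thesis by simp
 next
  case False
  then obtain ze where "ze \<in> homs" by blast
  then have "a + e <= ga" using e[of ze] homs(2)[of ze] by linarith
  then show ?thesis
   by (intro order_trans[OF ennreal_divide_powr_le[OF reconstruction_minus_S0_le, of a]] bd C1c_nonneg germ_const_ge)
 qed
 have 2: "ennreal (\<bar>S 0\<bar> / dl powr a) <= ?g * (ennreal (dl powr e) * (\<Sum>ze\<in>homs. avg dl (M ze) x))"
 proof -
  have "ennreal (\<bar>S 0\<bar> / dl powr a) <= ennreal (dl powr - a) * (\<Sum>ze\<in>homs. ennreal (2 ^ r * B * 4 powr \<bar>ze\<bar> * dl powr ze) * avg dl (M ze) x)"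
   by (rule ennreal_divide_powr_le[OF S0_le])
  also have "... <= (\<Sum>ze\<in>homs. ?g * (ennreal (dl powr e) * avg dl (M ze) x))"
   unfolding sum_distrib_left
  proof (intro sum_mono bd e)
   fix ze assume ze: "ze \<in> homs"
   show "0 <= 2 ^ r * B * 4 powr \<bar>ze\<bar>" using B(1) by simp
   have "1 <= (4::real) powr (ga - ze)" using homs(2)[OF ze] by (intro ge_one_powr_ge_zero) auto
   then have "2 ^ r * B * 4 powr \<bar>ze\<bar> * 1 <= 2 ^ r * B * 4 powr \<bar>ze\<bar> * 4 powr (ga - ze)" using B(1) by (intro mult_left_mono) auto
   also have "... <= germ_const s r ga homs" by (rule germ_const_ge(3)[OF ze])
   finally show "2 ^ r * B * 4 powr \<bar>ze\<bar> <= germ_const s r ga homs" by simp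
  qed
  finally show ?thesis by (simp only: sum_distrib_left[symmetric])
 qed
 have "\<bar>?D\<bar> / dl powr a <= \<bar>?D - S 0\<bar> / dl powr a + \<bar>S 0\<bar> / dl powr a"
  unfolding add_divide_distrib[symmetric] by (intro divide_right_mono) auto
 then have "ennreal (\<bar>?D\<bar> / dl powr a) <= ennreal (\<bar>?D - S 0\<bar> / dl powr a + \<bar>S 0\<bar> / dl powr a)" by (rule ennreal_leI)
 also have "... = ennreal (\<bar>?D - S 0\<bar> / dl powr a) + ennreal (\<bar>S 0\<bar> / dl powr a)" by (intro ennreal_plus) auto
 also have "... <= ?g * (ennreal (dl powr e) * avg dl (kmain dl) x) + ?g * (ennreal (dl powr e) * (\<Sum>ze\<in>homs. avg dl (M ze) x))"
  by (intro add_mono 1 2)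
 finally show ?thesis by (simp only: distrib_left[symmetric])
qed

end

section \<open>Bounds in L^p at a fixed scale\<close>

context germ
begin

lemma avg_eq:
 assumes [measurable]: "g \<in> borel_measurable borel"
 shows "avg dl g x = (NI h. ennreal (inverse (dl ^ N)) * indicator (sbox s 0 (2 * dl)) h * g (x + h))"
proof -
 have "avg dl g x = (NI h. ennreal (inverse (dl ^ N)) * indicator (sbox s x (2 * dl)) (x + h) * g (x + h))"
  unfolding avg_def by (rule nn_integral_lborel_translate[symmetric]) measurable
 moreover have "indicator (sbox s x (2 * dl)) (x + h) = (indicator (sbox s 0 (2 * dl)) h :: ennreal)" for h
  by (simp add: indicator_def sbox_def)
 ultimately show ?thesis by simp
qed

lemma avg_measurable [measurable]:
 assumes [measurable]: "g \<in> borel_measurable borel"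
 shows "avg dl g \<in> borel_measurable borel"
 unfolding avg_eq[OF assms, abs_def] by measurable

definition c2 :: ennreal where "c2 = ennreal (2 ^ CARD('d) * 2 ^ N)"

text \<open>Minkowski's inequality and translation invariance; \<open>c2\<close> is the mass of the
  averaging kernel.\<close>

lemma avg_Lp:
 assumes [measurable]: "g \<in> borel_measurable borel" and p: "1 <= p" and dl: "0 < dl"
 shows "Lp p (avg dl g) <= c2 * Lp p g"
proof -
 let ?w = "%h. ennreal (inverse (dl ^ N)) * indicator (sbox s 0 (2 * dl)) h :: ennreal"
 have "Lp p (avg dl g) = Lp p (%x. NI h. ?w h * g (x + h))"
  by (intro Lp_norm_cong avg_eq assms)
 also have "... <= (NI h. Lp p (%x. ?w h * g (x + h)))"
  by (intro Minkowski_integral lborel.sigma_finite_measure_axioms p) measurable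
 also have "... <= (NI h. ?w h * Lp p g)"
 proof (rule nn_integral_mono)
  fix h
  have "Lp p (%x. ?w h * g (x + h)) <= ?w h * Lp p (%x. g (x + h))"
   by (intro Lp_norm_cmult_le p) measurable
  also have "Lp p (%x. g (x + h)) = Lp p g"
   using Lp_norm_translate[OF assms(1), of p h] by (simp add: add.commute)
  finally show "Lp p (%x. ?w h * g (x + h)) <= ?w h * Lp p g" .
 qed
 also have "... = ennreal (inverse (dl ^ N)) * emeasure lborel (sbox s 0 (2 * dl)) * Lp p g"
  by (simp add: nn_integral_multc nn_integral_cmult)
 also have "ennreal (inverse (dl ^ N)) * emeasure lborel (sbox s 0 (2 * dl)) = c2"
  using dl by (subst emeasure_sbox[OF s], simp, subst ennreal_mult[symmetric])
   (auto simp: c2_def power_mult_distrib)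
 finally show ?thesis .
qed

text \<open>The inner norm of the increment term in the germ norm, as a function of
  \<open>h\<close>; the kernel acts on it.\<close>

definition omega :: "ennreal => real => real ^ 'd => ennreal" where
 "omega p ze h = Lp p (%x. ennreal (inverse (snorm s h powr (ga - ze))) * J ze x h)"

lemma omega_measurable [measurable]:
 assumes "ze \<in> homs"
 shows "omega p ze \<in> borel_measurable borel"
 unfolding omega_def[abs_def]
proof (rule Lp_norm_measurable[OF lborel.sigma_finite_measure_axioms])
 have [measurable]: "(%q. J ze (fst q) (snd q)) \<in> borel_measurable (lborel \<Otimes>\<^sub>M borel)"
  using assms by (intro J_measurable) auto
 show "(%(x, h). ennreal (inverse (snorm s h powr (ga - ze))) * J ze x h) \<in> borel_measurable (lborel \<Otimes>\<^sub>M borel)"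
  unfolding case_prod_beta' by measurable
qed

lemma omega_supp:
 assumes "1 <= p" "omega p ze h ~= 0"
 shows "0 < snorm s h \<and> snorm s h < 1"
proof (rule ccontr)
 assume "\<not> ?thesis"
 then have "J ze x h = 0" for x using J_supp[of ze x h] by blast
 then have "omega p ze h = 0" unfolding omega_def using assms(1) by simp
 then show False using assms(2) by simp
qed

lemma kmain_Lp:
 assumes p: "1 <= p"
 shows "Lp p (kmain dl) <= (\<Sum>ze\<in>homs. NI h. scale_kernel s ga dl h * omega p ze h)"
proof -
 have "Lp p (kmain dl) <= (NI h. Lp p (%x. scale_kernel s ga dl h * G x h))"
  unfolding kmain_def[abs_def] by (intro Minkowski_integral lborel.sigma_finite_measure_axioms p) measurable
 also have "... <= (NI h. (\<Sum>ze\<in>homs. scale_kernel s ga dl h * omega p ze h))"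
 proof (rule nn_integral_mono)
  fix h
  have [measurable]: "(%x. J ze x h) \<in> borel_measurable borel" if "ze \<in> homs" for ze
   using that by (intro J_measurable) auto
  have "Lp p (%x. scale_kernel s ga dl h * G x h) <= scale_kernel s ga dl h * Lp p (%x. G x h)"
   by (intro Lp_norm_cmult_le p) measurable
  also have "... <= scale_kernel s ga dl h * (\<Sum>ze\<in>homs. omega p ze h)"
   unfolding G_def omega_def
   by (intro mult_left_mono Lp_norm_sum_le lborel.sigma_finite_measure_axioms p homs(1)) auto
  finally show "Lp p (%x. scale_kernel s ga dl h * G x h) <= (\<Sum>ze\<in>homs. scale_kernel s ga dl h * omega p ze h)"
   by (simp add: sum_distrib_left)
 qed
 also have "... = (\<Sum>ze\<in>homs. NI h. scale_kernel s ga dl h * omega p ze h)"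
  by (rule nn_integral_sum) auto
 finally show ?thesis .
qed

abbreviation "Kom p dl \<equiv> (\<Sum>ze\<in>homs. NI h. scale_kernel s ga dl h * omega p ze h)"
abbreviation "MLp p \<equiv> (\<Sum>ze\<in>homs. Lp p (M ze))"

lemma sum_avg_M_Lp:
 assumes p: "1 <= p" and dl: "0 < dl"
 shows "Lp p (%x. \<Sum>ze\<in>homs. avg dl (M ze) x) <= c2 * MLp p"
proof -
 have "Lp p (%x. \<Sum>ze\<in>homs. avg dl (M ze) x) <= (\<Sum>ze\<in>homs. Lp p (avg dl (M ze)))"
  using M_meas by (intro Lp_norm_sum_le lborel.sigma_finite_measure_axioms p homs(1)) auto
 also have "... <= (\<Sum>ze\<in>homs. c2 * Lp p (M ze))" by (intro sum_mono avg_Lp M_meas p dl)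
 finally show ?thesis by (simp only: sum_distrib_left)
qed

text \<open>A measurable majorant of the error, the same for all test functions. Minkowski and the
  triangle inequality are applied to it and not to the supremum over test functions.\<close>

definition err :: "real => real ^ 'd => ennreal" where
 "err dl x = ennreal (germ_const s r ga homs) *
   (avg dl (kmain dl) x + kmain dl x + indicator {1/4<..} dl * (\<Sum>ze\<in>homs. avg dl (M ze) x + M ze x))"

lemma err_measurable [measurable]: "err dl \<in> borel_measurable borel"
proof -
 have [measurable]: "M ze \<in> borel_measurable borel" if "ze \<in> homs" for ze by (rule M_meas[OF that])
 have [measurable]: "(%x. \<Sum>ze\<in>homs. avg dl (M ze) x + M ze x) \<in> borel_measurable borel" by (rule borel_measurable_sum) measurable
 show ?thesis unfolding err_def[abs_def] by measurable
qed

lemma error_le_err: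
 assumes et: "et \<in> B_tests s r" and dl: "0 < dl" "dl < 1"
 shows "ennreal (\<bar>(LI y. diag y * rescale s et dl x y) - (LI y. F x y * rescale s et dl x y)\<bar> / dl powr ga) <= err dl x"
proof -
 note lt1 = dl(2)
 interpret germ_test s r ga F homs J M et dl x using et dl by unfold_locales auto
 show ?thesis using error_le[OF lt1] unfolding ps_def err_def .
qed

lemma err_Lp:
 assumes p: "1 <= p" and dl: "0 < dl"
 shows "Lp p (err dl)
  <= ennreal (germ_const s r ga homs) * ((c2 + 1) * Kom p dl + indicator {1/4<..} dl * ((c2 + 1) * MLp p))"
proof -
 let ?g = "ennreal (germ_const s r ga homs)"
 let ?A = "%x. \<Sum>ze\<in>homs. avg dl (M ze) x + M ze x"
 have [measurable]: "M ze \<in> borel_measurable borel" if "ze \<in> homs" for ze by (rule M_meas[OF that])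
 have Am [measurable]: "?A \<in> borel_measurable borel" by (rule borel_measurable_sum) measurable
 have "Lp p (err dl) <= ?g * Lp p (%x. avg dl (kmain dl) x + kmain dl x + indicator {1/4<..} dl * ?A x)"
  unfolding err_def[abs_def] by (intro Lp_norm_cmult_le p) measurable
 also have "... <= ?g * ((c2 + 1) * Kom p dl + indicator {1/4<..} dl * ((c2 + 1) * MLp p))"
 proof (rule mult_left_mono)
  have "Lp p (%x. avg dl (kmain dl) x + kmain dl x + indicator {1/4<..} dl * ?A x)
   <= Lp p (%x. avg dl (kmain dl) x + kmain dl x) + Lp p (%x. indicator {1/4<..} dl * ?A x)"
   by (intro Lp_norm_add_le lborel.sigma_finite_measure_axioms p) measurable
  also have "... <= (c2 + 1) * Kom p dl + indicator {1/4<..} dl * ((c2 + 1) * MLp p)"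
  proof (rule add_mono)
   have "Lp p (%x. avg dl (kmain dl) x + kmain dl x) <= Lp p (avg dl (kmain dl)) + Lp p (kmain dl)"
    by (intro Lp_norm_add_le lborel.sigma_finite_measure_axioms p) measurable
   also have "... <= c2 * Lp p (kmain dl) + 1 * Lp p (kmain dl)"
    unfolding mult_1 by (intro add_right_mono avg_Lp p dl kmain_measurable)
   also have "... = (c2 + 1) * Lp p (kmain dl)" by (simp only: distrib_right)
   also have "... <= (c2 + 1) * Kom p dl" by (intro mult_left_mono kmain_Lp p) auto
   finally show "Lp p (%x. avg dl (kmain dl) x + kmain dl x) <= (c2 + 1) * Kom p dl" .
   have "Lp p (%x. indicator {1/4<..} dl * ?A x) <= indicator {1/4<..} dl * Lp p ?A"
    by (intro Lp_norm_cmult_le p) measurable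
   also have "... <= indicator {1/4<..} dl * ((c2 + 1) * MLp p)"
   proof (rule mult_left_mono)
    have "Lp p ?A = Lp p (%x. (\<Sum>ze\<in>homs. avg dl (M ze) x) + (\<Sum>ze\<in>homs. M ze x))"
     by (simp only: sum.distrib)
    also have "... <= Lp p (%x. \<Sum>ze\<in>homs. avg dl (M ze) x) + Lp p (%x. \<Sum>ze\<in>homs. M ze x)"
     by (intro Lp_norm_add_le lborel.sigma_finite_measure_axioms p) auto
    also have "... <= c2 * MLp p + 1 * MLp p"
     unfolding mult_1 by (intro add_mono sum_avg_M_Lp p dl Lp_norm_sum_le lborel.sigma_finite_measure_axioms homs(1)) auto
    finally show "Lp p ?A <= (c2 + 1) * MLp p" by (simp only: distrib_right)
   qed simp
   finally show "Lp p (%x. indicator {1/4<..} dl * ?A x) <= indicator {1/4<..} dl * ((c2 + 1) * MLp p)" .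
  qed
  finally show "Lp p (%x. avg dl (kmain dl) x + kmain dl x + indicator {1/4<..} dl * ?A x)
   <= (c2 + 1) * Kom p dl + indicator {1/4<..} dl * ((c2 + 1) * MLp p)" .
 qed simp
 finally show ?thesis .
qed

lemma error_Lp:
 assumes p: "1 <= p" and dl: "0 < dl" "dl < 1"
 shows "Lp p (%x. SUP et\<in>B_tests s r. ennreal (\<bar>(LI y. diag y * rescale s et dl x y) -
   (LI y. F x y * rescale s et dl x y)\<bar> / dl powr ga))
  <= ennreal (germ_const s r ga homs) * ((c2 + 1) * Kom p dl + indicator {1/4<..} dl * ((c2 + 1) * MLp p))"
 by (rule order_trans[OF _ err_Lp[OF p dl(1)]]) (intro Lp_norm_mono SUP_least error_le_err dl)

text \<open>The set \<open>E\<close> allows for the smaller class of test functions that annihilate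
  polynomials.\<close>

lemma value_Lp:
 assumes p: "1 <= p" and dl: "0 < dl" "dl <= 1" and e: "!!ze. ze \<in> homs ==> a + e <= ze" and E: "E \<subseteq> B_tests s r"
 shows "Lp p (%x. SUP et\<in>E. ennreal (\<bar>LI y. diag y * rescale s et dl x y\<bar> / dl powr a))
  <= ennreal (germ_const s r ga homs) * (ennreal (dl powr e) * (c2 * (Kom p dl + MLp p)))"
proof -
 let ?g = "ennreal (germ_const s r ga homs)"
 have [measurable]: "M ze \<in> borel_measurable borel" if "ze \<in> homs" for ze by (rule M_meas[OF that])
 have "Lp p (%x. SUP et\<in>E. ennreal (\<bar>LI y. diag y * rescale s et dl x y\<bar> / dl powr a))
  <= Lp p (%x. ?g * (ennreal (dl powr e) * (avg dl (kmain dl) x + (\<Sum>ze\<in>homs. avg dl (M ze) x))))"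
 proof (intro Lp_norm_mono SUP_least)
  fix x et assume "et \<in> E"
  then have et: "et \<in> B_tests s r" using E by blast
  interpret germ_test s r ga F homs J M et dl x using et dl by unfold_locales auto
  show "ennreal (\<bar>LI y. diag y * rescale s et dl x y\<bar> / dl powr a)
   <= ?g * (ennreal (dl powr e) * (avg dl (kmain dl) x + (\<Sum>ze\<in>homs. avg dl (M ze) x)))"
   using value_le[of a e] e unfolding ps_def by simp
 qed
 also have "... <= ?g * Lp p (%x. ennreal (dl powr e) * (avg dl (kmain dl) x + (\<Sum>ze\<in>homs. avg dl (M ze) x)))"
  by (intro Lp_norm_cmult_le p) auto
 also have "... <= ?g * (ennreal (dl powr e) * Lp p (%x. avg dl (kmain dl) x + (\<Sum>ze\<in>homs. avg dl (M ze) x)))"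
  by (intro mult_left_mono Lp_norm_cmult_le p) auto
 also have "... <= ?g * (ennreal (dl powr e) * (Lp p (avg dl (kmain dl)) + Lp p (%x. \<Sum>ze\<in>homs. avg dl (M ze) x)))"
  by (intro mult_left_mono Lp_norm_add_le lborel.sigma_finite_measure_axioms p) auto
 also have "... <= ?g * (ennreal (dl powr e) * (c2 * Kom p dl + c2 * MLp p))"
  by (intro mult_left_mono add_mono sum_avg_M_Lp order_trans[OF avg_Lp[OF kmain_measurable]] kmain_Lp p dl) auto
 finally show ?thesis by (simp only: distrib_left)
qed

definition germ_norm :: "ennreal => ennreal => ennreal" where
 "germ_norm p q = (\<Sum>ze\<in>homs. Lp p (M ze) + Lb s q (omega p ze))"

lemma MLp_le: "MLp p <= germ_norm p q"
 and W_le: "(\<Sum>ze\<in>homs. Lb s q (omega p ze)) <= germ_norm p q"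
 unfolding germ_norm_def by (intro sum_mono; simp)+

end

section \<open>Bounds in L^q over the scales\<close>

definition kernel_const :: "('d::finite => nat) => real => ennreal => real" where
 "kernel_const s ga q = (SOME C. 0 < C \<and> (\<forall>om\<in>borel_measurable borel. (\<forall>h. om h ~= 0 --> 0 < snorm s h \<and> snorm s h < 1) -->
   Ls q (%dl. NI h. scale_kernel s ga dl h * om h) <= ennreal C * Lb s q om \<and>
   (\<forall>dl>0. (NI h. scale_kernel s ga dl h * om h) <= ennreal C * Lb s q om)))"

lemma kernel_const:
 assumes "scaling s" "0 < ga" "1 <= q"
 shows "0 < kernel_const s ga q"
  and "om \<in> borel_measurable borel ==> (!!h. om h ~= 0 ==> 0 < snorm s h \<and> snorm s h < 1) ==>
   Ls q (%dl. NI h. scale_kernel s ga dl h * om h) <= ennreal (kernel_const s ga q) * Lb s q om"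
  and "om \<in> borel_measurable borel ==> (!!h. om h ~= 0 ==> 0 < snorm s h \<and> snorm s h < 1) ==> 0 < dl ==>
   (NI h. scale_kernel s ga dl h * om h) <= ennreal (kernel_const s ga q) * Lb s q om"
 using someI_ex[OF scale_kernel_Lq[OF assms]] unfolding kernel_const_def[symmetric] by blast+

context germ
begin

lemma Kom_le:
 assumes "1 <= p" "1 <= q" "0 < dl"
 shows "Kom p dl <= ennreal (kernel_const s ga q) * germ_norm p q"
proof -
 have "Kom p dl <= (\<Sum>ze\<in>homs. ennreal (kernel_const s ga q) * Lb s q (omega p ze))"
  by (intro sum_mono kernel_const(3)[OF s ga assms(2)] omega_measurable omega_supp[OF assms(1)] assms(3))
 also have "... <= ennreal (kernel_const s ga q) * germ_norm p q"
  unfolding sum_distrib_left[symmetric] by (intro mult_left_mono W_le) simp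
 finally show ?thesis .
qed

lemma Kom_measurable: "(%dl. Kom p dl) \<in> borel_measurable scale_measure01"
 by (rule borel_measurable_sum) measurable

lemma Kom_Lq:
 assumes p: "1 <= p" and q: "1 <= q"
 shows "Ls q (%dl. Kom p dl) <= ennreal (kernel_const s ga q) * germ_norm p q"
proof -
 have "Ls q (%dl. Kom p dl) <= (\<Sum>ze\<in>homs. Ls q (%dl. NI h. scale_kernel s ga dl h * omega p ze h))"
  by (intro Lp_norm_sum_le sigma_finite_scale_measure01 q homs(1)) measurable
 also have "... <= (\<Sum>ze\<in>homs. ennreal (kernel_const s ga q) * Lb s q (omega p ze))"
  by (intro sum_mono kernel_const(2)[OF s ga q] omega_measurable omega_supp[OF p])
 also have "... <= ennreal (kernel_const s ga q) * germ_norm p q"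
  unfolding sum_distrib_left[symmetric] by (intro mult_left_mono W_le) simp
 finally show ?thesis .
qed

text \<open>The 1 serves the bound at a single scale in \<open>err_Lp'\<close>; the norm of 4 dl
  serves the scales above 1/4 in \<open>error_Lq\<close>.\<close>

definition error_const :: "ennreal => ennreal" where
 "error_const q = ennreal (germ_const s r ga homs) * ((c2 + 1) * (ennreal (kernel_const s ga q) + (1 + ennreal 4 * Ls q (%dl. ennreal (dl powr 1)))))"

lemma error_const_finite:
 assumes "1 <= q"
 shows "error_const q < top"
proof -
 have "Ls q (%dl. ennreal (dl powr 1)) < top"
  by (rule Lq_scale_powr[OF s ga assms]) simp
 then show ?thesis unfolding error_const_def c2_def
  by (intro ennreal_mult_less_top[THEN iffD2] disjI2 conjI ennreal_add_less_top[THEN iffD2] ennreal_less_top ennreal_one_less_top)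
qed

lemma err_Lp':
 assumes p: "1 <= p" and q: "1 <= q" and dl: "0 < dl"
 shows "Lp p (err dl) <= error_const q * germ_norm p q"
proof -
 let ?k = "ennreal (kernel_const s ga q)" and ?g = "ennreal (germ_const s r ga homs)"
 have i: "indicator {1/4<..} dl * ((c2 + 1) * MLp p) <= 1 * ((c2 + 1) * germ_norm p q)"
  by (intro mult_mono MLp_le) (auto simp: indicator_def)
 have k: "(c2 + 1) * Kom p dl <= (c2 + 1) * (?k * germ_norm p q)"
  by (intro mult_left_mono Kom_le p q dl) simp
 have "?g * ((c2 + 1) * Kom p dl + indicator {1/4<..} dl * ((c2 + 1) * MLp p)) <= ?g * ((c2 + 1) * (?k * germ_norm p q) + (c2 + 1) * germ_norm p q)"
  using mult_left_mono[OF add_mono[OF k i], of ?g] by simp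
 also have "... = ?g * ((c2 + 1) * (?k + 1)) * germ_norm p q" by (simp only: distrib_left distrib_right mult_1_right mult_1_left ac_simps)
 also have "... <= error_const q * germ_norm p q"
  unfolding error_const_def by (intro mult_right_mono mult_left_mono add_left_mono) auto
 finally show ?thesis using err_Lp[OF p dl] by (rule order_trans[rotated])
qed

lemma error_Lq:
 assumes p: "1 <= p" and q: "1 <= q"
 shows "Ls q (%dl. Lp p (%x. SUP et\<in>B_tests s r. ennreal (\<bar>(LI y. diag y * rescale s et dl x y) -
   (LI y. F x y * rescale s et dl x y)\<bar> / dl powr ga))) <= error_const q * germ_norm p q"
proof -
 let ?k = "ennreal (kernel_const s ga q)" and ?g = "ennreal (germ_const s r ga homs)"
 let ?I = "%dl::real. ennreal (dl powr 1)"
 let ?c = "c2 + 1"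
 have Km: "(%dl. Kom p dl) \<in> borel_measurable scale_measure01" by (rule Kom_measurable)
 have Im: "?I \<in> borel_measurable scale_measure01" by measurable
 have IM: "(%dl. (ennreal 4 * MLp p) * ?I dl) \<in> borel_measurable scale_measure01" by measurable
 have "Ls q (%dl. Lp p (%x. SUP et\<in>B_tests s r. ennreal (\<bar>(LI y. diag y * rescale s et dl x y) -
   (LI y. F x y * rescale s et dl x y)\<bar> / dl powr ga)))
  <= Ls q (%dl. (?g * ?c) * (Kom p dl + (ennreal 4 * MLp p) * ?I dl))"
 proof (rule Lp_norm_scale_mono)
  fix dl :: real assume dl: "0 < dl" "dl < 1"
  \<comment> \<open>The majorant 4 dl lies in L^q of the scales for every \<open>q\<close>, which
    the constant 1 does not for finite \<open>q\<close>.\<close>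
  have "indicator {1/4<..} dl <= ennreal 4 * ?I dl"
   using dl by (subst ennreal_mult[symmetric]) (auto simp: indicator_def ennreal_ge_1)
  then have "indicator {1/4<..} dl * (?c * MLp p) <= (ennreal 4 * ?I dl) * (?c * MLp p)" by (rule mult_right_mono) simp
  also have "... = ?c * ((ennreal 4 * MLp p) * ?I dl)" by (simp only: ac_simps)
  finally have "?g * (?c * Kom p dl + indicator {1/4<..} dl * (?c * MLp p)) <= ?g * (?c * Kom p dl + ?c * ((ennreal 4 * MLp p) * ?I dl))"
   by (intro mult_left_mono add_left_mono) auto
  also have "... = (?g * ?c) * (Kom p dl + (ennreal 4 * MLp p) * ?I dl)" by (simp only: distrib_left[symmetric] mult.assoc)
  finally show "Lp p (%x. SUP et\<in>B_tests s r. ennreal (\<bar>(LI y. diag y * rescale s et dl x y) -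
   (LI y. F x y * rescale s et dl x y)\<bar> / dl powr ga)) <= (?g * ?c) * (Kom p dl + (ennreal 4 * MLp p) * ?I dl)"
   using error_Lp[OF p dl] by (rule order_trans[rotated])
 qed
 also have "... <= (?g * ?c) * Ls q (%dl. Kom p dl + (ennreal 4 * MLp p) * ?I dl)"
  by (rule Lp_norm_cmult_le[OF q borel_measurable_add[OF Km IM]])
 also have "... <= (?g * ?c) * (Ls q (%dl. Kom p dl) + Ls q (%dl. (ennreal 4 * MLp p) * ?I dl))"
  by (rule mult_left_mono[OF Lp_norm_add_le[OF sigma_finite_scale_measure01 q Km IM]]) simp
 also have "... <= (?g * ?c) * (?k * germ_norm p q + (ennreal 4 * germ_norm p q) * Ls q ?I)"
 proof (intro mult_left_mono add_mono Kom_Lq p q)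
  have "Ls q (%dl. (ennreal 4 * MLp p) * ?I dl) <= (ennreal 4 * MLp p) * Ls q ?I"
   by (intro Lp_norm_cmult_le q Im)
  also have "... <= (ennreal 4 * germ_norm p q) * Ls q ?I"
   by (intro mult_right_mono mult_left_mono MLp_le) auto
  finally show "Ls q (%dl. (ennreal 4 * MLp p) * ?I dl) <= (ennreal 4 * germ_norm p q) * Ls q ?I" .
 qed simp
 also have "... = ?g * (?c * (?k + ennreal 4 * Ls q ?I)) * germ_norm p q"
  by (simp only: distrib_left distrib_right ac_simps)
 also have "... <= error_const q * germ_norm p q"
  unfolding error_const_def by (intro mult_right_mono mult_left_mono add_left_mono) auto
 finally show ?thesis .
qed

definition value_const :: "ennreal => ennreal" where
 "value_const q = ennreal (germ_const s r ga homs) * (c2 * (ennreal (kernel_const s ga q) + 1))"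

lemma value_const_finite: "value_const q < top"
 unfolding value_const_def c2_def
 by (intro ennreal_mult_less_top[THEN iffD2] disjI2 conjI ennreal_add_less_top[THEN iffD2] ennreal_less_top ennreal_one_less_top)

lemma value_Lp':
 assumes p: "1 <= p" and q: "1 <= q" and dl: "0 < dl" "dl <= 1" and e: "!!ze. ze \<in> homs ==> a + e <= ze" and E: "E \<subseteq> B_tests s r"
 shows "Lp p (%x. SUP et\<in>E. ennreal (\<bar>LI y. diag y * rescale s et dl x y\<bar> / dl powr a))
  <= (value_const q * germ_norm p q) * ennreal (dl powr e)"
proof -
 let ?k = "ennreal (kernel_const s ga q)" and ?g = "ennreal (germ_const s r ga homs)"
 have "?g * (ennreal (dl powr e) * (c2 * (Kom p dl + MLp p))) <= ?g * (ennreal (dl powr e) * (c2 * (?k * germ_norm p q + 1 * germ_norm p q)))"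
  unfolding mult_1 by (intro mult_left_mono add_mono Kom_le MLp_le p q dl) auto
 also have "... = (value_const q * germ_norm p q) * ennreal (dl powr e)"
  unfolding value_const_def distrib_right[symmetric] by (simp only: ac_simps)
 finally show ?thesis using value_Lp[OF p dl e E] by (rule order_trans[rotated])
qed

lemma value_Lq:
 assumes p: "1 <= p" and q: "1 <= q" and e: "!!ze. ze \<in> homs ==> a + e <= ze" and E: "E \<subseteq> B_tests s r"
 shows "Ls q (%dl. Lp p (%x. SUP et\<in>E. ennreal (\<bar>LI y. diag y * rescale s et dl x y\<bar> / dl powr a)))
  <= (value_const q * germ_norm p q) * Ls q (%dl. ennreal (dl powr e))"
proof -
 have "Ls q (%dl. Lp p (%x. SUP et\<in>E. ennreal (\<bar>LI y. diag y * rescale s et dl x y\<bar> / dl powr a)))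
  <= Ls q (%dl. (value_const q * germ_norm p q) * ennreal (dl powr e))"
  by (intro Lp_norm_scale_mono value_Lp' p q e E) auto
 also have "... <= (value_const q * germ_norm p q) * Ls q (%dl. ennreal (dl powr e))"
  by (intro Lp_norm_cmult_le q) measurable
 finally show ?thesis .
qed

end

section \<open>Modelled distributions\<close>

lemma limit_piecewise_cont_measurable:
 fixes J :: "'x::topological_space => real"
 assumes "limit_piecewise_cont UNIV J"
 shows "J \<in> borel_measurable borel"
proof -
 obtain Jm where J: "!!m::nat. piecewise_cont UNIV (Jm m)" "!!p. (%m. Jm m p) \<longlonglongrightarrow> J p"
  using assms unfolding limit_piecewise_cont_def by auto
 have "Jm m \<in> borel_measurable borel" for m using piecewise_cont_measurable[OF J(1)[of m]] by simp
 then show ?thesis using J(2) by (rule borel_measurable_LIMSEQ_real[rotated])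
qed

lemma limit_piecewise_cont_zero: "limit_piecewise_cont U (%p. 0)"
proof -
 have "piecewise_cont U (%p. 0)" unfolding piecewise_cont_def
  by (intro exI[of _ "%p. 0"] exI[of _ "%i p. 0"]) simp
 then show ?thesis unfolding limit_piecewise_cont_def by (intro exI[of _ "%m p. 0"]) simp
qed

lemma limit_piecewise_cont_sum:
 fixes J :: "'i => 'x::topological_space => 'b::real_normed_vector"
 assumes "finite A" "!!i. i \<in> A ==> limit_piecewise_cont U (J i)"
 shows "limit_piecewise_cont U (%p. \<Sum>i\<in>A. J i p)"
 using assms
proof (induction A rule: finite_induct)
 case empty
 then show ?case by (simp add: limit_piecewise_cont_zero)
next
 case (insert a A)
 have "limit_piecewise_cont U (%p. J a p - (0 - (\<Sum>i\<in>A. J i p)))"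
  using insert by (intro limit_piecewise_cont_diff limit_piecewise_cont_zero) auto
 then show ?case using insert by simp
qed

lemma open_snorm_less: "scaling s ==> open {p :: 'a::topological_space \<times> (real ^ 'd::finite). snorm s (snd p) < 1}"
 by (intro open_Collect_less continuous_on_const continuous_on_compose2[OF continuous_snorm[of s UNIV]] continuous_on_snd continuous_on_id) auto

text \<open>Restricts to the punctured open unit ball, where \<open>Gam_norm\<close> controls
  \<open>m_Gam\<close> and increments are known to be measurable.\<close>

definition cut :: "('d::finite => nat) => real ^ 'd => real" where
 "cut s h = indicator {h. 0 < snorm s h \<and> snorm s h < 1} h"

lemma cut_measurable [measurable]: "cut s \<in> borel_measurable borel"
 unfolding cut_def[abs_def] by measurable

lemma cut_nonneg [simp]: "0 <= cut s h" and cut_le_1: "cut s h <= 1"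
 by (auto simp: cut_def indicator_def)

lemma cut_eq_1: "0 < snorm s h ==> snorm s h < 1 ==> cut s h = 1"
 and cut_neq_0: "cut s h ~= 0 ==> 0 < snorm s h \<and> snorm s h < 1"
 by (auto simp: cut_def indicator_def split: if_splits)

lemma limit_piecewise_cont_cut_measurable:
 fixes J :: "(real ^ 'd::finite) \<times> (real ^ 'd) => 'b::real_normed_vector"
 assumes s: "scaling s" and J: "limit_piecewise_cont {p. snorm s (snd p) < 1} J"
 shows "(%p. cut s (snd p) * norm (J p)) \<in> borel_measurable (borel \<Otimes>\<^sub>M borel)"
proof -
 let ?U = "{p :: (real ^ 'd) \<times> (real ^ 'd). snorm s (snd p) < 1}"
 have [measurable]: "(%p. indicator ?U p * norm (J p)) \<in> borel_measurable (borel \<Otimes>\<^sub>M borel)"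
  using limit_piecewise_cont_norm_measurable[OF J open_snorm_less[OF s]] by (simp add: borel_prod)
 have "(%p. cut s (snd p) * (indicator ?U p * norm (J p))) \<in> borel_measurable (borel \<Otimes>\<^sub>M borel)" by measurable
 moreover have "cut s (snd p) * (indicator ?U p * norm (J p)) = cut s (snd p) * norm (J p)" for p
  by (auto simp: cut_def indicator_def)
 ultimately show ?thesis by simp
qed

context smooth_model_scaled
begin

lemma H_below: "ze \<in> H ==> ze < ga" and H_A: "ze \<in> H ==> ze \<in> rs_A \<T>"
 by (auto simp: hom_below_def)

lemma homog_below:
 assumes "ze \<in> H" "b \<in> rs_T \<T> ze"
 shows "homog ze b \<in> rs_below \<T> ga"
 using homog_in_sum[OF H_A[OF assms(1)] assms(2)] H_below[OF assms(1)] by (auto simp: rs_below_def homog_def)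

lemma nrm_homog: "ze \<in> H ==> nrm (homog ze b) = norm b"
 by (simp add: rs_norm_def homog_def if_distrib[of norm] sum.delta cong: if_cong)

lemma homog_diff: "homog ze (b - c) = (%al. homog ze b al - homog ze c al)"
 by (auto simp: homog_def)

lemma T_diff: "ze \<in> H ==> b \<in> rs_T \<T> ze ==> c \<in> rs_T \<T> ze ==> b - c \<in> rs_T \<T> ze"
 using subspace_T[OF H_A] by (rule subspace_diff)

text \<open>For fixed base point and argument the density is a bounded linear functional of the
  vector.\<close>

lemma dens_homog_tendsto:
 assumes ze: "ze \<in> H" and b: "!!m. b m \<in> rs_T \<T> ze" "c \<in> rs_T \<T> ze" "b \<longlonglongrightarrow> c"
 shows "(%m. dens z (homog ze (b m)) y) \<longlonglongrightarrow> dens z (homog ze c) y"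
proof -
 obtain C where C: "!!ta. ta \<in> rs_below \<T> ga ==> \<bar>dens z ta y\<bar> <= C * nrm ta"
  using dens_bound_fixed_base[of "{y}" z] by auto
 have le: "\<bar>dens z (homog ze (b m)) y - dens z (homog ze c) y\<bar> <= C * norm (b m - c)" for m
  using C[OF homog_below[OF ze T_diff[OF ze b(1)[of m] b(2)]]]
   dens_diff[OF homog_in_sum[OF H_A[OF ze] b(1)[of m]] homog_in_sum[OF H_A[OF ze] b(2)], of z y]
  unfolding homog_diff[symmetric] nrm_homog[OF ze] by simp
 have "(%m. C * norm (b m - c)) \<longlonglongrightarrow> C * 0"
  using b(3) by (intro tendsto_mult_left tendsto_norm_zero LIM_zero)
 then have "(%m. C * norm (b m - c)) \<longlonglongrightarrow> 0" by simp
 then have "(%m. dens z (homog ze (b m)) y - dens z (homog ze c) y) \<longlonglongrightarrow> 0"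
  by (rule Lim_null_comparison[OF always_eventually, rotated]) (use le in simp)
 then show ?thesis by (rule LIM_zero_cancel)
qed

lemma Gam_diff_eq:
 assumes "si \<in> rs_sum \<T>" "ta \<in> rs_sum \<T>"
 shows "m_Gam Z x y (%al. si al - ta al) = (%al. m_Gam Z x y si al - m_Gam Z x y ta al)"
 using G_lin[OF Gam_G assms, of x y 1 "-1"] by simp

lemma Gam_homog_tendsto:
 assumes ze: "ze \<in> H" and xy: "snorm s (x - y) < 1" and b: "!!m. b m \<in> rs_T \<T> ze" "c \<in> rs_T \<T> ze" "b \<longlonglongrightarrow> c"
 shows "(%m. m_Gam Z x y (homog ze (b m)) be) \<longlonglongrightarrow> m_Gam Z x y (homog ze c) be"
proof -
 let ?C = "1 + nGam * modulus (snorm s (x - y))"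
 have le: "norm (m_Gam Z x y (homog ze (b m)) be - m_Gam Z x y (homog ze c) be) <= ?C * norm (b m - c)" for m
 proof -
  let ?h = "homog ze (b m - c)"
  have h: "?h \<in> rs_below \<T> ga" by (intro homog_below ze T_diff b)
  have eq: "m_Gam Z x y (homog ze (b m)) be - m_Gam Z x y (homog ze c) be = m_Gam Z x y ?h be"
   unfolding homog_diff by (subst Gam_diff_eq) (auto intro: homog_in_sum H_A ze b)
  have "norm (m_Gam Z x y ?h be) <= norm (?h be) + norm (m_Gam Z x y ?h be - ?h be)"
   by (metis add.commute diff_add_cancel norm_triangle_ineq)
  also have "... <= nrm ?h + nGam * modulus (snorm s (x - y)) * nrm ?h"
   by (intro add_mono Gam_comp_le norm_comp_le_rs_norm h xy)
  also have "... = ?C * norm (b m - c)" unfolding nrm_homog[OF ze] by (simp add: algebra_simps)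
  finally show ?thesis unfolding eq .
 qed
 have "(%m. ?C * norm (b m - c)) \<longlonglongrightarrow> ?C * 0"
  using b(3) by (intro tendsto_mult_left tendsto_norm_zero LIM_zero)
 then have "(%m. ?C * norm (b m - c)) \<longlonglongrightarrow> 0" by simp
 then have "(%m. m_Gam Z x y (homog ze (b m)) be - m_Gam Z x y (homog ze c) be) \<longlonglongrightarrow> 0"
  by (rule Lim_null_comparison[OF always_eventually, rotated]) (use le in simp)
 then show ?thesis by (rule LIM_zero_cancel)
qed

end

locale modelled = smooth_model_scaled \<T> s r ga Z
 for \<T> :: "('b::banach) regstruct" and s :: "'d::finite => nat" and r ga Z +
 fixes p q :: ennreal and f :: "real ^ 'd => real => 'b"
 assumes ga: "0 < ga" and p: "1 <= p" and q: "1 <= q" and f: "f \<in> D_space \<T> s ga p q Z"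
begin

lemma f_below: "f x \<in> rs_below \<T> ga" and f_sum: "f x \<in> rs_sum \<T>"
 using f rs_below_sum by (auto simp: D_space_def)

lemma f_T: "ze \<in> H ==> f x ze \<in> rs_T \<T> ze"
 by (intro comp_in_T f_sum H_A)

lemma f_strong: "ze \<in> H ==> strongly_measurable (%x. f x ze)"
 using f by (auto simp: D_space_def hom_below_def)

text \<open>A component of \<open>f\<close> is a limit of functions with countably many values in
  \<open>rs_T\<close>. Where such a value is fixed, \<open>L\<close> is continuous in the point;
  continuity of \<open>L\<close> in the vector carries out the limit.\<close>

lemma limit_piecewise_cont_apply:
 fixes g :: "'x::topological_space => real ^ 'd" and L :: "'x => 'b => 'c::real_normed_vector"
 assumes ze: "ze \<in> H" and g: "g \<in> borel_measurable borel"
  and cont: "!!b. b \<in> rs_T \<T> ze ==> continuous_on U (%w. L w b)"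
  and conv: "!!w b c. w \<in> U ==> (!!m. b m \<in> rs_T \<T> ze) ==> c \<in> rs_T \<T> ze ==> b \<longlonglongrightarrow> c ==> (%m. L w (b m)) \<longlonglongrightarrow> L w c"
 shows "limit_piecewise_cont U (%w. L w (f (g w) ze))"
proof -
 obtain d :: "nat => 'b" and k :: "nat => real ^ 'd => nat" where d: "range d \<subseteq> range (%x. f x ze)"
  and k: "!!m. k m \<in> measurable borel (count_space UNIV)" and lim: "!!x. (%m. d (k m x)) \<longlonglongrightarrow> f x ze"
  using strongly_measurable_approx[OF f_strong[OF ze]] by blast
 have dT: "d i \<in> rs_T \<T> ze" for i
 proof -
  have "d i \<in> range (%x. f x ze)" using d by blast
  then obtain x where "d i = f x ze" by blast
  then show ?thesis using f_T[OF ze, of x] by simp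
 qed
 show ?thesis unfolding limit_piecewise_cont_def
 proof (intro exI[of _ "%m w. L w (d (k m (g w)))"] conjI allI ballI)
  fix m
  show "piecewise_cont U (%w. L w (d (k m (g w))))" unfolding piecewise_cont_def
   by (intro exI[of _ "%w. k m (g w)"] exI[of _ "%i w. L w (d i)"] conjI allI ballI cont dT measurable_compose[OF g k] refl)
 next
  fix w assume "w \<in> U"
  then show "(%m. L w (d (k m (g w)))) \<longlonglongrightarrow> L w (f (g w) ze)"
   by (intro conv dT f_T ze lim)
 qed
qed

definition F :: "real ^ 'd => real ^ 'd => real" where "F z = dens z (f z)"

lemma fst_borel: "(fst :: ('x::topological_space \<times> 'y::topological_space) => 'x) \<in> borel_measurable borel"
 by (intro borel_measurable_continuous_onI continuous_on_fst continuous_on_id)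

lemma F_meas: "(%w. F (fst w) (snd w)) \<in> borel_measurable borel"
proof -
 have "limit_piecewise_cont UNIV (%w. dens (fst w) (homog ze (f (fst w) ze)) (snd w))" if ze: "ze \<in> H" for ze
  by (rule limit_piecewise_cont_apply[where L = "%w b. dens (fst w) (homog ze b) (snd w)", OF ze fst_borel])
   (auto intro: dens_joint_continuous homog_below dens_homog_tendsto ze)
 then have "limit_piecewise_cont UNIV (%w. \<Sum>ze\<in>H. dens (fst w) (homog ze (f (fst w) ze)) (snd w))"
  by (rule limit_piecewise_cont_sum[OF finite_hom_below])
 then have "limit_piecewise_cont UNIV (%w. F (fst w) (snd w))"
  unfolding F_def by (simp add: dens_decomp[OF f_below])
 then show ?thesis by (rule limit_piecewise_cont_measurable)
qed

lemma lpc_f: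
 assumes ze: "ze \<in> H" and g: "g \<in> borel_measurable borel"
 shows "limit_piecewise_cont U (%w. f (g w) ze)"
 by (rule limit_piecewise_cont_apply[where L = "%w b. b", OF ze g]) auto

lemma f_lpc: "ze \<in> H ==> limit_piecewise_cont UNIV (%x. f x ze)"
 by (rule lpc_f) auto

lemma norm_f_measurable [measurable]: "ze \<in> H ==> (%x. norm (f x ze)) \<in> borel_measurable borel"
 using limit_piecewise_cont_norm_measurable[OF f_lpc] by simp

definition inc :: "real ^ 'd => real ^ 'd => real => 'b" where
 "inc x h ze = f (x + h) ze - m_Gam Z (x + h) x (f x) ze"

lemma inc_below: "inc x h \<in> rs_below \<T> ga"
 unfolding inc_def[abs_def] by (intro rs_below_diff f_below Gam_below)

text \<open>Split into homogeneous components, \<open>m_Gam\<close> acts on vectors to which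
  \<open>Gam_continuous\<close> and \<open>Gam_homog_tendsto\<close> apply separately.\<close>

lemma inc_lpc:
 assumes be: "be \<in> H"
 shows "limit_piecewise_cont {w. snorm s (snd w) < 1} (%w. inc (fst w) (snd w) be)"
proof -
 let ?U = "{w :: (real ^ 'd) \<times> (real ^ 'd). snorm s (snd w) < 1}"
 have G: "limit_piecewise_cont ?U (%w. m_Gam Z (fst w + snd w) (fst w) (homog ze (f (fst w) ze)) be)" if ze: "ze \<in> H" for ze
 proof (rule limit_piecewise_cont_apply[where L = "%w b. m_Gam Z (fst w + snd w) (fst w) (homog ze b) be", OF ze fst_borel])
  fix b assume b: "b \<in> rs_T \<T> ze"
  have "continuous_on ?U (%w. (fst w + snd w, fst w))"
   by (intro continuous_on_Pair continuous_on_add continuous_on_fst continuous_on_snd continuous_on_id)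
  from continuous_on_compose2[OF Gam_continuous[OF homog_below[OF ze b], of be] this]
  have "(%w. (fst w + snd w, fst w)) ` ?U \<subseteq> {p. snorm s (fst p - snd p) < 1} ==>
   continuous_on ?U (%w. m_Gam Z (fst w + snd w) (fst w) (homog ze b) be)" by simp
  moreover have "(%w. (fst w + snd w, fst w)) ` ?U \<subseteq> {p. snorm s (fst p - snd p) < 1}" by auto
  ultimately show "continuous_on ?U (%w. m_Gam Z (fst w + snd w) (fst w) (homog ze b) be)" by blast
 next
  fix w b c assume "w \<in> ?U" "!!m::nat. b m \<in> rs_T \<T> ze" "c \<in> rs_T \<T> ze" "b \<longlonglongrightarrow> c"
  then show "(%m. m_Gam Z (fst w + snd w) (fst w) (homog ze (b m)) be) \<longlonglongrightarrow> m_Gam Z (fst w + snd w) (fst w) (homog ze c) be"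
   by (intro Gam_homog_tendsto ze) auto
 qed
 have "limit_piecewise_cont ?U (%w. f (fst w + snd w) be - (\<Sum>ze\<in>H. m_Gam Z (fst w + snd w) (fst w) (homog ze (f (fst w) ze)) be))"
 proof (intro limit_piecewise_cont_diff limit_piecewise_cont_sum finite_hom_below G)
  show "limit_piecewise_cont ?U (%w. f (fst w + snd w) be)"
   by (rule lpc_f[OF be]) (intro borel_measurable_continuous_onI continuous_on_add continuous_on_fst continuous_on_snd continuous_on_id)
 qed
 moreover have "(\<Sum>ze\<in>H. m_Gam Z (x + h) x (homog ze (f x ze)) be) = m_Gam Z (x + h) x (f x) be" for x h
  by (rule additive_decomposition[where P = "%ta. m_Gam Z (x + h) x ta be", OF _ f_below, symmetric]) (simp add: G_lin[OF Gam_G])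
 ultimately show ?thesis by (simp add: inc_def)
qed

lemma inc_measurable [measurable]:
 "ze \<in> H ==> (%w. cut s (snd w) * norm (inc (fst w) (snd w) ze)) \<in> borel_measurable (borel \<Otimes>\<^sub>M borel)"
 by (rule limit_piecewise_cont_cut_measurable[OF s inc_lpc])

lemma D_norm_finite: "D_norm \<T> s ga p q Z f < top"
 using f by (simp add: D_space_def)

lemma D_norm_eq: "D_norm \<T> s ga p q Z f = (\<Sum>ze\<in>H. Lp p (%x. ennreal (norm (f x ze))) +
    Lb s q (%h. Lp p (%x. ennreal (norm (inc x h ze) / snorm s h powr (ga - ze)))))"
 by (simp add: D_norm_def increment_norm_def inc_def hom_below_def)

lemma f_Lp_finite: "ze \<in> H ==> Lp p (%x. ennreal (norm (f x ze))) < top" (is "_ ==> ?a ze < top")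
 and inc_Lq_finite: "ze \<in> H ==> Lb s q (%h. Lp p (%x. ennreal (norm (inc x h ze) / snorm s h powr (ga - ze)))) < top" (is "_ ==> ?b ze < top")
proof -
 assume "ze \<in> H"
 then have "?a ze + ?b ze <= D_norm \<T> s ga p q Z f"
  unfolding D_norm_eq by (intro member_le_sum[of ze H "%ze. ?a ze + ?b ze"]) auto
 then have "?a ze + ?b ze < top" using D_norm_finite by (rule le_less_trans)
 then show "?a ze < top" "?b ze < top" by simp_all
qed

definition iom :: "real => real ^ 'd => ennreal" where
 "iom ze h = Lp p (%x. ennreal (cut s h * norm (inc x h ze) / snorm s h powr (ga - ze)))"

lemma iom_measurable [measurable]: "ze \<in> H ==> iom ze \<in> borel_measurable borel"
 unfolding iom_def[abs_def]
proof (rule Lp_norm_measurable[OF lborel.sigma_finite_measure_axioms])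
 assume "ze \<in> H"
 then have "(%w. cut s (snd w) * norm (inc (fst w) (snd w) ze)) \<in> borel_measurable (borel \<Otimes>\<^sub>M borel)" by (rule inc_measurable)
 then have [measurable]: "(%w. cut s (snd w) * norm (inc (fst w) (snd w) ze)) \<in> borel_measurable (lborel \<Otimes>\<^sub>M borel)"
  by (simp cong: measurable_cong_sets sets_pair_measure_cong)
 show "(%(x, h). ennreal (cut s h * norm (inc x h ze) / snorm s h powr (ga - ze))) \<in> borel_measurable (lborel \<Otimes>\<^sub>M borel)"
  unfolding case_prod_beta' by measurable
qed

lemma iom_supp: "iom ze h ~= 0 ==> 0 < snorm s h \<and> snorm s h < 1"
 using cut_neq_0[of s h] p by (cases "cut s h = 0") (auto simp: iom_def)

lemma iom_Lq_finite: "ze \<in> H ==> Lb s q (iom ze) < top"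
proof -
 assume ze: "ze \<in> H"
 have "Lb s q (iom ze) <= Lb s q (%h. Lp p (%x. ennreal (norm (inc x h ze) / snorm s h powr (ga - ze))))"
  unfolding iom_def[abs_def] by (intro Lp_norm_mono ennreal_leI divide_right_mono) (auto intro: mult_left_le_one_le cut_le_1)
 then show ?thesis using inc_Lq_finite[OF ze] by (rule le_less_trans)
qed

end

lemma Hoelder_compact:
 fixes K :: "(real ^ 'd::finite) set"
 assumes "compact K" "1 <= p"
 shows "\<exists>C::real. 0 < C \<and> (\<forall>G\<in>borel_measurable lborel. (NI x. indicator K x * G x) <= ennreal C * Lp p G)"
proof -
 have [measurable]: "K \<in> sets borel" using assms(1) by (simp add: compact_imp_closed borel_closed)
 have "emeasure lborel K ~= top" using emeasure_compact_finite[OF assms(1)] by simp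
 then have "emeasure lborel K = ennreal (measure lborel K)" by (rule emeasure_eq_ennreal_measure)
 \<comment> \<open>The summand 1 keeps the mass constant positive when \<open>K\<close> is a null
   set.\<close>
 then have "(NI x. indicator K x) <= ennreal (measure lborel K + 1)" by (simp add: ennreal_leI)
 moreover have "0 < measure lborel K + 1" using measure_nonneg[of lborel K] by linarith
 ultimately show ?thesis using assms(2) by (intro Hoelder_weighted[where c = "measure lborel K + 1"]) (auto simp: indicator_def)
qed

text \<open>The layer \<open>n = 0\<close> alone.\<close>

lemma scale_kernel_ge:
 assumes "0 < snorm s h" "snorm s h <= 2 * dl"
 shows "ennreal (inverse (dl ^ hom_dim s)) <= scale_kernel s ga dl h"
proof -
 let ?k = "%n. ennreal (2 powr (- real n * ga) * inverse ((dl / 2 ^ n) ^ hom_dim s)) *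
   indicator {h. 0 < snorm s h \<and> snorm s h <= 2 * (dl / 2 ^ n)} h"
 have "ennreal (inverse (dl ^ hom_dim s)) = (\<Sum>n<1. ?k n)" using assms by simp
 also have "... <= (\<Sum>n. ?k n)" by (rule sum_le_suminf) auto
 finally show ?thesis unfolding scale_kernel_def .
qed

context modelled
begin

lemma norm_f_integrable:
 assumes K: "compact K" and ze: "ze \<in> H"
 shows "integrable lborel (%z. indicator K z * norm (f z ze))"
proof (rule integrableI_bounded)
 have [measurable]: "K \<in> sets borel" using K by (simp add: compact_imp_closed borel_closed)
 have [measurable]: "(%x. norm (f x ze)) \<in> borel_measurable borel" by (rule norm_f_measurable[OF ze])
 show "(%z. indicator K z * norm (f z ze)) \<in> borel_measurable lborel" by measurable
 obtain C where C: "!!G. G \<in> borel_measurable lborel ==> (NI x. indicator K x * G x) <= ennreal C * Lp p G"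
  using Hoelder_compact[OF K p] by blast
 have "(NI z. ennreal (norm (indicator K z * norm (f z ze)))) = (NI z. indicator K z * ennreal (norm (f z ze)))"
  by (intro nn_integral_cong) (auto simp: indicator_def)
 also have "... <= ennreal C * Lp p (%x. ennreal (norm (f x ze)))" by (intro C) measurable
 also have "... < \<infinity>" using f_Lp_finite[OF ze] by (simp add: ennreal_mult_less_top)
 finally show "(NI z. ennreal (norm (indicator K z * norm (f z ze)))) < \<infinity>" .
qed

lemma F_bound:
 assumes K: "compact K"
 shows "\<exists>m. (\<forall>z. 0 <= m z) \<and> integrable lborel (%z. indicator K z * m z) \<and> (\<forall>z\<in>K. \<forall>y\<in>K. \<bar>F z y\<bar> <= m z)"
proof -
 obtain C where C: "0 <= C" "!!z y ta. z \<in> K ==> y \<in> K ==> ta \<in> rs_below \<T> ga ==> \<bar>dens z ta y\<bar> <= C * nrm ta"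
  using dens_bound[OF K] by blast
 have "integrable lborel (%z. C * (\<Sum>ze\<in>H. indicator K z * norm (f z ze)))"
  by (intro integrable_mult_right Bochner_Integration.integrable_sum norm_f_integrable K)
 moreover have "C * (\<Sum>ze\<in>H. indicator K z * norm (f z ze)) = indicator K z * (C * nrm (f z))" for z
  by (simp only: rs_norm_def sum_distrib_left ac_simps)
 ultimately have "integrable lborel (%z. indicator K z * (C * nrm (f z)))" by (simp only:)
 then show ?thesis using C by (intro exI[of _ "%z. C * nrm (f z)"]) (auto simp: F_def f_below rs_norm_nonneg)
qed

text \<open>Moving the base point of \<open>F z\<close> to z + h turns the increment of the germ
  into the density of the increment of \<open>f\<close>. This is how the norm of the modelled
  distribution enters.\<close>

lemma F_increment_eq: "F (z + h) y - F z y = dens (z + h) (inc z h) y"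
proof -
 have "F z y = dens (z + h) (m_Gam Z (z + h) z (f z)) y" unfolding F_def by (simp add: dens_Gam[OF f_sum])
 then show ?thesis unfolding F_def inc_def[abs_def]
  by (subst dens_diff) (auto intro!: f_sum rs_below_sum[OF Gam_below[OF f_below]])
qed

lemma inc_integral_le:
 assumes C: "0 <= C" "!!G. G \<in> borel_measurable lborel ==> (NI x. indicator K x * G x) <= ennreal C * Lp p G"
  and ze: "ze \<in> H" and h: "0 < snorm s h" "snorm s h <= dl"
 shows "(NI y. indicator K y * ennreal (cut s h * norm (inc y h ze))) <= ennreal (C * dl powr (ga - ze)) * iom ze h"
proof -
 have m: "(%y. cut s h * norm (inc y h ze)) \<in> borel_measurable borel"
  using measurable_compose[OF _ inc_measurable[OF ze], of "%y. (y, h)" borel] by simp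
 have hp: "0 < snorm s h powr (ga - ze)" using h by simp
 have "(NI y. indicator K y * ennreal (cut s h * norm (inc y h ze))) <= ennreal C * Lp p (%y. ennreal (cut s h * norm (inc y h ze)))"
  using measurable_compose[OF m measurable_ennreal] by (intro C) simp
 also have "Lp p (%y. ennreal (cut s h * norm (inc y h ze))) =
  Lp p (%y. ennreal (snorm s h powr (ga - ze)) * ennreal (cut s h * norm (inc y h ze) / snorm s h powr (ga - ze)))"
  using hp by (intro Lp_norm_cong) (simp add: ennreal_mult[symmetric])
 also have "ennreal C * ... <= ennreal C * (ennreal (snorm s h powr (ga - ze)) * iom ze h)"
  unfolding iom_def using measurable_compose[OF borel_measurable_divide[OF m borel_measurable_const] measurable_ennreal]
  by (intro mult_left_mono Lp_norm_cmult_le p) auto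
 also have "... <= ennreal C * (ennreal (dl powr (ga - ze)) * iom ze h)"
  using h H_below[OF ze] by (intro mult_left_mono mult_right_mono ennreal_leI powr_mono2) auto
 also have "... = ennreal (C * dl powr (ga - ze)) * iom ze h" using C by (simp add: ennreal_mult mult.assoc)
 finally show ?thesis .
qed

text \<open>With z = y + h the oscillation is the density of \<open>inc y h\<close>, bounded on
  compact sets by its norm. The normalised indicator of |h| at most \<open>dl\<close> is dominated
  by \<open>scale_kernel\<close>, and Hoelder on \<open>K\<close> followed by the bound of
  \<open>kernel_const\<close> at a single scale leaves the positive power dl^(ga - ze).\<close>

lemma F_oscillation_le:
 assumes K: "compact K"
 shows "\<exists>C\<ge>0. \<forall>dl. 0 < dl --> dl < 1 --> (NI y. indicator K y * (NI z. ennreal (inverse (dl ^ hom_dim s)) *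
    indicator (sbox s y dl) z * ennreal \<bar>F z y - F y y\<bar>))
  <= (\<Sum>ze\<in>H. ennreal (C * dl powr (ga - ze)) * Lb s q (iom ze))"
proof -
 have [measurable]: "K \<in> sets borel" using K by (simp add: compact_imp_closed borel_closed)
 \<comment> \<open>Contains \<open>y\<close> and y + h for \<open>y\<close> in \<open>K\<close> and
   |h| at most 1, so one density bound covers both.\<close>
 define K1 where "K1 = {y + h | y h. y \<in> K \<and> h \<in> sbox s 0 1}"
 have cK1: "compact K1" unfolding K1_def using compact_sums[OF K compact_sbox[OF s, of 1 0]] by simp
 obtain C where C: "0 <= C" "!!z y ta. z \<in> K1 ==> y \<in> K1 ==> ta \<in> rs_below \<T> ga ==> \<bar>dens z ta y\<bar> <= C * nrm ta"
  using dens_bound[OF cK1] by blast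
 obtain C' where C': "0 < C'" "!!G. G \<in> borel_measurable lborel ==> (NI x. indicator K x * G x) <= ennreal C' * Lp p G"
  using Hoelder_compact[OF K p] by blast
 let ?N = "hom_dim s" and ?k = "kernel_const s ga q"
 have k: "0 < ?k" by (rule kernel_const(1)[OF s ga q])
 have Fm [measurable]: "(%z. F z y) \<in> borel_measurable borel" for y
  using measurable_compose[OF _ F_meas, of "%z. (z, y)" borel] by simp
 have F2 [measurable]: "(%p. F (fst p) (snd p)) \<in> borel_measurable (borel \<Otimes>\<^sub>M borel)" using F_meas by (simp add: borel_prod)
 have "(NI y. indicator K y * (NI z. ennreal (inverse (dl ^ ?N)) * indicator (sbox s y dl) z * ennreal \<bar>F z y - F y y\<bar>))
  <= (\<Sum>ze\<in>H. ennreal (C * C' * ?k * dl powr (ga - ze)) * Lb s q (iom ze))" if dl: "0 < dl" "dl < 1" for dl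
 proof -
  define w where "w h = ennreal (inverse (dl ^ ?N)) * indicator {h. 0 < snorm s h \<and> snorm s h <= dl} h" for h
  have wm [measurable]: "w \<in> borel_measurable borel" unfolding w_def[abs_def] by measurable
  define V where "V ze y h = ennreal (cut s h * norm (inc y h ze))" for ze y h
  have Vm: "(%p. V ze (fst p) (snd p)) \<in> borel_measurable (borel \<Otimes>\<^sub>M borel)" if "ze \<in> H" for ze
   unfolding V_def using inc_measurable[OF that] by measurable
  have Vm1: "(%y. V ze y h) \<in> borel_measurable borel" "(%h. V ze y h) \<in> borel_measurable borel" if "ze \<in> H" for ze y h
   using measurable_compose[OF _ Vm[OF that], of "%y. (y, h)" borel] measurable_compose[OF _ Vm[OF that], of "%h. (y, h)" borel] by simp_all
  have inner: "(NI z. ennreal (inverse (dl ^ ?N)) * indicator (sbox s y dl) z * ennreal \<bar>F z y - F y y\<bar>)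
   <= (NI h. (\<Sum>ze\<in>H. ennreal C * (w h * V ze y h)))" if y: "y \<in> K" for y
  proof -
   have "(NI z. ennreal (inverse (dl ^ ?N)) * indicator (sbox s y dl) z * ennreal \<bar>F z y - F y y\<bar>)
    = (NI h. ennreal (inverse (dl ^ ?N)) * indicator (sbox s y dl) (y + h) * ennreal \<bar>F (y + h) y - F y y\<bar>)"
    by (rule nn_integral_lborel_translate[symmetric]) measurable
   also have "... <= (NI h. (\<Sum>ze\<in>H. ennreal C * (w h * V ze y h)))"
   proof (rule nn_integral_mono)
    fix h
    show "ennreal (inverse (dl ^ ?N)) * indicator (sbox s y dl) (y + h) * ennreal \<bar>F (y + h) y - F y y\<bar> <= (\<Sum>ze\<in>H. ennreal C * (w h * V ze y h))"
    proof (cases "h = 0 \<or> \<not> snorm s h <= dl")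
     case True
     then show ?thesis by (auto simp: sbox_def)
    next
     case False
     then have h: "0 < snorm s h" "snorm s h <= dl" using snorm_eq_0_iff[OF s, of h] snorm_nonneg[of s h] by linarith+
     have sb: "h \<in> sbox s 0 1" "0 \<in> sbox s (0::real^'d) 1" using h dl snorm_eq_0_iff[OF s, of 0] by (auto simp: sbox_def)
     have yh: "y + h \<in> K1" using sb(1) y unfolding K1_def by blast
     have "y + 0 \<in> K1" using sb(2) y unfolding K1_def by blast
     then have y1: "y \<in> K1" by simp
     have wh: "w h = ennreal (inverse (dl ^ ?N))" using h by (simp add: w_def)
     have ind: "indicator (sbox s y dl) (y + h) = (1::ennreal)" using h by (simp add: sbox_def)
     have "\<bar>F (y + h) y - F y y\<bar> <= C * nrm (inc y h)" unfolding F_increment_eq by (rule C(2)[OF yh y1 inc_below])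
     also have "... = (\<Sum>ze\<in>H. C * (cut s h * norm (inc y h ze)))"
      using h dl by (simp add: rs_norm_def sum_distrib_left cut_eq_1)
     finally have "ennreal \<bar>F (y + h) y - F y y\<bar> <= ennreal (\<Sum>ze\<in>H. C * (cut s h * norm (inc y h ze)))" by (rule ennreal_leI)
     also have "... = (\<Sum>ze\<in>H. ennreal (C * (cut s h * norm (inc y h ze))))" using C(1) by (intro sum_ennreal[symmetric]) simp
     also have "... = (\<Sum>ze\<in>H. ennreal C * V ze y h)" unfolding V_def using C(1) by (intro sum.cong refl ennreal_mult) auto
     finally have "w h * ennreal \<bar>F (y + h) y - F y y\<bar> <= w h * (\<Sum>ze\<in>H. ennreal C * V ze y h)" by (rule mult_left_mono) simp
     then show ?thesis unfolding ind wh[symmetric] mult_1_right by (simp add: sum_distrib_left ac_simps)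
    qed
   qed
   finally show ?thesis .
  qed
  have per: "(NI y. (NI h. indicator K y * (ennreal C * (w h * V ze y h)))) <= ennreal (C * C' * ?k * dl powr (ga - ze)) * Lb s q (iom ze)"
   if ze: "ze \<in> H" for ze
  proof -
   have Vm2 [measurable]: "(%p. V ze (fst p) (snd p)) \<in> borel_measurable (lborel \<Otimes>\<^sub>M lborel)"
    using Vm[OF ze] by (simp cong: measurable_cong_sets sets_pair_measure_cong)
   have [measurable]: "(%y. V ze y h) \<in> borel_measurable borel" for h by (rule Vm1(1)[OF ze])
   have im [measurable]: "iom ze \<in> borel_measurable borel" by (rule iom_measurable[OF ze])
   have "(NI y. (NI h. indicator K y * (ennreal C * (w h * V ze y h))))
    = (NI h. (NI y. indicator K y * (ennreal C * (w h * V ze y h))))"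
   proof -
    have "(%p. indicator K (fst p) * (ennreal C * (w (snd p) * V ze (fst p) (snd p)))) \<in> borel_measurable (lborel \<Otimes>\<^sub>M lborel)"
     by measurable
    from lborel_pair.Fubini[OF this] show ?thesis by simp
   qed
   also have "... = (NI h. ennreal C * w h * (NI y. indicator K y * V ze y h))"
   proof (rule nn_integral_cong)
    fix h
    have "(NI y. indicator K y * (ennreal C * (w h * V ze y h))) = (NI y. (ennreal C * w h) * (indicator K y * V ze y h))"
     by (simp only: ac_simps)
    also have "... = ennreal C * w h * (NI y. indicator K y * V ze y h)" by (rule nn_integral_cmult) measurable
    finally show "(NI y. indicator K y * (ennreal C * (w h * V ze y h))) = ennreal C * w h * (NI y. indicator K y * V ze y h)" .
   qed
   also have "... <= (NI h. ennreal (C * (C' * dl powr (ga - ze))) * (scale_kernel s ga dl h * iom ze h))"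
   proof (rule nn_integral_mono)
    fix h
    show "ennreal C * w h * (NI y. indicator K y * V ze y h) <= ennreal (C * (C' * dl powr (ga - ze))) * (scale_kernel s ga dl h * iom ze h)"
    proof (cases "0 < snorm s h \<and> snorm s h <= dl")
     case False
     then show ?thesis by (auto simp: w_def)
    next
     case True
     then have wk: "w h <= scale_kernel s ga dl h" using scale_kernel_ge[of s h dl ga] dl by (simp add: w_def)
     have "ennreal C * w h * (NI y. indicator K y * V ze y h) <= ennreal C * scale_kernel s ga dl h * (ennreal (C' * dl powr (ga - ze)) * iom ze h)"
      unfolding V_def using True C'(1) by (intro mult_mono wk inc_integral_le C'(2) ze) auto
     also have "... = ennreal (C * (C' * dl powr (ga - ze))) * (scale_kernel s ga dl h * iom ze h)"
      using C(1) C'(1) by (subst ennreal_mult[of C]) (auto simp: ac_simps)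
     finally show ?thesis .
    qed
   qed
   also have "... = ennreal (C * (C' * dl powr (ga - ze))) * (NI h. scale_kernel s ga dl h * iom ze h)"
    by (rule nn_integral_cmult) measurable
   also have "... <= ennreal (C * (C' * dl powr (ga - ze))) * (ennreal ?k * Lb s q (iom ze))"
    by (intro mult_left_mono kernel_const(3)[OF s ga q im iom_supp dl(1)]) auto
   also have "... = ennreal (C * (C' * dl powr (ga - ze)) * ?k) * Lb s q (iom ze)"
    using C(1) less_imp_le[OF C'(1)] less_imp_le[OF k] by (simp add: ennreal_mult ac_simps)
   also have "C * (C' * dl powr (ga - ze)) * ?k = C * C' * ?k * dl powr (ga - ze)" by (simp only: ac_simps)
   finally show ?thesis .
  qed
  have "(NI y. indicator K y * (NI z. ennreal (inverse (dl ^ ?N)) * indicator (sbox s y dl) z * ennreal \<bar>F z y - F y y\<bar>))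
   <= (NI y. (\<Sum>ze\<in>H. NI h. indicator K y * (ennreal C * (w h * V ze y h))))"
  proof (rule nn_integral_mono)
   fix y
   show "indicator K y * (NI z. ennreal (inverse (dl ^ ?N)) * indicator (sbox s y dl) z * ennreal \<bar>F z y - F y y\<bar>)
    <= (\<Sum>ze\<in>H. NI h. indicator K y * (ennreal C * (w h * V ze y h)))"
   proof (cases "y \<in> K")
    case True
    have "(NI h. (\<Sum>ze\<in>H. ennreal C * (w h * V ze y h))) = (\<Sum>ze\<in>H. NI h. ennreal C * (w h * V ze y h))"
    proof (rule nn_integral_sum)
     fix ze assume "ze \<in> H"
     then have [measurable]: "(%h. V ze y h) \<in> borel_measurable borel" by (rule Vm1(2))
     show "(%h. ennreal C * (w h * V ze y h)) \<in> borel_measurable lborel" by measurable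
    qed
    then show ?thesis using inner[OF True] True by simp
   qed simp
  qed
  also have "... = (\<Sum>ze\<in>H. NI y. (NI h. indicator K y * (ennreal C * (w h * V ze y h))))"
  proof (rule nn_integral_sum)
   fix ze assume "ze \<in> H"
   then have "(%p. V ze (fst p) (snd p)) \<in> borel_measurable (lborel \<Otimes>\<^sub>M lborel)"
    using Vm by (simp cong: measurable_cong_sets sets_pair_measure_cong)
   then have [measurable]: "(%(y, h). V ze y h) \<in> borel_measurable (lborel \<Otimes>\<^sub>M lborel)" by (simp only: case_prod_beta')
   have "(%(y, h). indicator K y * (ennreal C * (w h * V ze y h))) \<in> borel_measurable (lborel \<Otimes>\<^sub>M lborel)" by measurable
   from lborel.borel_measurable_nn_integral[OF this]
   show "(%y. NI h. indicator K y * (ennreal C * (w h * V ze y h))) \<in> borel_measurable lborel" by simp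
  qed
  also have "... <= (\<Sum>ze\<in>H. ennreal (C * C' * ?k * dl powr (ga - ze)) * Lb s q (iom ze))"
   by (intro sum_mono per)
  finally show ?thesis .
 qed
 moreover have "0 <= C * C' * ?k" using C(1) C'(1) k by simp
 ultimately show ?thesis by blast
qed

lemma F_lim:
 assumes K: "compact K"
 shows "((%dl. NI y. indicator K y * (NI z. ennreal (inverse (dl ^ hom_dim s)) *
    indicator (sbox s y dl) z * ennreal \<bar>F z y - F y y\<bar>)) \<longlongrightarrow> 0) (at_right 0)"
  (is "(?E \<longlongrightarrow> 0) _")
proof -
 obtain C where C: "0 <= C" "!!dl. 0 < dl ==> dl < 1 ==> ?E dl <= (\<Sum>ze\<in>H. ennreal (C * dl powr (ga - ze)) * Lb s q (iom ze))"
  using F_oscillation_le[OF K] by blast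
 define W where "W ze = enn2real (Lb s q (iom ze))" for ze
 have W: "Lb s q (iom ze) = ennreal (W ze)" if "ze \<in> H" for ze
  unfolding W_def using iom_Lq_finite[OF that] by simp
 have W0: "0 <= W ze" for ze by (simp add: W_def)
 let ?b = "%dl. \<Sum>ze\<in>H. (C * W ze) * dl powr (ga - ze)"
 have "?E dl <= ennreal (?b dl)" if dl: "0 < dl" "dl < 1" for dl
 proof -
  have "(\<Sum>ze\<in>H. ennreal (C * dl powr (ga - ze)) * Lb s q (iom ze)) = (\<Sum>ze\<in>H. ennreal ((C * W ze) * dl powr (ga - ze)))"
   using C(1) W0 by (intro sum.cong refl) (simp add: W ennreal_mult[symmetric] ac_simps)
  also have "... = ennreal (?b dl)" using C(1) W0 by (intro sum_ennreal) simp
  finally show ?thesis using C(2)[OF dl] by simp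
 qed
 then have le: "\<forall>\<^sub>F dl in at_right 0. ?E dl <= ennreal (?b dl)"
  by (intro eventually_at_rightI[of 0 1]) auto
 have "(?b \<longlongrightarrow> (\<Sum>ze\<in>H. (C * W ze) * 0)) (at_right 0)"
 proof (intro tendsto_sum tendsto_mult_left)
  fix ze assume "ze \<in> H"
  then have "0 < ga - ze" using H_below by simp
  moreover have "\<forall>\<^sub>F dl in at_right 0. 0 <= (dl::real)" by (rule eventually_at_rightI[of 0 1]) auto
  ultimately show "((%dl. dl powr (ga - ze)) \<longlongrightarrow> 0) (at_right 0)"
   by (intro tendsto_zero_powrI[OF tendsto_ident_at tendsto_const]) auto
 qed
 then have "((%dl. ennreal (?b dl)) \<longlongrightarrow> ennreal 0) (at_right 0)" by (intro tendsto_ennrealI) simp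
 then have "((%dl. ennreal (?b dl)) \<longlongrightarrow> 0) (at_right 0)" by simp
 from tendsto_sandwich[OF always_eventually le tendsto_const this] show ?thesis by simp
qed

end

section \<open>Comparison of two modelled distributions over two models\<close>

lemma oscillation_measurable:
 fixes \<Phi> :: "real ^ 'd::finite => real ^ 'd => real"
 assumes \<Phi>: "(%p. \<Phi> (fst p) (snd p)) \<in> borel_measurable borel" and [measurable]: "K \<in> sets borel"
 shows "(%y. indicator K y * (NI z. c * indicator (sbox s y dl) z * ennreal \<bar>\<Phi> z y - \<Phi> y y\<bar>)) \<in> borel_measurable lborel"
proof -
 have [measurable (raw)]: "(%w. \<Phi> (f w) (g w)) \<in> borel_measurable A"
  if "f \<in> borel_measurable A" "g \<in> borel_measurable A" for f g :: "'x => real ^ 'd" and A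
 proof -
  have "(%w. (f w, g w)) \<in> borel_measurable A" using that by simp
  from measurable_compose[OF this \<Phi>] show ?thesis by simp
 qed
 have "(%y. indicator K y * (NI z. c * (if snorm s (z - y) <= dl then 1 else 0) * ennreal \<bar>\<Phi> z y - \<Phi> y y\<bar>)) \<in> borel_measurable lborel"
  by measurable
 then show ?thesis by (simp add: indicator_def sbox_def cong: if_cong)
qed

lemma dist_of_diff:
 assumes "continuous_on UNIV g" "continuous_on UNIV g'" "continuous_on UNIV ph" "supported_in ph K" "compact K"
 shows "dist_of (%y. g y - g' y) ph = dist_of g ph - dist_of g' ph"
proof -
 have "integrable lborel (%y. g y * ph y)" "integrable lborel (%y. g' y * ph y)"
  using assms by (auto intro: integrable_density_mult[OF locally_integrable_continuous])
 from Bochner_Integration.integral_diff[OF this] show ?thesis by (simp add: dist_of_def left_diff_distrib)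
qed

lemma borel_measurable_cmult_ennreal:
 "g \<in> borel_measurable D ==> (%x. c * g x :: ennreal) \<in> borel_measurable D"
 by measurable

lemma sigma_finite_ball_measure: "sigma_finite_measure (ball_measure s)"
 unfolding ball_measure_def
 by (subst sigma_finite_measure.sigma_finite_iff_density_finite[OF sigma_finite_lborel]) (auto simp: indicator_def)

locale modelled_pair = A: modelled \<T> s r ga Z p q f + B: modelled \<T> s r ga Z' p q f'
 for \<T> :: "('b::banach) regstruct" and s :: "'d::finite => nat" and r ga Z Z' p q f f'
begin

abbreviation "homs \<equiv> hom_below \<T> ga"

definition ddens :: "real ^ 'd => (real => 'b) => real ^ 'd => real" where
 "ddens x ta y = A.dens x ta y - B.dens x ta y"

definition nPid :: real where "nPid = enn2real (Pi_norm \<T> s r ga (Pi_diff Z Z'))"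

lemma nPid_nonneg: "0 <= nPid" by (simp add: nPid_def)

lemma ddens_continuous: "ta \<in> rs_sum \<T> ==> continuous_on D (ddens x ta)"
 unfolding ddens_def[abs_def] by (intro continuous_on_diff A.dens_continuous B.dens_continuous)

lemma pairing_ddens:
 assumes "ta \<in> rs_sum \<T>" "ph \<in> B_tests s r" "0 < dl"
 shows "pairing r (Pi_diff Z Z' x ta) (rescale s ph dl y) = dist_of (ddens x ta) (rescale s ph dl y)"
proof (rule pairing_density[OF locally_integrable_continuous[OF ddens_continuous[OF assms(1)]]])
 fix ph :: "real ^ 'd => real" assume ph: "ph \<in> test_funs"
 obtain K where K: "compact K" "supported_in ph K" using test_funs_supp[OF ph] by blast
 have c: "continuous_on UNIV ph" using ph smooth_continuous by (auto simp: test_funs_def)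
 show "Pi_diff Z Z' x ta ph = dist_of (ddens x ta) ph"
  unfolding ddens_def[abs_def] Pi_diff_def A.dens_eq[OF assms(1) ph] B.dens_eq[OF assms(1) ph]
  by (intro dist_of_diff[OF _ _ c K(2,1), symmetric] A.dens_continuous B.dens_continuous assms(1))
qed (use A.C_class_supp_rescale[OF assms(2,3), of y] in auto)

lemma dist_of_ddens:
 assumes "ta \<in> rs_sum \<T>" "ph \<in> B_tests s r" "0 < dl"
 shows "dist_of (ddens x ta) (rescale s ph dl y) = dist_of (A.dens x ta) (rescale s ph dl y) - dist_of (B.dens x ta) (rescale s ph dl y)"
 unfolding ddens_def[abs_def]
 using A.C_class_supp_rescale[OF assms(2,3), of y]
 by (intro dist_of_diff A.dens_continuous B.dens_continuous assms(1) C_class_continuous)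

text \<open>The norm of the difference is finite by the triangle inequality, so nothing is lost in
  passing to the real number \<open>nPid\<close>.\<close>

lemma Pi_diff_norm_eq: "Pi_norm \<T> s r ga (Pi_diff Z Z') = ennreal nPid"
proof -
 have "Pi_norm \<T> s r ga (Pi_diff Z Z') <= ennreal (A.nPi + B.nPi)"
  unfolding Pi_norm_def
 proof (intro SUP_least ennreal_leI)
  fix x ze b ph and dl :: real
  assume "ze \<in> rs_A \<T> \<inter> {..<ga}" and b: "b \<in> rs_T \<T> ze" and ph: "ph \<in> B_tests s r" and dl': "dl \<in> {0<..<1}"
  then have ze: "ze \<in> homs" and dl: "0 < dl" "dl < 1" by (auto simp: hom_below_def)
  have m: "homog ze b \<in> rs_sum \<T>" by (intro A.homog_in_sum A.H_A ze b)
  show "\<bar>pairing r (Pi_diff Z Z' x (homog ze b)) (rescale s ph dl x)\<bar> / (norm b * dl powr ze) <= A.nPi + B.nPi"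
  proof (cases "b = 0")
   case False
   have "\<bar>pairing r (Pi_diff Z Z' x (homog ze b)) (rescale s ph dl x)\<bar> <= (A.nPi + B.nPi) * (norm b * dl powr ze)"
    unfolding pairing_ddens[OF m ph dl(1)] dist_of_ddens[OF m ph dl(1)]
    using A.dist_of_dens_homog_le[OF ze b ph dl, of x] B.dist_of_dens_homog_le[OF ze b ph dl, of x]
    by (simp add: algebra_simps)
   then show ?thesis using False dl by (simp add: divide_le_eq)
  qed (use A.nPi_nonneg B.nPi_nonneg in simp)
 qed
 then show ?thesis unfolding nPid_def
  by (intro ennreal_enn2real[symmetric]) (rule le_less_trans, assumption, simp)
qed

lemma dist_of_ddens_homog_le:
 assumes ze: "ze \<in> homs" and b: "b \<in> rs_T \<T> ze" and ph: "ph \<in> B_tests s r" and dl: "0 < dl" "dl < 1"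
 shows "\<bar>dist_of (ddens x (homog ze b)) (rescale s ph dl x)\<bar> <= nPid * norm b * dl powr ze"
proof (cases "b = 0")
 case True
 have m: "homog ze b \<in> rs_sum \<T>" by (intro A.homog_in_sum A.H_A ze b)
 show ?thesis unfolding dist_of_ddens[OF m ph dl(1)]
  using A.dist_of_dens_homog_le[OF ze b ph dl, of x] B.dist_of_dens_homog_le[OF ze b ph dl, of x] True by simp
next
 case False
 have m: "homog ze b \<in> rs_sum \<T>" by (intro A.homog_in_sum A.H_A ze b)
 have "ennreal (\<bar>pairing r (Pi_diff Z Z' x (homog ze b)) (rescale s ph dl x)\<bar> / (norm b * dl powr ze)) <= Pi_norm \<T> s r ga (Pi_diff Z Z')"
  unfolding Pi_norm_def using assms
  by (intro SUP_upper2[of x] SUP_upper2[of ze] SUP_upper2[of b] SUP_upper2[of ph] SUP_upper2[of dl]) (auto simp: hom_below_def)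
 then have "\<bar>dist_of (ddens x (homog ze b)) (rescale s ph dl x)\<bar> / (norm b * dl powr ze) <= nPid"
  unfolding Pi_diff_norm_eq pairing_ddens[OF m ph dl(1)] using nPid_nonneg by (simp add: ennreal_le_iff)
 then show ?thesis using False assms by (simp add: divide_le_eq mult.assoc)
qed

lemma dist_of_ddens_le:
 assumes ta: "ta \<in> rs_below \<T> ga" and ph: "ph \<in> B_tests s r" and dl: "0 < dl" "dl < 1"
 shows "\<bar>dist_of (ddens x ta) (rescale s ph dl x)\<bar> <= (\<Sum>ze\<in>homs. nPid * norm (ta ze) * dl powr ze)"
proof -
 note C = A.C_class_supp_rescale[OF ph dl(1), of x]
 have "dist_of (ddens x ta) (rescale s ph dl x) = (\<Sum>ze\<in>homs. dist_of (A.dens x (homog ze (ta ze))) (rescale s ph dl x))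
   - (\<Sum>ze\<in>homs. dist_of (B.dens x (homog ze (ta ze))) (rescale s ph dl x))"
  unfolding dist_of_ddens[OF A.rs_below_sum[OF ta] ph dl(1)]
   A.dist_of_dens_decomp[OF ta C_class_continuous[OF C(1)] C(2,3)] B.dist_of_dens_decomp[OF ta C_class_continuous[OF C(1)] C(2,3)] ..
 also have "... = (\<Sum>ze\<in>homs. dist_of (ddens x (homog ze (ta ze))) (rescale s ph dl x))"
  unfolding sum_subtractf[symmetric]
  by (intro sum.cong refl dist_of_ddens[symmetric] A.homog_comp_in_sum ta ph dl)
 finally have eq: "dist_of (ddens x ta) (rescale s ph dl x) = (\<Sum>ze\<in>homs. dist_of (ddens x (homog ze (ta ze))) (rescale s ph dl x))" .
 show ?thesis unfolding eq
  by (intro order_trans[OF sum_abs] sum_mono dist_of_ddens_homog_le ph dl A.comp_in_T A.rs_below_sum[OF ta] A.H_A)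
qed

text \<open>The difference is split as Pi si - Pi' ta = Pi (si - ta) + (Pi - Pi') ta. The two terms
  are the origin of the two summands in the bound for a pair of models.\<close>

lemma pair_bound:
 assumes si: "si \<in> rs_below \<T> ga" and ta: "ta \<in> rs_below \<T> ga" and ph: "ph \<in> B_tests s r" and dl: "0 < dl" "dl < 1"
 shows "ennreal \<bar>LI y. (A.dens x si y - B.dens x ta y) * rescale s ph dl x y\<bar>
  <= (\<Sum>ze\<in>homs. ennreal (dl powr ze) * ennreal (A.nPi * norm (si ze - ta ze) + nPid * norm (ta ze)))"
proof -
 note C = A.C_class_supp_rescale[OF ph dl(1), of x]
 note sm = A.rs_below_sum[OF si] A.rs_below_sum[OF ta]
 let ?d = "%al. si al - ta al"
 have d: "?d \<in> rs_below \<T> ga" by (intro A.rs_below_diff si ta)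
 have "(LI y. (A.dens x si y - B.dens x ta y) * rescale s ph dl x y) = dist_of (%y. A.dens x si y - B.dens x ta y) (rescale s ph dl x)"
  by (simp add: dist_of_def)
 also have "... = dist_of (A.dens x si) (rescale s ph dl x) - dist_of (B.dens x ta) (rescale s ph dl x)"
  by (intro dist_of_diff[OF _ _ C_class_continuous[OF C(1)] C(2,3)] A.dens_continuous B.dens_continuous sm)
 also have "dist_of (A.dens x si) (rescale s ph dl x) = dist_of (A.dens x ?d) (rescale s ph dl x) + dist_of (A.dens x ta) (rescale s ph dl x)"
 proof -
  have "A.dens x ?d = (%y. A.dens x si y - A.dens x ta y)" using A.dens_diff[OF sm] by (simp add: fun_eq_iff)
  then have "dist_of (A.dens x ?d) (rescale s ph dl x) = dist_of (A.dens x si) (rescale s ph dl x) - dist_of (A.dens x ta) (rescale s ph dl x)"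
   using dist_of_diff[OF A.dens_continuous[OF sm(1)] A.dens_continuous[OF sm(2)] C_class_continuous[OF C(1)] C(2,3), of x x] by simp
  then show ?thesis by simp
 qed
 finally have eq: "(LI y. (A.dens x si y - B.dens x ta y) * rescale s ph dl x y) = dist_of (A.dens x ?d) (rescale s ph dl x) + dist_of (ddens x ta) (rescale s ph dl x)"
  using dist_of_ddens[OF sm(2) ph dl(1), of x x] by simp
 have "\<bar>LI y. (A.dens x si y - B.dens x ta y) * rescale s ph dl x y\<bar>
  <= (\<Sum>ze\<in>homs. A.nPi * norm (si ze - ta ze) * dl powr ze) + (\<Sum>ze\<in>homs. nPid * norm (ta ze) * dl powr ze)"
  unfolding eq using A.dist_of_dens_le[OF d ph dl, of x] dist_of_ddens_le[OF ta ph dl, of x] by linarith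
 also have "... = (\<Sum>ze\<in>homs. dl powr ze * (A.nPi * norm (si ze - ta ze) + nPid * norm (ta ze)))"
  unfolding sum.distrib[symmetric] by (intro sum.cong refl) (simp only: distrib_left ac_simps)
 finally have "ennreal \<bar>LI y. (A.dens x si y - B.dens x ta y) * rescale s ph dl x y\<bar> <= ennreal ..." by (rule ennreal_leI)
 also have "... = (\<Sum>ze\<in>homs. ennreal (dl powr ze * (A.nPi * norm (si ze - ta ze) + nPid * norm (ta ze))))"
  using A.nPi_nonneg nPid_nonneg by (intro sum_ennreal[symmetric]) simp
 also have "... = (\<Sum>ze\<in>homs. ennreal (dl powr ze) * ennreal (A.nPi * norm (si ze - ta ze) + nPid * norm (ta ze)))"
  using A.nPi_nonneg nPid_nonneg by (intro sum.cong refl ennreal_mult) auto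
 finally show ?thesis .
qed

definition F :: "real ^ 'd => real ^ 'd => real" where "F z y = A.F z y - B.F z y"

text \<open>The integrand of the split in \<open>pair_bound\<close>, with the model norms as
  weights, so that the germ norm is a combination of \<open>D_dist\<close> and
  \<open>D_norm\<close>.\<close>

definition J :: "real => real ^ 'd => real ^ 'd => ennreal" where
 "J ze z h = ennreal (cut s h * (A.nPi * norm (A.inc z h ze - B.inc z h ze) + nPid * norm (B.inc z h ze)))"

definition M :: "real => real ^ 'd => ennreal" where
 "M ze z = ennreal (A.nPi * norm (f z ze - f' z ze) + nPid * norm (f' z ze))"

lemma F_meas: "(%w. F (fst w) (snd w)) \<in> borel_measurable borel"
 unfolding F_def by (intro borel_measurable_diff A.F_meas B.F_meas)

lemma F_bound:
 assumes K: "compact K"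
 shows "\<exists>m. (\<forall>z. 0 <= m z) \<and> integrable lborel (%z. indicator K z * m z) \<and> (\<forall>z\<in>K. \<forall>y\<in>K. \<bar>F z y\<bar> <= m z)"
proof -
 obtain m where m: "!!z. 0 <= m z" "integrable lborel (%z. indicator K z * m z)" "!!z y. z \<in> K ==> y \<in> K ==> \<bar>A.F z y\<bar> <= m z"
  using A.F_bound[OF K] by blast
 obtain m' where m': "!!z. 0 <= m' z" "integrable lborel (%z. indicator K z * m' z)" "!!z y. z \<in> K ==> y \<in> K ==> \<bar>B.F z y\<bar> <= m' z"
  using B.F_bound[OF K] by blast
 show ?thesis
 proof (intro exI[of _ "%z. m z + m' z"] conjI allI ballI)
  show "0 <= m z + m' z" for z using m(1)[of z] m'(1)[of z] by simp
  show "integrable lborel (%z. indicator K z * (m z + m' z))"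
   unfolding distrib_left by (rule Bochner_Integration.integrable_add[OF m(2) m'(2)])
  show "\<bar>F z y\<bar> <= m z + m' z" if "z \<in> K" "y \<in> K" for z y
   using m(3)[OF that] m'(3)[OF that] by (simp add: F_def)
 qed
qed

lemma F_lim:
 assumes K: "compact K"
 shows "((%dl. NI y. indicator K y * (NI z. ennreal (inverse (dl ^ hom_dim s)) *
    indicator (sbox s y dl) z * ennreal \<bar>F z y - F y y\<bar>)) \<longlongrightarrow> 0) (at_right 0)"
proof -
 have Km: "K \<in> sets borel" using K by (simp add: compact_imp_closed borel_closed)
 define E where "E \<Phi> dl = (NI y. indicator K y * (NI z. ennreal (inverse (dl ^ hom_dim s)) *
    indicator (sbox s y dl) z * ennreal \<bar>\<Phi> z y - \<Phi> y y\<bar>))" for \<Phi> :: "real^'d => real^'d => real" and dl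
 have sec: "(%z. \<Phi> z y) \<in> borel_measurable borel" if "(%w. \<Phi> (fst w) (snd w)) \<in> borel_measurable borel" for \<Phi> :: "real^'d => real^'d => real" and y
  using measurable_compose[OF _ that, of "%z. (z, y)" borel] by simp
 have [measurable]: "(%z. A.F z y) \<in> borel_measurable borel" "(%z. B.F z y) \<in> borel_measurable borel" for y
  using sec[OF A.F_meas] sec[OF B.F_meas] .
 have le: "E F dl <= E A.F dl + E B.F dl" for dl
 proof -
  have "E F dl <= (NI y. indicator K y * (NI z. ennreal (inverse (dl ^ hom_dim s)) * indicator (sbox s y dl) z * ennreal \<bar>A.F z y - A.F y y\<bar>) +
    indicator K y * (NI z. ennreal (inverse (dl ^ hom_dim s)) * indicator (sbox s y dl) z * ennreal \<bar>B.F z y - B.F y y\<bar>))"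
   unfolding E_def
  proof (rule nn_integral_mono)
   fix y
   let ?w = "%z. ennreal (inverse (dl ^ hom_dim s)) * indicator (sbox s y dl) z"
   have "(NI z. ?w z * ennreal \<bar>F z y - F y y\<bar>) <= (NI z. ?w z * ennreal \<bar>A.F z y - A.F y y\<bar> + ?w z * ennreal \<bar>B.F z y - B.F y y\<bar>)"
   proof (rule nn_integral_mono)
    fix z
    have "ennreal \<bar>F z y - F y y\<bar> <= ennreal (\<bar>A.F z y - A.F y y\<bar> + \<bar>B.F z y - B.F y y\<bar>)" by (intro ennreal_leI) (simp add: F_def)
    also have "... = ennreal \<bar>A.F z y - A.F y y\<bar> + ennreal \<bar>B.F z y - B.F y y\<bar>" by simp
    finally show "?w z * ennreal \<bar>F z y - F y y\<bar> <= ?w z * ennreal \<bar>A.F z y - A.F y y\<bar> + ?w z * ennreal \<bar>B.F z y - B.F y y\<bar>"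
     unfolding distrib_left[symmetric] by (rule mult_left_mono) simp
   qed
   also have "... = (NI z. ?w z * ennreal \<bar>A.F z y - A.F y y\<bar>) + (NI z. ?w z * ennreal \<bar>B.F z y - B.F y y\<bar>)"
    by (rule nn_integral_add) measurable
   finally show "indicator K y * (NI z. ?w z * ennreal \<bar>F z y - F y y\<bar>) <= indicator K y * (NI z. ?w z * ennreal \<bar>A.F z y - A.F y y\<bar>) +
    indicator K y * (NI z. ?w z * ennreal \<bar>B.F z y - B.F y y\<bar>)"
    unfolding distrib_left[symmetric] by (rule mult_left_mono) simp
  qed
  also have "... = E A.F dl + E B.F dl"
   unfolding E_def by (intro nn_integral_add oscillation_measurable A.F_meas B.F_meas Km)
  finally show ?thesis .
 qed
 have "((%dl. E A.F dl + E B.F dl) \<longlongrightarrow> 0 + 0) (at_right 0)"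
  unfolding E_def by (intro tendsto_add A.F_lim B.F_lim K)
 then have "((%dl. E A.F dl + E B.F dl) \<longlongrightarrow> 0) (at_right 0)" by simp
 from tendsto_sandwich[OF always_eventually always_eventually tendsto_const this, of "E F"] le
 show ?thesis unfolding E_def by simp
qed

lemma dinc_measurable [measurable]:
 "ze \<in> homs ==> (%w. cut s (snd w) * norm (A.inc (fst w) (snd w) ze - B.inc (fst w) (snd w) ze)) \<in> borel_measurable (borel \<Otimes>\<^sub>M borel)"
 by (intro limit_piecewise_cont_cut_measurable[OF A.s] limit_piecewise_cont_diff A.inc_lpc B.inc_lpc)

lemma df_measurable [measurable]: "ze \<in> homs ==> (%x. norm (f x ze - f' x ze)) \<in> borel_measurable borel"
 using limit_piecewise_cont_norm_measurable[OF limit_piecewise_cont_diff[OF A.f_lpc B.f_lpc]] by simp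

lemma J_eq: "J ze z h = ennreal A.nPi * ennreal (cut s h * norm (A.inc z h ze - B.inc z h ze)) + ennreal nPid * ennreal (cut s h * norm (B.inc z h ze))"
 unfolding J_def using A.nPi_nonneg nPid_nonneg
 by (simp add: ennreal_mult[symmetric] ennreal_plus[symmetric] distrib_left ac_simps del: ennreal_plus)

lemma M_eq: "M ze z = ennreal A.nPi * ennreal (norm (f z ze - f' z ze)) + ennreal nPid * ennreal (norm (f' z ze))"
 unfolding M_def using A.nPi_nonneg nPid_nonneg
 by (simp add: ennreal_mult[symmetric] ennreal_plus[symmetric] del: ennreal_plus)

lemma J_meas: assumes ze: "ze \<in> homs" shows "(%w. J ze (fst w) (snd w)) \<in> borel_measurable borel"
proof -
 have "(%w. J ze (fst w) (snd w)) \<in> borel_measurable (borel \<Otimes>\<^sub>M borel)"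
  unfolding J_eq using dinc_measurable[OF ze] B.inc_measurable[OF ze] by measurable
 then show ?thesis by (simp add: borel_prod)
qed

lemma M_meas: assumes ze: "ze \<in> homs" shows "M ze \<in> borel_measurable borel"
 unfolding M_eq[abs_def] using df_measurable[OF ze] B.norm_f_measurable[OF ze] by measurable

lemma J_bound:
 assumes h: "0 < snorm s h" "snorm s h < 1" and "ph \<in> B_tests s r" "0 < dl" "dl < 1"
 shows "ennreal \<bar>LI y. (F (z + h) y - F z y) * rescale s ph dl (z + h) y\<bar> <= (\<Sum>ze\<in>homs. ennreal (dl powr ze) * J ze z h)"
proof -
 have "F (z + h) y - F z y = A.dens (z + h) (A.inc z h) y - B.dens (z + h) (B.inc z h) y" for y
  unfolding F_def A.F_increment_eq[symmetric] B.F_increment_eq[symmetric] by simp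
 then show ?thesis
  using pair_bound[OF A.inc_below B.inc_below assms(3-5), of "z + h" z h z h] unfolding J_def cut_eq_1[OF h] by simp
qed

lemma M_bound:
 assumes "ph \<in> B_tests s r" "0 < dl" "dl < 1"
 shows "ennreal \<bar>LI y. F z y * rescale s ph dl z y\<bar> <= (\<Sum>ze\<in>homs. ennreal (dl powr ze) * M ze z)"
 unfolding M_def F_def A.F_def B.F_def by (rule pair_bound[OF A.f_below B.f_below assms])

lemma J_supp: "J ze z h ~= 0 ==> 0 < snorm s h \<and> snorm s h < 1"
 using cut_neq_0[of s h] by (cases "cut s h = 0") (auto simp: J_def)

sublocale G: germ s r ga F homs J M
 by unfold_locales (fact A.s A.ga A.finite_hom_below F_meas | rule F_bound F_lim J_meas M_meas A.H_below J_bound M_bound J_supp; assumption)+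

lemma germ_norm_le:
 "G.germ_norm p q <= ennreal A.nPi * D_dist \<T> s ga p q Z Z' f f' + ennreal nPid * D_norm \<T> s ga p q Z' f'"
proof -
 note sl = lborel.sigma_finite_measure_axioms
 let ?a = "ennreal A.nPi" and ?b = "ennreal nPid"
 let ?e = "%ze h. ennreal (inverse (snorm s h powr (ga - ze)))"
 let ?f1 = "%ze x. ennreal (norm (f x ze - f' x ze))" and ?f2 = "%ze x. ennreal (norm (f' x ze))"
 let ?j1 = "%ze h x. ennreal (norm (A.inc x h ze - B.inc x h ze) / snorm s h powr (ga - ze))"
 let ?j2 = "%ze h x. ennreal (norm (B.inc x h ze) / snorm s h powr (ga - ze))"
 have 1: "Lp p (M ze) <= ?a * Lp p (?f1 ze) + ?b * Lp p (?f2 ze)" if ze: "ze \<in> homs" for ze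
 proof -
  have m1: "?f1 ze \<in> borel_measurable lborel" using df_measurable[OF ze] by simp
  have m2: "?f2 ze \<in> borel_measurable lborel" using B.norm_f_measurable[OF ze] by simp
  have "Lp p (M ze) <= Lp p (%x. ?a * ?f1 ze x) + Lp p (%x. ?b * ?f2 ze x)"
   unfolding M_eq[abs_def]
   by (rule Lp_norm_add_le[OF sl A.p borel_measurable_cmult_ennreal[OF m1] borel_measurable_cmult_ennreal[OF m2]])
  also have "... <= ?a * Lp p (?f1 ze) + ?b * Lp p (?f2 ze)"
   by (intro add_mono Lp_norm_cmult_le A.p m1 m2)
  finally show ?thesis .
 qed
 have 2: "Lb s q (G.omega p ze) <= ?a * Lb s q (%h. Lp p (?j1 ze h))
   + ?b * Lb s q (%h. Lp p (?j2 ze h))" if ze: "ze \<in> homs" for ze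
 proof -
  let ?c1 = "%h x. ennreal (cut s h * norm (A.inc x h ze - B.inc x h ze) / snorm s h powr (ga - ze))"
  let ?c2 = "%h x. ennreal (cut s h * norm (B.inc x h ze) / snorm s h powr (ga - ze))"
  have joint: "(%(x, h). ennreal (cut s h * norm (V x h) / snorm s h powr (ga - ze))) \<in> borel_measurable (lborel \<Otimes>\<^sub>M borel)"
   if "(%w. cut s (snd w) * norm (V (fst w) (snd w))) \<in> borel_measurable (borel \<Otimes>\<^sub>M borel)" for V :: "real^'d => real^'d => 'b"
  proof -
   have [measurable]: "(%w. cut s (snd w) * norm (V (fst w) (snd w))) \<in> borel_measurable (lborel \<Otimes>\<^sub>M borel)"
    using that by (simp cong: measurable_cong_sets sets_pair_measure_cong)
   show ?thesis unfolding case_prod_beta' by measurable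
  qed
  note j1 = joint[OF dinc_measurable[OF ze]] and j2 = joint[OF B.inc_measurable[OF ze]]
  have m1: "?c1 h \<in> borel_measurable lborel" for h using measurable_compose[OF _ j1, of "%x. (x, h)" lborel] by simp
  have m2: "?c2 h \<in> borel_measurable lborel" for h using measurable_compose[OF _ j2, of "%x. (x, h)" lborel] by simp
  let ?L1 = "%h. Lp p (?c1 h)" and ?L2 = "%h. Lp p (?c2 h)"
  have L1: "?L1 \<in> borel_measurable (ball_measure s)" using Lp_norm_measurable[OF sl j1, of p] by simp
  have L2: "?L2 \<in> borel_measurable (ball_measure s)" using Lp_norm_measurable[OF sl j2, of p] by simp
  have omle: "G.omega p ze h <= ?a * ?L1 h + ?b * ?L2 h" for h
  proof -
   have eq: "?e ze h * J ze x h = ?a * ?c1 h x + ?b * ?c2 h x" for x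
   proof -
    have "?e ze h * ennreal (cut s h * norm v) = ennreal (cut s h * norm v / snorm s h powr (ga - ze))" for v :: 'b
     by (simp add: ennreal_mult[symmetric] divide_inverse ac_simps)
    then show ?thesis unfolding J_eq by (simp add: distrib_left mult.left_commute[of "?e ze h"])
   qed
   have "G.omega p ze h <= Lp p (%x. ?a * ?c1 h x) + Lp p (%x. ?b * ?c2 h x)"
    unfolding G.omega_def eq
    by (rule Lp_norm_add_le[OF sl A.p borel_measurable_cmult_ennreal[OF m1] borel_measurable_cmult_ennreal[OF m2]])
   also have "... <= ?a * ?L1 h + ?b * ?L2 h" by (intro add_mono Lp_norm_cmult_le A.p m1 m2)
   finally show ?thesis .
  qed
  note sfb = sigma_finite_ball_measure[of s]
  have "Lb s q (G.omega p ze) <= Lb s q (%h. ?a * ?L1 h + ?b * ?L2 h)"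
   by (intro Lp_norm_mono omle)
  also have "... <= Lb s q (%h. ?a * ?L1 h) + Lb s q (%h. ?b * ?L2 h)"
   by (rule Lp_norm_add_le[OF sfb A.q borel_measurable_cmult_ennreal[OF L1] borel_measurable_cmult_ennreal[OF L2]])
  also have "... <= ?a * Lb s q ?L1 + ?b * Lb s q ?L2"
   by (intro add_mono Lp_norm_cmult_le A.q L1 L2)
  \<comment> \<open>Dropping the cut-off enlarges the norms and returns to the increments of the
    definition over the closed unit ball.\<close>
  also have "... <= ?a * Lb s q (%h. Lp p (?j1 ze h)) + ?b * Lb s q (%h. Lp p (?j2 ze h))"
   by (intro add_mono mult_left_mono Lp_norm_mono ennreal_leI divide_right_mono) (auto intro: mult_left_le_one_le cut_le_1)
  finally show ?thesis .
 qed
 have "G.germ_norm p q <= (\<Sum>ze\<in>homs. (?a * Lp p (?f1 ze) + ?b * Lp p (?f2 ze)) +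
   (?a * Lb s q (%h. Lp p (?j1 ze h)) + ?b * Lb s q (%h. Lp p (?j2 ze h))))"
  unfolding G.germ_norm_def by (intro sum_mono add_mono 1 2)
 also have "... = ?a * (\<Sum>ze\<in>homs. Lp p (?f1 ze) + Lb s q (%h. Lp p (?j1 ze h)))
   + ?b * (\<Sum>ze\<in>homs. Lp p (?f2 ze) + Lb s q (%h. Lp p (?j2 ze h)))"
  unfolding sum_distrib_left sum.distrib[symmetric] by (intro sum.cong refl) (simp only: distrib_left ac_simps)
 also have "(\<Sum>ze\<in>homs. Lp p (?f1 ze) + Lb s q (%h. Lp p (?j1 ze h))) = D_dist \<T> s ga p q Z Z' f f'"
  by (simp add: D_dist_def increment_norm_def A.inc_def B.inc_def hom_below_def)
 also have "(\<Sum>ze\<in>homs. Lp p (?f2 ze) + Lb s q (%h. Lp p (?j2 ze h))) = D_norm \<T> s ga p q Z' f'"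
  by (rule B.D_norm_eq[symmetric])
 finally show ?thesis .
qed

end

context smooth_model_scaled
begin

lemma Gam_zero: "m_Gam Z x y (%ze. 0) = (%ze. 0)"
 using Gam_diff_eq[OF rs_sum_zero rs_sum_zero, of x y] by simp

lemma dens_zero: "dens x (%ze. 0) y = 0"
 using dens_diff[OF rs_sum_zero rs_sum_zero, of x y] by simp

lemma D_norm_zero: "1 <= p ==> 1 <= q ==> D_norm \<T> s ga p q Z (%x ze. 0) = 0"
 by (simp add: D_norm_def increment_norm_def Gam_zero)

lemma D_dist_zero: "D_dist \<T> s ga p q Z Z f (%x ze. 0) = D_norm \<T> s ga p q Z f"
 by (simp add: D_norm_def D_dist_def increment_norm_def Gam_zero)

lemma zero_in_D_space:
 assumes "1 <= p" "1 <= q"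
 shows "(%x ze. 0) \<in> D_space \<T> s ga p q Z"
proof -
 have "strongly_measurable (%x :: real ^ 'd. 0 :: 'b)"
  unfolding strongly_measurable_def by (intro exI[of _ "%n x. 0"]) auto
 moreover have "(%ze. 0) \<in> rs_below \<T> ga" using rs_sum_zero by (simp add: rs_below_def)
 ultimately show ?thesis using D_norm_zero[OF assms] by (simp add: D_space_def)
qed

end

context modelled_pair
begin

text \<open>\<open>U\<close> is prescribed on test functions only. Local integrability of the
  diagonal and of \<open>F x\<close> makes \<open>pairing\<close> on C^r functions an integral
  against the same density.\<close>

lemma multiscale_le:
 assumes U: "!!x ph. ph \<in> test_funs ==> U x ph = dist_of (%y. G.diag y - F x y) ph"
 shows "multiscale_norm s r (B_tests s r) ga p q U <= G.error_const q * G.germ_norm p q"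
proof -
 have Fc: "continuous_on UNIV (F x)" for x
  unfolding F_def[abs_def] A.F_def B.F_def
  by (intro continuous_on_diff A.dens_continuous B.dens_continuous A.f_sum B.f_sum)
 have pair: "pairing r (U x) (rescale s et dl x) = (LI y. G.diag y * rescale s et dl x y) - (LI y. F x y * rescale s et dl x y)"
  if et: "et \<in> B_tests s r" and dl: "0 < dl" for x et dl
 proof -
  note C = A.C_class_supp_rescale[OF et dl, of x]
  note Cc = C_class_continuous[OF C(1)]
  have li: "locally_integrable (%y. G.diag y - F x y)"
   using G.locally_integrable_diag locally_integrable_continuous[OF Fc[of x]]
   unfolding locally_integrable_def by (auto intro: set_integral_diff)
  have "pairing r (U x) (rescale s et dl x) = dist_of (%y. G.diag y - F x y) (rescale s et dl x)"
   by (rule pairing_density[OF li U C])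
  also have "... = (LI y. G.diag y * rescale s et dl x y) - (LI y. F x y * rescale s et dl x y)"
   unfolding dist_of_def left_diff_distrib
   by (intro Bochner_Integration.integral_diff integrable_density_mult[OF _ Cc C(2,3)] G.locally_integrable_diag locally_integrable_continuous Fc)
  finally show ?thesis .
 qed
 show ?thesis unfolding multiscale_norm_def
 proof (rule order_trans[OF Lp_norm_scale_mono G.error_Lq[OF A.p A.q]])
  fix dl :: real assume "0 < dl" "dl < 1"
  then show "Lp p (%x. SUP et\<in>B_tests s r. ennreal (\<bar>pairing r (U x) (rescale s et dl x)\<bar> / dl powr ga)) <=
   Lp p (%x. SUP et\<in>B_tests s r. ennreal (\<bar>(LI y. G.diag y * rescale s et dl x y) - (LI y. F x y * rescale s et dl x y)\<bar> / dl powr ga))"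
   by (intro Lp_norm_mono SUP_mono) (auto simp: pair)
 qed
qed

end

section \<open>The reconstruction over a single model\<close>

context modelled
begin

lemma recon_fun_eq: "recon_fun Z f = (%y. F y y)"
 by (simp add: recon_fun_def F_def dens_def)

text \<open>Comparing \<open>f\<close> with 0 over the same model specialises the estimates for
  pairs to a single modelled distribution.\<close>

lemma modelled_pair_zero: "modelled_pair \<T> s r ga Z Z p q f (%x ze. 0)"
 unfolding modelled_pair_def
 by (intro conjI modelled_axioms modelled.intro smooth_model_scaled_axioms modelled_axioms.intro zero_in_D_space ga p q)

definition J0 :: "real => real ^ 'd => real ^ 'd => ennreal" where "J0 = modelled_pair.J \<T> s r ga Z Z f (%x ze. 0)"
definition M0 :: "real => real ^ 'd => ennreal" where "M0 = modelled_pair.M \<T> s r ga Z Z f (%x ze. 0)"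

lemma F_zero: "modelled_pair.F Z Z f (%x ze. 0) = F"
proof -
 interpret P: modelled_pair \<T> s r ga Z Z p q f "%x ze. 0" by (rule modelled_pair_zero)
 show ?thesis by (simp add: fun_eq_iff P.F_def P.B.F_def dens_zero)
qed

sublocale G: germ s r ga F H J0 M0
proof -
 interpret P: modelled_pair \<T> s r ga Z Z p q f "%x ze. 0" by (rule modelled_pair_zero)
 show "germ s r ga F H J0 M0" using P.G.germ_axioms unfolding F_zero J0_def M0_def .
qed

lemma germ_norm_le: "G.germ_norm p q <= ennreal nPi * D_norm \<T> s ga p q Z f"
proof -
 interpret P: modelled_pair \<T> s r ga Z Z p q f "%x ze. 0" by (rule modelled_pair_zero)
 show ?thesis using P.germ_norm_le unfolding D_dist_zero D_norm_zero[OF p q] J0_def M0_def by simp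
qed

lemma recon_eq: "recon Z f = dist_of G.diag"
 by (simp add: recon_def recon_fun_eq G.diag_def[abs_def])

lemma locally_integrable_recon: "locally_integrable (recon_fun Z f)"
 using G.locally_integrable_diag by (simp add: recon_fun_eq G.diag_def[abs_def])

lemma multiscale_recon_le:
 assumes "!!x ph. ph \<in> test_funs ==> U x ph = recon Z f ph - m_Pi Z x (f x) ph"
 shows "multiscale_norm s r (B_tests s r) ga p q U <= G.error_const q * (ennreal nPi * D_norm \<T> s ga p q Z f)"
proof -
 interpret P: modelled_pair \<T> s r ga Z Z p q f "%x ze. 0" by (rule modelled_pair_zero)
 have "multiscale_norm s r (B_tests s r) ga p q U <= G.error_const q * P.G.germ_norm p q"
 proof (rule P.multiscale_le)
  fix x ph assume ph: "ph \<in> (test_funs :: (real ^ 'd => real) set)"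
  obtain K where K: "compact K" "supported_in ph K" using test_funs_supp[OF ph] by blast
  have c: "continuous_on UNIV ph" using ph smooth_continuous by (auto simp: test_funs_def)
  have Fl: "locally_integrable (F x)" unfolding F_def by (intro locally_integrable_continuous dens_continuous f_sum)
  have "U x ph = (LI y. G.diag y * ph y) - (LI y. F x y * ph y)"
   unfolding assms[OF ph] recon_eq dens_eq[OF f_sum ph] by (simp add: dist_of_def F_def)
  also have "... = (LI y. G.diag y * ph y - F x y * ph y)"
   by (intro Bochner_Integration.integral_diff[symmetric] integrable_density_mult[OF _ c K(2,1)] G.locally_integrable_diag Fl)
  also have "... = dist_of (%y. P.G.diag y - P.F x y) ph"
   unfolding F_zero by (simp add: dist_of_def left_diff_distrib G.diag_def P.G.diag_def F_zero)
  finally show "U x ph = dist_of (%y. P.G.diag y - P.F x y) ph" .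
 qed
 also have "... <= G.error_const q * (ennreal nPi * D_norm \<T> s ga p q Z f)"
  using P.germ_norm_le unfolding D_dist_zero D_norm_zero[OF p q] by (intro mult_left_mono) auto
 finally show ?thesis .
qed

text \<open>The summand 1 on the right is for the unit scale term at \<open>a >= 0\<close>, the
  other one for the multiscale term; \<open>e\<close> is the room between \<open>a\<close> and the
  homogeneities.\<close>

lemma recon_besov_norm_le:
 assumes e: "!!ze. ze \<in> H ==> a + e <= ze"
 shows "besov_norm s r a p q (recon Z f) <=
  G.value_const q * (ennreal nPi * D_norm \<T> s ga p q Z f) * (1 + Ls q (%dl. ennreal (dl powr e)))"
proof -
 let ?L = "Ls q (%dl. ennreal (dl powr e))"
 let ?c = "G.value_const q * G.germ_norm p q"
 have pair: "pairing r (recon Z f) (rescale s et dl x) = (LI y. G.diag y * rescale s et dl x y)"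
  if et: "et \<in> B_tests s r" and dl: "0 < dl" for x et dl
  unfolding recon_eq using pairing_density[OF G.locally_integrable_diag refl C_class_supp_rescale[OF et dl, of x]]
  by (simp add: dist_of_def)
 have ms: "multiscale_norm s r E a p q (%x. recon Z f) <= ?c * ?L" if E: "E \<subseteq> B_tests s r" for E
  unfolding multiscale_norm_def
 proof (rule order_trans[OF Lp_norm_scale_mono G.value_Lq[OF p q e E]])
  fix dl :: real assume "0 < dl" "dl < 1"
  then show "Lp p (%x. SUP et\<in>E. ennreal (\<bar>pairing r (recon Z f) (rescale s et dl x)\<bar> / dl powr a)) <=
   Lp p (%x. SUP et\<in>E. ennreal (\<bar>LI y. G.diag y * rescale s et dl x y\<bar> / dl powr a))"
   using E by (intro Lp_norm_mono SUP_mono) (auto simp: pair subset_iff)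
 qed
 have unit: "Lp p (%x. SUP et\<in>B_tests s r. ennreal \<bar>pairing r (recon Z f) (rescale s et 1 x)\<bar>) <= ?c * 1"
 proof -
  have "Lp p (%x. SUP et\<in>B_tests s r. ennreal \<bar>pairing r (recon Z f) (rescale s et 1 x)\<bar>)
   <= Lp p (%x. SUP et\<in>B_tests s r. ennreal (\<bar>LI y. G.diag y * rescale s et 1 x y\<bar> / 1 powr a))"
   by (intro Lp_norm_mono SUP_mono) (auto simp: pair)
  also have "... <= ?c * ennreal (1 powr e)" by (intro G.value_Lp' p q e) auto
  finally show ?thesis by simp
 qed
 have "besov_norm s r a p q (recon Z f) <= ?c * 1 + ?c * ?L"
 proof (cases "a < 0")
  case True
  then show ?thesis using order_trans[OF ms[OF subset_refl] add_increasing[of "?c * 1" "?c * ?L" "?c * ?L"]] by (simp add: besov_norm_def)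
 next
  case False
  then show ?thesis unfolding besov_norm_def using add_mono[OF unit ms[of "B_tests_ann s r a"]] by (simp add: B_tests_ann_def)
 qed
 also have "... = ?c * (1 + ?L)" by (simp only: distrib_left)
 also have "... <= G.value_const q * (ennreal nPi * D_norm \<T> s ga p q Z f) * (1 + ?L)"
  by (intro mult_right_mono mult_left_mono germ_norm_le) auto
 finally show ?thesis .
qed

lemma recon_distribution: "distribution (recon Z f)" "order_at_most r (recon Z f)"
 unfolding recon_eq by (rule distribution_dist_of[OF G.locally_integrable_diag])+

lemma recon_bounds:
 assumes a: "!!ze. ze \<in> rs_A \<T> ==> al <= ze" and abar: "if q = \<infinity> then abar = al else abar < al"
 shows "besov_norm s r abar p q (recon Z f) <=
   ennreal (enn2real (G.value_const q * ennreal nPi * (1 + Ls q (%dl. ennreal (dl powr (al - abar)))))) * D_norm \<T> s ga p q Z f"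
  and "recon Z f \<in> besov s r abar p q"
proof -
 let ?L = "Ls q (%dl. ennreal (dl powr (al - abar)))"
 \<comment> \<open>The place where the condition on \<open>abar\<close> enters: equality is allowed
   for \<open>q\<close> infinite only.\<close>
 have "?L < top" using abar by (intro Lq_scale_powr[OF s ga q]) (auto split: if_splits)
 then have "G.value_const q * ennreal nPi * (1 + ?L) < top"
  by (intro ennreal_mult_less_top[THEN iffD2] disjI2 conjI ennreal_add_less_top[THEN iffD2] ennreal_less_top ennreal_one_less_top G.value_const_finite)
 then have fin: "ennreal (enn2real (G.value_const q * ennreal nPi * (1 + ?L))) = G.value_const q * ennreal nPi * (1 + ?L)"
  by (rule ennreal_enn2real)
 have "besov_norm s r abar p q (recon Z f) <= G.value_const q * (ennreal nPi * D_norm \<T> s ga p q Z f) * (1 + ?L)"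
  using a by (intro recon_besov_norm_le) (simp add: H_A)
 also have "... = G.value_const q * ennreal nPi * (1 + ?L) * D_norm \<T> s ga p q Z f" by (simp only: ac_simps)
 finally show 1: "besov_norm s r abar p q (recon Z f) <=
   ennreal (enn2real (G.value_const q * ennreal nPi * (1 + ?L))) * D_norm \<T> s ga p q Z f" unfolding fin .
 have "ennreal (enn2real (G.value_const q * ennreal nPi * (1 + ?L))) * D_norm \<T> s ga p q Z f < \<infinity>"
  using D_norm_finite by (simp add: ennreal_mult_less_top)
 then show "recon Z f \<in> besov s r abar p q"
  using recon_distribution le_less_trans[OF 1] by (simp add: besov_def)
qed

end

lemma recon_linear:
 assumes A: "modelled \<T> s r ga Z p q f" and B: "modelled \<T> s r ga Z p q g" and ph: "ph \<in> test_funs"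
 shows "recon Z (%x ze. c *\<^sub>R f x ze + d *\<^sub>R g x ze) ph = c * recon Z f ph + d * recon Z g ph"
proof -
 interpret A: modelled \<T> s r ga Z p q f by (rule A)
 interpret B: modelled \<T> s r ga Z p q g by (rule B)
 obtain K where K: "compact K" "supported_in ph K" using test_funs_supp[OF ph] by blast
 have cont: "continuous_on UNIV ph" using ph smooth_continuous by (auto simp: test_funs_def)
 have i: "integrable lborel (%y. recon_fun Z f y * ph y)" "integrable lborel (%y. recon_fun Z g y * ph y)"
  by (intro integrable_density_mult[OF _ cont K(2,1)] A.locally_integrable_recon B.locally_integrable_recon)+
 have "recon_fun Z (%x ze. c *\<^sub>R f x ze + d *\<^sub>R g x ze) y = c * recon_fun Z f y + d * recon_fun Z g y" for y
  using fun_cong[OF A.dens_lin[OF A.f_sum[of y] B.f_sum[of y], where x = y and a = c and b = d], of y]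
  by (simp add: recon_fun_def A.dens_def)
 then have "recon Z (%x ze. c *\<^sub>R f x ze + d *\<^sub>R g x ze) ph = (LI y. c * (recon_fun Z f y * ph y) + d * (recon_fun Z g y * ph y))"
  unfolding recon_def dist_of_def by (simp only: distrib_right mult.assoc)
 also have "... = c * recon Z f ph + d * recon Z g ph" using i by (simp add: recon_def dist_of_def)
 finally show ?thesis .
qed

section \<open>Uniqueness\<close>

text \<open>A product of hats: a smooth partition of unity on the grid of spacing
  \<open>dl ^ s i / 2\<close> in direction \<open>i\<close>, with grid points indexed by
  \<open>k\<close>.\<close>

definition cellfun :: "('d::finite => nat) => real => ('d => int) => real ^ 'd => real" where
 "cellfun s dl k y = (\<Prod>i\<in>UNIV. hat (2 * y $ i / dl ^ s i - real_of_int (k i)))"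

lemma C_class_prod_hat: "C_class m (%u :: real ^ 'd::finite. \<Prod>i\<in>UNIV. hat (u $ i))"
 by (intro C_class_prod C_class_C1 C1_hat)

lemma cellfun_eq: "cellfun s dl k = (%y. (%u. \<Prod>i\<in>UNIV. hat (u $ i)) (\<chi> i. - real_of_int (k i) + (2 / dl ^ s i) * y $ i))"
 by (simp add: cellfun_def[abs_def] algebra_simps)

lemma C_class_cellfun: "C_class m (cellfun s dl k)"
 unfolding cellfun_eq by (rule C_class_affine[OF C_class_prod_hat])

lemma cellfun_neq_0:
 assumes "cellfun s dl k y ~= 0"
 shows "\<bar>2 * y $ i / dl ^ s i - real_of_int (k i)\<bar> < 1"
proof (rule ccontr)
 assume "\<not> ?thesis"
 then have "hat (2 * y $ i / dl ^ s i - real_of_int (k i)) = 0" by (intro hat_eq_0) simp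
 then have "cellfun s dl k y = 0" unfolding cellfun_def by (intro prod_zero) auto
 then show False using assms by simp
qed

lemma sum_cellfun:
 assumes "!!i. \<bar>2 * y $ i / dl ^ s i\<bar> <= real n"
 shows "(\<Sum>k\<in>PiE UNIV (%_. {- int n..int n}). cellfun s dl k y) = 1"
proof -
 have "(\<Sum>k\<in>PiE UNIV (%_. {- int n..int n}). cellfun s dl k y) = (\<Prod>i\<in>UNIV. \<Sum>k\<in>{- int n..int n}. hat (2 * y $ i / dl ^ s i - real_of_int k))"
  unfolding cellfun_def by (rule prod_sum_PiE[symmetric]) auto
 also have "... = (\<Prod>i\<in>(UNIV :: 'a set). 1)" by (intro prod.cong refl sum_hat assms)
 finally show ?thesis by simp
qed

text \<open>The product is a test function at scale \<open>dl\<close> around every \<open>x\<close>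
  near the grid point, not just around the grid point itself: offset 1/2 and hat radius 1 give
  coordinates of size at most 3/4. One pairing is thus seen from a whole box of centres, which
  converts bounds in L^p over the centre into bounds for the pairing.\<close>

lemma cellfun_localize:
 fixes ph :: "real ^ 'd::finite => real"
 assumes s: "scaling s" and ph: "smooth ph" "supported_in ph K" "compact K"
 shows "\<exists>a>0. \<forall>dl x k. 0 < dl --> dl <= 1 --> (\<forall>i. \<bar>2 * x $ i / dl ^ s i - real_of_int (k i)\<bar> <= 1 / 2) -->
  (\<exists>et\<in>B_tests s r. smooth et \<and> (\<forall>y. ph y * cellfun s dl k y = a * dl ^ hom_dim s * rescale s et dl x y))"
proof -
 define \<Phi> where "\<Phi> = (%u :: real ^ 'd. \<Prod>i\<in>UNIV. hat (u $ i))"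
 have \<Phi>C: "C_class m \<Phi>" for m unfolding \<Phi>_def by (rule C_class_prod_hat)
 have \<Phi>0: "\<bar>u $ i\<bar> < 1" if "\<Phi> u ~= 0" for u i
 proof (rule ccontr)
  assume "\<not> ?thesis"
  then have "hat (u $ i) = 0" by (intro hat_eq_0) simp
  then have "\<Phi> u = 0" unfolding \<Phi>_def by (intro prod_zero) auto
  then show False using that by simp
 qed
 have "supported_in \<Phi> (sball s)"
  unfolding supported_in_def sball_def using \<Phi>0 snorm_le_iff[OF s, of 1] by (auto intro: less_imp_le)
 moreover have "compact (sball s :: (real ^ 'd) set)" unfolding sball_eq_cbox[OF s] by (rule compact_cbox)
 ultimately obtain b where b: "Cb r b \<Phi>" using Cb_exists[OF \<Phi>C] by blast
 obtain a1 where a1: "Cb r a1 ph" using Cb_exists[of r ph K] ph by (auto simp: smooth_def)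
 \<comment> \<open>The summand 1 keeps \<open>c\<close> positive; otherwise it is the product bound
   of \<open>Cb_mult\<close>.\<close>
 define c where "c = 2 ^ r * (1 ^ r * a1) * (2 ^ r * b) + 1"
 have c: "0 < c" using Cb_nonneg[OF a1] Cb_nonneg[OF b] by (simp add: c_def add_nonneg_pos)
 have "\<exists>et\<in>B_tests s r. smooth et \<and> (\<forall>y. ph y * cellfun s dl k y = c * dl ^ hom_dim s * rescale s et dl x y)"
  if dl: "0 < dl" "dl <= 1" and xk: "!!i. \<bar>2 * x $ i / dl ^ s i - real_of_int (k i)\<bar> <= 1 / 2" for dl x k
 proof -
  define m1 where "m1 = (%v :: real ^ 'd. ph (\<chi> i. x $ i + dl ^ s i * v $ i))"
  define m2 where "m2 = (%v :: real ^ 'd. \<Phi> (\<chi> i. (2 * x $ i / dl ^ s i - real_of_int (k i)) + 2 * v $ i))"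
  define et where "et = (%v. inverse c * (m1 v * m2 v))"
  have "Cb r (1 ^ r * a1) m1" unfolding m1_def using dl by (intro Cb_affine a1) (auto simp: power_le_one)
  moreover have "Cb r (2 ^ r * b) m2" unfolding m2_def by (intro Cb_affine b) auto
  ultimately have "Cb r (\<bar>inverse c\<bar> * (2 ^ r * (1 ^ r * a1) * (2 ^ r * b))) et"
   unfolding et_def by (intro Cb_cmult Cb_mult)
  moreover have "\<bar>inverse c\<bar> * (2 ^ r * (1 ^ r * a1) * (2 ^ r * b)) <= \<bar>inverse c\<bar> * c"
   by (intro mult_left_mono) (auto simp: c_def)
  moreover have "\<bar>inverse c\<bar> * c = 1" using c by simp
  ultimately have "Cb r 1 et" using Cb_mono by fastforce
  then have "C_class r et" "C_norm r et <= 1" using Cb_iff[of 1 r et] by auto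
  moreover have "supported_in et (sball s)"
   unfolding supported_in_def sball_def
  proof (intro allI impI CollectI)
   fix v assume "et v ~= 0"
   then have "m2 v ~= 0" by (auto simp: et_def)
   then have v: "\<bar>(2 * x $ i / dl ^ s i - real_of_int (k i)) + 2 * v $ i\<bar> < 1" for i
    unfolding m2_def using \<Phi>0 by fastforce
   then have "\<bar>v $ i\<bar> <= 1" for i using xk[of i] v[of i] by linarith
   then show "snorm s v <= 1" using snorm_le_iff[OF s, of 1 v] by simp
  qed
  moreover have "smooth et" unfolding smooth_def
  proof
   fix m
   have "C_class m m1" unfolding m1_def using ph(1) by (intro C_class_affine) (simp add: smooth_def)
   moreover have "C_class m m2" unfolding m2_def by (intro C_class_affine \<Phi>C)
   ultimately show "C_class m et" unfolding et_def by (intro C_class_mult C_class_const)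
  qed
  moreover have "ph y * cellfun s dl k y = c * dl ^ hom_dim s * rescale s et dl x y" for y
  proof -
   let ?v = "\<chi> i. (y $ i - x $ i) / dl ^ s i"
   have "(\<chi> i. x $ i + dl ^ s i * ?v $ i) = y" using dl by (simp add: vec_eq_iff)
   then have 1: "m1 ?v = ph y" by (simp only: m1_def)
   have eq2: "(2 * x $ i / dl ^ s i - real_of_int (k i)) + 2 * ?v $ i = - real_of_int (k i) + (2 / dl ^ s i) * y $ i" for i
    by (simp add: diff_divide_distrib right_diff_distrib)
   have 2: "m2 ?v = cellfun s dl k y" by (simp only: m2_def eq2 cellfun_eq \<Phi>_def)
   have "c * dl ^ hom_dim s * rescale s et dl x y = c * dl ^ hom_dim s * ((inverse c * (ph y * cellfun s dl k y)) / dl ^ hom_dim s)"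
    unfolding rescale_def et_def 1 2 ..
   also have "... = ph y * cellfun s dl k y" using c dl by simp
   finally show ?thesis by simp
  qed
  ultimately show ?thesis by (intro bexI[of _ et] conjI allI) (auto simp: B_tests_def)
 qed
 then show ?thesis using c by blast
qed

lemma test_funs_mult_cellfun:
 assumes "smooth ph" "supported_in ph K" "compact K"
 shows "(%y. ph y * cellfun s dl k y) \<in> test_funs"
 using assms unfolding test_funs_def smooth_def
 by (auto intro!: C_class_mult C_class_cellfun exI[of _ K] simp: supported_in_def)

lemma distribution_sum:
 assumes u: "distribution u" and I: "finite I" and K: "compact K"
  and ph: "!!k. k \<in> I ==> ph k \<in> test_funs" "!!k. k \<in> I ==> supported_in (ph k) K"
 shows "u (%y. \<Sum>k\<in>I. ph k y) = (\<Sum>k\<in>I. u (ph k))"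
proof -
 have zero: "(%y. 0) \<in> (test_funs :: (real ^ 'a => real) set)"
  unfolding test_funs_def smooth_def by (auto intro!: C_class_const exI[of _ "{}"] simp: supported_in_def)
 have lin: "\<forall>ph\<in>test_funs. \<forall>ps\<in>test_funs. \<forall>a b. u (%x. a * ph x + b * ps x) = a * u ph + b * u ps"
  using u by (simp add: distribution_def)
 have "(%y. \<Sum>k\<in>J. ph k y) \<in> test_funs \<and> u (%y. \<Sum>k\<in>J. ph k y) = (\<Sum>k\<in>J. u (ph k))" if "J \<subseteq> I" for J
  using finite_subset[OF that I] that
 proof (induction J rule: finite_induct)
  case empty
  show ?case using distribution_diff[OF u zero zero] zero by simp
 next
  case (insert j J)
  then have ih: "(%y. \<Sum>k\<in>J. ph k y) \<in> test_funs" "u (%y. \<Sum>k\<in>J. ph k y) = (\<Sum>k\<in>J. u (ph k))" and j: "ph j \<in> test_funs"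
   using ph by auto
  have "(%y. ph j y + (\<Sum>k\<in>J. ph k y)) \<in> test_funs"
  proof -
   obtain L where "compact L" "supported_in (%y. \<Sum>k\<in>J. ph k y) L" using test_funs_supp[OF ih(1)] by blast
   moreover have "supported_in (ph j) K" using insert ph by auto
   ultimately have "x \<in> K \<union> L" if "ph j x + (\<Sum>k\<in>J. ph k x) ~= 0" for x
    using that by (cases "ph j x = 0") (auto simp: supported_in_def)
   then have "supported_in (%y. ph j y + (\<Sum>k\<in>J. ph k y)) (K \<union> L)" "compact (K \<union> L)"
    using K \<open>compact L\<close> by (auto simp: supported_in_def)
   then show ?thesis using j ih(1) unfolding test_funs_def smooth_def by (auto intro!: C_class_add)
  qed
  moreover have "u (%y. 1 * ph j y + 1 * (\<Sum>k\<in>J. ph k y)) = 1 * u (ph j) + 1 * u (%y. \<Sum>k\<in>J. ph k y)"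
   using lin[rule_format, OF j ih(1), of 1 1] .
  ultimately show ?case using insert ih by simp
 qed
 then show ?thesis by blast
qed

lemma distribution_cmult:
 assumes u: "distribution u" and "ph \<in> test_funs"
 shows "u (%y. a * ph y) = a * u ph"
proof -
 have "u (%y. a * ph y + 0 * ph y) = a * u ph + 0 * u ph" using assms unfolding distribution_def by blast
 then show ?thesis by simp
qed

text \<open>Only \<open>H\<close> has to be measurable: subtracting it from a simple function below \<open>h + H\<close> leaves
 a measurable function below \<open>h\<close>.\<close>

lemma distribution_le_at_scale:
 fixes u :: "'d::finite functional"
 assumes s: "scaling s" and p: "1 <= p" and u: "distribution u" and ph: "ph \<in> test_funs"
 shows "\<exists>C\<ge>0. \<forall>dl h H. 0 < dl --> dl <= 1 --> H \<in> borel_measurable borel -->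
  (\<forall>x. \<forall>et\<in>B_tests s r. smooth et --> ennreal (\<bar>u (rescale s et dl x)\<bar> / dl powr ga) <= h x + H x) -->
  ennreal \<bar>u ph\<bar> <= ennreal (C * dl powr ga) * (Lp p h + Lp p H)"
proof -
 let ?N = "hom_dim s"
 obtain K where K: "compact K" "supported_in ph K" using test_funs_supp[OF ph] by blast
 have sm: "smooth ph" using ph by (simp add: test_funs_def)
 obtain a where a: "0 < a" and loc: "!!dl x k. 0 < dl ==> dl <= 1 ==> (!!i. \<bar>2 * x $ i / dl ^ s i - real_of_int (k i)\<bar> <= 1 / 2) ==>
  \<exists>et\<in>B_tests s r. smooth et \<and> (\<forall>y. ph y * cellfun s dl k y = a * dl ^ ?N * rescale s et dl x y)"
  using cellfun_localize[OF s sm K(2,1), of r] by blast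
 define K' where "K' = {y + h | y h. y \<in> K \<and> h \<in> sbox s 0 1}"
 have "compact K'" unfolding K'_def using compact_sums[OF K(1) compact_sbox[OF s, of 1 0]] by simp
 then obtain Ch where Ch: "0 < Ch" "!!G. G \<in> borel_measurable lborel ==> (NI x. indicator K' x * G x) <= ennreal Ch * Lp p G"
  using Hoelder_compact[OF _ p] by blast
 have [measurable]: "K' \<in> sets borel" using \<open>compact K'\<close> by (simp add: compact_imp_closed borel_closed)
 obtain R where R: "!!y. y \<in> K ==> norm y <= R" using compact_imp_bounded[OF K(1)] by (auto simp: bounded_iff)
 \<comment> \<open>\<open>v * dl ^ ?N\<close> is the volume of a box of radius
   \<open>dl / 8\<close>.\<close>
 define v where "v = 2 ^ CARD('d) * (1 / 8 :: real) ^ ?N"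
 have v: "0 < v" by (simp add: v_def)
 have "ennreal \<bar>u ph\<bar> <= ennreal (a / v * Ch * dl powr ga) * (Lp p h + Lp p H)"
  if dl: "0 < dl" "dl <= 1" and Hm [measurable]: "H \<in> borel_measurable borel"
   and le: "!!x et. et \<in> B_tests s r ==> smooth et ==> ennreal (\<bar>u (rescale s et dl x)\<bar> / dl powr ga) <= h x + H x" for dl h H
 proof -
  have dls: "0 < dl ^ s i" "dl ^ ?N <= dl ^ s i" "dl ^ s i <= 1" for i
   using dl member_le_sum[of i UNIV s] by (auto intro!: power_decreasing power_le_one simp: hom_dim_def)
  \<comment> \<open>\<open>dl ^ ?N\<close> is below every \<open>dl ^ s i\<close>, so indices up to
    \<open>n\<close> reach all cells meeting \<open>K\<close>.\<close>
  obtain n where n: "2 * R / dl ^ ?N <= real n" using real_arch_simple by blast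
  define I where "I = PiE (UNIV :: 'd set) (%_. {- int n..int n})"
  have fI: "finite I" unfolding I_def by (intro finite_PiE) auto
  define phk where "phk k = (%y. ph y * cellfun s dl k y)" for k
  have phkt: "phk k \<in> test_funs" for k unfolding phk_def by (rule test_funs_mult_cellfun[OF sm K(2,1)])
  have dec: "ph = (%y. \<Sum>k\<in>I. phk k y)"
  proof
   fix y
   show "ph y = (\<Sum>k\<in>I. phk k y)"
   proof (cases "y \<in> K")
    case True
    have "\<bar>2 * y $ i / dl ^ s i\<bar> <= real n" for i
    proof -
     have "\<bar>y $ i\<bar> <= R" using component_le_norm_cart[of y i] R[OF True] by linarith
     then have "2 * \<bar>y $ i\<bar> / dl ^ s i <= 2 * R / dl ^ ?N"
      using dls[of i] dl by (intro frac_le) auto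
     then show ?thesis using n dls(1)[of i] by simp
    qed
    from sum_cellfun[of y dl s n, OF this] show ?thesis
     unfolding phk_def I_def sum_distrib_left[symmetric] by simp
   next
    case False
    then have "ph y = 0" using K(2) by (auto simp: supported_in_def)
    then show ?thesis by (simp add: phk_def)
   qed
  qed
  have ud: "u ph = (\<Sum>k\<in>I. u (phk k))"
   by (subst dec, rule distribution_sum[OF u fI K(1) phkt]) (use K(2) in \<open>auto simp: supported_in_def phk_def\<close>)
  \<comment> \<open>Radius \<open>dl / 8\<close> makes boxes of different grid points disjoint, and
    all their points are centres allowed by \<open>cellfun_localize\<close>.\<close>
  define Q where "Q k = sbox s (\<chi> i. real_of_int (k i) * dl ^ s i / 2) (dl / 8)" for k
  have Q: "\<bar>2 * x $ i / dl ^ s i - real_of_int (k i)\<bar> <= 1 / 4" if "x \<in> Q k" for x k i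
  proof -
   have "\<bar>x $ i - real_of_int (k i) * dl ^ s i / 2\<bar> <= (dl / 8) ^ s i"
    using that snorm_le_iff[OF s, of "dl / 8" "x - (\<chi> i. real_of_int (k i) * dl ^ s i / 2)"] dl unfolding Q_def sbox_def by simp
   also have "... <= dl ^ s i / 8"
   proof -
    have "(8::real) ^ 1 <= 8 ^ s i" using s by (intro power_increasing) (auto simp: scaling_def)
    then show ?thesis unfolding power_divide using dls(1)[of i] by (intro divide_left_mono) auto
   qed
   finally have *: "\<bar>x $ i - real_of_int (k i) * dl ^ s i / 2\<bar> <= dl ^ s i / 8" .
   have "2 * x $ i / dl ^ s i - real_of_int (k i) = (x $ i - real_of_int (k i) * dl ^ s i / 2) * (2 / dl ^ s i)"
    using dls(1)[of i] dl by (simp add: field_simps)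
   then have "\<bar>2 * x $ i / dl ^ s i - real_of_int (k i)\<bar> = \<bar>x $ i - real_of_int (k i) * dl ^ s i / 2\<bar> * (2 / dl ^ s i)"
    using dls(1)[of i] by (simp only: abs_mult) simp
   also have "... <= dl ^ s i / 8 * (2 / dl ^ s i)" using * dls(1)[of i] by (intro mult_right_mono) auto
   also have "... = 1 / 4" using dl by simp
   finally show ?thesis .
  qed
  have disj: "k = k'" if "x \<in> Q k" "x \<in> Q k'" for x k k'
  proof
   fix i
   have "\<bar>real_of_int (k i) - real_of_int (k' i)\<bar> < 1" using Q[OF that(1), of i] Q[OF that(2), of i] by linarith
   then show "k i = k' i" by linarith
  qed
  \<comment> \<open>On the box of \<open>k\<close> the step function \<open>g\<close> has as its
    value the size of the pairing with cell \<open>k\<close>, normalised as in the hypothesis. Its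
    integral is therefore a multiple of the sum of all these pairings.\<close>
  define c where "c k = \<bar>u (phk k)\<bar> / (a * dl ^ ?N * dl powr ga)" for k
  have c0: "0 <= c k" for k using a dl by (simp add: c_def)
  define g where "g x = (\<Sum>k\<in>I. ennreal (c k) * indicator (Q k) x)" for x
  have [measurable]: "Q k \<in> sets borel" for k unfolding Q_def by measurable
  have gm [measurable]: "g \<in> borel_measurable borel" unfolding g_def[abs_def] by measurable
  have gQ: "g x = ennreal (c k)" if "k \<in> I" "x \<in> Q k" for x k
  proof -
   have "g x = (\<Sum>k'\<in>I. if k' = k then ennreal (c k) else 0)"
    unfolding g_def using that disj by (intro sum.cong refl) (auto simp: indicator_def)
   then show ?thesis using that(1) fI by simp
  qed
  have g0: "g x = 0" if "!!k. k \<in> I ==> x \<notin> Q k" for x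
   unfolding g_def using that by (intro sum.neutral) auto
  have g_le: "g x <= H x + h x" for x
  proof (cases "\<exists>k\<in>I. x \<in> Q k")
   case True
   then obtain k where k: "k \<in> I" "x \<in> Q k" by blast
   have half: "\<bar>2 * x $ i / dl ^ s i - real_of_int (k i)\<bar> <= 1 / 2" for i using Q[OF k(2), of i] by linarith
   obtain et where et: "et \<in> B_tests s r" "smooth et" "!!y. ph y * cellfun s dl k y = a * dl ^ ?N * rescale s et dl x y"
    using loc[OF dl half] by blast
   have t: "rescale s et dl x \<in> test_funs"
    unfolding test_funs_def smooth_def
    using et(1,2) rescale_supp[OF s _ dl(1), of et x] compact_sbox[OF s, of dl x] dl
    by (intro CollectI conjI allI exI[of _ "sbox s x dl"] C_class_rescale) (auto simp: smooth_def B_tests_def)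
   have "phk k = (%y. (a * dl ^ ?N) * rescale s et dl x y)" unfolding phk_def et(3) ..
   then have "u (phk k) = (a * dl ^ ?N) * u (rescale s et dl x)" using distribution_cmult[OF u t] by simp
   then have "c k = \<bar>u (rescale s et dl x)\<bar> / dl powr ga" unfolding c_def using a dl by (simp add: abs_mult)
   then show ?thesis using le[OF et(1,2), of x] gQ[OF k] by (simp add: add.commute)
  next
   case False
   then show ?thesis using g0[of x] by simp
  qed
  \<comment> \<open>A nonzero pairing needs a cell that meets \<open>K\<close>, and the box of that
    cell is within distance 1 of the common point.\<close>
  have g_supp: "x \<in> K'" if gx: "g x ~= 0" for x
  proof -
   obtain k where k: "k \<in> I" "x \<in> Q k" using g0[of x] gx by blast
   have "c k ~= 0" using gQ[OF k] gx by auto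
   then have "u (phk k) ~= 0" by (auto simp: c_def)
   moreover have "u (%y. 0 * ph y) = 0" using distribution_cmult[OF u ph, of 0] by simp
   ultimately have "phk k ~= (%y. 0)" by auto
   then obtain y where y: "phk k y ~= 0" by auto
   then have yK: "y \<in> K" using K(2) by (auto simp: phk_def supported_in_def)
   have cy: "cellfun s dl k y ~= 0" using y by (auto simp: phk_def)
   have "\<bar>(x - y) $ i\<bar> <= 1" for i
   proof -
    have "\<bar>2 * x $ i / dl ^ s i - 2 * y $ i / dl ^ s i\<bar> <= 2" using Q[OF k(2), of i] cellfun_neq_0[OF cy, of i] by linarith
    moreover have "2 * x $ i / dl ^ s i - 2 * y $ i / dl ^ s i = (x - y) $ i * (2 / dl ^ s i)" by (simp add: diff_divide_distrib left_diff_distrib mult.commute)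
    ultimately have "\<bar>(x - y) $ i\<bar> * (2 / dl ^ s i) <= 2" using dls(1)[of i] by (simp only: abs_mult) simp
    then have "\<bar>(x - y) $ i\<bar> <= dl ^ s i" using dls(1)[of i] by (simp add: divide_le_eq)
    then show ?thesis using dls(3)[of i] by linarith
   qed
   then have "x - y \<in> sbox s 0 1" using snorm_le_iff[OF s, of 1 "x - y"] by (simp add: sbox_def)
   then have "y + (x - y) \<in> K'" unfolding K'_def using yK by blast
   then show ?thesis by simp
  qed
  have "(NI x. g x) = (\<Sum>k\<in>I. ennreal (c k) * emeasure lborel (Q k))"
   unfolding g_def by (subst nn_integral_sum) (auto simp: nn_integral_cmult)
  also have "... = (\<Sum>k\<in>I. ennreal (c k * (v * dl ^ ?N)))"
  proof (intro sum.cong refl)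
   fix k
   have "emeasure lborel (Q k) = ennreal (v * dl ^ ?N)"
    unfolding Q_def using dl by (subst emeasure_sbox[OF s]) (auto simp: v_def power_divide)
   then show "ennreal (c k) * emeasure lborel (Q k) = ennreal (c k * (v * dl ^ ?N))" using c0 v dl by (simp add: ennreal_mult)
  qed
  also have "... = ennreal (\<Sum>k\<in>I. c k * (v * dl ^ ?N))" using c0 v dl by (intro sum_ennreal) simp
  also have "(\<Sum>k\<in>I. c k * (v * dl ^ ?N)) = (\<Sum>k\<in>I. \<bar>u (phk k)\<bar>) * (v / (a * dl powr ga))"
   unfolding sum_distrib_right c_def using a dl by (intro sum.cong refl) (simp add: field_simps)
  finally have int_g: "(NI x. g x) = ennreal ((\<Sum>k\<in>I. \<bar>u (phk k)\<bar>) * (v / (a * dl powr ga)))" .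
  have "(NI x. g x) <= (NI x. indicator K' x * (g x - H x) + indicator K' x * H x)"
  proof (rule nn_integral_mono)
   fix x
   show "g x <= indicator K' x * (g x - H x) + indicator K' x * H x"
   proof (cases "x \<in> K'")
    case True
    have "g x <= (g x - H x) + H x" using ennreal_minus_le_iff[of "g x" "H x" "g x - H x"] by (simp add: add.commute)
    then show ?thesis using True by simp
   next
    case False
    then have "g x = 0" using g_supp by blast
    then show ?thesis by simp
   qed
  qed
  also have "... = (NI x. indicator K' x * (g x - H x)) + (NI x. indicator K' x * H x)"
   by (rule nn_integral_add) measurable
  also have "... <= ennreal Ch * Lp p (%x. g x - H x) + ennreal Ch * Lp p H"
   by (intro add_mono Ch(2)) measurable
  also have "... <= ennreal Ch * Lp p h + ennreal Ch * Lp p H"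
  proof (intro add_right_mono mult_left_mono Lp_norm_mono)
   fix x
   have "g x ~= top" unfolding g_def by (simp add: fI ennreal_mult_eq_top_iff indicator_def)
   then show "g x - H x <= h x" unfolding ennreal_minus_le_iff using g_le[of x] by simp
  qed simp
  also have "... = ennreal Ch * (Lp p h + Lp p H)" by (simp only: distrib_left)
  finally have fin: "ennreal ((\<Sum>k\<in>I. \<bar>u (phk k)\<bar>) * (v / (a * dl powr ga))) <= ennreal Ch * (Lp p h + Lp p H)"
   unfolding int_g .
  have "\<bar>u ph\<bar> <= (\<Sum>k\<in>I. \<bar>u (phk k)\<bar>)" unfolding ud by (rule sum_abs)
  also have "... = (a * dl powr ga / v) * ((\<Sum>k\<in>I. \<bar>u (phk k)\<bar>) * (v / (a * dl powr ga)))" using a v dl by simp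
  finally have "ennreal \<bar>u ph\<bar> <= ennreal ((a * dl powr ga / v) * ((\<Sum>k\<in>I. \<bar>u (phk k)\<bar>) * (v / (a * dl powr ga))))" by (rule ennreal_leI)
  also have "... = ennreal (a * dl powr ga / v) * ennreal ((\<Sum>k\<in>I. \<bar>u (phk k)\<bar>) * (v / (a * dl powr ga)))"
   using a v by (intro ennreal_mult) (auto intro!: mult_nonneg_nonneg sum_nonneg)
  also have "... <= ennreal (a * dl powr ga / v) * (ennreal Ch * (Lp p h + Lp p H))"
   by (intro mult_left_mono fin) simp
  also have "... = ennreal (a * dl powr ga / v * Ch) * (Lp p h + Lp p H)"
  proof -
   have "ennreal (a * dl powr ga / v * Ch) = ennreal (a * dl powr ga / v) * ennreal Ch"
    using a v Ch(1) by (intro ennreal_mult) auto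
   then show ?thesis by (simp only: mult.assoc)
  qed
  also have "a * dl powr ga / v * Ch = a / v * Ch * dl powr ga" by simp
  finally show ?thesis .
 qed
 moreover have "0 <= a / v * Ch" using a v Ch(1) by simp
 ultimately show ?thesis by blast
qed

text \<open>The interval (t/2, t) has mass at least 1/2 for the measure on scales, whatever
  \<open>t\<close>. If \<open>g\<close> exceeded 2 w + 1 on all of it, its norm would be at least (2
  w + 1)/2, more than \<open>w\<close>.\<close>

lemma scale_Lq_pick:
 assumes q: "1 <= q" and fin: "Ls q g < top"
 shows "\<exists>C\<ge>0. \<forall>t. 0 < t --> t <= 1 --> (\<exists>dl. 0 < dl \<and> dl < t \<and> g dl <= ennreal C)"
proof -
 obtain w where w: "0 <= w" "Ls q g = ennreal w" using fin by (cases "Ls q g") auto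
 define C where "C = 2 * w + 1"
 have C: "0 <= C" "w < C" using w(1) by (simp_all add: C_def)
 have "\<exists>dl. 0 < dl \<and> dl < t \<and> g dl <= ennreal C" if t: "0 < t" "t <= 1" for t
 proof (rule ccontr)
  assume no: "\<not> ?thesis"
  let ?A = "{t/2<..<t}"
  define G where "G dl = ennreal C * indicator ?A dl" for dl
  have "G dl <= g dl" for dl
  proof (cases "dl \<in> ?A")
   case True
   then have "\<not> g dl <= ennreal C" using no t by auto
   then show ?thesis using True by (simp add: G_def)
  qed (simp add: G_def)
  then have Gw: "Ls q G <= ennreal w" unfolding w(2)[symmetric] by (intro Lp_norm_mono)
  have mass: "ennreal (1/2) <= (\<integral>\<^sup>+dl. indicator ?A dl \<partial>scale_measure01)"
  proof -
   have "ennreal (1/2) = ennreal (1/t) * emeasure lborel ?A" using t by (simp add: ennreal_mult[symmetric])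
   also have "... = (NI dl. ennreal (1/t) * indicator ?A dl)" by (simp add: nn_integral_cmult)
   also have "... <= (NI dl. indicator {0<..<1} dl * ennreal (1 / dl) * indicator ?A dl)"
    using t by (intro nn_integral_mono) (auto simp: indicator_def intro!: ennreal_leI frac_le)
   also have "... = (\<integral>\<^sup>+dl. indicator ?A dl \<partial>scale_measure01)" by (rule nn_integral_scale_measure01[symmetric]) measurable
   finally show ?thesis .
  qed
  show False
  proof (cases "q = top")
   case True
   have "AE dl in scale_measure01. G dl <= ennreal w"
    using AE_le_Lp_norm_infinity[where M = scale_measure01 and g = G] by (rule eventually_mono) (use Gw True in \<open>auto intro: order_trans\<close>)
   then have "AE dl in scale_measure01. indicator ?A dl = (0::ennreal)"
    by (rule eventually_mono) (use w(1) C in \<open>auto simp: G_def indicator_def ennreal_le_iff split: if_splits\<close>)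
   then have "(\<integral>\<^sup>+dl. indicator ?A dl \<partial>scale_measure01) = (\<integral>\<^sup>+dl. 0 \<partial>scale_measure01)" by (rule nn_integral_cong_AE)
   then show False using mass by (simp add: ennreal_eq_0_iff)
  next
   case False
   define P where "P = enn2real q"
   have P: "1 <= P" unfolding P_def by (rule enn2real_ge_1[OF q False])
   have "ennreal (C powr P) * ennreal (1/2) <= ennreal (C powr P) * (\<integral>\<^sup>+dl. indicator ?A dl \<partial>scale_measure01)"
    by (intro mult_left_mono mass) simp
   also have "... = (\<integral>\<^sup>+dl. ennreal (C powr P) * indicator ?A dl \<partial>scale_measure01)" by (rule nn_integral_cmult[symmetric]) measurable
   also have "... = (\<integral>\<^sup>+dl. ennreal_powr (G dl) P \<partial>scale_measure01)"
    unfolding G_def using C P by (intro nn_integral_cong) (auto simp: indicator_def)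
   finally have *: "ennreal (C powr P) * ennreal (1/2) <= (\<integral>\<^sup>+dl. ennreal_powr (G dl) P \<partial>scale_measure01)" .
   have 1: "ennreal (C powr P * (1/2)) <= (\<integral>\<^sup>+dl. ennreal_powr (G dl) P \<partial>scale_measure01)"
    by (subst ennreal_mult) (use * in simp_all)
   have "ennreal ((C powr P * (1/2)) powr (1 / P)) <= ennreal w"
    using order_trans[OF ennreal_powr_mono[OF _ 1, of "1 / P"] Gw[unfolded Lp_norm_finite[OF False] P_def[symmetric]]] P by simp
   then have "(C powr P * (1/2)) powr (1 / P) <= w" using w(1) by (simp add: ennreal_le_iff)
   moreover have "(C powr P * (1/2)) powr (1 / P) = C * (1/2) powr (1 / P)"
    by (subst powr_mult) (use C P in \<open>simp_all add: powr_powr\<close>)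
   moreover have "C * (1/2) powr 1 <= C * (1/2) powr (1 / P)"
    using C P by (intro mult_left_mono powr_mono') auto
   ultimately have "C * (1/2) powr 1 <= w" by linarith
   then show False by (simp add: C_def)
  qed
 qed
 then show ?thesis using C by (intro exI[of _ C]) simp
qed

lemma distribution_minus:
 assumes "distribution u" "order_at_most r u" "distribution v" "order_at_most r v"
 shows "distribution (%ph. u ph - v ph)" "order_at_most r (%ph. u ph - v ph)"
proof -
 have bd: "\<exists>C. \<forall>ph\<in>test_funs. supported_in ph K --> ennreal \<bar>u ph - v ph\<bar> <= ennreal C * C_norm r ph" if K: "compact K" for K
 proof -
  obtain C C' where C: "!!ph. ph \<in> test_funs ==> supported_in ph K ==> ennreal \<bar>u ph\<bar> <= ennreal C * C_norm r ph"
   "!!ph. ph \<in> test_funs ==> supported_in ph K ==> ennreal \<bar>v ph\<bar> <= ennreal C' * C_norm r ph"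
   using assms(2,4) K unfolding order_at_most_def by metis
  have "ennreal \<bar>u ph - v ph\<bar> <= ennreal (\<bar>C\<bar> + \<bar>C'\<bar>) * C_norm r ph" if "ph \<in> test_funs" "supported_in ph K" for ph
  proof -
   have "ennreal \<bar>u ph - v ph\<bar> <= ennreal (\<bar>u ph\<bar> + \<bar>v ph\<bar>)" by (intro ennreal_leI) linarith
   also have "... = ennreal \<bar>u ph\<bar> + ennreal \<bar>v ph\<bar>" by simp
   also have "... <= ennreal C * C_norm r ph + ennreal C' * C_norm r ph" by (intro add_mono C that)
   also have "... <= ennreal \<bar>C\<bar> * C_norm r ph + ennreal \<bar>C'\<bar> * C_norm r ph"
    by (intro add_mono mult_right_mono ennreal_leI) auto
   also have "... = ennreal (\<bar>C\<bar> + \<bar>C'\<bar>) * C_norm r ph" by (simp add: distrib_right)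
   finally show ?thesis .
  qed
  then show ?thesis by blast
 qed
 show "order_at_most r (%ph. u ph - v ph)" unfolding order_at_most_def using bd by blast
 have "u (%x. a * ph x + b * ps x) - v (%x. a * ph x + b * ps x) = a * (u ph - v ph) + b * (u ps - v ps)"
  if "ph \<in> test_funs" "ps \<in> test_funs" for ph ps a b
 proof -
  have "u (%x. a * ph x + b * ps x) = a * u ph + b * u ps" "v (%x. a * ph x + b * ps x) = a * v ph + b * v ps"
   using assms(1,3) that unfolding distribution_def by blast+
  then show ?thesis by (simp add: algebra_simps)
 qed
 then show "distribution (%ph. u ph - v ph)" unfolding distribution_def using bd by blast
qed

context modelled
begin

text \<open>The two errors are treated differently. That of the given \<open>u\<close> is merely
  finite in L^q over the scales, hence bounded only at scales chosen by
  \<open>scale_Lq_pick\<close>; that of \<open>recon\<close> has the measurable majorant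
  \<open>err\<close>, bounded at every scale, which serves as the function \<open>H\<close> of
  \<open>distribution_le_at_scale\<close>.\<close>

lemma reconstruction_unique:
 assumes u: "distribution u" "order_at_most r u"
  and fin: "multiscale_norm s r (B_tests s r) ga p q (%x ph. u ph - m_Pi Z x (f x) ph) < top"
  and ph: "ph \<in> test_funs"
 shows "u ph = recon Z f ph"
proof -
 let ?U = "%x ph. u ph - m_Pi Z x (f x) ph"
 define h where "h dl x = (SUP et\<in>B_tests s r. ennreal (\<bar>pairing r (?U x) (rescale s et dl x)\<bar> / dl powr ga))" for dl x
 define w where "w ph = u ph - recon Z f ph" for ph
 have wd: "distribution w"
  unfolding w_def using distribution_minus[OF u recon_distribution] by simp
 have mPi: "distribution (m_Pi Z x (f x))" "order_at_most r (m_Pi Z x (f x))" for x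
  using model f_sum by (auto simp: is_model_def)
 have pt: "ennreal (\<bar>w (rescale s et dl x)\<bar> / dl powr ga) <= h dl x + G.err dl x"
  if et: "et \<in> B_tests s r" "smooth et" and dl: "0 < dl" "dl < 1" for et dl x
 proof -
  let ?ps = "rescale s et dl x"
  have t: "?ps \<in> test_funs"
   unfolding test_funs_def smooth_def
   using et C_class_supp_rescale(2,3)[OF et(1) dl(1), of x]
   by (intro CollectI conjI allI exI[of _ "sbox s x dl"] C_class_rescale) (auto simp: smooth_def)
  have "pairing r (?U x) ?ps = ?U x ?ps"
   by (rule pairing_test_fun[OF distribution_minus[OF u mPi] t])
  then have 1: "ennreal (\<bar>?U x ?ps\<bar> / dl powr ga) <= h dl x"
   unfolding h_def using et(1) by (intro SUP_upper2[of et]) auto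
  have rec: "recon Z f ?ps - m_Pi Z x (f x) ?ps = (LI y. G.diag y * ?ps y) - (LI y. F x y * ?ps y)"
   unfolding recon_eq dens_eq[OF f_sum t] by (simp add: dist_of_def F_def)
  have 2: "ennreal (\<bar>recon Z f ?ps - m_Pi Z x (f x) ?ps\<bar> / dl powr ga) <= G.err dl x"
   unfolding rec by (rule G.error_le_err[OF et(1) dl])
  have "\<bar>w ?ps\<bar> / dl powr ga <= \<bar>?U x ?ps\<bar> / dl powr ga + \<bar>recon Z f ?ps - m_Pi Z x (f x) ?ps\<bar> / dl powr ga"
   unfolding add_divide_distrib[symmetric] w_def by (intro divide_right_mono) auto
  then have "ennreal (\<bar>w ?ps\<bar> / dl powr ga) <= ennreal (\<bar>?U x ?ps\<bar> / dl powr ga + \<bar>recon Z f ?ps - m_Pi Z x (f x) ?ps\<bar> / dl powr ga)"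
   by (rule ennreal_leI)
  also have "... = ennreal (\<bar>?U x ?ps\<bar> / dl powr ga) + ennreal (\<bar>recon Z f ?ps - m_Pi Z x (f x) ?ps\<bar> / dl powr ga)"
   by (intro ennreal_plus) auto
  also have "... <= h dl x + G.err dl x" by (intro add_mono 1 2)
  finally show ?thesis .
 qed
 have "Ls q (%dl. Lp p (h dl)) < top"
  using fin unfolding multiscale_norm_def h_def[abs_def] .
 from scale_Lq_pick[OF q this] obtain C1 where C1: "0 <= C1"
  "!!t. 0 < t ==> t <= 1 ==> \<exists>dl. 0 < dl \<and> dl < t \<and> Lp p (h dl) <= ennreal C1" by blast
 have "G.error_const q * G.germ_norm p q < top"
 proof -
  have "G.germ_norm p q < top"
   using D_norm_finite by (intro le_less_trans[OF germ_norm_le]) (simp add: ennreal_mult_less_top)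
  then show ?thesis using G.error_const_finite[OF q] by (simp add: ennreal_mult_less_top)
 qed
 then obtain C2 where C2: "0 <= C2" "G.error_const q * G.germ_norm p q = ennreal C2"
  by (cases "G.error_const q * G.germ_norm p q") auto
 obtain C where C: "0 <= C" "!!dl h H. 0 < dl ==> dl <= 1 ==> H \<in> borel_measurable borel ==>
  (!!x et. et \<in> B_tests s r ==> smooth et ==> ennreal (\<bar>w (rescale s et dl x)\<bar> / dl powr ga) <= h x + H x) ==>
  ennreal \<bar>w ph\<bar> <= ennreal (C * dl powr ga) * (Lp p h + Lp p H)"
  using distribution_le_at_scale[OF s p wd ph, of r ga] by blast
 have bound: "\<bar>w ph\<bar> <= C * (C1 + C2) * t powr ga" if t: "0 < t" "t <= 1" for t
 proof -
  obtain dl where dl: "0 < dl" "dl < t" "Lp p (h dl) <= ennreal C1" using C1(2)[OF t] by blast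
  have "ennreal \<bar>w ph\<bar> <= ennreal (C * dl powr ga) * (Lp p (h dl) + Lp p (G.err dl))"
   using dl t by (intro C(2) pt G.err_measurable) auto
  also have "... <= ennreal (C * dl powr ga) * (ennreal C1 + ennreal C2)"
   unfolding C2(2)[symmetric] by (intro mult_left_mono add_mono dl G.err_Lp' p q) auto
  also have "... = ennreal (C * dl powr ga * (C1 + C2))" using C(1) C1(1) C2(1) by (simp add: ennreal_mult)
  finally have "\<bar>w ph\<bar> <= C * dl powr ga * (C1 + C2)" using C(1) C1(1) C2(1) by (simp add: ennreal_le_iff)
  also have "... <= C * t powr ga * (C1 + C2)"
   using dl ga C(1) C1(1) C2(1) by (intro mult_right_mono mult_left_mono powr_mono2) auto
  finally show ?thesis by (simp add: mult.commute mult.left_commute)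
 qed
 have ev: "\<forall>\<^sub>F t in at_right 0. \<bar>w ph\<bar> <= C * (C1 + C2) * t powr ga"
  by (rule eventually_at_rightI[of 0 1]) (auto intro: bound)
 have nn: "\<forall>\<^sub>F t in at_right 0. 0 <= (t::real)" by (rule eventually_at_rightI[of 0 1]) auto
 have "((%t. t powr ga) \<longlongrightarrow> 0) (at_right 0)"
  by (rule tendsto_zero_powrI[OF tendsto_ident_at tendsto_const nn ga])
 from tendsto_mult_left[OF this, of "C * (C1 + C2)"]
 have "((%t. C * (C1 + C2) * t powr ga) \<longlongrightarrow> 0) (at_right 0)" by simp
 from tendsto_lowerbound[OF this ev] have "\<bar>w ph\<bar> <= 0" by simp
 then show ?thesis by (simp add: w_def)
qed

end

section \<open>The bounds in terms of the norms of models\<close>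

context modelled
begin

lemma recon_minus_Pi:
 assumes ph: "ph \<in> test_funs"
 shows "integrable lborel (%y. (F y y - F x y) * ph y)"
  and "recon Z f ph - m_Pi Z x (f x) ph = (LI y. (F y y - F x y) * ph y)"
proof -
 obtain K where K: "compact K" "supported_in ph K" using test_funs_supp[OF ph] by blast
 have c: "continuous_on UNIV ph" using ph smooth_continuous by (auto simp: test_funs_def)
 have Fl: "locally_integrable (F x)" unfolding F_def by (intro locally_integrable_continuous dens_continuous f_sum)
 have i: "integrable lborel (%y. F y y * ph y)" "integrable lborel (%y. F x y * ph y)"
  using integrable_density_mult[OF G.locally_integrable_diag c K(2,1)] integrable_density_mult[OF Fl c K(2,1)]
  by (simp_all add: G.diag_def)
 show "integrable lborel (%y. (F y y - F x y) * ph y)"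
  unfolding left_diff_distrib by (rule Bochner_Integration.integrable_diff[OF i])
 have Fx: "dens x (f x) = F x" by (simp add: F_def)
 have "recon Z f ph - m_Pi Z x (f x) ph = (LI y. F y y * ph y) - (LI y. F x y * ph y)"
  unfolding recon_eq dens_eq[OF f_sum ph] Fx dist_of_def G.diag_def ..
 then show "recon Z f ph - m_Pi Z x (f x) ph = (LI y. (F y y - F x y) * ph y)"
  unfolding left_diff_distrib Bochner_Integration.integral_diff[OF i] .
qed

lemma multiscale_recon_bound:
 "multiscale_norm s r (B_tests s r) ga p q (%x ph. recon Z f ph - m_Pi Z x (f x) ph) <=
  ennreal (enn2real (G.error_const q)) * (D_norm \<T> s ga p q Z f * Pi_norm \<T> s r ga (m_Pi Z) * (1 + Gam_norm \<T> s ga (m_Gam Z)))"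
proof -
 have "multiscale_norm s r (B_tests s r) ga p q (%x ph. recon Z f ph - m_Pi Z x (f x) ph) <= G.error_const q * (ennreal nPi * D_norm \<T> s ga p q Z f)"
  by (rule multiscale_recon_le) simp
 also have "... = G.error_const q * (D_norm \<T> s ga p q Z f * ennreal nPi * 1)" by (simp only: mult_1_right mult_1_left mult.commute)
 also have "... <= G.error_const q * (D_norm \<T> s ga p q Z f * ennreal nPi * (1 + Gam_norm \<T> s ga (m_Gam Z)))"
  by (intro mult_left_mono) auto
 finally show ?thesis unfolding Pi_norm_eq ennreal_enn2real[OF G.error_const_finite[OF q]] .
qed

end

context modelled_pair
begin

lemma multiscale_recon_diff_bound:
 "multiscale_norm s r (B_tests s r) ga p q
   (%x ph. recon Z f ph - m_Pi Z x (f x) ph - recon Z' f' ph + m_Pi Z' x (f' x) ph)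
  <= ennreal (enn2real (G.error_const q)) *
   (D_dist \<T> s ga p q Z Z' f f' * Pi_norm \<T> s r ga (m_Pi Z) * (1 + Gam_norm \<T> s ga (m_Gam Z))
    + D_norm \<T> s ga p q Z' f' *
     (Pi_norm \<T> s r ga (Pi_diff Z Z') * (1 + Gam_norm \<T> s ga (m_Gam Z))
     + Pi_norm \<T> s r ga (m_Pi Z') * Gam_norm \<T> s ga (Gam_diff Z Z')))"
proof -
 let ?U = "%x ph. recon Z f ph - m_Pi Z x (f x) ph - recon Z' f' ph + m_Pi Z' x (f' x) ph"
 let ?g = "1 + Gam_norm \<T> s ga (m_Gam Z)"
 have "multiscale_norm s r (B_tests s r) ga p q ?U <= G.error_const q * G.germ_norm p q"
 proof (rule multiscale_le)
  fix x and ph :: "real ^ 'd => real" assume ph: "ph \<in> test_funs"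
  have "?U x ph = (LI y. (A.F y y - A.F x y) * ph y) - (LI y. (B.F y y - B.F x y) * ph y)"
   using A.recon_minus_Pi(2)[OF ph, of x] B.recon_minus_Pi(2)[OF ph, of x] by simp
  also have "... = (LI y. (A.F y y - A.F x y) * ph y - (B.F y y - B.F x y) * ph y)"
   using A.recon_minus_Pi(1)[OF ph, of x] B.recon_minus_Pi(1)[OF ph, of x] by simp
  also have "... = dist_of (%y. G.diag y - F x y) ph"
   unfolding dist_of_def G.diag_def F_def by (intro Bochner_Integration.integral_cong refl) (simp add: algebra_simps)
  finally show "?U x ph = dist_of (%y. G.diag y - F x y) ph" .
 qed
 also have "... <= G.error_const q * (ennreal A.nPi * D_dist \<T> s ga p q Z Z' f f' + ennreal nPid * D_norm \<T> s ga p q Z' f')"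
  by (intro mult_left_mono germ_norm_le) simp
 \<comment> \<open>The germ bound is enlarged, using \<open>1 <= ?g\<close> and the sign of the last
   term. The deviation between the two \<open>m_Gam\<close> is already measured by the increments in
   \<open>D_dist\<close>.\<close>
 also have "... <= G.error_const q * (D_dist \<T> s ga p q Z Z' f f' * ennreal A.nPi * ?g
   + D_norm \<T> s ga p q Z' f' * (ennreal nPid * ?g + Pi_norm \<T> s r ga (m_Pi Z') * Gam_norm \<T> s ga (Gam_diff Z Z')))"
 proof (intro mult_left_mono add_mono)
  have "D_dist \<T> s ga p q Z Z' f f' * ennreal A.nPi * 1 <= D_dist \<T> s ga p q Z Z' f f' * ennreal A.nPi * ?g"
   by (intro mult_left_mono) auto
  then show "ennreal A.nPi * D_dist \<T> s ga p q Z Z' f f' <= D_dist \<T> s ga p q Z Z' f f' * ennreal A.nPi * ?g"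
   by (simp only: mult_1_right mult_1_left mult.commute)
  have "ennreal nPid * 1 + 0 <= ennreal nPid * ?g + Pi_norm \<T> s r ga (m_Pi Z') * Gam_norm \<T> s ga (Gam_diff Z Z')"
   by (intro add_mono mult_left_mono) auto
  then have "D_norm \<T> s ga p q Z' f' * (ennreal nPid * 1 + 0) <= D_norm \<T> s ga p q Z' f' *
    (ennreal nPid * ?g + Pi_norm \<T> s r ga (m_Pi Z') * Gam_norm \<T> s ga (Gam_diff Z Z'))"
   by (rule mult_left_mono) simp
  then show "ennreal nPid * D_norm \<T> s ga p q Z' f' <= D_norm \<T> s ga p q Z' f' *
    (ennreal nPid * ?g + Pi_norm \<T> s r ga (m_Pi Z') * Gam_norm \<T> s ga (Gam_diff Z Z'))"
   unfolding mult_1_right add_0_right by (subst mult.commute)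
 qed simp
 finally show ?thesis unfolding A.Pi_norm_eq Pi_diff_norm_eq ennreal_enn2real[OF G.error_const_finite[OF A.q]] .
qed

end

theorem proposition4p3:
  fixes s :: "'d::finite \<Rightarrow> nat"
    and r :: nat
    and \<T> :: "('b::banach) regstruct"
    and \<alpha> abar \<gamma> :: real
    and p q :: ennreal
  assumes "scaling s"
    and "regularity_structure \<T>"
    and "\<alpha> \<in> rs_A \<T>" and "\<forall>\<beta>\<in>rs_A \<T>. \<alpha> \<le> \<beta>"
    and "\<bar>\<alpha>\<bar> < real r"
    and "1 \<le> p" and "1 \<le> q"
    and "0 < \<gamma>"
    and "if q = \<infinity> then abar = \<alpha> else abar < \<alpha>"
  shows
    "(\<forall>Z :: ('d, 'b) model. smooth_model \<T> s r Z \<longrightarrow>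
        (\<forall>f\<in>D_space \<T> s \<gamma> p q Z. locally_integrable (recon_fun Z f)) \<and>
        reconstruction_operator \<T> s r abar \<gamma> p q Z (recon Z) \<and>
        (\<forall>R. reconstruction_operator \<T> s r abar \<gamma> p q Z R \<longrightarrow>
           (\<forall>f\<in>D_space \<T> s \<gamma> p q Z. \<forall>\<phi>\<in>test_funs. R f \<phi> = recon Z f \<phi>)))
     \<and>
     (\<exists>C::real. \<forall>Z :: ('d, 'b) model. smooth_model \<T> s r Z \<longrightarrow>
        (\<forall>f\<in>D_space \<T> s \<gamma> p q Z.
           multiscale_norm s r (B_tests s r) \<gamma> p q (\<lambda>x \<phi>. recon Z f \<phi> - m_Pi Z x (f x) \<phi>)
           \<le> ennreal C *
              (D_norm \<T> s \<gamma> p q Z f * Pi_norm \<T> s r \<gamma> (m_Pi Z) * (1 + Gam_norm \<T> s \<gamma> (m_Gam Z)))))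
     \<and>
     (\<exists>C::real. \<forall>(Z :: ('d, 'b) model) (Z' :: ('d, 'b) model).
        smooth_model \<T> s r Z \<and> smooth_model \<T> s r Z' \<longrightarrow>
        (\<forall>f\<in>D_space \<T> s \<gamma> p q Z. \<forall>f'\<in>D_space \<T> s \<gamma> p q Z'.
           multiscale_norm s r (B_tests s r) \<gamma> p q
             (\<lambda>x \<phi>. recon Z f \<phi> - m_Pi Z x (f x) \<phi> - recon Z' f' \<phi> + m_Pi Z' x (f' x) \<phi>)
           \<le> ennreal C *
              (D_dist \<T> s \<gamma> p q Z Z' f f' * Pi_norm \<T> s r \<gamma> (m_Pi Z) * (1 + Gam_norm \<T> s \<gamma> (m_Gam Z))
               + D_norm \<T> s \<gamma> p q Z' f' *
                 (Pi_norm \<T> s r \<gamma> (Pi_diff Z Z') * (1 + Gam_norm \<T> s \<gamma> (m_Gam Z))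
                  + Pi_norm \<T> s r \<gamma> (m_Pi Z') * Gam_norm \<T> s \<gamma> (Gam_diff Z Z')))))"
proof -
  let ?D = "\<lambda>Z :: ('d, 'b) model. D_space \<T> s \<gamma> p q Z"
  \<comment> \<open>\<open>error_const\<close> refers to \<open>s\<close>, \<open>r\<close>,
    \<open>\<gamma>\<close>, \<open>q\<close> and the homogeneities alone, so the same number serves
    all models and both bounds.\<close>
  let ?C = "enn2real (germ.error_const s r \<gamma> (hom_below \<T> \<gamma>) q)"
  let ?L = "Lp_norm scale_measure01 q (\<lambda>\<delta>. ennreal (\<delta> powr (\<alpha> - abar)))"
  have low: "\<zeta> \<in> rs_A \<T> \<Longrightarrow> \<alpha> \<le> \<zeta>" for \<zeta> using assms(4) by blast
  have mod: "modelled \<T> s r \<gamma> Z p q f" if "smooth_model \<T> s r Z" "f \<in> ?D Z" for Z f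
    using that assms
    by (intro modelled.intro smooth_model_scaled.intro reg_structure.intro smooth_model_scaled_axioms.intro modelled_axioms.intro)
  have single: "multiscale_norm s r (B_tests s r) \<gamma> p q (\<lambda>x \<phi>. recon Z f \<phi> - m_Pi Z x (f x) \<phi>)
      \<le> ennreal ?C * (D_norm \<T> s \<gamma> p q Z f * Pi_norm \<T> s r \<gamma> (m_Pi Z) * (1 + Gam_norm \<T> s \<gamma> (m_Gam Z)))"
    if "smooth_model \<T> s r Z" "f \<in> ?D Z" for Z f
    by (rule modelled.multiscale_recon_bound[OF mod[OF that]])
  have op: "reconstruction_operator \<T> s r abar \<gamma> p q Z (recon Z)" if Z: "smooth_model \<T> s r Z" for Z :: "('d, 'b) model"
    unfolding reconstruction_operator_def
  proof (intro conjI ballI allI)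
    show "recon Z f \<in> besov s r abar p q" if "f \<in> ?D Z" for f
      by (rule modelled.recon_bounds(2)[OF mod[OF Z that] low assms(9)])
    show "recon Z (\<lambda>x \<zeta>. c *\<^sub>R f x \<zeta> + d *\<^sub>R g x \<zeta>) \<phi> = c * recon Z f \<phi> + d * recon Z g \<phi>"
      if "f \<in> ?D Z" "g \<in> ?D Z" "\<phi> \<in> test_funs" for f g c d \<phi>
      by (rule recon_linear[OF mod[OF Z that(1)] mod[OF Z that(2)] that(3)])
    show "\<exists>C. \<forall>f\<in>?D Z. besov_norm s r abar p q (recon Z f) \<le> ennreal C * D_norm \<T> s \<gamma> p q Z f"
      using modelled.recon_bounds(1)[OF mod[OF Z] low assms(9)] by blast
    show "\<exists>C. \<forall>f\<in>?D Z. recon_error_norm s r \<gamma> p q Z (recon Z) f \<le>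
        ennreal C * (D_norm \<T> s \<gamma> p q Z f * Pi_norm \<T> s r \<gamma> (m_Pi Z) * (1 + Gam_norm \<T> s \<gamma> (m_Gam Z)))"
      unfolding recon_error_norm_def using single[OF Z] by blast
  qed
  have uniq: "R f \<phi> = recon Z f \<phi>"
    if Z: "smooth_model \<T> s r Z" and R: "reconstruction_operator \<T> s r abar \<gamma> p q Z R" and f: "f \<in> ?D Z" and \<phi>: "\<phi> \<in> test_funs"
    for Z :: "('d, 'b) model" and R f \<phi>
  proof -
    interpret modelled \<T> s r \<gamma> Z p q f by (rule mod[OF Z f])
    have u: "distribution (R f)" "order_at_most r (R f)"
      using R f by (auto simp: reconstruction_operator_def besov_def)
    obtain C where C: "\<forall>f\<in>?D Z. recon_error_norm s r \<gamma> p q Z R f \<le>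
        ennreal C * (D_norm \<T> s \<gamma> p q Z f * Pi_norm \<T> s r \<gamma> (m_Pi Z) * (1 + Gam_norm \<T> s \<gamma> (m_Gam Z)))"
      using R unfolding reconstruction_operator_def by blast
    \<comment> \<open>For uniqueness the constant may depend on the model: the argument needs that
      the error norm of \<open>R\<close> is finite.\<close>
    have "ennreal C * (D_norm \<T> s \<gamma> p q Z f * Pi_norm \<T> s r \<gamma> (m_Pi Z) * (1 + Gam_norm \<T> s \<gamma> (m_Gam Z))) < top"
      unfolding Pi_norm_eq Gam_norm_eq using D_norm_finite by (simp add: ennreal_mult_less_top)
    with C f have "recon_error_norm s r \<gamma> p q Z R f < top" by (blast intro: le_less_trans)
    then show ?thesis by (intro reconstruction_unique u \<phi>) (simp add: recon_error_norm_def)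
  qed
  have pair: "multiscale_norm s r (B_tests s r) \<gamma> p q
       (\<lambda>x \<phi>. recon Z f \<phi> - m_Pi Z x (f x) \<phi> - recon Z' f' \<phi> + m_Pi Z' x (f' x) \<phi>)
     \<le> ennreal ?C *
        (D_dist \<T> s \<gamma> p q Z Z' f f' * Pi_norm \<T> s r \<gamma> (m_Pi Z) * (1 + Gam_norm \<T> s \<gamma> (m_Gam Z))
         + D_norm \<T> s \<gamma> p q Z' f' *
           (Pi_norm \<T> s r \<gamma> (Pi_diff Z Z') * (1 + Gam_norm \<T> s \<gamma> (m_Gam Z))
            + Pi_norm \<T> s r \<gamma> (m_Pi Z') * Gam_norm \<T> s \<gamma> (Gam_diff Z Z')))"
    if "smooth_model \<T> s r Z" "smooth_model \<T> s r Z'" "f \<in> ?D Z" "f' \<in> ?D Z'" for Z Z' :: "('d, 'b) model" and f f'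
    by (rule modelled_pair.multiscale_recon_diff_bound[OF modelled_pair.intro[OF mod[OF that(1,3)] mod[OF that(2,4)]]])
  have li: "locally_integrable (recon_fun Z f)" if "smooth_model \<T> s r Z" "f \<in> ?D Z" for Z f
    by (rule modelled.locally_integrable_recon[OF mod[OF that]])
  show ?thesis using li op uniq single pair by blast
qed

end
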